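(* Let $\mu$ be a Borel probability measure on $X$. Suppose $G^+$ is abelian, $\mathfrak g_+$ is an eigenspace of $\mathrm{Ad}_a$, and the action of the Auslander normal subgroup of $a$ on $X$ is uniquely ergodic. If $\mu$ has local maximal dimension in the unstable horospherical direction and there is no loss of mass on average for $\mu$ with respect to $T$, then $$\lim_{k\to\infty}\frac1k\sum_{l=0}^{k-1}T_*^l\mu=m_X$$ in the weak$^*$ topology.
   Context: Setup: $G\subset SL(N_0,\mathbb R)$ is a closed connected subgroup with identity $e$ and Lie algebra $\mathfrak g$; $\Gamma\subset G$ is a lattice; $X=\Gamma\backslash G$ with $G$-invariant probability measure $m_X$. $G$ acts on $X$ by $g.x=xg^{-1}$. $a\in G$ is of class $\mathscr A$: (i) $a$ is conjugate in $SL(N_0,\mathbb R)$ to a (real) diagonal element; (ii) $1$ is the only eigenvalue of $\mathrm{Ad}_a$ of absolute value $1$; (iii) no two different eigenvalues of $\mathrm{Ad}_a$ have the same absolute value. $T=T_a:X\to X$, $T(x)=a.x=xa^{-1}$. $\mathfrak g=\mathfrak g_-\oplus\mathfrak g_0\oplus\mathfrak g_+$, where $\mathfrak g_0$ is the eigenspace of $\mathrm{Ad}_a$ for eigenvalue $1$ and $\mathfrak g_-$ (resp. $\mathfrak g_+$) is the sum of eigenspaces with eigenvalues of absolute value $<1$ (resp. $>1$). $G^-=\{g: a^lga^{-l}\to e,\ l\to\infty\}$ and $G^+=\{g:a^lga^{-l}\to e,\ l\to-\infty\}$ are closed subgroups with Lie algebras $\mathfrak g_-,\mathfrak g_+$.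 $n=\dim\mathfrak g_+$, and $t>0$ is the logarithm of the absolute value of the eigenvalue of $\mathrm{Ad}_a$ on $\mathfrak g_+$. The Auslander normal subgroup of $a$ is the closed subgroup generated by $G^+$ and $G^-$. Bases consisting of eigenvectors of $\mathrm{Ad}_a$ are fixed for $\mathfrak g_-,\mathfrak g_0,\mathfrak g_+$; $B_s^-,B_s^0,B_s^+$ denote the balls of radius $s$ centered at $0$ in these spaces in the sup norms with respect to these bases. Local dimension: let $\kappa>0$. A Borel probability measure $\mu$ with compact support on $X$ has local dimension $\kappa$ in the unstable horospherical direction, with data $(s_0,\lambda)$, where $s_0>0$ and $\lambda$ is a finite measure on $X$, if there is a constant $C_\kappa$ such that for all $0<\tilde s\le s<s_0$, $u\in B_s^+$ with $B_{\tilde s}^++u\subset B_s^+$, $0<\delta<1$ and $x\in\mathrm{supp}(\mu)$, $$\mu\big(\exp(B_s^-)\exp(B_s^0)\exp(B^+_{\delta\tilde s}+u).x\big)\le C_\kappa\,\delta^\kappa\,\lambda\big(\exp(B_s^-)\exp(B_s^0)\exp(B^+_{\tilde s}+u).x\big).$$ $\mu$ has local maximal dimension in the unstable horospherical direction if there exist $s_0>0$ and a finite measure $\lambda$ such that this holds (with the same $s_0,\lambda$) for every $\kappa<n$. No loss of mass on average: every weak$^*$ limit point $\eta$ (tested against compactly supported continuous functions) of $\frac1k\sum_{l=0}^{k-1}T_*^l\mu$ satisfies $\eta(X)=1$. *)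

theory Defs
  imports "HOL-Analysis.Analysis" "HOL-Algebra.Coset"
begin

definition SL :: "(real ^ 'n ^ 'n) monoid" where
  "SL = \<lparr>carrier = {A. det A = 1}, mult = (**), one = mat 1\<rparr>"

definition mexp :: "real ^ 'n ^ 'n \<Rightarrow> real ^ 'n ^ 'n" where
  "mexp Y = (\<Sum>k. (1 / fact k) *\<^sub>R (((\<lambda>Z. Y ** Z) ^^ k) (mat 1)))"

definition lie_algebra :: "(real ^ 'n ^ 'n) set \<Rightarrow> (real ^ 'n ^ 'n) set" where
  "lie_algebra G = {Y. \<forall>t::real. mexp (t *\<^sub>R Y) \<in> G}"

definition Ad :: "real ^ 'n ^ 'n \<Rightarrow> real ^ 'n ^ 'n \<Rightarrow> real ^ 'n ^ 'n" where
  "Ad a Y = a ** Y ** inv\<^bsub>SL\<^esub> a"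

definition Ad_eigenspace ::
    "(real ^ 'n ^ 'n) set \<Rightarrow> real ^ 'n ^ 'n \<Rightarrow> real \<Rightarrow> (real ^ 'n ^ 'n) set" where
  "Ad_eigenspace G a c = {Y \<in> lie_algebra G. Ad a Y = c *\<^sub>R Y}"

text \<open>Only real eigenvalues are considered. In every use below \<open>a\<close> is conjugate to a real
  diagonal matrix, so that the restriction of \<open>Ad a\<close> to the Lie algebra is diagonalizable over
  the reals and has no other eigenvalues.\<close>

definition Ad_eigenvalue :: "(real ^ 'n ^ 'n) set \<Rightarrow> real ^ 'n ^ 'n \<Rightarrow> real \<Rightarrow> bool" where
  "Ad_eigenvalue G a c \<longleftrightarrow> (\<exists>Y \<in> Ad_eigenspace G a c. Y \<noteq> 0)"

definition class_A :: "(real ^ 'n ^ 'n) set \<Rightarrow> real ^ 'n ^ 'n \<Rightarrow> bool" where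
  "class_A G a \<longleftrightarrow>
     a \<in> G \<and>
     (\<exists>s \<in> carrier SL. \<forall>i j. i \<noteq> j \<longrightarrow> (s ** a ** inv\<^bsub>SL\<^esub> s) $ i $ j = 0) \<and>
     (\<forall>c. Ad_eigenvalue G a c \<and> \<bar>c\<bar> = 1 \<longrightarrow> c = 1) \<and>
     (\<forall>c d. Ad_eigenvalue G a c \<and> Ad_eigenvalue G a d \<and> c \<noteq> d \<longrightarrow> \<bar>c\<bar> \<noteq> \<bar>d\<bar>)"

definition g_minus :: "(real ^ 'n ^ 'n) set \<Rightarrow> real ^ 'n ^ 'n \<Rightarrow> (real ^ 'n ^ 'n) set" where
  "g_minus G a = span (\<Union>c \<in> {c. \<bar>c\<bar> < 1}. Ad_eigenspace G a c)"

definition g_zero :: "(real ^ 'n ^ 'n) set \<Rightarrow> real ^ 'n ^ 'n \<Rightarrow> (real ^ 'n ^ 'n) set" where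
  "g_zero G a = Ad_eigenspace G a 1"

definition g_plus :: "(real ^ 'n ^ 'n) set \<Rightarrow> real ^ 'n ^ 'n \<Rightarrow> (real ^ 'n ^ 'n) set" where
  "g_plus G a = span (\<Union>c \<in> {c. \<bar>c\<bar> > 1}. Ad_eigenspace G a c)"

definition G_minus :: "(real ^ 'n ^ 'n) set \<Rightarrow> real ^ 'n ^ 'n \<Rightarrow> (real ^ 'n ^ 'n) set" where
  "G_minus G a =
     {g \<in> G. ((\<lambda>l::int. a [^]\<^bsub>SL\<^esub> l ** g ** a [^]\<^bsub>SL\<^esub> (- l)) \<longlongrightarrow> mat 1) at_top}"

definition G_plus :: "(real ^ 'n ^ 'n) set \<Rightarrow> real ^ 'n ^ 'n \<Rightarrow> (real ^ 'n ^ 'n) set" where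
  "G_plus G a =
     {g \<in> G. ((\<lambda>l::int. a [^]\<^bsub>SL\<^esub> l ** g ** a [^]\<^bsub>SL\<^esub> (- l)) \<longlongrightarrow> mat 1) at_bot}"

definition auslander :: "(real ^ 'n ^ 'n) set \<Rightarrow> real ^ 'n ^ 'n \<Rightarrow> (real ^ 'n ^ 'n) set" where
  "auslander G a = (\<lambda>H. subgroup H (SL\<lparr>carrier := G\<rparr>) \<and> closed H) hull (G_plus G a \<union> G_minus G a)"

definition hspace :: "(real ^ 'n ^ 'n) set \<Rightarrow> (real ^ 'n ^ 'n) set \<Rightarrow> (real ^ 'n ^ 'n) set set" where
  "hspace \<Gamma> G = rcosets\<^bsub>SL\<lparr>carrier := G\<rparr>\<^esub> \<Gamma>"

text \<open>The quotient topology of the projection \<open>g \<mapsto> \<Gamma> g\<close>.\<close>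

definition hspace_topology ::
    "(real ^ 'n ^ 'n) set \<Rightarrow> (real ^ 'n ^ 'n) set \<Rightarrow> (real ^ 'n ^ 'n) set topology" where
  "hspace_topology \<Gamma> G =
     topology (\<lambda>U. U \<subseteq> hspace \<Gamma> G \<and> openin (top_of_set G) {g \<in> G. \<Gamma> #>\<^bsub>SL\<^esub> g \<in> U})"

lemma openin_hspace_topology:
  "openin (hspace_topology \<Gamma> G) U \<longleftrightarrow>
     U \<subseteq> hspace \<Gamma> G \<and> openin (top_of_set G) {g \<in> G. \<Gamma> #>\<^bsub>SL\<^esub> g \<in> U}"
proof -
  have "istopology (\<lambda>U. U \<subseteq> hspace \<Gamma> G \<and> openin (top_of_set G) {g \<in> G. \<Gamma> #>\<^bsub>SL\<^esub> g \<in> U})"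
  proof (unfold istopology_def, intro conjI allI impI; (elim conjE)?)
    fix S T assume "openin (top_of_set G) {g \<in> G. \<Gamma> #>\<^bsub>SL\<^esub> g \<in> S}"
      "openin (top_of_set G) {g \<in> G. \<Gamma> #>\<^bsub>SL\<^esub> g \<in> T}"
    then have "openin (top_of_set G) ({g \<in> G. \<Gamma> #>\<^bsub>SL\<^esub> g \<in> S} \<inter> {g \<in> G. \<Gamma> #>\<^bsub>SL\<^esub> g \<in> T})"
      by (rule openin_Int)
    moreover have "{g \<in> G. \<Gamma> #>\<^bsub>SL\<^esub> g \<in> S} \<inter> {g \<in> G. \<Gamma> #>\<^bsub>SL\<^esub> g \<in> T} = {g \<in> G. \<Gamma> #>\<^bsub>SL\<^esub> g \<in> S \<inter> T}"
      by blast
    ultimately show "openin (top_of_set G) {g \<in> G. \<Gamma> #>\<^bsub>SL\<^esub> g \<in> S \<inter> T}"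
      by simp
  next
    fix \<K>
    assume *: "\<forall>K\<in>\<K>. K \<subseteq> hspace \<Gamma> G \<and> openin (top_of_set G) {g \<in> G. \<Gamma> #>\<^bsub>SL\<^esub> g \<in> K}"
    have "openin (top_of_set G) (\<Union>K\<in>\<K>. {g \<in> G. \<Gamma> #>\<^bsub>SL\<^esub> g \<in> K})"
      using * by (intro openin_Union) auto
    moreover have "(\<Union>K\<in>\<K>. {g \<in> G. \<Gamma> #>\<^bsub>SL\<^esub> g \<in> K}) = {g \<in> G. \<Gamma> #>\<^bsub>SL\<^esub> g \<in> \<Union>\<K>}"
      by blast
    ultimately show "openin (top_of_set G) {g \<in> G. \<Gamma> #>\<^bsub>SL\<^esub> g \<in> \<Union>\<K>}"
      by simp
  qed blast+
  then show ?thesis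
    unfolding hspace_topology_def by (simp add: topology_inverse')
qed

definition hborel ::
    "(real ^ 'n ^ 'n) set \<Rightarrow> (real ^ 'n ^ 'n) set \<Rightarrow> (real ^ 'n ^ 'n) set measure" where
  "hborel \<Gamma> G = sigma (hspace \<Gamma> G) {U. openin (hspace_topology \<Gamma> G) U}"

text \<open>The left action \<open>g . x = x g\<inverse>\<close>.\<close>

definition act :: "real ^ 'n ^ 'n \<Rightarrow> (real ^ 'n ^ 'n) set \<Rightarrow> (real ^ 'n ^ 'n) set" where
  "act g x = x #>\<^bsub>SL\<^esub> inv\<^bsub>SL\<^esub> g"

definition borel_prob ::
    "(real ^ 'n ^ 'n) set \<Rightarrow> (real ^ 'n ^ 'n) set \<Rightarrow> (real ^ 'n ^ 'n) set measure \<Rightarrow> bool" where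
  "borel_prob \<Gamma> G \<mu> \<longleftrightarrow> sets \<mu> = sets (hborel \<Gamma> G) \<and> emeasure \<mu> (space \<mu>) = 1"

definition invariant_prob ::
    "(real ^ 'n ^ 'n) set \<Rightarrow> (real ^ 'n ^ 'n) set \<Rightarrow> (real ^ 'n ^ 'n) set \<Rightarrow>
     (real ^ 'n ^ 'n) set measure \<Rightarrow> bool" where
  "invariant_prob \<Gamma> G H \<mu> \<longleftrightarrow>
     borel_prob \<Gamma> G \<mu> \<and> (\<forall>h \<in> H. distr \<mu> (hborel \<Gamma> G) (act h) = \<mu>)"

definition uniquely_ergodic ::
    "(real ^ 'n ^ 'n) set \<Rightarrow> (real ^ 'n ^ 'n) set \<Rightarrow> (real ^ 'n ^ 'n) set \<Rightarrow> bool" where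
  "uniquely_ergodic \<Gamma> G H \<longleftrightarrow> (\<exists>!\<mu>. invariant_prob \<Gamma> G H \<mu>)"

definition lattice_in :: "(real ^ 'n ^ 'n) set \<Rightarrow> (real ^ 'n ^ 'n) set \<Rightarrow> bool" where
  "lattice_in \<Gamma> G \<longleftrightarrow>
     subgroup \<Gamma> (SL\<lparr>carrier := G\<rparr>) \<and> discrete \<Gamma> \<and> (\<exists>m. invariant_prob \<Gamma> G G m)"

definition msupport ::
    "(real ^ 'n ^ 'n) set \<Rightarrow> (real ^ 'n ^ 'n) set \<Rightarrow> (real ^ 'n ^ 'n) set measure \<Rightarrow>
     (real ^ 'n ^ 'n) set set" where
  "msupport \<Gamma> G \<mu> =
     {x \<in> hspace \<Gamma> G. \<forall>U. openin (hspace_topology \<Gamma> G) U \<and> x \<in> U \<longrightarrow> emeasure \<mu> U > 0}"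

definition Cc ::
    "(real ^ 'n ^ 'n) set \<Rightarrow> (real ^ 'n ^ 'n) set \<Rightarrow> ((real ^ 'n ^ 'n) set \<Rightarrow> real) set" where
  "Cc \<Gamma> G = {f. continuous_map (hspace_topology \<Gamma> G) euclideanreal f \<and>
     (\<exists>K. compactin (hspace_topology \<Gamma> G) K \<and> (\<forall>x \<in> hspace \<Gamma> G - K. f x = 0))}"

definition weak_star_lim ::
    "(real ^ 'n ^ 'n) set \<Rightarrow> (real ^ 'n ^ 'n) set \<Rightarrow> (nat \<Rightarrow> (real ^ 'n ^ 'n) set measure) \<Rightarrow>
     (real ^ 'n ^ 'n) set measure \<Rightarrow> bool" where
  "weak_star_lim \<Gamma> G \<nu> \<eta> \<longleftrightarrow>
     (\<forall>f \<in> Cc \<Gamma> G. (\<lambda>k. integral\<^sup>L (\<nu> k) f) \<longlonglongrightarrow> integral\<^sup>L \<eta> f)"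

text \<open>The average of the push-forwards of \<open>\<mu>\<close> under the first \<open>k\<close> iterates of \<open>act a\<close>
  (the zero measure for \<open>k = 0\<close>).\<close>

definition orbit_average ::
    "(real ^ 'n ^ 'n) set \<Rightarrow> (real ^ 'n ^ 'n) set \<Rightarrow> real ^ 'n ^ 'n \<Rightarrow>
     (real ^ 'n ^ 'n) set measure \<Rightarrow> nat \<Rightarrow> (real ^ 'n ^ 'n) set measure" where
  "orbit_average \<Gamma> G a \<mu> k =
     measure_of (hspace \<Gamma> G) (sets (hborel \<Gamma> G))
       (\<lambda>A. (\<Sum>l<k. emeasure (distr \<mu> (hborel \<Gamma> G) (act a ^^ l)) A) / of_nat k)"

text \<open>Weak-star limit points are limits of subsequences; since the space is locally compact and
  second countable, the weak-star topology on measures of mass at most one is metrizable, and these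
  are all the cluster points.\<close>

definition no_mass_loss_on_average ::
    "(real ^ 'n ^ 'n) set \<Rightarrow> (real ^ 'n ^ 'n) set \<Rightarrow> real ^ 'n ^ 'n \<Rightarrow>
     (real ^ 'n ^ 'n) set measure \<Rightarrow> bool" where
  "no_mass_loss_on_average \<Gamma> G a \<mu> \<longleftrightarrow>
     (\<forall>\<eta> (r :: nat \<Rightarrow> nat).
        finite_measure \<eta> \<and> sets \<eta> = sets (hborel \<Gamma> G) \<and> strict_mono r \<and>
        weak_star_lim \<Gamma> G (\<lambda>j. orbit_average \<Gamma> G a \<mu> (r j)) \<eta>
        \<longrightarrow> emeasure \<eta> (hspace \<Gamma> G) = 1)"

definition eigenbasis ::
    "real ^ 'n ^ 'n \<Rightarrow> (real ^ 'n ^ 'n) set \<Rightarrow> (real ^ 'n ^ 'n) set \<Rightarrow> bool" where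
  "eigenbasis a V B \<longleftrightarrow> independent B \<and> span B = V \<and> (\<forall>b \<in> B. \<exists>c::real. Ad a b = c *\<^sub>R b)"

text \<open>The open ball of radius \<open>s\<close> centred at the origin of \<open>span B\<close>, for the sup norm of the
  coordinates with respect to the basis \<open>B\<close>.\<close>

definition sball :: "(real ^ 'n ^ 'n) set \<Rightarrow> real \<Rightarrow> (real ^ 'n ^ 'n) set" where
  "sball B s = {v \<in> span B. \<forall>b \<in> B. \<bar>representation B v b\<bar> < s}"

text \<open>The set \<open>exp(B\<^sub>s\<^sup>-) exp(B\<^sub>s\<^sup>0) exp(B\<^sub>r\<^sup>+ + u) . x\<close>.\<close>

definition exp_box ::
    "(real ^ 'n ^ 'n) set \<Rightarrow> (real ^ 'n ^ 'n) set \<Rightarrow> (real ^ 'n ^ 'n) set \<Rightarrow>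
     real \<Rightarrow> real \<Rightarrow> real ^ 'n ^ 'n \<Rightarrow> (real ^ 'n ^ 'n) set \<Rightarrow> (real ^ 'n ^ 'n) set set" where
  "exp_box Bm Bz Bp s r u x =
     {act (mexp v ** mexp w ** mexp (y + u)) x |v w y.
        v \<in> sball Bm s \<and> w \<in> sball Bz s \<and> y \<in> sball Bp r}"

definition local_dim_unstable ::
    "(real ^ 'n ^ 'n) set \<Rightarrow> (real ^ 'n ^ 'n) set \<Rightarrow>
     (real ^ 'n ^ 'n) set \<Rightarrow> (real ^ 'n ^ 'n) set \<Rightarrow> (real ^ 'n ^ 'n) set \<Rightarrow>
     (real ^ 'n ^ 'n) set measure \<Rightarrow> real \<Rightarrow> real \<Rightarrow> (real ^ 'n ^ 'n) set measure \<Rightarrow> bool" where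
  "local_dim_unstable \<Gamma> G Bm Bz Bp \<mu> \<kappa> s0 \<Lambda> \<longleftrightarrow>
     borel_prob \<Gamma> G \<mu> \<and> compactin (hspace_topology \<Gamma> G) (msupport \<Gamma> G \<mu>) \<and>
     s0 > 0 \<and> finite_measure \<Lambda> \<and> sets \<Lambda> = sets (hborel \<Gamma> G) \<and>
     (\<exists>C::real. \<forall>s' s u \<delta>. \<forall>x \<in> msupport \<Gamma> G \<mu>.
        0 < s' \<and> s' \<le> s \<and> s < s0 \<and>
        u \<in> sball Bp s \<and> (\<lambda>y. y + u) ` sball Bp s' \<subseteq> sball Bp s \<and>
        0 < \<delta> \<and> \<delta> < 1 \<longrightarrow>
        measure \<mu> (exp_box Bm Bz Bp s (\<delta> * s') u x)
          \<le> C * \<delta> powr \<kappa> * measure \<Lambda> (exp_box Bm Bz Bp s s' u x))"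

definition local_max_dim_unstable ::
    "(real ^ 'n ^ 'n) set \<Rightarrow> (real ^ 'n ^ 'n) set \<Rightarrow> real ^ 'n ^ 'n \<Rightarrow>
     (real ^ 'n ^ 'n) set \<Rightarrow> (real ^ 'n ^ 'n) set \<Rightarrow> (real ^ 'n ^ 'n) set \<Rightarrow>
     (real ^ 'n ^ 'n) set measure \<Rightarrow> bool" where
  "local_max_dim_unstable \<Gamma> G a Bm Bz Bp \<mu> \<longleftrightarrow>
     (\<exists>s0 \<Lambda>. s0 > 0 \<and> finite_measure \<Lambda> \<and> sets \<Lambda> = sets (hborel \<Gamma> G) \<and>
       (\<forall>\<kappa>. 0 < \<kappa> \<and> \<kappa> < real (dim (g_plus G a)) \<longrightarrow>
        local_dim_unstable \<Gamma> G Bm Bz Bp \<mu> \<kappa> s0 \<Lambda>))"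

end

theory Submission
  imports Defs "HOL-Probability.Probability"
begin

text \<open>
  The proof is a covering argument. Put \<open>\<tau> = \<bar>c\<bar>\<close> for the eigenvalue \<open>c\<close> of \<open>Ad a\<close> on \<open>g_plus\<close> and \<open>n\<close> for
  the dimension of \<open>g_plus\<close>.

  Fix a compactly supported continuous function \<open>f\<close>. The action of \<open>a\<close> on \<open>m_X\<close> is ergodic: by a Mautner
  type argument the limit of the averages of \<open>f\<close> is invariant under \<open>G_plus\<close> and \<open>G_minus\<close>, because
  conjugation by powers of \<open>a\<close> shrinks their elements; so it is invariant under the Auslander subgroup, and
  unique ergodicity makes it constant. Hence the averages of \<open>f\<close> over the first \<open>M\<close> steps converge to the
  mean in measure (\<open>averages_converge_in_measure\<close>).

  The next step passes from \<open>m_X\<close>-measure to every single plaque \<open>exp y . x\<close>, \<open>y\<close> in a small ball of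
  \<open>g_plus\<close>. At time \<open>M\<close> a plaque is stretched by \<open>\<tau> ^ M\<close>, so that it consists of about \<open>\<tau> ^ (n * M)\<close> cells
  of size \<open>\<tau> ^ -M\<close> on which the average over \<open>M\<close> steps is nearly constant. In a compact part of the
  space, if \<open>M\<close> is large, only a proportion \<open>\<epsilon>\<close> of these cells is bad, that is, has an average far from the
  mean: otherwise, sliding the plaque along the contracting and neutral directions, which hardly changes
  the averages, would produce a set of bad points of \<open>m_X\<close>-measure bounded from below
  (\<open>bad_set_coverable\<close>).

  Since the map is again of the same kind on each stretched cell, these estimates can be multiplied along
  an orbit (\<open>coverable_blocks\<close>): among the \<open>\<tau> ^ (n * k)\<close> cells of size \<open>\<tau> ^ -k\<close> of a plaque,
  those which are bad at \<open>j\<close> given times in steps of \<open>M\<close> number only \<open>\<epsilon> ^ j * C ^ (k / M) * \<tau> ^ (n * k)\<close>. A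
  measure of dimension \<open>\<kappa>\<close> close to \<open>n\<close> gives each of these cells, thickened in the contracting and neutral
  directions, mass of order \<open>\<tau> ^ (- \<kappa> * k)\<close>. If \<open>\<epsilon>\<close> is small enough, the points which are bad for a
  fixed positive proportion of the time up to \<open>k\<close> therefore have \<open>\<mu>\<close>-measure tending to \<open>0\<close>
  (\<open>exceptional_set_null\<close>).

  For the other points of the compact part the average of \<open>f\<close> up to time \<open>k\<close> is close to the mean. The time
  spent outside a large compact part is small on average, since otherwise a weak-star limit point of the
  averages of \<open>\<mu>\<close> would have lost mass (\<open>tight_averages\<close>).
\<close>

section \<open>The matrix exponential\<close>

lemma norm_matrix_mult_le: "norm (A ** B) \<le> norm (A :: real^'n^'n) * norm (B :: real^'n^'n)"
proof -
  have sq: "(norm C)\<^sup>2 = (\<Sum>i\<in>UNIV. \<Sum>j\<in>UNIV. (C$i$j)\<^sup>2)" for C :: "real^'n^'n"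
    by (simp add: norm_vec_def L2_set_def sum_nonneg)
  have cs: "((A ** B)$i$j)\<^sup>2 \<le> (\<Sum>k\<in>UNIV. (A$i$k)\<^sup>2) * (\<Sum>k\<in>UNIV. (B$k$j)\<^sup>2)" for i j
    using Cauchy_Schwarz_ineq_sum[of "\<lambda>k. A$i$k" "\<lambda>k. B$k$j" UNIV]
    by (simp add: matrix_matrix_mult_def)
  have "(norm (A ** B))\<^sup>2 \<le> (\<Sum>i\<in>UNIV. \<Sum>j\<in>UNIV. (\<Sum>k\<in>UNIV. (A$i$k)\<^sup>2) * (\<Sum>k\<in>UNIV. (B$k$j)\<^sup>2))"
    unfolding sq by (intro sum_mono cs)
  also have "\<dots> = (\<Sum>i\<in>UNIV. \<Sum>k\<in>UNIV. (A$i$k)\<^sup>2) * (\<Sum>j\<in>UNIV. \<Sum>k\<in>UNIV. (B$k$j)\<^sup>2)"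
    by (simp add: sum_product)
  also have "\<dots> = (\<Sum>i\<in>UNIV. \<Sum>k\<in>UNIV. (A$i$k)\<^sup>2) * (\<Sum>k\<in>UNIV. \<Sum>j\<in>UNIV. (B$k$j)\<^sup>2)"
    by (subst (2) sum.swap) (rule refl)
  also have "\<dots> = (norm A * norm B)\<^sup>2"
    by (simp only: sq power_mult_distrib)
  finally have "(norm (A ** B))\<^sup>2 \<le> (norm A * norm B)\<^sup>2" .
  then show ?thesis
    by (rule power2_le_imp_le) simp
qed

lemma bounded_bilinear_matrix_mult: "bounded_bilinear ((**) :: real^'n^'n \<Rightarrow> real^'n^'n \<Rightarrow> real^'n^'n)"
proof
  show "\<exists>K. \<forall>(a :: real^'n^'n) (b :: real^'n^'n). norm (a ** b) \<le> norm a * norm b * K"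
    by (intro exI[of _ 1]) (simp add: norm_matrix_mult_le)
qed (auto simp: matrix_matrix_mult_def vec_eq_iff sum.distrib sum_distrib_left algebra_simps)

interpretation mm: bounded_bilinear "(**) :: real^'n^'n \<Rightarrow> real^'n^'n \<Rightarrow> real^'n^'n"
  by (rule bounded_bilinear_matrix_mult)

definition mpow :: "real^'n^'n \<Rightarrow> nat \<Rightarrow> real^'n^'n" where
  "mpow Y k = (((**) Y) ^^ k) (mat 1)"

lemma mpow_0 [simp]: "mpow Y 0 = mat 1"
  by (simp add: mpow_def)

lemma mpow_Suc: "mpow Y (Suc k) = Y ** mpow Y k"
  by (simp add: mpow_def)

lemma mpow_add: "mpow Y (j + k) = mpow Y j ** mpow Y k"
  by (induction j) (auto simp: mpow_Suc matrix_mul_assoc)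

lemma mpow_1 [simp]: "mpow Y (Suc 0) = Y"
  by (simp add: mpow_Suc)

lemma mpow_Suc2: "mpow Y (Suc k) = mpow Y k ** Y"
  using mpow_add[of Y k 1] by simp

lemma mpow_scaleR: "mpow (t *\<^sub>R Y) k = t ^ k *\<^sub>R mpow Y k"
  by (induction k) (auto simp: mpow_Suc mm.scaleR_left mm.scaleR_right)

lemma mpow_conj:
  assumes "h' ** h = mat 1" "h ** h' = mat 1"
  shows "mpow (h ** Y ** h') k = h ** mpow Y k ** h'"
proof (induction k)
  case (Suc k)
  have "mpow (h ** Y ** h') (Suc k) = h ** Y ** (h' ** h) ** mpow Y k ** h'"
    by (simp only: mpow_Suc Suc matrix_mul_assoc)
  then show ?case
    by (simp add: assms mpow_Suc matrix_mul_assoc)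
qed (auto simp: assms)

lemma norm_mpow_le: "norm (mpow Y k) \<le> norm (mat 1 :: real^'n^'n) * norm (Y :: real^'n^'n) ^ k"
proof (induction k)
  case (Suc k)
  have "norm (mpow Y (Suc k)) \<le> norm Y * norm (mpow Y k)"
    by (simp add: mpow_Suc norm_matrix_mult_le)
  also have "\<dots> \<le> norm Y * (norm (mat 1 :: real^'n^'n) * norm Y ^ k)"
    by (intro mult_left_mono Suc) auto
  finally show ?case
    by (simp add: mult_ac)
qed auto

lemma norm_mexp_term_le:
  "norm ((1 / fact k) *\<^sub>R mpow Y k) \<le> norm (mat 1 :: real^'n^'n) * (norm (Y :: real^'n^'n) ^ k /\<^sub>R fact k)"
  using norm_mpow_le[of Y k] by (simp add: divide_simps)

lemma mexp_sums: "(\<lambda>k. (1 / fact k) *\<^sub>R mpow Y k) sums mexp (Y :: real^'n^'n)"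
proof -
  have "summable (\<lambda>k. (1 / fact k) *\<^sub>R mpow Y k)"
    by (rule summable_comparison_test'[OF summable_mult[OF summable_exp_generic[of "norm Y"], of "norm (mat 1 :: real^'n^'n)"]])
       (use norm_mexp_term_le in auto)
  then show ?thesis
    by (simp add: mexp_def mpow_def summable_sums)
qed

lemma mexp_0 [simp]: "mexp 0 = mat 1"
proof -
  have "mpow (0::real^'n^'n) k = 0" if "k > 0" for k
    using that by (cases k) (auto simp: mpow_Suc)
  then have "(\<lambda>k. (1 / fact k) *\<^sub>R mpow (0::real^'n^'n) k) sums (\<Sum>k\<in>{0}. (1 / fact k) *\<^sub>R mpow 0 k)"
    by (intro sums_finite) auto
  then show ?thesis
    using sums_unique2[OF mexp_sums[of 0]] by simp
qed

lemma mexp_conj: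
  assumes "h' ** h = mat 1" "h ** h' = mat 1"
  shows "h ** mexp Y ** h' = mexp (h ** Y ** (h' :: real^'n^'n))"
proof -
  have "(\<lambda>k. h ** ((1 / fact k) *\<^sub>R mpow Y k) ** h') sums (h ** mexp Y ** h')"
    by (rule bounded_linear.sums[OF mm.bounded_linear_left
          bounded_linear.sums[OF mm.bounded_linear_right mexp_sums]])
  moreover have "h ** ((1 / fact k) *\<^sub>R mpow Y k) ** h' = (1 / fact k) *\<^sub>R mpow (h ** Y ** h') k" for k
    by (simp add: mpow_conj[OF assms] mm.scaleR_left mm.scaleR_right)
  ultimately have "(\<lambda>k. (1 / fact k) *\<^sub>R mpow (h ** Y ** h') k) sums (h ** mexp Y ** h')"
    by simp
  then show ?thesis
    by (rule sums_unique2[OF _ mexp_sums])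
qed

text \<open>Entrywise this is the Cauchy product of two real exponential series, the coefficients being
  summed by the binomial formula.\<close>

lemma mexp_add_multiples: "mexp (s *\<^sub>R Y) ** mexp (t *\<^sub>R Y) = mexp ((s + t) *\<^sub>R (Y :: real^'n^'n))"
proof -
  define e where "e r i j k = (1 / fact k) * (r ^ k * mpow Y k $ i $ j)" for r :: real and i j k
  have bl: "bounded_linear (\<lambda>A :: real^'n^'n. A $ i $ j)" for i j
    using bounded_linear_compose[OF bounded_linear_vec_nth bounded_linear_vec_nth] by blast
  have e_sums: "e r i j sums (mexp (r *\<^sub>R Y) $ i $ j)" for r i j
    using bounded_linear.sums[OF bl mexp_sums[of "r *\<^sub>R Y"], of i j]
    by (simp add: e_def[abs_def] mpow_scaleR)
  have e_summable: "summable (\<lambda>k. norm (e r i j k))" for r i j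
  proof (rule summable_comparison_test'[OF summable_mult[OF summable_exp_generic[of "norm (r *\<^sub>R Y)"], of "norm (mat 1 :: real^'n^'n)"]])
    fix k
    have "norm (e r i j k) \<le> norm ((1 / fact k) *\<^sub>R mpow (r *\<^sub>R Y) k)"
    proof -
      have "e r i j k = ((1 / fact k) *\<^sub>R mpow (r *\<^sub>R Y) k) $ i $ j"
        by (simp add: e_def mpow_scaleR)
      then show ?thesis
        by (metis Finite_Cartesian_Product.norm_nth_le order_trans)
    qed
    then show "norm (norm (e r i j k)) \<le> norm (mat 1 :: real^'n^'n) * (norm (r *\<^sub>R Y) ^ k /\<^sub>R fact k)"
      using norm_mexp_term_le[of k "r *\<^sub>R Y"] by simp
  qed
  have "(mexp (s *\<^sub>R Y) ** mexp (t *\<^sub>R Y)) $ i $ j = mexp ((s + t) *\<^sub>R Y) $ i $ j" for i j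
  proof -
    have "(\<lambda>k. \<Sum>l\<in>UNIV. \<Sum>p\<le>k. e s i l p * e t l j (k - p)) sums
        (\<Sum>l\<in>UNIV. (\<Sum>k. e s i l k) * (\<Sum>k. e t l j k))"
      by (intro sums_sum Cauchy_product_sums e_summable)
    also have "(\<Sum>l\<in>UNIV. (\<Sum>k. e s i l k) * (\<Sum>k. e t l j k)) = (mexp (s *\<^sub>R Y) ** mexp (t *\<^sub>R Y)) $ i $ j"
      by (simp add: matrix_matrix_mult_def sums_unique[OF e_sums, symmetric])
    also have "(\<lambda>k. \<Sum>l\<in>UNIV. \<Sum>p\<le>k. e s i l p * e t l j (k - p)) = e (s + t) i j"
    proof
      fix k
      have "(\<Sum>l\<in>UNIV. \<Sum>p\<le>k. e s i l p * e t l j (k - p))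
          = (\<Sum>p\<le>k. \<Sum>l\<in>UNIV. e s i l p * e t l j (k - p))"
        by (rule sum.swap)
      also have "\<dots> = (\<Sum>p\<le>k. (s ^ p * t ^ (k - p) / (fact p * fact (k - p))) * mpow Y k $ i $ j)"
      proof (rule sum.cong[OF refl])
        fix p assume "p \<in> {..k}"
        then have "mpow Y k = mpow Y p ** mpow Y (k - p)"
          by (simp flip: mpow_add)
        then show "(\<Sum>l\<in>UNIV. e s i l p * e t l j (k - p)) =
            (s ^ p * t ^ (k - p) / (fact p * fact (k - p))) * mpow Y k $ i $ j"
          by (simp add: e_def matrix_matrix_mult_def sum_distrib_left mult_ac divide_simps)
      qed
      also have "\<dots> = (\<Sum>p\<le>k. of_nat (k choose p) * s ^ p * t ^ (k - p)) / fact k * mpow Y k $ i $ j"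
        by (simp add: sum_distrib_right sum_divide_distrib binomial_fact divide_simps)
      also have "\<dots> = e (s + t) i j k"
        by (simp add: e_def binomial_ring)
      finally show "(\<Sum>l\<in>UNIV. \<Sum>p\<le>k. e s i l p * e t l j (k - p)) = e (s + t) i j k" .
    qed
    finally show ?thesis
      using e_sums sums_unique2 by blast
  qed
  then show ?thesis
    by (simp add: vec_eq_iff)
qed

lemma mexp_minus: "mexp Y ** mexp (- Y) = mat 1" "mexp (- Y) ** mexp Y = mat 1"
  using mexp_add_multiples[of 1 Y "-1"] mexp_add_multiples[of "-1" Y 1] by auto

lemma mexp_of_nat: "mexp (real k *\<^sub>R Y) = mpow (mexp Y) k"
proof (induction k)
  case (Suc k)
  have "mexp (real (Suc k) *\<^sub>R Y) = mexp (1 *\<^sub>R Y) ** mexp (real k *\<^sub>R Y)"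
    unfolding mexp_add_multiples by (simp add: algebra_simps)
  then show ?case
    by (simp add: Suc mpow_Suc)
qed auto

lemma mexp_first_order:
  assumes "norm (Y :: real^'n^'n) \<le> 1"
  shows "norm (mexp Y - mat 1 - Y) \<le> norm (mat 1 :: real^'n^'n) * (norm Y)\<^sup>2"
proof -
  let ?f = "\<lambda>k. (1 / fact k) *\<^sub>R mpow Y k" and ?I = "norm (mat 1 :: real^'n^'n)"
  have sm: "summable (\<lambda>k. norm Y ^ k /\<^sub>R fact k)" by (rule summable_exp_generic)
  have s: "(\<lambda>k. ?f (k + 2)) sums (mexp Y - mat 1 - Y)"
    using sums_split_initial_segment[OF mexp_sums[of Y], of 2]
    by (simp add: numeral_2_eq_2 algebra_simps)
  have r: "(\<lambda>k. norm Y ^ (k+2) /\<^sub>R fact (k+2)) sums (exp (norm Y) - 1 - norm Y)"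
    using sums_split_initial_segment[OF exp_converges[of "norm Y"], of 2]
    by (simp add: numeral_2_eq_2 algebra_simps)
  have "norm (mexp Y - mat 1 - Y) \<le> ?I * (exp (norm Y) - 1 - norm Y)"
    by (rule norm_sums_le[OF s sums_mult[OF r]]) (rule norm_mexp_term_le)
  also have "\<dots> \<le> ?I * (norm Y)\<^sup>2"
    using exp_bound[of "norm Y"] assms by (intro mult_left_mono) auto
  finally show ?thesis .
qed

lemma continuous_mpow: "continuous_on UNIV (\<lambda>Y :: real^'n^'n. mpow Y k)"
  by (induction k) (auto simp: mpow_Suc intro!: mm.continuous_on continuous_intros)

lemma continuous_mexp: "continuous_on UNIV (mexp :: real^'n^'n \<Rightarrow> _)"
proof -
  let ?f = "\<lambda>k Y :: real^'n^'n. (1 / fact k) *\<^sub>R mpow Y k"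
  have "continuous_on (ball 0 R) (mexp :: real^'n^'n \<Rightarrow> _)" if "R > 0" for R
  proof (rule uniform_limit_theorem)
    have "uniform_limit (ball 0 R) (\<lambda>m Y. \<Sum>k<m. ?f k Y) (\<lambda>Y. suminf (\<lambda>k. ?f k Y)) sequentially"
    proof (rule Weierstrass_m_test)
      show "summable (\<lambda>k. norm (mat 1 :: real^'n^'n) * (R ^ k /\<^sub>R fact k))"
        by (rule summable_mult[OF summable_exp_generic])
      fix k and Y :: "real^'n^'n" assume "Y \<in> ball 0 R"
      then have "norm (mat 1 :: real^'n^'n) * (norm Y ^ k /\<^sub>R fact k) \<le> norm (mat 1 :: real^'n^'n) * (R ^ k /\<^sub>R fact k)"
        by (intro mult_left_mono scaleR_left_mono power_mono) auto
      then show "norm (?f k Y) \<le> norm (mat 1 :: real^'n^'n) * (R ^ k /\<^sub>R fact k)"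
        using norm_mexp_term_le[of k Y] by linarith
    qed
    then show "uniform_limit (ball 0 R) (\<lambda>m Y. \<Sum>k<m. ?f k Y) mexp sequentially"
      by (simp only: sums_unique[OF mexp_sums, symmetric])
    show "\<forall>\<^sub>F m in sequentially. continuous_on (ball 0 R) (\<lambda>Y. \<Sum>k<m. ?f k Y)"
      by (intro always_eventually allI continuous_intros continuous_on_subset[OF continuous_mpow]) auto
  qed auto
  then have "continuous_on (\<Union>R\<in>{0<..}. ball 0 R) (mexp :: real^'n^'n \<Rightarrow> _)"
    by (intro continuous_on_open_UN) auto
  moreover have "Y \<in> (\<Union>R\<in>{0<..}. ball 0 R)" for Y :: "real^'n^'n"
    by (rule UN_I[of "norm Y + 1"]) (auto intro: add_nonneg_pos)
  then have "(\<Union>R\<in>{0<..}. ball 0 R) = (UNIV :: (real^'n^'n) set)"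
    by blast
  ultimately show ?thesis by simp
qed

lemma tendsto_mexp:
  fixes Y :: "real^'n^'n"
  assumes "(f \<longlongrightarrow> Y) F"
  shows "((\<lambda>x. mexp (f x)) \<longlongrightarrow> mexp Y) F"
  using continuous_on_tendsto_compose[OF continuous_mexp assms] by simp

lemma norm_le_mexp_diff:
  "\<exists>\<eta>>0. \<forall>Y :: real^'n^'n. norm Y \<le> \<eta> \<longrightarrow> norm Y \<le> 2 * norm (mexp Y - mat 1)"
proof -
  let ?I = "norm (mat 1 :: real^'n^'n)"
  define \<eta> where "\<eta> = min 1 (1 / (2 * (?I + 1)))"
  have I: "?I + 1 > 0" by (rule add_nonneg_pos) auto
  then have "\<eta> > 0" by (simp add: \<eta>_def)
  moreover have "norm Y \<le> 2 * norm (mexp Y - mat 1)" if "norm Y \<le> \<eta>" for Y :: "real^'n^'n"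
  proof -
    have "?I * norm Y \<le> (?I + 1) * norm Y" by (simp add: mult_right_mono)
    also have "\<dots> \<le> (?I + 1) * (1 / (2 * (?I + 1)))"
      using that by (intro mult_left_mono) (auto simp: \<eta>_def)
    also have "\<dots> = 1/2" using I by simp
    finally have *: "?I * norm Y \<le> 1/2" .
    have "norm (mexp Y - mat 1 - Y) \<le> ?I * norm Y * norm Y"
      using mexp_first_order[of Y] that by (simp add: \<eta>_def power2_eq_square mult.assoc)
    also have "\<dots> \<le> 1/2 * norm Y" by (intro mult_right_mono *) auto
    finally have "norm (mexp Y - mat 1 - Y) \<le> 1/2 * norm Y" .
    moreover have "norm Y \<le> norm (mexp Y - mat 1) + norm (mexp Y - mat 1 - Y)"
      using norm_triangle_ineq4[of "mexp Y - mat 1" "mexp Y - mat 1 - Y"] by simp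
    ultimately show ?thesis by simp
  qed
  ultimately show ?thesis by blast
qed

lemma norm_near_one_mult_le:
  fixes Z V :: "real^'n^'n"
  assumes "norm (Z - mat 1) \<le> d"
  shows "norm (Z ** V) \<le> (1 + d) * norm V"
proof -
  have "Z ** V = V + (Z - mat 1) ** V"
    by (simp add: mm.diff_left)
  then have "norm (Z ** V) \<le> norm V + norm ((Z - mat 1) ** V)"
    by (metis norm_triangle_ineq)
  also have "norm ((Z - mat 1) ** V) \<le> d * norm V"
    using norm_matrix_mult_le[of "Z - mat 1" V] assms mult_right_mono[OF assms, of "norm V"] by simp
  finally show ?thesis by (simp add: algebra_simps)
qed

lemma norm_mpow_diff_le:
  fixes Z W :: "real^'n^'n"
  assumes Z: "norm (Z - mat 1) \<le> d" and W: "norm (W - mat 1) \<le> d"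
  shows "norm (mpow Z k - mpow W k) \<le> real k * norm (mat 1 :: real^'n^'n) * (1 + d) ^ k * norm (Z - W)"
proof (induction k)
  case (Suc k)
  let ?I = "norm (mat 1 :: real^'n^'n)"
  have d: "d \<ge> 0" using Z norm_ge_zero order_trans by blast
  have Wk: "norm (mpow W j) \<le> ?I * (1 + d) ^ j" for j
  proof (induction j)
    case (Suc j)
    have "norm (mpow W (Suc j)) \<le> (1 + d) * norm (mpow W j)"
      by (simp add: mpow_Suc norm_near_one_mult_le[OF W])
    also have "\<dots> \<le> (1 + d) * (?I * (1 + d) ^ j)"
      by (intro mult_left_mono Suc) (use d in auto)
    finally show ?case by (simp add: mult_ac)
  qed auto
  have "mpow Z (Suc k) - mpow W (Suc k) = Z ** (mpow Z k - mpow W k) + (Z - W) ** mpow W k"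
    by (simp add: mpow_Suc mm.diff_left mm.diff_right)
  then have "norm (mpow Z (Suc k) - mpow W (Suc k)) \<le> norm (Z ** (mpow Z k - mpow W k)) + norm ((Z - W) ** mpow W k)"
    by (metis norm_triangle_ineq)
  also have "norm (Z ** (mpow Z k - mpow W k)) \<le> (1 + d) * (real k * ?I * (1 + d) ^ k * norm (Z - W))"
    by (rule order_trans[OF norm_near_one_mult_le[OF Z]]) (intro mult_left_mono Suc, use d in auto)
  also have "norm ((Z - W) ** mpow W k) \<le> norm (Z - W) * (?I * (1 + d) ^ k)"
    by (rule order_trans[OF norm_matrix_mult_le]) (intro mult_left_mono Wk, auto)
  also have "norm (Z - W) * (?I * (1 + d) ^ k) \<le> norm (Z - W) * (?I * (1 + d) ^ Suc k)"
    using d by (intro mult_left_mono power_increasing) auto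
  finally show ?case by (simp add: algebra_simps)
qed auto

lemma mexp_scaled_tendsto:
  "(\<lambda>k. real k *\<^sub>R (mexp ((1 / real k) *\<^sub>R A) - mat 1)) \<longlonglongrightarrow> (A :: real^'n^'n)"
proof -
  let ?I = "norm (mat 1 :: real^'n^'n)"
  have "(\<lambda>k. real k *\<^sub>R (mexp ((1 / real k) *\<^sub>R A) - mat 1) - A) \<longlonglongrightarrow> 0"
  proof (rule Lim_null_comparison)
    show "(\<lambda>k. (?I * (norm A)\<^sup>2) * (1 / real k)) \<longlonglongrightarrow> 0"
      using tendsto_mult_right_zero[OF lim_1_over_n] by simp
    show "\<forall>\<^sub>F k in sequentially. norm (real k *\<^sub>R (mexp ((1 / real k) *\<^sub>R A) - mat 1) - A) \<le> (?I * (norm A)\<^sup>2) * (1 / real k)"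
      using eventually_ge_at_top[of "nat \<lceil>norm A\<rceil> + 1"]
    proof eventually_elim
      case (elim k)
      then have k: "real k \<ge> norm A" "k > 0" by linarith+
      have "real k *\<^sub>R (mexp ((1 / real k) *\<^sub>R A) - mat 1) - A
          = real k *\<^sub>R (mexp ((1 / real k) *\<^sub>R A) - mat 1 - (1 / real k) *\<^sub>R A)"
        using k by (simp add: scaleR_diff_right)
      moreover have "norm (mexp ((1 / real k) *\<^sub>R A) - mat 1 - (1 / real k) *\<^sub>R A) \<le> ?I * (norm ((1 / real k) *\<^sub>R A))\<^sup>2"
        using k by (intro mexp_first_order) (simp add: divide_simps)
      ultimately have "norm (real k *\<^sub>R (mexp ((1 / real k) *\<^sub>R A) - mat 1) - A) \<le> real k * (?I * (norm ((1 / real k) *\<^sub>R A))\<^sup>2)"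
        by (simp add: mult_left_mono)
      also have "\<dots> = (?I * (norm A)\<^sup>2) * (1 / real k)"
        using k by (simp add: power2_eq_square divide_simps)
      finally show ?case .
    qed
  qed
  then show ?thesis
    using Lim_null by blast
qed

lemma mpow_tendsto_mexp:
  assumes "(\<lambda>k. real k *\<^sub>R (Z k - mat 1)) \<longlonglongrightarrow> (A :: real^'n^'n)"
  shows "(\<lambda>k. mpow (Z k) k) \<longlonglongrightarrow> mexp A"
proof -
  let ?I = "norm (mat 1 :: real^'n^'n)"
  define W where "W k = mexp ((1 / real k) *\<^sub>R A)" for k
  have W: "(\<lambda>k. real k *\<^sub>R (W k - mat 1)) \<longlonglongrightarrow> A"
    unfolding W_def by (rule mexp_scaled_tendsto)
  obtain C1 where C1: "norm (real k *\<^sub>R (Z k - mat 1)) \<le> C1" for k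
    using convergent_imp_Bseq[OF convergentI[OF assms]] unfolding Bseq_def by blast
  obtain C2 where C2: "norm (real k *\<^sub>R (W k - mat 1)) \<le> C2" for k
    using convergent_imp_Bseq[OF convergentI[OF W]] unfolding Bseq_def by blast
  define C where "C = max 0 (max C1 C2)"
  have "(\<lambda>k. mpow (Z k) k - mpow (W k) k) \<longlonglongrightarrow> 0"
  proof (rule Lim_null_comparison)
    have "(\<lambda>k. norm (real k *\<^sub>R (Z k - mat 1) - real k *\<^sub>R (W k - mat 1))) \<longlonglongrightarrow> norm (A - A)"
      by (intro tendsto_intros assms W)
    then show "(\<lambda>k. ?I * exp C * norm (real k *\<^sub>R (Z k - mat 1) - real k *\<^sub>R (W k - mat 1))) \<longlonglongrightarrow> 0"
      by (intro tendsto_mult_right_zero) simp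
    show "\<forall>\<^sub>F k in sequentially. norm (mpow (Z k) k - mpow (W k) k) \<le> ?I * exp C * norm (real k *\<^sub>R (Z k - mat 1) - real k *\<^sub>R (W k - mat 1))"
      using eventually_gt_at_top[of 0]
    proof eventually_elim
      case (elim k)
      have "real k * norm (Z k - mat 1) \<le> C" "real k * norm (W k - mat 1) \<le> C"
        using C1[of k] C2[of k] unfolding C_def norm_scaleR by auto
      then have "norm (Z k - mat 1) \<le> C / real k" "norm (W k - mat 1) \<le> C / real k"
        using elim by (simp_all add: pos_le_divide_eq mult.commute)
      from norm_mpow_diff_le[OF this, of k]
      have "norm (mpow (Z k) k - mpow (W k) k) \<le> real k * ?I * (1 + C / real k) ^ k * norm (Z k - W k)" .
      also have "\<dots> \<le> real k * ?I * exp C * norm (Z k - W k)"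
        using exp_ge_one_plus_x_over_n_power_n[of k C] elim
        by (intro mult_left_mono mult_right_mono) (auto simp: C_def)
      also have "\<dots> = ?I * exp C * norm (real k *\<^sub>R (Z k - W k))"
        by simp
      finally show ?case by (simp add: algebra_simps)
    qed
  qed
  then have "(\<lambda>k. mpow (Z k) k - mpow (W k) k + mexp A) \<longlonglongrightarrow> mexp A"
    using tendsto_add[OF _ tendsto_const[of "mexp A"]] by fastforce
  moreover have "mpow (W k) k = mexp A" if "k > 0" for k
    using that mexp_of_nat[of k "(1 / real k) *\<^sub>R A"] by (simp add: W_def)
  then have "\<forall>\<^sub>F k in sequentially. mpow (Z k) k - mpow (W k) k + mexp A = mpow (Z k) k"
    by (intro eventually_mono[OF eventually_gt_at_top[of 0]]) simp
  ultimately show ?thesis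
    by (rule Lim_transform_eventually)
qed

text \<open>The Lie product formula.\<close>

lemma trotter:
  fixes A B :: "real^'n^'n"
  shows "(\<lambda>k. mpow (mexp ((1 / real k) *\<^sub>R A) ** mexp ((1 / real k) *\<^sub>R B)) k) \<longlonglongrightarrow> mexp (A + B)"
proof (rule mpow_tendsto_mexp)
  let ?A = "\<lambda>k. mexp ((1 / real k) *\<^sub>R A)" and ?B = "\<lambda>k. mexp ((1 / real k) *\<^sub>R B)"
  have "(\<lambda>k. (1 / real k) *\<^sub>R B) \<longlonglongrightarrow> 0 *\<^sub>R B"
    by (intro tendsto_intros lim_1_over_n)
  then have "?B \<longlonglongrightarrow> mat 1"
    using tendsto_mexp by fastforce
  then have "(\<lambda>k. (real k *\<^sub>R (?A k - mat 1)) ** ?B k + real k *\<^sub>R (?B k - mat 1)) \<longlonglongrightarrow> A ** mat 1 + B"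
    by (intro tendsto_add mm.tendsto mexp_scaled_tendsto)
  moreover have "(real k *\<^sub>R (?A k - mat 1)) ** ?B k + real k *\<^sub>R (?B k - mat 1)
      = real k *\<^sub>R (?A k ** ?B k - mat 1)" for k
    by (simp add: mm.scaleR_left mm.diff_left algebra_simps)
  ultimately show "(\<lambda>k. real k *\<^sub>R (?A k ** ?B k - mat 1)) \<longlonglongrightarrow> A + B"
    by simp
qed

lemma mexp_has_derivative_0: "(mexp has_derivative (\<lambda>h. h)) (at (0 :: real^'n^'n))"
proof -
  let ?I = "norm (mat 1 :: real^'n^'n)"
  have "((\<lambda>h. norm (mexp (0 + h) - mexp 0 - h) / norm h) \<longlongrightarrow> 0) (at (0 :: real^'n^'n))"
  proof (rule Lim_null_comparison)
    have "((\<lambda>h :: real^'n^'n. ?I * norm h) \<longlongrightarrow> ?I * norm (0 :: real^'n^'n)) (at 0)"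
      by (intro tendsto_intros)
    then show "((\<lambda>h :: real^'n^'n. ?I * norm h) \<longlongrightarrow> 0) (at 0)"
      by simp
    have "\<forall>\<^sub>F h :: real^'n^'n in at 0. norm h < 1"
      unfolding eventually_at by (intro exI[of _ 1]) auto
    then show "\<forall>\<^sub>F h :: real^'n^'n in at 0. norm (norm (mexp (0 + h) - mexp 0 - h) / norm h) \<le> ?I * norm h"
    proof eventually_elim
      case (elim h)
      then show ?case
        using mexp_first_order[of h] by (cases "h = 0") (auto simp: power2_eq_square field_simps)
    qed
  qed
  then show ?thesis
    unfolding has_derivative_at by (auto intro: bounded_linear_ident)
qed

section \<open>Closed linear groups and their Lie algebras\<close>

abbreviation minv :: "real^'n^'n \<Rightarrow> real^'n^'n" where
  "minv g \<equiv> inv\<^bsub>SL\<^esub> g"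

lemma SL_simps [simp]: "carrier SL = {A. det A = 1}" "mult SL = (**)" "one SL = mat 1"
  by (simp_all add: SL_def)

lemma group_SL: "group (SL :: (real^'n^'n) monoid)"
proof (rule groupI)
  fix x :: "real^'n^'n" assume x: "x \<in> carrier SL"
  then have "invertible x" by (simp add: invertible_det_nz)
  then obtain y where y: "y ** x = mat 1" by (auto simp: invertible_def)
  then have "det y * det x = 1" by (metis det_mul det_I)
  then show "\<exists>y\<in>carrier SL. y \<otimes>\<^bsub>SL\<^esub> x = \<one>\<^bsub>SL\<^esub>"
    using x y by auto
qed (auto simp: det_mul matrix_mul_assoc)

interpretation SL: group "SL :: (real^'n^'n) monoid"
  by (rule group_SL)

locale closed_linear_group =
  fixes G :: "(real^'n^'n) set"
  assumes subgroup_G: "subgroup G SL" and closed_G: "closed G"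
begin

lemma G_SL: "g \<in> G \<Longrightarrow> g \<in> carrier SL"
  using subgroup.subset[OF subgroup_G] by blast

lemma one_G [simp]: "mat 1 \<in> G"
  using subgroup.one_closed[OF subgroup_G] by simp

lemma mult_G [simp]: "g \<in> G \<Longrightarrow> h \<in> G \<Longrightarrow> g ** h \<in> G"
  using subgroup.m_closed[OF subgroup_G] by simp

lemma minv_G [simp]: "g \<in> G \<Longrightarrow> minv g \<in> G"
  using subgroup.m_inv_closed[OF subgroup_G] by simp

lemma minv_left [simp]: "g \<in> G \<Longrightarrow> minv g ** g = mat 1"
  using SL.l_inv[OF G_SL] by simp

lemma minv_right [simp]: "g \<in> G \<Longrightarrow> g ** minv g = mat 1"
  using SL.r_inv[OF G_SL] by simp

lemma minv_mult: "g \<in> G \<Longrightarrow> h \<in> G \<Longrightarrow> minv (g ** h) = minv h ** minv g"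
  using SL.inv_mult_group[OF G_SL G_SL, of g h] by simp

lemma minv_minv [simp]: "g \<in> G \<Longrightarrow> minv (minv g) = g"
  using SL.inv_inv[OF G_SL, of g] by simp

lemma minv_one [simp]: "minv (mat 1 :: real^'n^'n) = mat 1"
  using SL.inv_one by simp

lemma minv_unique: "g \<in> G \<Longrightarrow> h \<in> G \<Longrightarrow> h ** g = mat 1 \<Longrightarrow> minv g = h"
  using SL.inv_equality[OF _ G_SL G_SL, of h g] by simp

lemma mpow_G [simp]: "g \<in> G \<Longrightarrow> mpow g k \<in> G"
  by (induction k) (auto simp: mpow_Suc)

lemma norm_minv_diff_le:
  assumes "g \<in> G" "h \<in> G" "norm (minv g) * norm (h - g) \<le> 1 / 2"
  shows "norm (minv h - minv g) \<le> 2 * (norm (minv g))\<^sup>2 * norm (h - g)"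
proof -
  have eq: "minv h - minv g = - (minv h ** (h - g) ** minv g)"
    using assms by (simp add: mm.diff_left mm.diff_right flip: matrix_mul_assoc)
  then have *: "norm (minv h - minv g) \<le> norm (minv h) * norm (h - g) * norm (minv g)"
  proof -
    have "norm (minv h - minv g) = norm (minv h ** (h - g) ** minv g)"
      unfolding eq by simp
    also have "\<dots> \<le> norm (minv h ** (h - g)) * norm (minv g)"
      by (rule norm_matrix_mult_le)
    also have "\<dots> \<le> norm (minv h) * norm (h - g) * norm (minv g)"
      by (intro mult_right_mono norm_matrix_mult_le) auto
    finally show ?thesis .
  qed
  also have "\<dots> = norm (minv h) * (norm (minv g) * norm (h - g))" by (simp add: mult_ac)
  also have "\<dots> \<le> norm (minv h) * (1 / 2)"
    using assms by (intro mult_left_mono) auto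
  finally have "norm (minv h) \<le> 2 * norm (minv g)"
    using norm_triangle_ineq2[of "minv h" "minv g"] by simp
  then have "norm (minv h) * norm (h - g) * norm (minv g) \<le> (2 * norm (minv g)) * norm (h - g) * norm (minv g)"
    by (intro mult_right_mono) auto
  with * show ?thesis by (simp add: power2_eq_square mult_ac)
qed

lemma continuous_on_minv: "continuous_on G minv"
proof (rule continuous_onI)
  fix g :: "real^'n^'n" and e :: real assume g: "g \<in> G" and e: "e > 0"
  let ?N = "norm (minv g)"
  define d where "d = min (1 / (2 * (?N + 1))) (e / (4 * (?N\<^sup>2 + 1)))"
  have p: "?N + 1 > 0" "?N\<^sup>2 + 1 > 0" by (auto intro: add_nonneg_pos)
  have d: "d > 0" using e p by (auto simp: d_def)
  moreover have "dist (minv h) (minv g) \<le> e" if h: "h \<in> G" "dist h g < d" for h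
  proof -
    have n: "norm (h - g) \<le> d" using h by (simp add: dist_norm)
    have "?N * norm (h - g) \<le> (?N + 1) * (1 / (2 * (?N + 1)))"
      using n by (intro mult_mono) (auto simp: d_def)
    also have "\<dots> = 1 / 2" using p by simp
    finally have "norm (minv h - minv g) \<le> 2 * ?N\<^sup>2 * norm (h - g)"
      using norm_minv_diff_le g h by blast
    also have "\<dots> \<le> 2 * (?N\<^sup>2 + 1) * (e / (4 * (?N\<^sup>2 + 1)))"
      using n by (intro mult_mono) (auto simp: d_def)
    also have "\<dots> \<le> e" using p e by (simp add: field_simps)
    finally show ?thesis by (simp add: dist_norm)
  qed
  ultimately show "\<exists>d>0. \<forall>x'\<in>G. dist x' g < d \<longrightarrow> dist (minv x') (minv g) \<le> e"
    by blast
qed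

lemma tendsto_minv: "(f \<longlongrightarrow> g) F \<Longrightarrow> \<forall>\<^sub>F x in F. f x \<in> G \<Longrightarrow> g \<in> G \<Longrightarrow> ((\<lambda>x. minv (f x)) \<longlongrightarrow> minv g) F"
  by (rule continuous_on_tendsto_compose[OF continuous_on_minv])

lemma mexp_G: "Y \<in> lie_algebra G \<Longrightarrow> mexp Y \<in> G"
  using spec[of "\<lambda>t. mexp (t *\<^sub>R Y) \<in> G" 1] by (simp add: lie_algebra_def)

lemma subspace_lie_algebra: "subspace (lie_algebra G)"
proof (rule subspaceI)
  fix X Y assume X: "X \<in> lie_algebra G" and Y: "Y \<in> lie_algebra G"
  have "mexp (t *\<^sub>R (X + Y)) \<in> G" for t
  proof -
    have "mexp ((1 / real k) *\<^sub>R t *\<^sub>R V) \<in> G" if "V \<in> lie_algebra G" for V k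
      using that by (auto simp: lie_algebra_def)
    then have "mpow (mexp ((1 / real k) *\<^sub>R t *\<^sub>R X) ** mexp ((1 / real k) *\<^sub>R t *\<^sub>R Y)) k \<in> G" for k
      using X Y by (intro mpow_G mult_G) auto
    then show ?thesis
      using closed_sequentially[OF closed_G _ trotter[of "t *\<^sub>R X" "t *\<^sub>R Y"]] by (simp add: scaleR_add_right)
  qed
  then show "X + Y \<in> lie_algebra G" by (simp add: lie_algebra_def)
qed (auto simp: lie_algebra_def)

lemma minv_mexp: "Y \<in> lie_algebra G \<Longrightarrow> minv (mexp Y) = mexp (- Y)"
  by (rule minv_unique) (auto intro: mexp_G subspace_neg subspace_lie_algebra simp: mexp_minus)

text \<open>The one-parameter group in the limiting direction is approximated by integer powers of the
  elements \<open>mexp (Y k)\<close>, since \<open>\<lfloor>t / norm (Y k)\<rfloor>\<close> multiples of \<open>Y k\<close> converge to \<open>t\<close> times the direction.\<close>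

lemma lie_algebra_limit_direction:
  assumes Y: "\<And>k. mexp (Y k) \<in> G" "\<And>k. Y k \<noteq> 0" "Y \<longlonglongrightarrow> 0"
    and lim: "(\<lambda>k. (1 / norm (Y k)) *\<^sub>R Y k) \<longlonglongrightarrow> Z"
  shows "Z \<in> lie_algebra G"
proof -
  have int: "mexp (of_int m *\<^sub>R Y k) \<in> G" for m :: int and k
  proof (cases "m \<ge> 0")
    case True
    then show ?thesis using mexp_of_nat[of "nat m" "Y k"] Y(1) by simp
  next
    case False
    have "mexp (- Y k) \<in> G"
    proof -
      have "minv (mexp (Y k)) = (minv (mexp (Y k)) ** mexp (Y k)) ** mexp (- Y k)"
        using mexp_minus[of "Y k"] by (simp flip: matrix_mul_assoc)
      then show ?thesis using Y(1)[of k] minv_G[OF Y(1)[of k]] by simp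
    qed
    then show ?thesis using False mexp_of_nat[of "nat (- m)" "- Y k"] by simp
  qed
  have "mexp (t *\<^sub>R Z) \<in> G" for t
  proof (rule closed_sequentially[OF closed_G])
    let ?m = "\<lambda>k. \<lfloor>t / norm (Y k)\<rfloor>"
    show "mexp (of_int (?m k) *\<^sub>R Y k) \<in> G" for k by (rule int)
    have "(\<lambda>k. of_int (?m k) * norm (Y k) - t) \<longlonglongrightarrow> 0"
    proof (rule Lim_null_comparison)
      show "(\<lambda>k. norm (Y k)) \<longlonglongrightarrow> 0" using Y(3) tendsto_norm_zero by blast
      show "\<forall>\<^sub>F k in sequentially. norm (of_int (?m k) * norm (Y k) - t) \<le> norm (Y k)"
      proof (intro always_eventually allI)
        fix k
        have n: "norm (Y k) > 0" using Y(2) by simp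
        have "of_int (?m k) * norm (Y k) \<le> t"
          using n by (simp add: pos_le_divide_eq[symmetric])
        moreover have "t < (of_int (?m k) + 1) * norm (Y k)"
          using n by (simp add: pos_divide_less_eq[symmetric])
        ultimately show "norm (of_int (?m k) * norm (Y k) - t) \<le> norm (Y k)"
          by (simp add: distrib_right abs_le_iff)
      qed
    qed
    then have "(\<lambda>k. of_int (?m k) * norm (Y k)) \<longlonglongrightarrow> t" by (rule LIM_zero_cancel)
    then have "(\<lambda>k. (of_int (?m k) * norm (Y k)) *\<^sub>R ((1 / norm (Y k)) *\<^sub>R Y k)) \<longlonglongrightarrow> t *\<^sub>R Z"
      by (intro tendsto_scaleR lim)
    then have "(\<lambda>k. of_int (?m k) *\<^sub>R Y k) \<longlonglongrightarrow> t *\<^sub>R Z"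
      using Y(2) by simp
    then show "(\<lambda>k. mexp (of_int (?m k) *\<^sub>R Y k)) \<longlonglongrightarrow> mexp (t *\<^sub>R Z)"
      by (rule tendsto_mexp)
  qed
  then show ?thesis by (simp add: lie_algebra_def)
qed

lemma Ad_mexp: "g \<in> G \<Longrightarrow> g ** mexp Y ** minv g = mexp (Ad g Y)"
  unfolding Ad_def by (intro mexp_conj) auto

lemma linear_Ad: "linear (Ad g)"
  by (rule linearI) (auto simp: Ad_def mm.add_left mm.add_right mm.scaleR_left mm.scaleR_right)

lemma Ad_lie_algebra: "g \<in> G \<Longrightarrow> Y \<in> lie_algebra G \<Longrightarrow> Ad g Y \<in> lie_algebra G"
  by (auto simp: lie_algebra_def linear_cmul[OF linear_Ad, symmetric] Ad_mexp[symmetric])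

end

section \<open>Sup-norm balls and grids\<close>

lemma representation_sum_scaleR:
  assumes B: "independent B" "finite B" and b: "b \<in> B"
  shows "representation B (\<Sum>b'\<in>B. f b' *\<^sub>R b') b = f b"
proof -
  have "representation B (\<Sum>b'\<in>B. f b' *\<^sub>R b') = (\<lambda>v. \<Sum>b'\<in>B. representation B (f b' *\<^sub>R b') v)"
    using B by (intro representation_sum) (auto intro: span_scale span_base)
  moreover have "representation B (f b' *\<^sub>R b') b = (if b' = b then f b else 0)" if "b' \<in> B" for b'
    using B that b by (auto simp: representation_scale representation_basis span_base)
  ultimately show ?thesis
    using B b by simp
qed

lemma representation_bounded:
  fixes B :: "'a::euclidean_space set"
  assumes B: "independent B"
  shows "\<exists>K>0. \<forall>v\<in>span B. \<forall>b\<in>B. \<bar>representation B v b\<bar> \<le> K * norm v"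
proof -
  have fin: "finite B" using B by (rule independent_imp_finite)
  have "\<exists>K>0. \<forall>v\<in>span B. \<bar>representation B v b\<bar> \<le> K * norm v" if b: "b \<in> B" for b
  proof -
    obtain g :: "'a \<Rightarrow> real" where g: "linear g" "\<forall>x\<in>B. g x = (if x = b then 1 else 0)"
      using linear_independent_extend[OF B, of "\<lambda>x. if x = b then 1 else 0"] by blast
    have "g v = representation B v b" if "v \<in> span B" for v
    proof -
      have "g v = g (\<Sum>x\<in>B. representation B v x *\<^sub>R x)"
        using sum_representation_eq[OF B that fin] by simp
      also have "\<dots> = (\<Sum>x\<in>B. representation B v x * g x)"
        by (simp add: linear_sum[OF g(1)] linear_cmul[OF g(1)])
      also have "\<dots> = representation B v b"
      proof -
        have "(\<Sum>x\<in>B. representation B v x * g x) = (\<Sum>x\<in>B. if x = b then representation B v x else 0)"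
          using g(2) by (intro sum.cong) auto
        then show ?thesis using fin b by simp
      qed
      finally show ?thesis .
    qed
    moreover obtain K where "K > 0" "\<And>v. norm (g v) \<le> K * norm v"
      using linear_bounded_pos[OF g(1)] by blast
    ultimately have "\<forall>v\<in>span B. \<bar>representation B v b\<bar> \<le> K * norm v"
      by (metis real_norm_def)
    then show ?thesis using \<open>K > 0\<close> by blast
  qed
  then have "\<forall>b\<in>B. \<exists>K>0. \<forall>v\<in>span B. \<bar>representation B v b\<bar> \<le> K * norm v" by blast
  from bchoice[OF this] obtain K where K: "\<And>b. b \<in> B \<Longrightarrow> K b > 0"
    "\<And>b v. b \<in> B \<Longrightarrow> v \<in> span B \<Longrightarrow> \<bar>representation B v b\<bar> \<le> K b * norm v"
    by blast
  have "\<bar>representation B v b\<bar> \<le> (1 + sum K B) * norm v" if "v \<in> span B" "b \<in> B" for v b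
  proof -
    have "K b \<le> sum K B" using K(1) that fin by (intro member_le_sum) (auto intro: less_imp_le)
    then have "K b * norm v \<le> (1 + sum K B) * norm v" by (intro mult_right_mono) auto
    with K(2) that show ?thesis by fastforce
  qed
  moreover have "1 + sum K B > 0" using K(1) by (intro add_pos_nonneg sum_nonneg) (auto intro: less_imp_le)
  ultimately show ?thesis by blast
qed

lemma sball_span: "v \<in> sball B s \<Longrightarrow> v \<in> span B"
  by (simp add: sball_def)

lemma sball_mono: "s \<le> r \<Longrightarrow> v \<in> sball B s \<Longrightarrow> v \<in> sball B r"
  by (force simp: sball_def)

lemma sball_contains_ball:
  assumes "independent B" "s > 0"
  shows "\<exists>\<eta>>0. \<forall>v\<in>span B. norm v < \<eta> \<longrightarrow> v \<in> sball B s"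
proof -
  obtain K where K: "K > 0" "\<forall>v\<in>span B. \<forall>b\<in>B. \<bar>representation B v b\<bar> \<le> K * norm v"
    using representation_bounded[OF assms(1)] by blast
  have "v \<in> sball B s" if "v \<in> span B" "norm v < s / K" for v
  proof -
    have "K * norm v < s" using that K(1) by (simp add: field_simps)
    then show ?thesis using K(2) that by (force simp: sball_def)
  qed
  then show ?thesis using assms K(1) by (intro exI[of _ "s / K"]) auto
qed

lemma norm_sball_le:
  assumes B: "independent B"
  shows "\<exists>K>0. \<forall>s\<ge>0. \<forall>v\<in>sball B s. norm v \<le> K * s"
proof -
  have fin: "finite B" using B by (rule independent_imp_finite)
  define K where "K = 1 + (\<Sum>b\<in>B. norm b)"
  have "norm v \<le> K * s" if v: "v \<in> sball B s" and s: "s \<ge> 0" for v s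
  proof -
    have "norm v = norm (\<Sum>b\<in>B. representation B v b *\<^sub>R b)"
      using sum_representation_eq[OF B sball_span[OF v] fin] by simp
    also have "\<dots> \<le> (\<Sum>b\<in>B. norm (representation B v b *\<^sub>R b))" by (rule norm_sum)
    also have "\<dots> \<le> (\<Sum>b\<in>B. s * norm b)"
    proof (rule sum_mono)
      fix b assume "b \<in> B"
      then have "\<bar>representation B v b\<bar> \<le> s" using v by (force simp: sball_def)
      then show "norm (representation B v b *\<^sub>R b) \<le> s * norm b" by (simp add: mult_right_mono)
    qed
    also have "\<dots> \<le> K * s"
      using s by (simp add: K_def algebra_simps sum_distrib_left)
    finally show ?thesis .
  qed
  moreover have "K > 0" unfolding K_def by (intro add_pos_nonneg sum_nonneg) auto
  ultimately show ?thesis by blast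
qed

lemma sball_add:
  "independent B \<Longrightarrow> v \<in> sball B s \<Longrightarrow> w \<in> sball B r \<Longrightarrow> v + w \<in> sball B (s + r)"
  by (fastforce simp: sball_def representation_add span_add)

lemma sball_uminus: "independent B \<Longrightarrow> v \<in> sball B s \<Longrightarrow> - v \<in> sball B s"
  by (auto simp: sball_def representation_neg span_neg)

lemma sball_diff:
  "independent B \<Longrightarrow> v \<in> sball B s \<Longrightarrow> w \<in> sball B r \<Longrightarrow> v - w \<in> sball B (s + r)"
  using sball_add[of B v s "- w" r] by (simp add: sball_uminus)

lemma sball_scaleR:
  assumes "independent B" "c \<noteq> 0"
  shows "c *\<^sub>R v \<in> sball B (\<bar>c\<bar> * s) \<longleftrightarrow> v \<in> sball B s"
proof -
  have "c *\<^sub>R v \<in> span B \<longleftrightarrow> v \<in> span B"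
    using span_scale[of "c *\<^sub>R v" B "1 / c"] span_scale[of v B c] assms by auto
  then show ?thesis
    using assms by (auto simp: sball_def representation_scale abs_mult)
qed

text \<open>Rounding the coordinates down to multiples of \<open>\<delta>\<close>.\<close>

lemma sball_grid:
  fixes B :: "(real^'n^'n) set"
  assumes B: "independent B" and \<delta>: "0 < \<delta>" "\<delta> \<le> s"
  shows "\<exists>U. finite U \<and> U \<subseteq> sball B (2 * s) \<and> real (card U) \<le> (4 * s / \<delta>) ^ card B \<and>
           (\<forall>y\<in>sball B s. \<exists>u\<in>U. y - u \<in> sball B \<delta>)"
proof -
  have fin: "finite B" using B by (rule independent_imp_finite)
  define m where "m = \<lceil>s / \<delta>\<rceil>"
  define pt where "pt k = (\<Sum>b\<in>B. (\<delta> * of_int (k b)) *\<^sub>R b)" for k :: "real^'n^'n \<Rightarrow> int"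
  define U where "U = pt ` (B \<rightarrow>\<^sub>E {- m..m - 1})"
  have pt_span: "pt k \<in> span B" for k
    unfolding pt_def by (intro span_sum span_scale span_base)
  have pt_rep: "representation B (pt k) b = \<delta> * of_int (k b)" if "b \<in> B" for k b
    unfolding pt_def using representation_sum_scaleR[OF B fin that] .
  have m1: "s / \<delta> \<le> of_int m" "of_int m < s / \<delta> + 1" unfolding m_def by linarith+
  have m2: "m \<ge> 1" using \<delta> by (simp add: m_def le_ceiling_iff)
  have finF: "finite (B \<rightarrow>\<^sub>E {- m..m - 1})" using fin by (intro finite_PiE) auto
  have "U \<subseteq> sball B (2 * s)"
  proof
    fix u assume "u \<in> U"
    then obtain k where k: "u = pt k" "k \<in> B \<rightarrow>\<^sub>E {- m..m - 1}" by (auto simp: U_def)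
    have "\<bar>representation B u b\<bar> < 2 * s" if b: "b \<in> B" for b
    proof -
      have "k b \<in> {- m..m - 1}" using k(2) b by auto
      then have "\<bar>of_int (k b)\<bar> \<le> (of_int m :: real)" by (auto simp: abs_le_iff)
      then have "\<delta> * \<bar>of_int (k b)\<bar> \<le> \<delta> * of_int m" using \<delta> by (intro mult_left_mono) auto
      also have "\<dots> < \<delta> * (s / \<delta> + 1)" using m1 \<delta> by (intro mult_strict_left_mono) auto
      also have "\<dots> \<le> 2 * s" using \<delta> by (simp add: algebra_simps)
      finally show ?thesis using k pt_rep[OF b] \<delta> by (simp add: abs_mult)
    qed
    then show "u \<in> sball B (2 * s)" using k pt_span by (simp add: sball_def)
  qed
  moreover have "finite U" using finF by (simp add: U_def)
  moreover have "real (card U) \<le> (4 * s / \<delta>) ^ card B"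
  proof -
    have "card U \<le> card (B \<rightarrow>\<^sub>E {- m..m - 1})" unfolding U_def by (rule card_image_le[OF finF])
    also have "\<dots> = nat (2 * m) ^ card B" using fin by (simp add: card_PiE)
    finally have "real (card U) \<le> real (nat (2 * m)) ^ card B" by (metis of_nat_le_iff of_nat_power)
    also have "\<dots> \<le> (4 * s / \<delta>) ^ card B"
    proof (rule power_mono)
      have "s / \<delta> \<ge> 1" using \<delta> by simp
      then show "real (nat (2 * m)) \<le> 4 * s / \<delta>" using m1 m2 by simp
    qed auto
    finally show ?thesis .
  qed
  moreover have "\<exists>u\<in>U. y - u \<in> sball B \<delta>" if y: "y \<in> sball B s" for y
  proof -
    define k where "k = (\<lambda>b\<in>B. \<lfloor>representation B y b / \<delta>\<rfloor>)"
    have yb: "\<bar>representation B y b\<bar> < s" if "b \<in> B" for b using y that by (auto simp: sball_def)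
    have "k \<in> B \<rightarrow>\<^sub>E {- m..m - 1}"
    proof (rule PiE_I)
      fix b assume b: "b \<in> B"
      have "\<bar>representation B y b / \<delta>\<bar> < s / \<delta>"
        using yb[OF b] \<delta> by (simp add: divide_strict_right_mono)
      then have "representation B y b / \<delta> < of_int m" "- of_int m \<le> representation B y b / \<delta>"
        using m1 by linarith+
      then show "k b \<in> {- m..m - 1}" using b by (auto simp: k_def le_floor_iff floor_less_iff simp flip: less_iff_succ_less_eq)
    qed (auto simp: k_def)
    then have "pt k \<in> U" by (auto simp: U_def)
    moreover have "\<bar>representation B (y - pt k) b\<bar> < \<delta>" if b: "b \<in> B" for b
    proof -
      let ?q = "representation B y b / \<delta>"
      have "representation B (y - pt k) b = \<delta> * (?q - of_int \<lfloor>?q\<rfloor>)"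
        using \<delta> b y by (simp add: representation_diff[OF B] pt_span sball_span pt_rep k_def algebra_simps)
      moreover have "0 \<le> ?q - of_int \<lfloor>?q\<rfloor>" "?q - of_int \<lfloor>?q\<rfloor> < 1" by linarith+
      ultimately show ?thesis using \<delta> by (simp add: abs_mult)
    qed
    then have "y - pt k \<in> sball B \<delta>"
      using y pt_span by (simp add: sball_def span_diff)
    ultimately show ?thesis by blast
  qed
  ultimately show ?thesis by blast
qed

section \<open>Decomposition of the Lie algebra and local coordinates\<close>

text \<open>Applying \<open>L - d\<close> removes the \<open>d\<close>-component of a sum of eigenvectors and multiplies the other
  components by non-zero factors, so that induction on the number of components applies.\<close>

lemma eigen_components_in_subspace:
  assumes V: "subspace V" and L: "linear L" "\<And>v. v \<in> V \<Longrightarrow> L v \<in> V"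
    and "finite C" "\<And>c. c \<in> C \<Longrightarrow> L (Y c) = c *\<^sub>R Y c" "(\<Sum>c\<in>C. Y c) \<in> V"
  shows "\<forall>c\<in>C. Y c \<in> V"
  using assms(4-6)
proof (induction C arbitrary: Y rule: finite_induct)
  case (insert d C)
  have S: "(\<Sum>c\<in>insert d C. Y c) = Y d + (\<Sum>c\<in>C. Y c)"
    using insert.hyps by simp
  have "L (Y d + (\<Sum>c\<in>C. Y c)) - d *\<^sub>R (Y d + (\<Sum>c\<in>C. Y c)) = (\<Sum>c\<in>C. L (Y c) - d *\<^sub>R Y c)"
    using insert.prems(1)[of d]
    by (simp add: linear_add[OF L(1)] linear_sum[OF L(1)] scaleR_sum_right sum_subtractf scaleR_add_right)
  also have "\<dots> = (\<Sum>c\<in>C. (c - d) *\<^sub>R Y c)"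
    using insert.prems(1) by (intro sum.cong) (auto simp: scaleR_diff_left)
  finally have eq: "L (Y d + (\<Sum>c\<in>C. Y c)) - d *\<^sub>R (Y d + (\<Sum>c\<in>C. Y c)) = (\<Sum>c\<in>C. (c - d) *\<^sub>R Y c)" .
  have "(\<Sum>c\<in>C. (c - d) *\<^sub>R Y c) \<in> V"
    unfolding eq[symmetric] using insert.prems(2)[unfolded S] by (intro subspace_diff[OF V] L(2) subspace_scale[OF V])
  then have cd: "\<forall>c\<in>C. (c - d) *\<^sub>R Y c \<in> V"
    using insert.prems(1) by (intro insert.IH) (auto simp: linear_cmul[OF L(1)])
  have *: "Y c \<in> V" if "c \<in> C" for c
  proof -
    have "c - d \<noteq> 0" using that insert.hyps by auto
    moreover have "(1 / (c - d)) *\<^sub>R ((c - d) *\<^sub>R Y c) \<in> V"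
      by (rule subspace_scale[OF V]) (use cd that in auto)
    ultimately show ?thesis by simp
  qed
  moreover have "(Y d + (\<Sum>c\<in>C. Y c)) - (\<Sum>c\<in>C. Y c) \<in> V"
    using insert.prems(2)[unfolded S] * by (intro subspace_diff[OF V] subspace_sum[OF V])
  then have "Y d \<in> V" by simp
  ultimately show ?case by blast
qed auto

text \<open>If \<open>a\<close> is diagonal with entries \<open>d i\<close>, the matrix with a single non-zero entry at \<open>(i, j)\<close> is an
  eigenvector of \<open>Ad a\<close> for \<open>d i / d j\<close>; the components collect the entries with equal quotients.\<close>

lemma Ad_diagonalizable:
  fixes a s :: "real^'n^'n"
  assumes a: "a \<in> carrier SL" and s: "s \<in> carrier SL"
    and diag: "\<forall>i j. i \<noteq> j \<longrightarrow> (s ** a ** minv s) $ i $ j = 0"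
  shows "\<exists>C Z. finite C \<and> (\<forall>c\<in>C. Ad a (Z c) = c *\<^sub>R Z c) \<and> (\<Sum>c\<in>C. Z c) = Y"
proof -
  define D where "D = s ** a ** minv s"
  define d where "d i = D $ i $ i" for i
  define W where "W = s ** Y ** minv s"
  define C where "C = (\<lambda>(i, j). d i / d j) ` UNIV"
  define Wc where "Wc c = (\<chi> i j. if d i / d j = c then W $ i $ j else 0)" for c
  define Z where "Z c = minv s ** Wc c ** s" for c
  have inv: "minv s ** s = mat 1" "s ** minv s = mat 1" "minv a ** a = mat 1" "a ** minv a = mat 1"
    using SL.l_inv[OF s] SL.r_inv[OF s] SL.l_inv[OF a] SL.r_inv[OF a] by auto
  have D: "D $ i $ j = (if i = j then d i else 0)" for i j
    using diag by (auto simp: D_def d_def)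
  have "det D = det a"
  proof -
    have "det D * 1 = det s * det a * det (minv s)" by (simp add: D_def det_mul)
    also have "\<dots> = det a * (det (minv s) * det s)" by simp
    also have "det (minv s) * det s = 1" using inv(1) by (metis det_mul det_I)
    finally show ?thesis by simp
  qed
  moreover have "det D = prod d UNIV"
    by (subst det_diagonal) (auto simp: D)
  ultimately have "prod d UNIV \<noteq> 0" using a by simp
  then have d0: "d i \<noteq> 0" for i by simp
  have DW: "D ** Wc c = c *\<^sub>R (Wc c ** D)" for c
  proof -
    have "(D ** Wc c) $ i $ j = (c *\<^sub>R (Wc c ** D)) $ i $ j" for i j
    proof -
      have "(D ** Wc c) $ i $ j = d i * Wc c $ i $ j"
        by (simp add: matrix_matrix_mult_def D if_distrib[of "\<lambda>x. x * _"] sum.delta' cong: if_cong)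
      moreover have "(Wc c ** D) $ i $ j = Wc c $ i $ j * d j"
        by (simp add: matrix_matrix_mult_def D if_distrib sum.delta' cong: if_cong)
      ultimately show ?thesis using d0[of j] by (auto simp: Wc_def)
    qed
    then show ?thesis by (simp add: vec_eq_iff)
  qed
  have "Ad a (Z c) = c *\<^sub>R Z c" for c
  proof -
    have sa: "D ** s = s ** a"
    proof -
      have "D ** s = s ** a ** (minv s ** s)" by (simp only: D_def matrix_mul_assoc)
      then show ?thesis by (simp add: inv)
    qed
    have as: "a ** minv s = minv s ** D"
    proof -
      have "minv s ** D = (minv s ** s) ** a ** minv s" by (simp only: D_def matrix_mul_assoc)
      then show ?thesis by (simp add: inv)
    qed
    have "a ** Z c = minv s ** (D ** Wc c) ** s" by (simp only: Z_def matrix_mul_assoc as)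
    also have "\<dots> = c *\<^sub>R (minv s ** Wc c ** (D ** s))"
      by (simp only: DW mm.scaleR_left mm.scaleR_right matrix_mul_assoc)
    also have "\<dots> = c *\<^sub>R (Z c ** a)" by (simp only: Z_def matrix_mul_assoc sa)
    finally have "a ** Z c ** minv a = c *\<^sub>R (Z c ** (a ** minv a))" by (simp only: mm.scaleR_left matrix_mul_assoc)
    then show ?thesis by (simp add: Ad_def inv)
  qed
  moreover have "(\<Sum>c\<in>C. Z c) = Y"
  proof -
    have "(\<Sum>c\<in>C. Wc c) = W"
    proof -
      have "(\<Sum>c\<in>C. Wc c) $ i $ j = W $ i $ j" for i j
      proof -
        have "d i / d j \<in> C" unfolding C_def by (rule image_eqI[of _ _ "(i, j)"]) auto
        moreover have "finite C" by (simp add: C_def)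
        ultimately show ?thesis by (simp add: sum_component Wc_def)
      qed
      then show ?thesis by (simp add: vec_eq_iff)
    qed
    then have "(\<Sum>c\<in>C. Z c) = minv s ** W ** s"
      by (simp add: Z_def mm.sum_left[symmetric] mm.sum_right[symmetric])
    also have "\<dots> = (minv s ** s) ** Y ** (minv s ** s)" by (simp only: W_def matrix_mul_assoc)
    finally show ?thesis by (simp add: inv)
  qed
  ultimately show ?thesis by (intro exI[of _ C] exI[of _ Z]) (auto simp: C_def)
qed

lemma spanning_subspaces_projections:
  fixes V :: "nat \<Rightarrow> 'a::euclidean_space set"
  assumes V: "\<And>i. i < k \<Longrightarrow> subspace (V i)" and span: "\<And>Y. \<exists>v. (\<forall>i<k. v i \<in> V i) \<and> Y = (\<Sum>i<k. v i)"
  shows "\<exists>p. \<forall>i<k. linear (p i) \<and> (\<forall>Y. p i Y \<in> V i) \<and> (\<forall>Y. (\<Sum>i<k. p i Y) = Y)"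
proof -
  obtain v where v: "\<And>b i. i < k \<Longrightarrow> v b i \<in> V i" "\<And>b. b = (\<Sum>i<k. v b i)"
    using span by metis
  define p where "p i Y = (\<Sum>b\<in>Basis. (Y \<bullet> b) *\<^sub>R v b i)" for i Y
  have "(\<Sum>i<k. p i Y) = Y" for Y
  proof -
    have "(\<Sum>i<k. p i Y) = (\<Sum>b\<in>Basis. (Y \<bullet> b) *\<^sub>R (\<Sum>i<k. v b i))"
      unfolding p_def by (subst sum.swap) (simp add: scaleR_sum_right)
    also have "\<dots> = Y" by (simp add: v(2)[symmetric] euclidean_representation)
    finally show ?thesis .
  qed
  moreover have "linear (p i)" for i
    unfolding p_def by (intro linear_compose_sum ballI linearI) (auto simp: inner_add_left scaleR_add_left)
  moreover have "p i Y \<in> V i" if "i < k" for i Y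
    unfolding p_def using V[OF that] v(1)[OF that] by (intro subspace_sum subspace_scale)
  ultimately show ?thesis by blast
qed

section \<open>Conjugation by an element of class A\<close>

lemma filterlim_at_bot_int:
  assumes "filterlim F L (at_bot :: int filter)"
  shows "filterlim (\<lambda>k. F (- int k)) L sequentially"
proof (rule filterlim_compose[OF assms])
  show "filterlim (\<lambda>k. - int k) at_bot sequentially"
    unfolding filterlim_at_bot
  proof
    fix Z :: int
    show "\<forall>\<^sub>F k in sequentially. - int k \<le> Z"
      using eventually_ge_at_top[of "nat (- Z)"] by eventually_elim linarith
  qed
qed

lemma filterlim_at_bot_intI:
  assumes "filterlim (\<lambda>k. F (- int k)) L sequentially"
  shows "filterlim F L (at_bot :: int filter)"
proof -
  have "filterlim (\<lambda>l :: int. nat (- l)) sequentially at_bot"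
    unfolding filterlim_at_top
  proof
    fix Z :: nat
    show "\<forall>\<^sub>F l in at_bot. Z \<le> nat (- l)"
      using eventually_le_at_bot[of "- int Z"] by eventually_elim linarith
  qed
  from filterlim_compose[OF assms this] have "filterlim (\<lambda>l. F (- int (nat (- l)))) L at_bot" .
  then show ?thesis
    by (rule filterlim_mono_eventually) (auto intro: eventually_mono[OF eventually_le_at_bot[of 0]])
qed

lemma filterlim_at_top_int:
  assumes "filterlim F L (at_top :: int filter)"
  shows "filterlim (\<lambda>k. F (int k)) L sequentially"
  by (rule filterlim_compose[OF assms filterlim_int_sequentially])

context closed_linear_group
begin

lemma pow_nat: "a \<in> G \<Longrightarrow> a [^]\<^bsub>SL\<^esub> (k :: nat) = mpow a k"
  by (induction k) (auto simp: SL.nat_pow_Suc mpow_Suc2)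

lemma pow_int: "a \<in> G \<Longrightarrow> a [^]\<^bsub>SL\<^esub> (int k) = mpow a k"
  by (simp add: int_pow_int pow_nat)

lemma pow_int_neg: "a \<in> G \<Longrightarrow> a [^]\<^bsub>SL\<^esub> (- int k) = minv (mpow a k)"
  using SL.int_pow_neg_int[OF G_SL, of a k] by (simp add: pow_nat)

lemma G_minus_tendsto:
  assumes "a \<in> G" "g \<in> G_minus G a"
  shows "(\<lambda>k. mpow a k ** g ** minv (mpow a k)) \<longlonglongrightarrow> mat 1"
  using filterlim_at_top_int[of _ "nhds (mat 1)"] assms unfolding G_minus_def
  by (force simp: pow_int pow_int_neg)

lemma G_plus_iff:
  assumes "a \<in> G"
  shows "g \<in> G_plus G a \<longleftrightarrow> g \<in> G \<and> (\<lambda>k. minv (mpow a k) ** g ** mpow a k) \<longlonglongrightarrow> mat 1"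
  using filterlim_at_bot_int[of "\<lambda>l. a [^]\<^bsub>SL\<^esub> l ** g ** a [^]\<^bsub>SL\<^esub> (- l)" "nhds (mat 1)"]
    filterlim_at_bot_intI[of "\<lambda>l. a [^]\<^bsub>SL\<^esub> l ** g ** a [^]\<^bsub>SL\<^esub> (- l)" "nhds (mat 1)"] assms
  unfolding G_plus_def by (auto simp: pow_int pow_int_neg)

end

locale expanding = closed_linear_group G for G :: "(real^'n^'n) set" +
  fixes a :: "real^'n^'n" and Bm Bz Bp :: "(real^'n^'n) set" and c :: real
  assumes class_A: "class_A G a"
    and bases: "eigenbasis a (g_minus G a) Bm" "eigenbasis a (g_zero G a) Bz"
      "eigenbasis a (g_plus G a) Bp"
    and c: "Ad_eigenvalue G a c" "g_plus G a = Ad_eigenspace G a c"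
    and abelian: "\<forall>g \<in> G_plus G a. \<forall>h \<in> G_plus G a. g ** h = h ** g"
begin

lemma a_G [simp]: "a \<in> G"
  using class_A by (simp add: class_A_def)

lemma indep: "independent Bm" "independent Bz" "independent Bp"
  and spans: "span Bm = g_minus G a" "span Bz = g_zero G a" "span Bp = g_plus G a"
  using bases by (auto simp: eigenbasis_def)

lemma subspace_eigenspace: "subspace (Ad_eigenspace G a d)"
  using subspace_lie_algebra unfolding Ad_eigenspace_def subspace_def
  by (auto simp: linear_0[OF linear_Ad] linear_add[OF linear_Ad] linear_cmul[OF linear_Ad] scaleR_add_right)

lemma spans_lie: "span Bm \<subseteq> lie_algebra G" "span Bz \<subseteq> lie_algebra G" "span Bp \<subseteq> lie_algebra G"
proof -
  have "span (\<Union>d\<in>S. Ad_eigenspace G a d) \<subseteq> lie_algebra G" for S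
    by (rule span_minimal[OF _ subspace_lie_algebra]) (auto simp: Ad_eigenspace_def)
  then show "span Bm \<subseteq> lie_algebra G" "span Bz \<subseteq> lie_algebra G" "span Bp \<subseteq> lie_algebra G"
    unfolding spans g_minus_def g_zero_def g_plus_def by (auto simp: Ad_eigenspace_def)
qed

lemma sball_lie:
  "v \<in> sball Bm s \<Longrightarrow> v \<in> lie_algebra G" "w \<in> sball Bz s \<Longrightarrow> w \<in> lie_algebra G"
  "y \<in> sball Bp s \<Longrightarrow> y \<in> lie_algebra G"
  using sball_span spans_lie by blast+

lemma Ad_plus: "y \<in> span Bp \<Longrightarrow> Ad a y = c *\<^sub>R y"
  using spans(3) c(2) by (auto simp: Ad_eigenspace_def)

lemma Ad_zero: "w \<in> span Bz \<Longrightarrow> Ad a w = w"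
  using spans(2) by (auto simp: g_zero_def Ad_eigenspace_def)

lemma Ad_pow_plus: "y \<in> span Bp \<Longrightarrow> (Ad a ^^ l) y = c ^ l *\<^sub>R y"
  by (induction l) (auto simp: Ad_plus span_scale linear_cmul[OF linear_Ad])

lemma Ad_pow_zero: "w \<in> span Bz \<Longrightarrow> (Ad a ^^ l) w = w"
  by (induction l) (auto simp: Ad_zero)

lemma abs_c: "\<bar>c\<bar> > 1"
proof (rule ccontr)
  assume "\<not> \<bar>c\<bar> > 1"
  have "(\<Union>d\<in>{d. \<bar>d\<bar> > 1}. Ad_eigenspace G a d) \<subseteq> {0}"
  proof
    fix Y assume "Y \<in> (\<Union>d\<in>{d. \<bar>d\<bar> > 1}. Ad_eigenspace G a d)"
    then obtain d where d: "\<bar>d\<bar> > 1" "Y \<in> Ad_eigenspace G a d" by blast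
    then have "Y \<in> Ad_eigenspace G a c"
      unfolding c(2)[symmetric] g_plus_def by (intro span_base) auto
    then have "d *\<^sub>R Y = c *\<^sub>R Y" using d by (auto simp: Ad_eigenspace_def)
    then show "Y \<in> {0}" using d \<open>\<not> \<bar>c\<bar> > 1\<close> by auto
  qed
  then have "g_plus G a \<subseteq> span {0}"
    unfolding g_plus_def by (rule span_mono)
  then show False using c by (auto simp: Ad_eigenvalue_def)
qed

lemma c_nonzero [simp]: "c \<noteq> 0"
  using abs_c by auto

lemma dim_plus: "dim (g_plus G a) = card Bp" "card Bp \<ge> 1"
proof -
  show "dim (g_plus G a) = card Bp"
    using dim_eq_card[of Bp "g_plus G a"] indep spans(3) by (metis span_span)
  obtain Y where "Y \<in> span Bp" "Y \<noteq> 0"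
    using c spans(3) by (auto simp: Ad_eigenvalue_def)
  then have "Bp \<noteq> {}" by auto
  then show "card Bp \<ge> 1"
    using independent_imp_finite[OF indep(3)] by (simp add: Suc_le_eq card_gt_0_iff)
qed

lemma Ad_pow_minus_tendsto: "Y \<in> g_minus G a \<Longrightarrow> (\<lambda>l. (Ad a ^^ l) Y) \<longlonglongrightarrow> 0"
proof -
  have lin: "linear (Ad a ^^ l)" for l
  proof (induction l)
    case (Suc l)
    then show ?case using linear_compose[OF Suc linear_Ad[of a]] by (simp add: o_def)
  qed (auto intro: linearI)
  have "subspace {Y. (\<lambda>l. (Ad a ^^ l) Y) \<longlonglongrightarrow> 0}"
  proof (rule subspaceI)
    show "0 \<in> {Y. (\<lambda>l. (Ad a ^^ l) Y) \<longlonglongrightarrow> 0}" by (simp add: linear_0[OF lin])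
    fix X Y r
    assume X: "X \<in> {Y. (\<lambda>l. (Ad a ^^ l) Y) \<longlonglongrightarrow> 0}"
    then have "(\<lambda>l. r *\<^sub>R (Ad a ^^ l) X) \<longlonglongrightarrow> r *\<^sub>R 0" by (intro tendsto_intros) auto
    then show "r *\<^sub>R X \<in> {Y. (\<lambda>l. (Ad a ^^ l) Y) \<longlonglongrightarrow> 0}" by (simp add: linear_cmul[OF lin])
    assume "Y \<in> {Y. (\<lambda>l. (Ad a ^^ l) Y) \<longlonglongrightarrow> 0}"
    with X have "(\<lambda>l. (Ad a ^^ l) X + (Ad a ^^ l) Y) \<longlonglongrightarrow> 0 + 0" by (intro tendsto_add) auto
    then show "X + Y \<in> {Y. (\<lambda>l. (Ad a ^^ l) Y) \<longlonglongrightarrow> 0}" by (simp add: linear_add[OF lin])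
  qed
  moreover have "(\<Union>d\<in>{d. \<bar>d\<bar> < 1}. Ad_eigenspace G a d) \<subseteq> {Y. (\<lambda>l. (Ad a ^^ l) Y) \<longlonglongrightarrow> 0}"
  proof
    fix Y assume "Y \<in> (\<Union>d\<in>{d. \<bar>d\<bar> < 1}. Ad_eigenspace G a d)"
    then obtain d where d: "\<bar>d\<bar> < 1" "Ad a Y = d *\<^sub>R Y" by (auto simp: Ad_eigenspace_def)
    have "(Ad a ^^ l) Y = d ^ l *\<^sub>R Y" for l
      by (induction l) (auto simp: d linear_cmul[OF linear_Ad])
    moreover have "(\<lambda>l. d ^ l *\<^sub>R Y) \<longlonglongrightarrow> 0 *\<^sub>R Y"
      using d by (intro tendsto_intros LIMSEQ_abs_realpow_zero2) auto
    ultimately show "Y \<in> {Y. (\<lambda>l. (Ad a ^^ l) Y) \<longlonglongrightarrow> 0}" by simp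
  qed
  ultimately have "g_minus G a \<subseteq> {Y. (\<lambda>l. (Ad a ^^ l) Y) \<longlonglongrightarrow> 0}"
    unfolding g_minus_def by (intro span_minimal)
  then show "Y \<in> g_minus G a \<Longrightarrow> (\<lambda>l. (Ad a ^^ l) Y) \<longlonglongrightarrow> 0" by blast
qed

text \<open>The coordinates refer to a basis of eigenvectors, on each of which \<open>Ad a\<close> contracts.\<close>

lemma Ad_sball_minus:
  assumes v: "v \<in> sball Bm s"
  shows "Ad a v \<in> sball Bm s"
proof -
  have fin: "finite Bm" using indep(1) by (rule independent_imp_finite)
  have "\<exists>d. \<bar>d\<bar> < 1 \<and> Ad a b = d *\<^sub>R b" if b: "b \<in> Bm" for b
  proof -
    obtain d where d: "Ad a b = d *\<^sub>R b" using bases(1) b by (auto simp: eigenbasis_def)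
    have "(Ad a ^^ l) b = d ^ l *\<^sub>R b" for l
      by (induction l) (auto simp: d linear_cmul[OF linear_Ad])
    moreover have "b \<in> g_minus G a" using spans(1) b span_base by blast
    ultimately have lim: "(\<lambda>l. d ^ l *\<^sub>R b) \<longlonglongrightarrow> 0"
      using Ad_pow_minus_tendsto by fastforce
    have "\<bar>d\<bar> < 1"
    proof (rule ccontr)
      assume "\<not> \<bar>d\<bar> < 1"
      then have "norm b \<le> norm (d ^ l *\<^sub>R b)" for l
        using one_le_power[of "\<bar>d\<bar>" l] mult_right_mono[of 1 "\<bar>d\<bar> ^ l" "norm b"] by (simp add: power_abs)
      then have "norm b \<le> norm (0 :: real^'n^'n)"
        by (intro tendsto_lowerbound[OF tendsto_norm[OF lim]] always_eventually) auto
      then show False using b indep(1) dependent_zero by force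
    qed
    with d show ?thesis by blast
  qed
  then have "\<forall>b\<in>Bm. \<exists>d. \<bar>d\<bar> < 1 \<and> Ad a b = d *\<^sub>R b" by blast
  from bchoice[OF this] obtain d where d: "\<And>b. b \<in> Bm \<Longrightarrow> \<bar>d b\<bar> < 1" "\<And>b. b \<in> Bm \<Longrightarrow> Ad a b = d b *\<^sub>R b"
    by blast
  have "Ad a v = Ad a (\<Sum>b\<in>Bm. representation Bm v b *\<^sub>R b)"
    using sum_representation_eq[OF indep(1) sball_span[OF v] fin] by simp
  also have "\<dots> = (\<Sum>b\<in>Bm. (representation Bm v b * d b) *\<^sub>R b)"
    using d by (simp add: linear_sum[OF linear_Ad] linear_cmul[OF linear_Ad])
  finally have eq: "Ad a v = (\<Sum>b\<in>Bm. (representation Bm v b * d b) *\<^sub>R b)" .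
  have "\<bar>representation Bm (Ad a v) b\<bar> < s" if b: "b \<in> Bm" for b
  proof -
    have "\<bar>representation Bm (Ad a v) b\<bar> = \<bar>representation Bm v b\<bar> * \<bar>d b\<bar>"
      unfolding eq representation_sum_scaleR[OF indep(1) fin b] by (rule abs_mult)
    also have "\<dots> \<le> \<bar>representation Bm v b\<bar> * 1"
      using d(1)[OF b] by (intro mult_left_mono) auto
    also have "\<dots> < s" using v b by (auto simp: sball_def)
    finally show ?thesis .
  qed
  moreover have "Ad a v \<in> span Bm" unfolding eq by (intro span_sum span_scale span_base)
  ultimately show ?thesis by (simp add: sball_def)
qed

lemma Ad_pow_sball_minus: "v \<in> sball Bm s \<Longrightarrow> (Ad a ^^ l) v \<in> sball Bm s"
  by (induction l) (auto intro: Ad_sball_minus)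

lemma conj_mexp: "mpow a l ** mexp Y ** minv (mpow a l) = mexp ((Ad a ^^ l) Y)"
proof (induction l)
  case (Suc l)
  have "mpow a (Suc l) ** mexp Y ** minv (mpow a (Suc l))
      = a ** (mpow a l ** mexp Y ** minv (mpow a l)) ** minv a"
    by (simp add: mpow_Suc minv_mult matrix_mul_assoc)
  then show ?case by (simp add: Suc Ad_mexp)
qed auto

lemma mexp_G_plus:
  assumes y: "y \<in> span Bp"
  shows "mexp y \<in> G_plus G a"
proof -
  have conj: "minv (mpow a k) ** mexp y ** mpow a k = mexp ((1 / c ^ k) *\<^sub>R y)" for k
  proof -
    have "mpow a k ** mexp ((1 / c ^ k) *\<^sub>R y) ** minv (mpow a k) = mexp y"
      using abs_c y by (simp add: conj_mexp Ad_pow_plus span_scale)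
    then have "minv (mpow a k) ** mexp y ** mpow a k = minv (mpow a k) ** (mpow a k ** mexp ((1 / c ^ k) *\<^sub>R y) ** minv (mpow a k)) ** mpow a k"
      by simp
    also have "\<dots> = (minv (mpow a k) ** mpow a k) ** mexp ((1 / c ^ k) *\<^sub>R y) ** (minv (mpow a k) ** mpow a k)"
      by (simp only: matrix_mul_assoc)
    finally show ?thesis by simp
  qed
  have "(\<lambda>k. (1 / c) ^ k *\<^sub>R y) \<longlonglongrightarrow> 0 *\<^sub>R y"
    using abs_c by (intro tendsto_intros LIMSEQ_abs_realpow_zero2) (auto simp: abs_divide)
  then have "(\<lambda>k. mexp ((1 / c ^ k) *\<^sub>R y)) \<longlonglongrightarrow> mat 1"
    using tendsto_mexp[of "\<lambda>k. (1 / c ^ k) *\<^sub>R y" 0] by (simp add: power_one_over)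
  then show ?thesis
    using y spans_lie by (auto simp: G_plus_iff conj intro: mexp_G)
qed

text \<open>In the Lie product formula the two factors commute, so that the approximants are constant.\<close>

lemma mexp_add_plus:
  assumes y: "y \<in> span Bp" and u: "u \<in> span Bp"
  shows "mexp (y + u) = mexp y ** mexp u"
proof -
  have "mpow (mexp ((1 / real k) *\<^sub>R y) ** mexp ((1 / real k) *\<^sub>R u)) k = mexp y ** mexp u" if "k > 0" for k
  proof -
    let ?g = "mexp ((1 / real k) *\<^sub>R y)" and ?h = "mexp ((1 / real k) *\<^sub>R u)"
    have gh: "?g ** ?h = ?h ** ?g"
      using abelian mexp_G_plus y u by (auto intro: span_scale)
    have gj: "mpow ?g j ** ?h = ?h ** mpow ?g j" for j
    proof (induction j)
      case (Suc j)
      have "mpow ?g (Suc j) ** ?h = ?g ** (mpow ?g j ** ?h)" by (simp only: mpow_Suc matrix_mul_assoc)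
      also have "\<dots> = (?g ** ?h) ** mpow ?g j" by (simp only: Suc matrix_mul_assoc)
      also have "\<dots> = ?h ** mpow ?g (Suc j)" by (simp only: gh mpow_Suc matrix_mul_assoc)
      finally show ?case .
    qed auto
    have "mpow (?g ** ?h) j = mpow ?g j ** mpow ?h j" for j
    proof (induction j)
      case (Suc j)
      have "mpow (?g ** ?h) (Suc j) = ?g ** (?h ** mpow ?g j) ** mpow ?h j" by (simp only: mpow_Suc Suc matrix_mul_assoc)
      also have "\<dots> = mpow ?g (Suc j) ** mpow ?h (Suc j)" by (simp only: gj[symmetric] mpow_Suc matrix_mul_assoc)
      finally show ?case .
    qed auto
    moreover have "mpow ?g k = mexp y" "mpow ?h k = mexp u"
      using that mexp_of_nat[of k "(1 / real k) *\<^sub>R y"] mexp_of_nat[of k "(1 / real k) *\<^sub>R u"] by auto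
    ultimately show ?thesis by simp
  qed
  then have "\<forall>\<^sub>F k in sequentially. mpow (mexp ((1 / real k) *\<^sub>R y) ** mexp ((1 / real k) *\<^sub>R u)) k = mexp y ** mexp u"
    by (intro eventually_mono[OF eventually_gt_at_top[of 0]])
  from Lim_transform_eventually[OF trotter this] show ?thesis
    using LIMSEQ_unique tendsto_const by blast
qed

text \<open>The eigencomponents of an element of the Lie algebra lie in it again. An eigenvalue of absolute
  value \<open>1\<close> equals \<open>1\<close>, so that the components sort into the three subspaces.\<close>

lemma lie_algebra_decomposition:
  assumes Y: "Y \<in> lie_algebra G"
  shows "\<exists>v\<in>span Bm. \<exists>w\<in>span Bz. \<exists>y\<in>span Bp. Y = v + w + y"
proof -
  have "\<exists>s\<in>carrier SL. \<forall>i j. i \<noteq> j \<longrightarrow> (s ** a ** minv s) $ i $ j = 0"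
    using class_A unfolding class_A_def by (elim conjE)
  then obtain s where s: "s \<in> carrier SL" "\<forall>i j. i \<noteq> j \<longrightarrow> (s ** a ** minv s) $ i $ j = 0"
    by (elim bexE)
  obtain C Z where C: "finite C" "\<And>d. d \<in> C \<Longrightarrow> Ad a (Z d) = d *\<^sub>R Z d" "(\<Sum>d\<in>C. Z d) = Y"
    using Ad_diagonalizable[OF G_SL[OF a_G] s, of Y] by blast
  have "\<forall>d\<in>C. Z d \<in> lie_algebra G"
    using C Y by (intro eigen_components_in_subspace[OF subspace_lie_algebra linear_Ad Ad_lie_algebra[OF a_G]]) auto
  then have Z: "Z d \<in> Ad_eigenspace G a d" if "d \<in> C" for d
    using that C by (auto simp: Ad_eigenspace_def)
  have one: "Z d \<in> g_zero G a" if "d \<in> C" "\<bar>d\<bar> = 1" for d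
  proof (cases "Z d = 0")
    case True
    then show ?thesis using subspace_0[OF subspace_eigenspace] by (simp add: g_zero_def)
  next
    case False
    then have "Ad_eigenvalue G a d" using Z that by (auto simp: Ad_eigenvalue_def)
    moreover have "\<forall>d. Ad_eigenvalue G a d \<and> \<bar>d\<bar> = 1 \<longrightarrow> d = 1"
      using class_A unfolding class_A_def by (elim conjE)
    ultimately have "d = 1" using that by blast
    then show ?thesis using Z that by (simp add: g_zero_def)
  qed
  let ?C1 = "{d\<in>C. \<bar>d\<bar> < 1}" and ?C2 = "{d\<in>C. \<bar>d\<bar> = 1}" and ?C3 = "{d\<in>C. \<bar>d\<bar> > 1}"
  have "C = (?C1 \<union> ?C2) \<union> ?C3" by auto
  then have "Y = (\<Sum>d\<in>(?C1 \<union> ?C2) \<union> ?C3. Z d)" using C(3) by simp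
  also have "\<dots> = (\<Sum>d\<in>?C1 \<union> ?C2. Z d) + (\<Sum>d\<in>?C3. Z d)"
    using C(1) by (intro sum.union_disjoint) auto
  also have "(\<Sum>d\<in>?C1 \<union> ?C2. Z d) = (\<Sum>d\<in>?C1. Z d) + (\<Sum>d\<in>?C2. Z d)"
    using C(1) by (intro sum.union_disjoint) auto
  finally have "Y = (\<Sum>d\<in>?C1. Z d) + (\<Sum>d\<in>?C2. Z d) + (\<Sum>d\<in>?C3. Z d)" .
  moreover have "(\<Sum>d\<in>?C1. Z d) \<in> span Bm"
    unfolding spans g_minus_def using Z by (intro span_sum span_base) auto
  moreover have "(\<Sum>d\<in>?C2. Z d) \<in> span Bz"
    unfolding spans using one subspace_eigenspace by (intro subspace_sum) (auto simp: g_zero_def)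
  moreover have "(\<Sum>d\<in>?C3. Z d) \<in> span Bp"
    unfolding spans g_plus_def using Z by (intro span_sum span_base) auto
  ultimately show ?thesis by blast
qed

text \<open>If \<open>Y\<close> ran through a null sequence of counterexamples, a limit of the directions of \<open>Y\<close> would lie in
  the Lie algebra by \<open>lie_algebra_limit_direction\<close>, but it is a unit vector orthogonal to the Lie algebra.\<close>

lemma transversal_not_in_G:
  "\<exists>\<eta>>0. \<forall>Y. (\<forall>X\<in>lie_algebra G. orthogonal X Y) \<and> norm Y < \<eta> \<and> mexp Y \<in> G \<longrightarrow> Y = 0"
proof (rule ccontr)
  assume "\<not> ?thesis"
  then have "\<exists>Y. (\<forall>X\<in>lie_algebra G. orthogonal X Y) \<and> norm Y < 1 / Suc k \<and> mexp Y \<in> G \<and> Y \<noteq> 0" for k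
    by (metis of_nat_0_less_iff zero_less_Suc zero_less_divide_1_iff)
  then obtain Y where Y: "\<And>k X. X \<in> lie_algebra G \<Longrightarrow> orthogonal X (Y k)" "\<And>k. norm (Y k) < 1 / Suc k"
    "\<And>k. mexp (Y k) \<in> G" "\<And>k. Y k \<noteq> 0"
    by metis
  let ?Z = "\<lambda>k. (1 / norm (Y k)) *\<^sub>R Y k"
  have "\<forall>k. ?Z k \<in> sphere 0 1" using Y(4) by simp
  from seq_compactE[OF compact_imp_seq_compact[OF compact_sphere] this]
  obtain Z r where Z: "Z \<in> sphere 0 1" "strict_mono r" "(?Z \<circ> r) \<longlonglongrightarrow> Z" .
  have "Y \<longlonglongrightarrow> 0"
    by (rule Lim_null_comparison[OF _ LIMSEQ_inverse_real_of_nat])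
       (use Y(2) in \<open>auto intro!: always_eventually less_imp_le simp: inverse_eq_divide\<close>)
  then have Yr: "(Y \<circ> r) \<longlonglongrightarrow> 0" using Z(2) by (rule LIMSEQ_subseq_LIMSEQ)
  have Zl: "Z \<in> lie_algebra G"
    by (rule lie_algebra_limit_direction[of "Y \<circ> r"]) (use Y Yr Z in \<open>auto simp: o_def\<close>)
  have "(\<lambda>k. Z \<bullet> (?Z \<circ> r) k) \<longlonglongrightarrow> Z \<bullet> Z" by (intro tendsto_inner tendsto_const Z)
  moreover have "Z \<bullet> Y k = 0" for k using Y(1)[OF Zl] by (simp add: orthogonal_def)
  then have "(\<lambda>k. Z \<bullet> (?Z \<circ> r) k) = (\<lambda>k. 0)" by auto
  ultimately have "(\<lambda>k :: nat. 0 :: real) \<longlonglongrightarrow> Z \<bullet> Z" by simp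
  then have "Z \<bullet> Z = 0" by (simp add: LIMSEQ_const_iff)
  then show False using Z(1) by auto
qed

text \<open>Complete the three factors by a fourth one in a complement of the Lie algebra. The resulting map
  on all matrices has the identity as its derivative at \<open>0\<close>, and so its image contains a neighbourhood of
  the identity; for an element of \<open>G\<close> the fourth factor is trivial.\<close>

lemma local_coordinates:
  assumes r: "r > 0"
  shows "\<exists>\<rho>>0. \<forall>g\<in>G. norm (g - mat 1) < \<rho> \<longrightarrow>
           (\<exists>v\<in>sball Bm r. \<exists>w\<in>sball Bz r. \<exists>y\<in>sball Bp r. g = mexp v ** mexp w ** mexp y)"
proof -
  define L where "L = lie_algebra G"
  define V where "V i = (if i = 0 then span Bm else if i = 1 then span Bz else if i = 2 then span Bp
    else {Y. \<forall>X\<in>L. orthogonal X Y})" for i :: nat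
  have "\<exists>p. \<forall>i<4. linear (p i) \<and> (\<forall>Y. p i Y \<in> V i) \<and> (\<forall>Y. (\<Sum>i<4. p i Y) = Y)"
  proof (rule spanning_subspaces_projections)
    show "subspace (V i)" for i
    proof -
      have "subspace {Y. \<forall>X\<in>L. orthogonal X Y}"
        by (auto simp: subspace_def orthogonal_def inner_add_right)
      then show ?thesis by (simp add: V_def)
    qed
    fix Y :: "real^'n^'n"
    obtain X Z where XZ: "X \<in> span L" "\<And>w. w \<in> span L \<Longrightarrow> orthogonal Z w" "Y = X + Z"
      using orthogonal_subspace_decomp_exists by metis
    have "X \<in> lie_algebra G" using XZ(1) subspace_lie_algebra by (simp add: L_def span_eq_iff[THEN iffD2])
    then obtain v w y where "v \<in> span Bm" "w \<in> span Bz" "y \<in> span Bp" "X = v + w + y"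
      using lie_algebra_decomposition by blast
    then show "\<exists>v. (\<forall>i<4. v i \<in> V i) \<and> Y = (\<Sum>i<4. v i)"
      using XZ by (intro exI[of _ "(\<lambda>i :: nat. if i = 0 then v else if i = 1 then w else if i = 2 then y else Z)"])
        (auto simp: V_def eval_nat_numeral orthogonal_commute span_base)
  qed
  then obtain p where p: "\<And>i. i < 4 \<Longrightarrow> linear (p i)" "\<And>i Y. i < 4 \<Longrightarrow> p i Y \<in> V i" "\<And>Y. (\<Sum>i<4. p i Y) = Y"
    by (metis zero_less_numeral)
  define \<Psi> where "\<Psi> Y = mexp (p 0 Y) ** mexp (p 1 Y) ** mexp (p 2 Y) ** mexp (p 3 Y)" for Y
  have bl: "bounded_linear (p i)" if "i < 4" for i
    using p(1)[OF that] by (rule linear_conv_bounded_linear[THEN iffD1])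
  have p0: "p i 0 = 0" if "i < 4" for i using linear_0[OF p(1)[OF that]] .
  have d: "((\<lambda>Y. mexp (p i Y)) has_derivative p i) (at 0)" if "i < 4" for i
    using has_derivative_compose[OF bounded_linear.has_derivative[OF bl[OF that] has_derivative_ident, of "at 0"], of mexp "\<lambda>h. h"]
      mexp_has_derivative_0 p0[OF that] by simp
  have "(\<Psi> has_derivative (\<lambda>h. p 0 h + p 1 h + p 2 h + p 3 h)) (at 0)"
  proof -
    have dd: "((\<lambda>Y. mexp (p 0 Y)) has_derivative p 0) (at 0)" "((\<lambda>Y. mexp (p 1 Y)) has_derivative p 1) (at 0)"
      "((\<lambda>Y. mexp (p 2 Y)) has_derivative p 2) (at 0)" "((\<lambda>Y. mexp (p 3 Y)) has_derivative p 3) (at 0)"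
      by (rule d, simp)+
    show ?thesis
      unfolding \<Psi>_def
      by (rule has_derivative_eq_rhs[OF mm.FDERIV[OF mm.FDERIV[OF mm.FDERIV[OF dd(1,2)] dd(3)] dd(4)]])
         (simp add: p0 fun_eq_iff)
  qed
  moreover have "(\<lambda>h. p 0 h + p 1 h + p 2 h + p 3 h) = (\<lambda>h. h)"
    using p(3) by (simp add: eval_nat_numeral fun_eq_iff)
  ultimately have der: "(\<Psi> has_derivative (\<lambda>h. h)) (at 0)" by simp
  have cont: "continuous_on UNIV \<Psi>"
  proof -
    have "continuous_on UNIV (\<lambda>Y. mexp (p i Y))" if "i < 4" for i
      by (rule continuous_on_compose2[OF continuous_mexp linear_continuous_on[OF bl[OF that]]]) simp
    then show ?thesis
      unfolding \<Psi>_def by (intro mm.continuous_on) simp_all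
  qed
  have small: "\<exists>\<eta>>0. \<forall>Y. norm Y < \<eta> \<longrightarrow> norm (p i Y) < e" if i: "i < 4" and e: "e > 0" for i e
  proof -
    obtain K where K: "K > 0" "\<And>Y. norm (p i Y) \<le> K * norm Y"
      using linear_bounded_pos[OF p(1)[OF i]] by blast
    have "norm (p i Y) < e" if "norm Y < e / K" for Y
      using K(2)[of Y] that K(1) by (simp add: field_simps)
    then show ?thesis using K e by (intro exI[of _ "e / K"]) auto
  qed
  obtain e0 where e0: "e0 > 0" "\<forall>v\<in>span Bm. norm v < e0 \<longrightarrow> v \<in> sball Bm r"
    using sball_contains_ball[OF indep(1) r] by blast
  obtain e1 where e1: "e1 > 0" "\<forall>v\<in>span Bz. norm v < e1 \<longrightarrow> v \<in> sball Bz r"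
    using sball_contains_ball[OF indep(2) r] by blast
  obtain e2 where e2: "e2 > 0" "\<forall>v\<in>span Bp. norm v < e2 \<longrightarrow> v \<in> sball Bp r"
    using sball_contains_ball[OF indep(3) r] by blast
  obtain e3 where e3: "e3 > 0" "\<forall>Y. (\<forall>X\<in>L. orthogonal X Y) \<and> norm Y < e3 \<and> mexp Y \<in> G \<longrightarrow> Y = 0"
    using transversal_not_in_G unfolding L_def by blast
  define e where "e = Min {e0, e1, e2, e3}"
  have e: "e > 0" "e \<le> e0" "e \<le> e1" "e \<le> e2" "e \<le> e3"
    using e0 e1 e2 e3 by (auto simp: e_def)
  obtain \<eta> where \<eta>: "\<And>i. i < 4 \<Longrightarrow> \<eta> i > 0" "\<And>i Y. i < 4 \<Longrightarrow> norm Y < \<eta> i \<Longrightarrow> norm (p i Y) < e"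
    using small[OF _ e(1)] by metis
  define h where "h = Min {\<eta> 0, \<eta> 1, \<eta> 2, \<eta> 3}"
  have h: "h > 0" using \<eta>(1) by (simp add: h_def)
  have "\<Psi> 0 \<in> interior (\<Psi> ` ball 0 h)"
    by (rule sussmann_open_mapping[OF open_UNIV cont UNIV_I der bounded_linear_ident])
       (use h in \<open>auto simp: interior_open id_def\<close>)
  moreover have "\<Psi> 0 = mat 1" by (simp add: \<Psi>_def p0)
  ultimately obtain \<rho> where \<rho>: "\<rho> > 0" "ball (mat 1) \<rho> \<subseteq> \<Psi> ` ball 0 h"
    by (auto simp: mem_interior)
  show ?thesis
  proof (intro exI[of _ \<rho>] conjI ballI impI \<rho>(1))
    fix g assume g: "g \<in> G" "norm (g - mat 1) < \<rho>"
    then have "g \<in> ball (mat 1) \<rho>" by (simp add: dist_norm norm_minus_commute)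
    then obtain Y where Y: "norm Y < h" "g = \<Psi> Y" using \<rho>(2) by auto
    have n: "norm (p i Y) < e" if "i < 4" for i
    proof -
      have "i \<in> {0, 1, 2, 3}" using that by auto
      then have "h \<le> \<eta> i" unfolding h_def by (intro Min_le) auto
      then show ?thesis using \<eta>(2)[OF that] Y(1) by simp
    qed
    have v: "p 0 Y \<in> sball Bm r" and w: "p 1 Y \<in> sball Bz r" and y: "p 2 Y \<in> sball Bp r"
      using n[of 0] n[of 1] n[of 2] p(2)[of 0 Y] p(2)[of 1 Y] p(2)[of 2 Y] e e0 e1 e2 by (auto simp: V_def)
    define k where "k = mexp (p 0 Y) ** mexp (p 1 Y) ** mexp (p 2 Y)"
    have k: "k \<in> G" unfolding k_def using v w y by (intro mult_G mexp_G) (auto dest: sball_lie)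
    have "mexp (p 3 Y) = minv k ** g"
    proof -
      have "minv k ** g = (minv k ** k) ** mexp (p 3 Y)" unfolding Y \<Psi>_def k_def[symmetric] by (simp only: matrix_mul_assoc)
      then show ?thesis using k by simp
    qed
    then have "mexp (p 3 Y) \<in> G" using k g by simp
    moreover have "p 3 Y \<in> V 3" "norm (p 3 Y) < e3" using p(2)[of 3] n[of 3] e by auto
    ultimately have "p 3 Y = 0" using e3(2) by (auto simp: V_def)
    then have "g = mexp (p 0 Y) ** mexp (p 1 Y) ** mexp (p 2 Y)" using Y by (simp add: \<Psi>_def)
    then show "\<exists>v\<in>sball Bm r. \<exists>w\<in>sball Bz r. \<exists>y\<in>sball Bp r. g = mexp v ** mexp w ** mexp y"
      using v w y by blast
  qed
qed

end

section \<open>The homogeneous space\<close>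

text \<open>Discreteness is that of the subspace topology: every point of \<open>\<Gamma>\<close> is isolated in \<open>\<Gamma>\<close>.\<close>

locale homogeneous_space = closed_linear_group G for G :: "(real^'n^'n) set" +
  fixes \<Gamma> :: "(real^'n^'n) set"
  assumes subgroup_\<Gamma>: "subgroup \<Gamma> (SL\<lparr>carrier := G\<rparr>)" and discrete_\<Gamma>: "Isolated.discrete \<Gamma>"
begin

text \<open>Parametrised by \<open>g \<mapsto> \<Gamma> g\<inverse>\<close>, the space carries the action by left multiplication.\<close>

definition pt :: "real^'n^'n \<Rightarrow> (real^'n^'n) set" where
  "pt g = \<Gamma> #>\<^bsub>SL\<^esub> minv g"

abbreviation "X \<equiv> hspace \<Gamma> G"
abbreviation "TX \<equiv> hspace_topology \<Gamma> G"
abbreviation "BX \<equiv> hborel \<Gamma> G"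

lemma \<Gamma>_G: "\<gamma> \<in> \<Gamma> \<Longrightarrow> \<gamma> \<in> G"
  using subgroup.subset[OF subgroup_\<Gamma>] by auto

lemma \<Gamma>_one: "mat 1 \<in> \<Gamma>"
  using subgroup.one_closed[OF subgroup_\<Gamma>] by simp

lemma \<Gamma>_mult: "\<gamma> \<in> \<Gamma> \<Longrightarrow> \<delta> \<in> \<Gamma> \<Longrightarrow> \<gamma> ** \<delta> \<in> \<Gamma>"
  using subgroup.m_closed[OF subgroup_\<Gamma>] by simp

lemma \<Gamma>_inv: "\<gamma> \<in> \<Gamma> \<Longrightarrow> minv \<gamma> \<in> \<Gamma>"
  by (metis subgroup.m_inv_closed[OF subgroup_\<Gamma>] SL.m_inv_consistent[OF subgroup_G] \<Gamma>_G)

lemma pt_eq: "pt g = (\<lambda>\<gamma>. \<gamma> ** minv g) ` \<Gamma>"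
  by (auto simp: pt_def r_coset_def)

lemma hspace_eq: "X = pt ` G"
proof -
  have "X = (\<lambda>g. \<Gamma> #>\<^bsub>SL\<^esub> g) ` G"
    by (auto simp: hspace_def RCOSETS_def r_coset_def)
  also have "\<dots> = pt ` G"
  proof -
    have "G = minv ` G"
      using minv_minv minv_G by (metis (no_types, lifting) image_eqI image_subsetI subsetI subset_antisym)
    then have "(\<lambda>g. \<Gamma> #>\<^bsub>SL\<^esub> g) ` G = (\<lambda>g. \<Gamma> #>\<^bsub>SL\<^esub> g) ` minv ` G" by (rule arg_cong)
    then show ?thesis by (simp add: image_image pt_def)
  qed
  finally show ?thesis .
qed

lemma pt_in [simp]: "g \<in> G \<Longrightarrow> pt g \<in> X"
  by (simp add: hspace_eq)

lemma act_pt: "h \<in> G \<Longrightarrow> g \<in> G \<Longrightarrow> act h (pt g) = pt (h ** g)"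
  by (auto simp: act_def pt_eq r_coset_def minv_mult matrix_mul_assoc)

lemma act_in [simp]: "h \<in> G \<Longrightarrow> x \<in> X \<Longrightarrow> act h x \<in> X"
  by (auto simp: hspace_eq act_pt)

lemma act_act: "h \<in> G \<Longrightarrow> k \<in> G \<Longrightarrow> x \<in> X \<Longrightarrow> act h (act k x) = act (h ** k) x"
  by (auto simp: hspace_eq act_pt matrix_mul_assoc)

lemma act_one [simp]: "x \<in> X \<Longrightarrow> act (mat 1) x = x"
  by (auto simp: hspace_eq act_pt)

lemma act_pow: "h \<in> G \<Longrightarrow> x \<in> X \<Longrightarrow> (act h ^^ l) x = act (mpow h l) x"
  by (induction l) (auto simp: act_act mpow_Suc)

lemma pt_eq_iff: "g \<in> G \<Longrightarrow> h \<in> G \<Longrightarrow> pt g = pt h \<longleftrightarrow> (\<exists>\<gamma>\<in>\<Gamma>. g = h ** \<gamma>)"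
proof
  assume g: "g \<in> G" "h \<in> G" and "pt g = pt h"
  moreover have "minv h \<in> pt h" using \<Gamma>_one by (auto simp: pt_eq intro!: image_eqI[of _ _ "mat 1"])
  ultimately obtain \<gamma> where \<gamma>: "\<gamma> \<in> \<Gamma>" "minv h = \<gamma> ** minv g" by (auto simp: pt_eq)
  then have "minv (minv h) = minv (minv g) ** minv \<gamma>"
    using g \<Gamma>_G by (metis minv_G minv_mult)
  then have "h = g ** minv \<gamma>" using g by simp
  then have "h ** \<gamma> = g ** (minv \<gamma> ** \<gamma>)" by (simp only: matrix_mul_assoc)
  then show "\<exists>\<gamma>\<in>\<Gamma>. g = h ** \<gamma>" using \<gamma> \<Gamma>_G by auto
next
  assume g: "g \<in> G" "h \<in> G" and "\<exists>\<gamma>\<in>\<Gamma>. g = h ** \<gamma>"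
  then obtain \<gamma> where \<gamma>: "\<gamma> \<in> \<Gamma>" "g = h ** \<gamma>" by blast
  have "(\<lambda>\<delta>. \<delta> ** minv g) ` \<Gamma> = (\<lambda>\<delta>. \<delta> ** minv h) ` (\<lambda>\<delta>. \<delta> ** minv \<gamma>) ` \<Gamma>"
    using \<gamma> g \<Gamma>_G by (simp add: image_image minv_mult matrix_mul_assoc)
  also have "(\<lambda>\<delta>. \<delta> ** minv \<gamma>) ` \<Gamma> = \<Gamma>"
  proof
    show "\<Gamma> \<subseteq> (\<lambda>\<delta>. \<delta> ** minv \<gamma>) ` \<Gamma>"
    proof
      fix \<delta> assume "\<delta> \<in> \<Gamma>"
      then show "\<delta> \<in> (\<lambda>\<delta>. \<delta> ** minv \<gamma>) ` \<Gamma>"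
        using \<gamma> \<Gamma>_G \<Gamma>_mult by (intro image_eqI[of _ _ "\<delta> ** \<gamma>"]) (auto simp flip: matrix_mul_assoc)
    qed
  qed (use \<gamma> \<Gamma>_mult \<Gamma>_inv in auto)
  finally show "pt g = pt h" by (simp add: pt_eq)
qed

lemma continuous_on_mult_right: "continuous_on A (\<lambda>g. g ** h)" for h :: "real^'n^'n" and A :: "(real^'n^'n) set"
  by (intro mm.continuous_on continuous_intros)

lemma openin_TX: "openin TX U \<longleftrightarrow> U \<subseteq> X \<and> openin (top_of_set G) {g \<in> G. pt g \<in> U}"
proof -
  have pre: "openin (top_of_set G) {g \<in> G. minv g \<in> S}" if "openin (top_of_set G) S" for S
  proof -
    have "{g \<in> G. minv g \<in> S} = G \<inter> minv -` S" by blast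
    then show ?thesis
      using continuous_openin_preimage[OF continuous_on_minv _ that] by auto
  qed
  have "openin (top_of_set G) {g \<in> G. \<Gamma> #>\<^bsub>SL\<^esub> g \<in> U} \<longleftrightarrow> openin (top_of_set G) {g \<in> G. pt g \<in> U}"
  proof
    assume "openin (top_of_set G) {g \<in> G. \<Gamma> #>\<^bsub>SL\<^esub> g \<in> U}"
    from pre[OF this] show "openin (top_of_set G) {g \<in> G. pt g \<in> U}"
      by (rule back_subst[of "openin _"]) (auto simp: pt_def)
  next
    assume "openin (top_of_set G) {g \<in> G. pt g \<in> U}"
    from pre[OF this] show "openin (top_of_set G) {g \<in> G. \<Gamma> #>\<^bsub>SL\<^esub> g \<in> U}"
      by (rule back_subst[of "openin _"]) (auto simp: pt_def)
  qed
  then show ?thesis by (simp add: openin_hspace_topology)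
qed

lemma topspace_TX [simp]: "topspace TX = X"
proof
  have "{g \<in> G. pt g \<in> X} = G" by auto
  then have "openin TX X" by (simp add: openin_TX)
  then show "X \<subseteq> topspace TX" by (rule openin_subset)
qed (auto simp: topspace_def openin_TX)

lemma space_BX [simp]: "space BX = X"
  by (auto simp: hborel_def openin_TX intro!: space_measure_of)

lemma sets_BX: "sets BX = sigma_sets X {U. openin TX U}"
  by (auto simp: hborel_def openin_TX intro!: sets_measure_of)

lemma openin_sets: "openin TX U \<Longrightarrow> U \<in> sets BX"
  by (auto simp: sets_BX)

lemma continuous_map_pt: "continuous_map (top_of_set G) TX pt"
  by (auto simp: continuous_map openin_TX hspace_eq)

lemma open_image_pt:
  assumes U: "openin (top_of_set G) U"
  shows "openin TX (pt ` U)"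
proof -
  have UG: "U \<subseteq> G" using openin_imp_subset[OF U] .
  have "{g \<in> G. pt g \<in> pt ` U} = (\<Union>\<gamma>\<in>\<Gamma>. G \<inter> (\<lambda>g. g ** \<gamma>) -` U)"
  proof (intro equalityI subsetI)
    fix g assume "g \<in> {g \<in> G. pt g \<in> pt ` U}"
    then obtain h where h: "g \<in> G" "h \<in> U" "pt h = pt g" by force
    then obtain \<gamma> where "\<gamma> \<in> \<Gamma>" "h = g ** \<gamma>" using pt_eq_iff UG by blast
    then show "g \<in> (\<Union>\<gamma>\<in>\<Gamma>. G \<inter> (\<lambda>g. g ** \<gamma>) -` U)" using h by blast
  next
    fix g assume "g \<in> (\<Union>\<gamma>\<in>\<Gamma>. G \<inter> (\<lambda>g. g ** \<gamma>) -` U)"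
    then obtain \<gamma> where \<gamma>: "\<gamma> \<in> \<Gamma>" "g \<in> G" "g ** \<gamma> \<in> U" by blast
    then have "pt (g ** \<gamma>) = pt g" using pt_eq_iff \<Gamma>_G by auto
    then show "g \<in> {g \<in> G. pt g \<in> pt ` U}" using \<gamma> by (metis (mono_tags) imageI mem_Collect_eq)
  qed
  moreover have "openin (top_of_set G) (\<Union>\<gamma>\<in>\<Gamma>. G \<inter> (\<lambda>g. g ** \<gamma>) -` U)"
  proof (rule openin_Union, clarify)
    fix \<gamma> assume "\<gamma> \<in> \<Gamma>"
    then show "openin (top_of_set G) (G \<inter> (\<lambda>g. g ** \<gamma>) -` U)"
      using \<Gamma>_G by (intro continuous_openin_preimage[OF continuous_on_mult_right _ U]) auto
  qed
  ultimately have "openin (top_of_set G) {g \<in> G. pt g \<in> pt ` U}" by simp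
  then show ?thesis
    using UG unfolding openin_TX by (auto simp: hspace_eq)
qed

lemma continuous_map_act: "h \<in> G \<Longrightarrow> continuous_map TX TX (act h)"
proof (unfold continuous_map, intro conjI allI impI)
  fix U assume h: "h \<in> G" and U: "openin TX U"
  have "openin (top_of_set G) (G \<inter> (\<lambda>g. h ** g) -` {g \<in> G. pt g \<in> U})"
    using U h unfolding openin_TX
    by (intro continuous_openin_preimage[where T = G] mm.continuous_on continuous_intros) auto
  moreover have "G \<inter> (\<lambda>g. h ** g) -` {g \<in> G. pt g \<in> U} = {g \<in> G. pt g \<in> {x \<in> topspace TX. act h x \<in> U}}"
    using h by (auto simp: act_pt)
  ultimately show "openin TX {x \<in> topspace TX. act h x \<in> U}"
    by (auto simp: openin_TX)
qed auto

lemma measurable_act [measurable]: "h \<in> G \<Longrightarrow> act h \<in> measurable BX BX"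
proof -
  assume h: "h \<in> G"
  show ?thesis
  proof (rule measurable_sigma_sets[OF sets_BX])
    fix U assume "U \<in> {U. openin TX U}"
    then have "openin TX {x \<in> topspace TX. act h x \<in> U}"
      using continuous_map_act[OF h] by (auto simp: continuous_map)
    then show "act h -` U \<inter> space BX \<in> sets BX"
      by (intro openin_sets) (auto elim!: back_subst[of "openin TX"])
  qed (use h in \<open>auto simp: openin_TX\<close>)
qed

lemma measurable_act_pow [measurable]: "h \<in> G \<Longrightarrow> act h ^^ l \<in> measurable BX BX"
proof (induction l)
  case (Suc l)
  have "act h \<circ> (act h ^^ l) \<in> measurable BX BX"
    by (rule measurable_comp[OF Suc.IH[OF Suc.prems] measurable_act[OF Suc.prems]])
  then show ?case by (simp add: o_def)
qed (auto simp: id_def)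

lemma continuous_map_real_iff: "continuous_map TX euclideanreal f \<longleftrightarrow> continuous_on G (\<lambda>g. f (pt g))"
proof -
  have "{g \<in> G. pt g \<in> {x \<in> X. f x \<in> U}} = G \<inter> (\<lambda>g. f (pt g)) -` U" for U by auto
  then show ?thesis
    unfolding continuous_map continuous_on_open_gen[OF image_subset_iff_funcset[THEN iffD1, OF subset_UNIV]]
    by (auto simp: openin_TX)
qed

lemma continuous_map_measurable:
  assumes "continuous_map TX euclideanreal f"
  shows "f \<in> borel_measurable BX"
proof (rule borel_measurableI)
  fix S :: "real set" assume "open S"
  then have "openin TX {x \<in> topspace TX. f x \<in> S}" using assms by (auto simp: continuous_map)
  then show "f -` S \<inter> space BX \<in> sets BX"
    by (intro openin_sets) (auto elim!: back_subst[of "openin TX"])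
qed

text \<open>The image of the open ball of radius \<open>R\<close>; these sets exhaust the space by relatively compact sets.\<close>

definition OX :: "real \<Rightarrow> (real^'n^'n) set set" where
  "OX R = pt ` (G \<inter> ball 0 R)"

lemma openin_OX: "openin TX (OX R)"
  unfolding OX_def by (intro open_image_pt) (auto simp: openin_open_Int)

lemma OX_sets [measurable]: "OX R \<in> sets BX"
  by (intro openin_sets openin_OX)

lemma OX_subset: "OX R \<subseteq> X"
  by (auto simp: OX_def)

lemma OX_mono: "R \<le> S \<Longrightarrow> OX R \<subseteq> OX S"
  by (auto simp: OX_def)

lemma X_eq_Union_OX: "X = (\<Union>i :: nat. OX (real i))"
proof -
  have "pt g \<in> OX (real (nat \<lceil>norm g\<rceil> + 1))" if "g \<in> G" for g
    unfolding OX_def using that by (intro imageI) (auto; linarith)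
  then have "X \<subseteq> (\<Union>i :: nat. OX (real i))" unfolding hspace_eq by blast
  then show ?thesis using OX_subset by blast
qed

lemma compactin_subset_OX:
  assumes "compactin TX K"
  shows "\<exists>R. K \<subseteq> OX R"
proof -
  have "K \<subseteq> \<Union>(range (\<lambda>i :: nat. OX (real i)))"
    using compactin_subset_topspace[OF assms] X_eq_Union_OX by auto
  moreover have "\<forall>U\<in>range (\<lambda>i :: nat. OX (real i)). openin TX U" using openin_OX by blast
  ultimately have "\<exists>F. finite F \<and> F \<subseteq> range (\<lambda>i :: nat. OX (real i)) \<and> K \<subseteq> \<Union>F"
    using assms unfolding compactin_def by blast
  then obtain F where F: "finite F" "F \<subseteq> range (\<lambda>i :: nat. OX (real i))" "K \<subseteq> \<Union>F" by blast
  obtain I where I: "finite I" "F = (\<lambda>i :: nat. OX (real i)) ` I"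
    using finite_subset_image[OF F(1,2)] by blast
  have "K \<subseteq> OX (real (Max (insert 0 I)))"
  proof
    fix x assume "x \<in> K"
    then obtain i where "i \<in> I" "x \<in> OX (real i)" using F I by auto
    moreover have "real i \<le> real (Max (insert 0 I))" using I \<open>i \<in> I\<close> by simp
    ultimately show "x \<in> OX (real (Max (insert 0 I)))" using OX_mono by blast
  qed
  then show ?thesis by blast
qed

lemma OX_act:
  assumes "h \<in> G" "norm (h - mat 1) \<le> 1" "x \<in> OX R"
  shows "act h x \<in> OX (2 * R)"
proof -
  obtain g where g: "g \<in> G" "norm g < R" "x = pt g" using assms by (auto simp: OX_def)
  have "norm (h ** g) \<le> (1 + 1) * norm g" by (rule norm_near_one_mult_le[OF assms(2)])
  then show ?thesis using g assms by (auto simp: OX_def act_pt)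
qed

lemma compact_G_cball: "compact (G \<inter> cball 0 R)"
  using closed_G by (simp add: closed_Int_compact)

lemma compactin_pt_image: "compact C \<Longrightarrow> C \<subseteq> G \<Longrightarrow> compactin TX (pt ` C)"
  by (rule image_compactin[OF _ continuous_map_pt]) (auto simp: compactin_subtopology)

lemma closed_\<Gamma>: "closed \<Gamma>"
  unfolding closed_sequential_limits
proof (intro allI impI)
  fix \<gamma> g assume "(\<forall>k :: nat. \<gamma> k \<in> \<Gamma>) \<and> \<gamma> \<longlonglongrightarrow> g"
  then have \<gamma>: "\<And>k. \<gamma> k \<in> \<Gamma>" "\<gamma> \<longlonglongrightarrow> g" by auto
  have g: "g \<in> G" using closed_sequentially[OF closed_G _ \<gamma>(2)] \<gamma>(1) \<Gamma>_G by blast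
  obtain e where e: "e > 0" "ball (mat 1) e \<inter> \<Gamma> = {mat 1}"
  proof -
    have "mat 1 isolated_in \<Gamma>" using discrete_\<Gamma> \<Gamma>_one by (auto simp: Isolated.discrete_def)
    then obtain e where "e > 0" "\<forall>y\<in>\<Gamma>. dist (mat 1) y < e \<longrightarrow> y = mat 1"
      unfolding isolated_in_dist_Ex_iff by blast
    moreover from this have "ball (mat 1) e \<inter> \<Gamma> = {mat 1}" using \<Gamma>_one by auto
    ultimately show ?thesis using that by blast
  qed
  have "(\<lambda>k. minv (\<gamma> k) ** \<gamma> (Suc k)) \<longlonglongrightarrow> minv g ** g"
    using \<gamma> g \<Gamma>_G LIMSEQ_Suc[OF \<gamma>(2)] by (intro mm.tendsto tendsto_minv) auto
  then have "\<forall>\<^sub>F k in sequentially. minv (\<gamma> k) ** \<gamma> (Suc k) \<in> ball (mat 1) e"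
    using g e by (intro topological_tendstoD) auto
  then obtain K where K: "\<And>k. k \<ge> K \<Longrightarrow> minv (\<gamma> k) ** \<gamma> (Suc k) \<in> ball (mat 1) e"
    by (auto simp: eventually_sequentially)
  have step: "\<gamma> (Suc k) = \<gamma> k" if "k \<ge> K" for k
  proof -
    have "minv (\<gamma> k) ** \<gamma> (Suc k) \<in> ball (mat 1) e \<inter> \<Gamma>"
      by (intro IntI K[OF that] \<Gamma>_mult \<Gamma>_inv \<gamma>(1))
    then have "minv (\<gamma> k) ** \<gamma> (Suc k) = mat 1" unfolding e(2) by simp
    then have "\<gamma> k ** (minv (\<gamma> k) ** \<gamma> (Suc k)) = \<gamma> k" by simp
    then show ?thesis using \<gamma> \<Gamma>_G by (simp add: matrix_mul_assoc)
  qed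
  have "\<gamma> (K + j) = \<gamma> K" for j by (induction j) (auto simp: step)
  then have "\<gamma> k = \<gamma> K" if "k \<ge> K" for k using that by (metis le_add_diff_inverse)
  then have "\<forall>\<^sub>F k in sequentially. \<gamma> k = \<gamma> K" unfolding eventually_sequentially by blast
  then have "\<gamma> \<longlonglongrightarrow> \<gamma> K" by (rule tendsto_eventually)
  then have "g = \<gamma> K" using \<gamma>(2) LIMSEQ_unique by blast
  then show "g \<in> \<Gamma>" using \<gamma> by simp
qed

text \<open>The image is closed: its preimage in \<open>G\<close> is a product of the compact \<open>C\<close> and the closed \<open>\<Gamma>\<close>.\<close>

lemma compact_image_sets:
  assumes C: "compact C" "C \<subseteq> G"
  shows "pt ` C \<in> sets BX"
proof -
  let ?S = "{g \<in> G. pt g \<in> pt ` C}"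
  have S: "g \<in> ?S \<longleftrightarrow> (\<exists>h\<in>C. \<exists>\<gamma>\<in>\<Gamma>. g = h ** \<gamma>)" for g
    using C pt_eq_iff \<Gamma>_G by (auto simp: image_iff) (metis mult_G subsetD)+
  have "closed ?S"
    unfolding closed_sequential_limits
  proof (intro allI impI)
    fix s g assume "(\<forall>k :: nat. s k \<in> ?S) \<and> s \<longlonglongrightarrow> g"
    then have s: "\<And>k. s k \<in> ?S" "s \<longlonglongrightarrow> g" by auto
    then obtain h \<gamma> where h: "\<And>k. h k \<in> C" "\<And>k. \<gamma> k \<in> \<Gamma>" "\<And>k. s k = h k ** \<gamma> k"
      unfolding S by metis
    have "\<forall>k. h k \<in> C" using h by blast
    from seq_compactE[OF compact_imp_seq_compact[OF C(1)] this]
    obtain l r where l: "l \<in> C" "strict_mono r" "(h \<circ> r) \<longlonglongrightarrow> l" .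
    have lG: "l \<in> G" using l C by blast
    have sr: "(s \<circ> r) \<longlonglongrightarrow> g" using s l by (intro LIMSEQ_subseq_LIMSEQ)
    have hG: "h k \<in> G" for k using h C by blast
    have "(\<lambda>k. minv ((h \<circ> r) k) ** (s \<circ> r) k) \<longlonglongrightarrow> minv l ** g"
      using lG hG by (intro mm.tendsto tendsto_minv l(3) sr) auto
    moreover have "minv ((h \<circ> r) k) ** (s \<circ> r) k = \<gamma> (r k)" for k
      using hG h by (simp add: matrix_mul_assoc)
    ultimately have "(\<lambda>k. \<gamma> (r k)) \<longlonglongrightarrow> minv l ** g" by simp
    then have "minv l ** g \<in> \<Gamma>" by (rule closed_sequentially[OF closed_\<Gamma> h(2)])
    moreover have "g = l ** (minv l ** g)" using lG by (simp add: matrix_mul_assoc)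
    ultimately show "g \<in> ?S" unfolding S using l by blast
  qed
  then have "openin (top_of_set G) (G - ?S)"
    unfolding Diff_eq by (intro openin_open_Int open_Compl)
  moreover have "{g \<in> G. pt g \<in> X - pt ` C} = G - ?S" by auto
  ultimately have "openin TX (X - pt ` C)" by (simp add: openin_TX)
  then have "X - (X - pt ` C) \<in> sets BX" using openin_sets sets.compl_sets[of "X - pt ` C" BX] by simp
  moreover have "X - (X - pt ` C) = pt ` C" using C by auto
  ultimately show ?thesis by simp
qed

lemma sigma_compact_image_sets:
  assumes "\<And>j :: nat. compact (C j)" "\<And>j. C j \<subseteq> G"
  shows "pt ` (\<Union>j. C j) \<in> sets BX"
  unfolding image_UN using assms by (intro sets.countable_UN) (auto intro: compact_image_sets)

lemma Cc_continuous: "f \<in> Cc \<Gamma> G \<Longrightarrow> continuous_on G (\<lambda>g. f (pt g))"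
  by (simp add: Cc_def continuous_map_real_iff)

lemma Cc_measurable: "f \<in> Cc \<Gamma> G \<Longrightarrow> f \<in> borel_measurable BX"
  by (auto simp: Cc_def intro: continuous_map_measurable)

lemma Cc_support: "f \<in> Cc \<Gamma> G \<Longrightarrow> \<exists>R. \<forall>x\<in>X - OX R. f x = 0"
  using compactin_subset_OX unfolding Cc_def by blast

lemma Cc_bounded:
  assumes f: "f \<in> Cc \<Gamma> G"
  shows "\<exists>b>0. \<forall>x\<in>X. \<bar>f x\<bar> \<le> b"
proof -
  obtain R where R: "\<forall>x\<in>X - OX R. f x = 0" using Cc_support[OF f] by blast
  have "compact ((\<lambda>g. f (pt g)) ` (G \<inter> cball 0 R))"
    by (intro compact_continuous_image compact_G_cball continuous_on_subset[OF Cc_continuous[OF f]]) auto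
  then obtain b where b: "b > 0" "\<forall>y\<in>(\<lambda>g. f (pt g)) ` (G \<inter> cball 0 R). norm y \<le> b"
    using compact_imp_bounded bounded_pos by blast
  have "\<bar>f x\<bar> \<le> b" if "x \<in> X" for x
  proof (cases "x \<in> OX R")
    case True
    then show ?thesis using b(2) by (auto simp: OX_def)
  next
    case False
    then show ?thesis using R b that by simp
  qed
  then show ?thesis using b by blast
qed

lemma inverse_at_one:
  assumes "\<rho> > 0"
  shows "\<exists>\<rho>'>0. \<rho>' \<le> \<rho> \<and> (\<forall>h\<in>G. norm (h - mat 1) < \<rho>' \<longrightarrow> norm (minv h - mat 1) < \<rho>)"
proof -
  obtain d where d: "d > 0" "\<forall>h\<in>G. dist h (mat 1) < d \<longrightarrow> dist (minv h) (minv (mat 1)) < \<rho>"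
    using continuous_on_minv assms unfolding continuous_on_iff by (metis one_G)
  then show ?thesis
    using assms by (intro exI[of _ "min d \<rho>"]) (auto simp: dist_norm)
qed

lemma Cc_uniformly_continuous_OX:
  assumes f: "f \<in> Cc \<Gamma> G" and e: "e > 0"
  shows "\<exists>\<rho>>0. \<forall>h\<in>G. \<forall>x\<in>OX R. norm (h - mat 1) < \<rho> \<longrightarrow> \<bar>f (act h x) - f x\<bar> < e"
proof (rule ccontr)
  assume neg: "\<not> ?thesis"
  have "\<exists>h g. h \<in> G \<and> g \<in> G \<inter> cball 0 R \<and> norm (h - mat 1) < 1 / Suc k \<and> \<not> \<bar>f (pt (h ** g)) - f (pt g)\<bar> < e" for k :: nat
  proof -
    have "(1 :: real) / Suc k > 0" by simp
    then obtain h x where "h \<in> G" "x \<in> OX R" "norm (h - mat 1) < 1 / Suc k" "\<not> \<bar>f (act h x) - f x\<bar> < e"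
      using neg by blast
    moreover from \<open>x \<in> OX R\<close> have "\<exists>g\<in>G \<inter> cball 0 R. x = pt g" by (auto simp: OX_def)
    then obtain g where "g \<in> G \<inter> cball 0 R" "x = pt g" by blast
    ultimately show ?thesis by (intro exI[of _ h] exI[of _ g]) (auto simp: act_pt)
  qed
  then have "\<forall>k. \<exists>p. fst p \<in> G \<and> snd p \<in> G \<inter> cball 0 R \<and> norm (fst p - mat 1) < 1 / Suc k \<and>
      \<not> \<bar>f (pt (fst p ** snd p)) - f (pt (snd p))\<bar> < e" by simp
  from choice[OF this] obtain p where p: "\<forall>k. fst (p k) \<in> G \<and> snd (p k) \<in> G \<inter> cball 0 R \<and> norm (fst (p k) - mat 1) < 1 / Suc k \<and>
      \<not> \<bar>f (pt (fst (p k) ** snd (p k))) - f (pt (snd (p k)))\<bar> < e" ..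
  define h where "h k = fst (p k)" for k
  define g where "g k = snd (p k)" for k
  have hg: "\<And>k. h k \<in> G" "\<And>k. g k \<in> G \<inter> cball 0 R" "\<And>k :: nat. norm (h k - mat 1) < 1 / Suc k"
    "\<And>k. \<not> \<bar>f (pt (h k ** g k)) - f (pt (g k))\<bar> < e"
    using p unfolding h_def g_def by blast+
  have "(\<lambda>k. h k - mat 1) \<longlonglongrightarrow> 0"
    by (rule Lim_null_comparison[OF _ LIMSEQ_inverse_real_of_nat])
       (use hg(3) in \<open>auto intro!: always_eventually less_imp_le simp: inverse_eq_divide\<close>)
  then have h1: "h \<longlonglongrightarrow> mat 1" by (rule LIM_zero_cancel)
  have "\<forall>k. g k \<in> G \<inter> cball 0 R" using hg(2) by blast
  from seq_compactE[OF compact_imp_seq_compact[OF compact_G_cball] this]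
  obtain l r where l: "l \<in> G \<inter> cball 0 R" "strict_mono r" "(g \<circ> r) \<longlonglongrightarrow> l" .
  have gl: "(\<lambda>k. f (pt ((g \<circ> r) k))) \<longlonglongrightarrow> f (pt l)"
    by (rule continuous_on_tendsto_compose[OF Cc_continuous[OF f] l(3)]) (use l hg in auto)
  have "(\<lambda>k. (h \<circ> r) k ** (g \<circ> r) k) \<longlonglongrightarrow> mat 1 ** l"
    by (intro mm.tendsto LIMSEQ_subseq_LIMSEQ[OF h1 l(2)] l(3))
  then have "(\<lambda>k. (h \<circ> r) k ** (g \<circ> r) k) \<longlonglongrightarrow> l" by simp
  then have hgl: "(\<lambda>k. f (pt ((h \<circ> r) k ** (g \<circ> r) k))) \<longlonglongrightarrow> f (pt l)"
    by (rule continuous_on_tendsto_compose[OF Cc_continuous[OF f]]) (use l hg in auto)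
  from tendsto_diff[OF hgl gl] have "(\<lambda>k. f (pt ((h \<circ> r) k ** (g \<circ> r) k)) - f (pt ((g \<circ> r) k))) \<longlonglongrightarrow> 0"
    by simp
  from tendstoD[OF this e] obtain k where "dist (f (pt ((h \<circ> r) k ** (g \<circ> r) k)) - f (pt ((g \<circ> r) k))) 0 < e"
    using eventually_happens by fastforce
  then show False using hg(4)[of "r k"] by (simp add: o_def)
qed

lemma Cc_uniformly_continuous:
  assumes f: "f \<in> Cc \<Gamma> G" and e: "e > 0"
  shows "\<exists>\<rho>>0. \<forall>h\<in>G. \<forall>x\<in>X. norm (h - mat 1) < \<rho> \<longrightarrow> \<bar>f (act h x) - f x\<bar> < e"
proof -
  obtain R where R: "\<forall>x\<in>X - OX R. f x = 0" using Cc_support[OF f] by blast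
  obtain \<rho> where \<rho>: "\<rho> > 0" "\<And>h x. h \<in> G \<Longrightarrow> x \<in> OX R \<Longrightarrow> norm (h - mat 1) < \<rho> \<Longrightarrow> \<bar>f (act h x) - f x\<bar> < e"
    using Cc_uniformly_continuous_OX[OF f e, of R] by blast
  obtain \<rho>' where \<rho>': "\<rho>' > 0" "\<rho>' \<le> \<rho>" "\<And>h. h \<in> G \<Longrightarrow> norm (h - mat 1) < \<rho>' \<Longrightarrow> norm (minv h - mat 1) < \<rho>"
    using inverse_at_one[OF \<rho>(1)] by blast
  have "\<bar>f (act h x) - f x\<bar> < e" if h: "h \<in> G" "norm (h - mat 1) < \<rho>'" and x: "x \<in> X" for h x
  proof -
    consider "x \<in> OX R" | "act h x \<in> OX R" | "x \<notin> OX R" "act h x \<notin> OX R" by blast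
    then show ?thesis
    proof cases
      case 1
      then show ?thesis using \<rho>(2) h \<rho>'(2) by simp
    next
      case 2
      have "\<bar>f (act (minv h) (act h x)) - f (act h x)\<bar> < e"
        using \<rho>(2)[OF minv_G[OF h(1)] 2] \<rho>'(3)[OF h] by simp
      then show ?thesis using h x by (simp add: act_act abs_minus_commute)
    next
      case 3
      then show ?thesis using R e x h by simp
    qed
  qed
  then show ?thesis using \<rho>'(1) by blast
qed

end

section \<open>Vague compactness\<close>

text \<open>The tent-like function of Schoenberg's space-filling curve: it reads off the leading ternary digit
  (\<open>0\<close> or \<open>2\<close>) of a point of the Cantor set.\<close>

definition schoenberg :: "real \<Rightarrow> real" where
  "schoenberg t = max 0 (min 1 (3 * infdist t (range (\<lambda>m :: int. 2 * of_int m)) - 1))"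

lemma continuous_schoenberg: "continuous_on UNIV schoenberg"
  unfolding schoenberg_def by (intro continuous_intros)

lemma schoenberg_range: "0 \<le> schoenberg t" "schoenberg t \<le> 1"
  by (auto simp: schoenberg_def)

lemma schoenberg_digit:
  assumes b: "b \<in> {0, 1 :: real}" and z: "0 \<le> z" "z \<le> 1"
  shows "schoenberg (2 * of_int m + 2 * b / 3 + z / 3) = b"
proof -
  let ?E = "range (\<lambda>m :: int. 2 * of_int m :: real)" and ?t = "2 * of_int m + 2 * b / 3 + z / 3"
  show ?thesis
  proof (cases "b = 0")
    case True
    have "infdist ?t ?E \<le> dist ?t (2 * of_int m)" by (rule infdist_le) auto
    also have "\<dots> \<le> 1 / 3" using True z by (simp add: dist_real_def)
    finally show ?thesis using True by (simp add: schoenberg_def)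
  next
    case False
    then have b1: "b = 1" using b by simp
    have ne: "?E \<noteq> {}" by blast
    have "infdist ?t ?E \<ge> 2 / 3"
      unfolding infdist_notempty[OF ne]
    proof (rule cINF_greatest[OF ne])
      fix y assume "y \<in> ?E"
      then obtain j :: int where j: "y = 2 * of_int j" by auto
      show "2 / 3 \<le> dist ?t y"
      proof (cases "j \<le> m")
        case True
        then have "(of_int j :: real) \<le> of_int m" by simp
        then show ?thesis using j b1 z by (simp add: dist_real_def)
      next
        case False
        then have "(of_int j :: real) \<ge> of_int m + 1" by linarith
        then show ?thesis using j b1 z by (simp add: dist_real_def)
      qed
    qed
    then show ?thesis using b1 by (simp add: schoenberg_def)
  qed
qed

definition cantor :: "(nat \<Rightarrow> real) \<Rightarrow> real" where
  "cantor b = (\<Sum>k. 2 * b k / 3 ^ Suc k)"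

lemma cantor_summable:
  fixes b :: "nat \<Rightarrow> real"
  assumes "\<And>k. b k \<in> {0, 1}"
  shows "summable (\<lambda>k. 2 * b k / 3 ^ Suc k)"
proof (rule summable_comparison_test')
  show "summable (\<lambda>k. 2 / 3 * (1 / 3 :: real) ^ k)" by (intro summable_mult summable_geometric) auto
  show "norm (2 * b k / 3 ^ Suc k) \<le> 2 / 3 * (1 / 3) ^ k" for k
    using assms[of k] by (auto simp: power_one_over divide_simps)
qed

lemma cantor_range:
  assumes b: "\<And>k. b k \<in> {0, 1}"
  shows "0 \<le> cantor b" "cantor b \<le> 1"
proof -
  show "0 \<le> cantor b"
    unfolding cantor_def
  proof (intro suminf_nonneg cantor_summable b)
    show "0 \<le> 2 * b k / 3 ^ Suc k" for k using b[of k] by auto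
  qed
  have "(\<lambda>k. 2 / 3 * (1 / 3 :: real) ^ k) sums (2 / 3 * (1 / (1 - 1 / 3)))"
    by (intro sums_mult geometric_sums) auto
  then have s: "(\<lambda>k. 2 / 3 * (1 / 3 :: real) ^ k) sums 1" by simp
  have "cantor b \<le> (\<Sum>k. 2 / 3 * (1 / 3 :: real) ^ k)"
    unfolding cantor_def
  proof (rule suminf_le[OF _ cantor_summable[OF b] sums_summable[OF s]])
    show "2 * b k / 3 ^ Suc k \<le> 2 / 3 * (1 / 3) ^ k" for k
      using b[of k] by (auto simp: power_one_over divide_simps)
  qed
  then show "cantor b \<le> 1" using sums_unique[OF s] by simp
qed

lemma cantor_shift:
  assumes b: "\<And>k. b k \<in> {0, 1}"
  shows "cantor b = 2 * b 0 / 3 + cantor (\<lambda>k. b (Suc k)) / 3"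
proof -
  have s: "summable (\<lambda>k. 2 * b k / 3 ^ Suc k)" by (rule cantor_summable) (rule b)
  have "cantor b = (\<Sum>k. 2 * b (Suc k) / 3 ^ Suc (Suc k)) + 2 * b 0 / 3 ^ Suc 0"
    unfolding cantor_def using suminf_split_head[OF s] by linarith
  also have "(\<Sum>k. 2 * b (Suc k) / 3 ^ Suc (Suc k)) = (\<Sum>k. (2 * b (Suc k) / 3 ^ Suc k) / 3)"
    by (simp add: field_simps)
  also have "\<dots> = cantor (\<lambda>k. b (Suc k)) / 3"
    unfolding cantor_def by (rule suminf_divide[OF cantor_summable[of "\<lambda>k. b (Suc k)"]]) (rule b)
  finally show ?thesis by simp
qed

lemma schoenberg_cantor:
  assumes b: "\<And>k. b k \<in> {0, 1}"
  shows "schoenberg (3 ^ k * cantor b) = b k"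
proof -
  have "\<exists>m :: int. 3 ^ k * cantor b = 2 * of_int m + cantor (\<lambda>j. b (k + j))"
  proof (induction k)
    case 0
    show ?case by (intro exI[of _ 0]) simp
  next
    case (Suc k)
    then obtain m :: int where m: "3 ^ k * cantor b = 2 * of_int m + cantor (\<lambda>j. b (k + j))" by blast
    obtain n :: int where n: "b k = of_int n" using b[of k] by (metis insert_iff of_int_0 of_int_1 empty_iff)
    have "3 ^ Suc k * cantor b = 3 * (2 * of_int m + cantor (\<lambda>j. b (k + j)))" using m by simp
    also have "\<dots> = 2 * of_int (3 * m + n) + cantor (\<lambda>j. b (Suc k + j))"
      using cantor_shift[of "\<lambda>j. b (k + j)", OF b] n by simp
    finally show ?case by blast
  qed
  then obtain m :: int where m: "3 ^ k * cantor b = 2 * of_int m + cantor (\<lambda>j. b (k + j))" by blast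
  have "3 ^ k * cantor b = 2 * of_int m + 2 * b k / 3 + cantor (\<lambda>j. b (k + Suc j)) / 3"
    using m cantor_shift[of "\<lambda>j. b (k + j)", OF b] by simp
  then show ?thesis
    using schoenberg_digit[OF b cantor_range[of "\<lambda>j. b (k + Suc j)", OF b]] by simp
qed

definition bit :: "real \<Rightarrow> nat \<Rightarrow> real" where
  "bit u m = of_int \<lfloor>2 ^ Suc m * u\<rfloor> - 2 * of_int \<lfloor>2 ^ m * u\<rfloor>"

lemma bit_range: "bit u m \<in> {0, 1}"
proof -
  have "\<lfloor>2 * v\<rfloor> - 2 * \<lfloor>v\<rfloor> \<in> {0, 1}" for v :: real by (simp; linarith)
  from this[of "2 ^ m * u"] show ?thesis
    unfolding bit_def by (auto simp: algebra_simps simp flip: of_int_mult of_int_diff)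
qed

lemma bit_sums:
  assumes u: "0 \<le> u" "u < 1"
  shows "(\<lambda>m. bit u m / 2 ^ Suc m) sums u"
proof -
  have part: "(\<Sum>m<M. bit u m / 2 ^ Suc m) = of_int \<lfloor>2 ^ M * u\<rfloor> / 2 ^ M" for M
  proof (induction M)
    case 0
    have "\<lfloor>u\<rfloor> = 0" using u by linarith
    then show ?case by simp
  qed (simp add: bit_def field_simps)
  have "(\<lambda>M. of_int \<lfloor>2 ^ M * u\<rfloor> / 2 ^ M - u) \<longlonglongrightarrow> 0"
  proof (rule Lim_null_comparison)
    show "\<forall>\<^sub>F M in sequentially. norm (of_int \<lfloor>2 ^ M * u\<rfloor> / 2 ^ M - u) \<le> (1 / 2) ^ M"
    proof (intro always_eventually allI)
      fix M
      have "\<bar>of_int \<lfloor>2 ^ M * u\<rfloor> - 2 ^ M * u\<bar> \<le> 1" by linarith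
      moreover have "of_int \<lfloor>2 ^ M * u\<rfloor> / 2 ^ M - u = (of_int \<lfloor>2 ^ M * u\<rfloor> - 2 ^ M * u) / 2 ^ M"
        by (simp add: field_simps)
      ultimately show "norm (of_int \<lfloor>2 ^ M * u\<rfloor> / 2 ^ M - u) \<le> (1 / 2) ^ M"
        by (simp add: abs_divide power_one_over divide_right_mono)
    qed
    show "(\<lambda>M. (1 / 2 :: real) ^ M) \<longlonglongrightarrow> 0" by (intro LIMSEQ_realpow_zero) auto
  qed
  then have "(\<lambda>M. of_int \<lfloor>2 ^ M * u\<rfloor> / 2 ^ M) \<longlonglongrightarrow> u" by (rule LIM_zero_cancel)
  then show ?thesis unfolding sums_def part .
qed

text \<open>The coordinate functions of the space-filling curve.\<close>

definition curve :: "nat \<Rightarrow> nat \<Rightarrow> real \<Rightarrow> real" where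
  "curve D i t = (\<Sum>m. schoenberg (3 ^ (m * D + i) * t) / 2 ^ Suc m)"

text \<open>Interleaving the binary digits of the coordinates.\<close>

definition code :: "nat \<Rightarrow> (nat \<Rightarrow> real) \<Rightarrow> real" where
  "code D u = cantor (\<lambda>k. bit (u (k mod D)) (k div D))"

lemma half_sums: "(\<lambda>m. 1 / 2 ^ Suc m :: real) sums 1"
  using sums_mult[OF geometric_sums[of "1 / 2 :: real"], of "1 / 2"] by (simp add: power_one_over)

lemma curve_summable: "summable (\<lambda>m. schoenberg (3 ^ (m * D + i) * t) / 2 ^ Suc m)"
proof (rule summable_comparison_test'[OF sums_summable[OF half_sums]])
  show "norm (schoenberg (3 ^ (m * D + i) * t) / 2 ^ Suc m) \<le> 1 / 2 ^ Suc m" for m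
    using schoenberg_range[of "3 ^ (m * D + i) * t"] by (simp add: divide_right_mono)
qed

lemma curve_range: "0 \<le> curve D i t" "curve D i t \<le> 1"
proof -
  show "0 \<le> curve D i t"
    unfolding curve_def by (intro suminf_nonneg curve_summable) (use schoenberg_range in auto)
  have "curve D i t \<le> (\<Sum>m. 1 / 2 ^ Suc m :: real)"
    unfolding curve_def
    by (intro suminf_le curve_summable sums_summable[OF half_sums] divide_right_mono schoenberg_range) auto
  then show "curve D i t \<le> 1" using sums_unique[OF half_sums] by simp
qed

lemma continuous_curve: "continuous_on UNIV (curve D i)"
proof -
  have ul: "uniform_limit UNIV (\<lambda>n t. \<Sum>m<n. schoenberg (3 ^ (m * D + i) * t) / 2 ^ Suc m) (curve D i) sequentially"
    unfolding curve_def
  proof (rule Weierstrass_m_test[OF _ sums_summable[OF half_sums]])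
    show "norm (schoenberg (3 ^ (m * D + i) * t) / 2 ^ Suc m) \<le> 1 / 2 ^ Suc m" for m t
      using schoenberg_range[of "3 ^ (m * D + i) * t"] by (simp add: divide_right_mono)
  qed
  have "continuous_on UNIV (\<lambda>t. schoenberg (3 ^ k * t))" for k
    by (rule continuous_on_compose2[OF continuous_schoenberg]) (auto intro!: continuous_intros)
  then have "\<forall>\<^sub>F n in sequentially. continuous_on UNIV (\<lambda>t. \<Sum>m<n. schoenberg (3 ^ (m * D + i) * t) / 2 ^ Suc m)"
    by (intro always_eventually allI continuous_intros) auto
  then show ?thesis
    by (rule uniform_limit_theorem[OF _ ul]) simp
qed

lemma curve_code:
  assumes u: "0 \<le> u i" "u i < 1" and i: "i < D"
  shows "curve D i (code D u) = u i"
proof -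
  have "schoenberg (3 ^ (m * D + i) * code D u) = bit (u i) m" for m
  proof -
    have "(m * D + i) mod D = i" "(m * D + i) div D = m" using i by auto
    then show ?thesis
      unfolding code_def by (subst schoenberg_cantor[OF bit_range]) simp
  qed
  then show ?thesis
    unfolding curve_def using sums_unique[OF bit_sums[OF u]] by simp
qed

lemma measurable_code:
  assumes "\<And>i. i < D \<Longrightarrow> (\<lambda>x. u x i) \<in> borel_measurable M" "D > 0"
  shows "(\<lambda>x. code D (u x)) \<in> borel_measurable M"
proof -
  have "(\<lambda>x. bit (u x (k mod D)) (k div D)) \<in> borel_measurable M" for k
  proof -
    have [measurable]: "(\<lambda>x. u x (k mod D)) \<in> borel_measurable M" using assms by simp
    show ?thesis unfolding bit_def by measurable
  qed
  then show ?thesis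
    unfolding code_def cantor_def by measurable
qed

text \<open>The squashed coordinates \<open>x / (1 + \<bar>x\<bar>)\<close> of a point are read off from its code; a compactly
  supported function is a continuous function of the squashed coordinates, cut off away from
  \<open>\<plusminus>1\<close>. Escaping mass ends up in parameters where some squashed coordinate is \<open>\<plusminus>1\<close>.\<close>

definition squash :: "real \<Rightarrow> real" where "squash x = x / (1 + \<bar>x\<bar>)"
definition unsquash :: "real \<Rightarrow> real" where "unsquash w = w / (1 - \<bar>w\<bar>)"

lemma squash_less: "\<bar>squash x\<bar> < 1"
  by (simp add: squash_def abs_divide)

lemma unsquash_squash: "unsquash (squash x) = x"
proof -
  have "1 + \<bar>x\<bar> > 0" by linarith
  moreover have "1 - \<bar>squash x\<bar> = 1 / (1 + \<bar>x\<bar>)"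
    using calculation by (simp add: squash_def abs_divide field_simps)
  ultimately show ?thesis by (simp add: unsquash_def squash_def)
qed

lemma abs_squash_le_iff:
  assumes "R > 0"
  shows "\<bar>squash x\<bar> \<le> squash R \<longleftrightarrow> \<bar>x\<bar> \<le> R"
proof -
  have "1 + \<bar>x\<bar> > 0" "1 + R > 0" using assms by linarith+
  then show ?thesis using assms by (simp add: squash_def abs_divide field_simps)
qed

text \<open>The measures are transported to the line by \<open>code\<close>, a Borel right inverse of the space-filling curve.
  On the line Helly's theorem gives limits of subsequences, and integrals of functions of the coordinates
  are integrals of continuous functions of the parameter along the curve.\<close>

theorem vague_compactness:
  fixes M :: "nat \<Rightarrow> 'a::euclidean_space measure"
  assumes prob: "\<And>j. prob_space (M j)" and sets: "\<And>j. sets (M j) = sets borel"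
  shows "\<exists>r M'. strict_mono r \<and> finite_measure M' \<and> sets M' = sets borel \<and>
     (\<forall>g :: 'a \<Rightarrow> real. continuous_on UNIV g \<and> (\<exists>R. \<forall>x. norm x \<ge> R \<longrightarrow> g x = 0) \<longrightarrow>
        (\<lambda>j. integral\<^sup>L (M (r j)) g) \<longlonglongrightarrow> integral\<^sup>L M' g)"
proof -
  define D where "D = DIM('a)"
  have D: "D > 0" by (simp add: D_def)
  obtain e :: "nat \<Rightarrow> 'a" where e: "bij_betw e {..<D} Basis"
    using ex_bij_betw_nat_finite[OF finite_Basis] unfolding D_def lessThan_atLeast0 by blast
  then have eB: "e i \<in> Basis" if "i < D" for i using that by (auto simp: bij_betw_def)
  have coord: "(\<Sum>i<D. (x \<bullet> e i) *\<^sub>R e i) = x" for x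
    using sum.reindex_bij_betw[OF e, of "\<lambda>b. (x \<bullet> b) *\<^sub>R b"] by (simp add: euclidean_representation)
  have inner_e: "(\<Sum>i<D. f i *\<^sub>R e i) \<bullet> e k = f k" if "k < D" for f k
  proof -
    have "e i \<bullet> e k = (if i = k then 1 else 0)" if "i < D" for i
      using e \<open>k < D\<close> that eB by (auto simp: inner_Basis bij_betw_def inj_on_def)
    then have "(\<Sum>i<D. f i * (e i \<bullet> e k)) = (\<Sum>i<D. if i = k then f i else 0)"
      by (intro sum.cong) auto
    then show ?thesis using \<open>k < D\<close> by (simp add: inner_sum_left)
  qed
  define \<Phi> where "\<Phi> i t = 2 * curve D i t - 1" for i t
  define \<Psi> where "\<Psi> x = code D (\<lambda>i. (squash (x \<bullet> e i) + 1) / 2)" for x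
  have \<Phi>\<Psi>: "\<Phi> i (\<Psi> x) = squash (x \<bullet> e i)" if "i < D" for i x
  proof -
    have "\<bar>squash (x \<bullet> e i)\<bar> < 1" by (rule squash_less)
    then have "curve D i (\<Psi> x) = (squash (x \<bullet> e i) + 1) / 2"
      unfolding \<Psi>_def by (intro curve_code that) auto
    then show ?thesis by (simp add: \<Phi>_def)
  qed
  have cont_\<Phi>: "continuous_on UNIV (\<Phi> i)" for i
    unfolding \<Phi>_def by (intro continuous_intros continuous_curve)
  have meas_\<Phi> [measurable]: "\<Phi> i \<in> borel_measurable borel" for i
    by (rule borel_measurable_continuous_onI[OF cont_\<Phi>])
  have \<Phi>1: "\<bar>\<Phi> i t\<bar> \<le> 1" for i t
    using curve_range[of D i t] by (auto simp: \<Phi>_def abs_le_iff)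
  have meas_\<Psi>: "\<Psi> \<in> borel_measurable borel"
    unfolding \<Psi>_def squash_def by (intro measurable_code D) measurable
  have meas: "\<Psi> \<in> borel_measurable (M j)" for j
    using meas_\<Psi> measurable_cong_sets[OF sets refl] by blast
  define N where "N j = distr (M j) borel \<Psi>" for j
  have N: "real_distribution (N j)" for j
    unfolding N_def by (rule prob_space.real_distribution_distr[OF prob meas])
  have \<Psi>01: "0 \<le> \<Psi> x" "\<Psi> x \<le> 1" for x
    unfolding \<Psi>_def code_def by (rule cantor_range[OF bit_range])+
  have "tight N"
    unfolding tight_def
  proof (intro conjI allI impI N)
    fix \<epsilon> :: real assume "\<epsilon> > 0"
    have "measure (N j) {-1<..1} = 1" for j
    proof -
      have "\<Psi> -` {-1<..1} \<inter> space (M j) = space (M j)" using \<Psi>01 by (auto simp: less_le_trans[of "-1" 0])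
      then show ?thesis
        unfolding N_def using meas by (simp add: measure_distr prob_space.prob_space[OF prob])
    qed
    then show "\<exists>a b. a < b \<and> (\<forall>n. measure (N n) {a<..b} > 1 - \<epsilon>)"
      using \<open>\<epsilon> > 0\<close> by (intro exI[of _ "-1"] exI[of _ 1]) auto
  qed
  from tight_imp_convergent_subsubsequence[OF this strict_mono_id]
  obtain r N' where r: "strict_mono r" and N': "real_distribution N'" "weak_conv_m (N \<circ> id \<circ> r) N'"
    by blast
  interpret N': real_distribution N' by (rule N'(1))
  define A where "A = {t. \<forall>i<D. \<bar>\<Phi> i t\<bar> < 1}"
  define K where "K t = (\<Sum>i<D. unsquash (\<Phi> i t) *\<^sub>R e i)" for t
  have A [measurable]: "A \<in> sets borel" unfolding A_def by measurable
  have K [measurable]: "K \<in> borel_measurable borel" unfolding K_def unsquash_def by measurable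
  define M' where "M' = distr (restrict_space N' A) borel K"
  have KR: "K \<in> measurable (restrict_space N' A) borel"
    by (intro measurable_restrict_space1) (simp add: measurable_cong_sets[OF N'.events_eq_borel refl])
  have "finite_measure M'"
    unfolding M'_def by (intro finite_measure.finite_measure_distr[OF _ KR] finite_measure_restrict_space N'.finite_measure_axioms) simp
  moreover have "(\<lambda>j. integral\<^sup>L (M (r j)) g) \<longlonglongrightarrow> integral\<^sup>L M' g"
    if g: "continuous_on UNIV g" and R: "\<forall>x. norm x \<ge> R \<longrightarrow> g x = 0" for g :: "'a \<Rightarrow> real" and R
  proof -
    define R' where "R' = max 1 R"
    define q where "q = squash R'"
    have R': "R' > 0" "\<And>x. norm x \<ge> R' \<Longrightarrow> g x = 0" using R by (auto simp: R'_def)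
    have q: "0 < q" "q < 1" using R' squash_less[of R'] by (auto simp: q_def squash_def)
    define cl where "cl w = max (- q) (min q w)" for w
    have cl: "\<bar>cl w\<bar> \<le> q" "\<bar>w\<bar> \<le> q \<Longrightarrow> cl w = w" "\<bar>w\<bar> > q \<Longrightarrow> \<bar>cl w\<bar> = q" for w
      using q by (auto simp: cl_def)
    have big: "g (\<Sum>i<D. f i *\<^sub>R e i) = 0" if k: "k < D" "\<bar>f k\<bar> \<ge> R'" for f k
    proof (rule R')
      have "\<bar>(\<Sum>i<D. f i *\<^sub>R e i) \<bullet> e k\<bar> \<le> norm (\<Sum>i<D. f i *\<^sub>R e i)" using eB[OF k(1)] by (rule Basis_le_norm)
      then show "norm (\<Sum>i<D. f i *\<^sub>R e i) \<ge> R'" using k inner_e[OF k(1)] by simp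
    qed
    have unq: "\<bar>unsquash w\<bar> \<ge> R'" if "\<bar>w\<bar> \<ge> q" "\<bar>w\<bar> < 1" for w
    proof -
      have "q \<le> \<bar>w\<bar>" "1 + R' > 0" using that R' by auto
      then have "R' \<le> \<bar>w\<bar> * (1 + R')" using R' unfolding q_def squash_def by (simp add: field_simps)
      then show ?thesis using that by (simp add: unsquash_def abs_divide field_simps)
    qed
    define H where "H t = g (\<Sum>i<D. unsquash (cl (\<Phi> i t)) *\<^sub>R e i)" for t
    have cont_H: "continuous_on UNIV H"
      unfolding H_def
    proof (rule continuous_on_compose2[OF g])
      have "continuous_on UNIV (\<lambda>t. cl (\<Phi> i t))" for i unfolding cl_def by (intro continuous_intros cont_\<Phi>)
      moreover have "1 - \<bar>cl w\<bar> \<noteq> 0" for w using cl(1)[of w] q by auto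
      ultimately show "continuous_on UNIV (\<lambda>t. \<Sum>i<D. unsquash (cl (\<Phi> i t)) *\<^sub>R e i)"
        unfolding unsquash_def by (intro continuous_intros) auto
    qed auto
    have H\<Psi>: "H (\<Psi> x) = g x" for x
    proof (cases "\<exists>k<D. \<bar>x \<bullet> e k\<bar> > R'")
      case True
      then obtain k where k: "k < D" "\<bar>x \<bullet> e k\<bar> > R'" by blast
      have "\<not> \<bar>squash (x \<bullet> e k)\<bar> \<le> q" unfolding q_def using k R' by (simp add: abs_squash_le_iff)
      then have "\<bar>cl (\<Phi> k (\<Psi> x))\<bar> = q" using \<Phi>\<Psi>[OF k(1)] cl(3) by simp
      then have "\<bar>unsquash (cl (\<Phi> k (\<Psi> x)))\<bar> \<ge> R'" using unq q by simp
      then have "H (\<Psi> x) = 0" unfolding H_def using big[OF k(1), of "\<lambda>i. unsquash (cl (\<Phi> i (\<Psi> x)))"] by blast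
      moreover have "\<bar>x \<bullet> e k\<bar> \<le> norm x" using eB[OF k(1)] by (rule Basis_le_norm)
      then have "g x = 0" using k R'(2) by simp
      ultimately show ?thesis by simp
    next
      case False
      have "unsquash (cl (\<Phi> i (\<Psi> x))) = x \<bullet> e i" if "i < D" for i
      proof -
        have "\<not> \<bar>x \<bullet> e i\<bar> > R'" using False that by blast
        then have "\<bar>squash (x \<bullet> e i)\<bar> \<le> q" unfolding q_def using R' by (simp add: abs_squash_le_iff)
        then show ?thesis using \<Phi>\<Psi>[OF that] cl(2) by (simp add: unsquash_squash)
      qed
      then have "(\<Sum>i<D. unsquash (cl (\<Phi> i (\<Psi> x))) *\<^sub>R e i) = (\<Sum>i<D. (x \<bullet> e i) *\<^sub>R e i)"
        by (intro sum.cong) auto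
      then show ?thesis unfolding H_def coord by simp
    qed
    have HK: "H t = indicator A t * g (K t)" for t
    proof (cases "\<exists>k<D. \<bar>\<Phi> k t\<bar> > q")
      case True
      then obtain k where k: "k < D" "\<bar>\<Phi> k t\<bar> > q" by blast
      then have "\<bar>unsquash (cl (\<Phi> k t))\<bar> \<ge> R'" using unq[of "cl (\<Phi> k t)"] q cl(3) by simp
      then have "H t = 0" unfolding H_def using big[OF k(1), of "\<lambda>i. unsquash (cl (\<Phi> i t))"] by blast
      moreover have "g (K t) = 0" if "t \<in> A"
      proof -
        have "\<bar>unsquash (\<Phi> k t)\<bar> \<ge> R'" using that k by (intro unq) (auto simp: A_def)
        then show ?thesis unfolding K_def using big[OF k(1), of "\<lambda>i. unsquash (\<Phi> i t)"] by blast
      qed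
      ultimately show ?thesis by (cases "t \<in> A") auto
    next
      case False
      then have *: "\<bar>\<Phi> i t\<bar> \<le> q" if "i < D" for i using False that leI by blast
      then have "t \<in> A" using q by (force simp: A_def)
      moreover have "(\<Sum>i<D. unsquash (cl (\<Phi> i t)) *\<^sub>R e i) = K t"
        unfolding K_def using cl(2)[OF *] by (intro sum.cong) auto
      then have "H t = g (K t)" unfolding H_def by simp
      ultimately show ?thesis by simp
    qed
    have meas_g: "g \<in> borel_measurable borel" by (rule borel_measurable_continuous_onI[OF g])
    have meas_H: "H \<in> borel_measurable borel" by (rule borel_measurable_continuous_onI[OF cont_H])
    have "compact (g ` cball 0 R')" by (intro compact_continuous_image continuous_on_subset[OF g]) auto
    then obtain B where B: "\<forall>y\<in>g ` cball 0 R'. norm y \<le> B" "B > 0"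
      using compact_imp_bounded bounded_pos by blast
    have gB: "norm (g x) \<le> B" for x
    proof (cases "norm x \<le> R'")
      case False
      then show ?thesis using R'(2) B(2) by simp
    qed (use B in auto)
    have "(\<lambda>j. integral\<^sup>L ((N \<circ> id \<circ> r) j) H) \<longlonglongrightarrow> integral\<^sup>L N' H"
    proof (rule weak_conv_imp_integral_bdd_continuous_conv[OF _ N'])
      show "real_distribution ((N \<circ> id \<circ> r) j)" for j using N by simp
      show "isCont H x" for x using cont_H continuous_on_eq_continuous_at[OF open_UNIV] by blast
      show "norm (H x) \<le> B" for x unfolding H_def by (rule gB)
    qed
    moreover have "integral\<^sup>L ((N \<circ> id \<circ> r) j) H = integral\<^sup>L (M (r j)) g" for j
      unfolding N_def comp_apply id_apply by (subst integral_distr[OF meas meas_H]) (simp add: H\<Psi>)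
    moreover have "H = (\<lambda>t. indicator A t * g (K t))" by (rule ext) (rule HK)
    then have "integral\<^sup>L N' H = integral\<^sup>L M' g"
      unfolding M'_def by (subst integral_distr[OF KR meas_g]) (simp add: integral_restrict_space)
    ultimately show ?thesis by simp
  qed
  ultimately show ?thesis
    using r by (intro exI[of _ r] exI[of _ M']) (auto simp: M'_def)
qed

context homogeneous_space
begin

subsection \<open>A proper continuous function\<close>

text \<open>The smallest norm of a representative; its sublevel sets are the sets \<open>OX R\<close>.\<close>

definition normX :: "(real^'n^'n) set \<Rightarrow> real" where
  "normX x = (INF g\<in>{g \<in> G. pt g = x}. norm g)"

lemma normX_less_iff:
  assumes "x \<in> X"
  shows "normX x < R \<longleftrightarrow> x \<in> OX R"
proof -
  have "{g \<in> G. pt g = x} \<noteq> {}" using assms by (auto simp: hspace_eq)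
  moreover have "bdd_below (norm ` {g \<in> G. pt g = x})" by (rule bdd_belowI[of _ 0]) auto
  ultimately have "normX x < R \<longleftrightarrow> (\<exists>g\<in>{g \<in> G. pt g = x}. norm g < R)"
    unfolding normX_def by (rule cINF_less_iff)
  also have "\<dots> \<longleftrightarrow> x \<in> OX R" by (auto simp: OX_def)
  finally show ?thesis .
qed

lemma normX_act_le:
  assumes h: "h \<in> G" and x: "x \<in> X"
  shows "normX (act h x) \<le> (1 + norm (h - mat 1)) * normX x"
proof (rule dense_ge)
  fix r assume r: "(1 + norm (h - mat 1)) * normX x < r"
  have p: "1 + norm (h - mat 1) > 0" by (intro add_pos_nonneg) auto
  then have "normX x < r / (1 + norm (h - mat 1))" using r by (simp add: field_simps)
  then obtain g where g: "g \<in> G" "x = pt g" "norm g < r / (1 + norm (h - mat 1))"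
    using x by (auto simp: normX_less_iff OX_def)
  have "norm (h ** g) \<le> (1 + norm (h - mat 1)) * norm g" by (rule norm_near_one_mult_le) simp
  also have "\<dots> < r" using g(3) p by (simp add: field_simps)
  finally have "act h x \<in> OX r" using g h by (auto simp: OX_def act_pt)
  then show "normX (act h x) \<le> r" using normX_less_iff h x by (meson act_in less_imp_le)
qed

lemma continuous_normX: "continuous_on G (\<lambda>g. normX (pt g))"
  unfolding continuous_on_def
proof
  fix g assume g: "g \<in> G"
  let ?F = "at g within G"
  let ?k = "\<lambda>h. 1 + norm (h ** minv g - mat 1)" and ?k' = "\<lambda>h. 1 + norm (g ** minv h - mat 1)"
  have ev: "\<forall>\<^sub>F h in ?F. h \<in> G" by (simp add: eventually_at_filter)
  have "((\<lambda>h. h ** minv g) \<longlongrightarrow> g ** minv g) ?F" "((\<lambda>h. g ** minv h) \<longlongrightarrow> g ** minv g) ?F"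
    by (intro mm.tendsto tendsto_minv tendsto_ident_at tendsto_const ev g)+
  then have "(?k \<longlongrightarrow> 1 + norm (g ** minv g - mat 1)) ?F" "(?k' \<longlongrightarrow> 1 + norm (g ** minv g - mat 1)) ?F"
    by (intro tendsto_intros; simp)+
  then have k: "(?k \<longlongrightarrow> 1) ?F" "(?k' \<longlongrightarrow> 1) ?F" using g by auto
  show "((\<lambda>h. normX (pt h)) \<longlongrightarrow> normX (pt g)) ?F"
  proof (rule tendsto_sandwich)
    show "((\<lambda>h. normX (pt g) / ?k' h) \<longlongrightarrow> normX (pt g)) ?F"
      using tendsto_divide[OF tendsto_const k(2), of "normX (pt g)"] by simp
    show "((\<lambda>h. ?k h * normX (pt g)) \<longlongrightarrow> normX (pt g)) ?F"
      using tendsto_mult[OF k(1) tendsto_const, of "normX (pt g)"] by simp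
    show "\<forall>\<^sub>F h in ?F. normX (pt h) \<le> ?k h * normX (pt g)"
      using ev
    proof eventually_elim
      case (elim h)
      have "act (h ** minv g) (pt g) = pt h" using elim g by (simp add: act_pt flip: matrix_mul_assoc)
      then show ?case using normX_act_le[of "h ** minv g" "pt g"] elim g by simp
    qed
    show "\<forall>\<^sub>F h in ?F. normX (pt g) / ?k' h \<le> normX (pt h)"
      using ev
    proof eventually_elim
      case (elim h)
      have "act (g ** minv h) (pt h) = pt g" using elim g by (simp add: act_pt flip: matrix_mul_assoc)
      then have "normX (pt g) \<le> ?k' h * normX (pt h)" using normX_act_le[of "g ** minv h" "pt h"] elim g by simp
      moreover have "?k' h > 0" by (intro add_pos_nonneg) auto
      ultimately show ?case by (simp add: field_simps)
    qed
  qed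
qed

definition bump :: "real \<Rightarrow> (real^'n^'n) set \<Rightarrow> real" where
  "bump R x = max 0 (min 1 (R + 1 - normX x))"

lemma bump_range: "0 \<le> bump R x" "bump R x \<le> 1"
  by (auto simp: bump_def)

lemma bump_one: "x \<in> OX R \<Longrightarrow> bump R x = 1"
  using normX_less_iff[of x R] subsetD[OF OX_subset, of x R] by (auto simp: bump_def)

lemma bump_zero: "x \<in> X \<Longrightarrow> x \<notin> OX (R + 1) \<Longrightarrow> bump R x = 0"
  using normX_less_iff[of x "R + 1"] by (auto simp: bump_def)

lemma bump_Cc: "bump R \<in> Cc \<Gamma> G"
proof -
  have "continuous_map TX euclideanreal (bump R)"
    unfolding continuous_map_real_iff bump_def by (intro continuous_intros continuous_normX)
  moreover have "compactin TX (pt ` (G \<inter> cball 0 (R + 1)))"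
    by (intro compactin_pt_image compact_G_cball) auto
  moreover have "OX (R + 1) \<subseteq> pt ` (G \<inter> cball 0 (R + 1))" by (auto simp: OX_def)
  then have "\<forall>x\<in>X - pt ` (G \<inter> cball 0 (R + 1)). bump R x = 0" using bump_zero by blast
  ultimately show ?thesis unfolding Cc_def by blast
qed

subsection \<open>A Borel section that is bounded on relatively compact sets\<close>

lemma locally_injective:
  assumes g: "g \<in> G"
  shows "\<exists>d>0. inj_on pt (G \<inter> ball g d)"
proof -
  have "mat 1 isolated_in \<Gamma>" using discrete_\<Gamma> \<Gamma>_one by (auto simp: Isolated.discrete_def)
  then obtain e where e: "e > 0" "\<forall>y\<in>\<Gamma>. dist (mat 1) y < e \<longrightarrow> y = mat 1"
    unfolding isolated_in_dist_Ex_iff by blast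
  let ?f = "\<lambda>p. minv (fst p) ** snd p"
  have "continuous_on (G \<times> G) ?f"
    by (intro mm.continuous_on continuous_on_compose2[OF continuous_on_minv] continuous_intros) auto
  then obtain d where d: "d > 0" "\<And>p. p \<in> G \<times> G \<Longrightarrow> dist p (g, g) < d \<Longrightarrow> dist (?f p) (?f (g, g)) < e"
    using g e(1) unfolding continuous_on_iff by (metis mem_Sigma_iff)
  have "inj_on pt (G \<inter> ball g (d / 2))"
  proof (rule inj_onI)
    fix h k assume h: "h \<in> G \<inter> ball g (d / 2)" and k: "k \<in> G \<inter> ball g (d / 2)" and eq: "pt h = pt k"
    then obtain \<gamma> where \<gamma>: "\<gamma> \<in> \<Gamma>" "h = k ** \<gamma>" using pt_eq_iff by blast
    have "dist (k, h) (g, g) \<le> dist k g + dist h g"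
      using dist_triangle[of "(k, h)" "(g, g)" "(g, h)"] by (simp add: dist_Pair_Pair)
    also have "\<dots> < d" using h k by (simp add: dist_commute)
    finally have "dist (minv k ** h) (mat 1) < e" using d(2)[of "(k, h)"] h k g by simp
    moreover have "minv k ** h = \<gamma>" using \<gamma> k by (simp add: matrix_mul_assoc)
    ultimately have "\<gamma> = mat 1" using e(2) \<gamma> by (simp add: dist_commute)
    then show "h = k" using \<gamma> by simp
  qed
  then show ?thesis using d(1) by (intro exI[of _ "d / 2"]) auto
qed

lemma countable_injective_cover:
  "\<exists>V :: nat \<Rightarrow> (real^'n^'n) set. (\<forall>i. open (V i) \<and> bounded (V i) \<and> inj_on pt (G \<inter> V i)) \<and> G \<subseteq> (\<Union>i. V i)"
proof -
  obtain d where d: "\<And>g. g \<in> G \<Longrightarrow> d g > 0 \<and> inj_on pt (G \<inter> ball g (d g))"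
    using locally_injective by metis
  let ?F = "(\<lambda>g. ball g (d g)) ` G"
  obtain F where F: "F \<subseteq> ?F" "countable F" "\<Union>F = \<Union>?F"
    using Lindelof[of ?F] by auto
  have "F \<noteq> {}" using F(3) d one_G by (metis Union_empty centre_in_ball empty_iff UN_I)
  let ?V = "from_nat_into F"
  have V: "?V i \<in> F" for i using \<open>F \<noteq> {}\<close> by (rule from_nat_into)
  then have "open (?V i) \<and> bounded (?V i) \<and> inj_on pt (G \<inter> ?V i)" for i
    using F(1) d by (metis (no_types, lifting) V bounded_ball image_iff open_ball subsetD)
  moreover have "G \<subseteq> (\<Union>i. ?V i)"
  proof
    fix g assume "g \<in> G"
    then have "g \<in> \<Union>F" unfolding F(3) using d by (intro UN_I[of g]) auto
    then show "g \<in> (\<Union>i. ?V i)" using range_from_nat_into[OF \<open>F \<noteq> {}\<close> F(2)] by auto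
  qed
  ultimately show ?thesis by blast
qed

text \<open>On the images of countably many open sets on which \<open>pt\<close> is injective, the inverse of \<open>pt\<close> is used
  for the first of these images to which a point belongs. Finitely many of them cover \<open>OX R\<close>.\<close>

lemma borel_section:
  "\<exists>s \<in> borel_measurable BX. (\<forall>x\<in>X. s x \<in> G \<and> pt (s x) = x) \<and> (\<forall>R. \<exists>R'. \<forall>x\<in>OX R. norm (s x) \<le> R')"
proof -
  obtain V :: "nat \<Rightarrow> (real^'n^'n) set" where V: "\<And>i. open (V i)" "\<And>i. bounded (V i)" "\<And>i. inj_on pt (G \<inter> V i)"
    and GV: "G \<subseteq> (\<Union>i. V i)"
    using countable_injective_cover by metis
  define idx where "idx x = (LEAST i. x \<in> pt ` (G \<inter> V i))" for x
  define s where "s x = (THE g. g \<in> G \<inter> V (idx x) \<and> pt g = x)" for x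
  have ex: "\<exists>i. x \<in> pt ` (G \<inter> V i)" if "x \<in> X" for x
  proof -
    from that obtain g where g: "g \<in> G" "x = pt g" by (auto simp: hspace_eq)
    with GV obtain i where "g \<in> V i" by blast
    with g show ?thesis by blast
  qed
  have idx: "x \<in> pt ` (G \<inter> V (idx x))" if "x \<in> X" for x
    unfolding idx_def using ex[OF that] by (rule LeastI_ex)
  have s: "s x \<in> G \<inter> V (idx x) \<and> pt (s x) = x" if "x \<in> X" for x
  proof -
    from idx[OF that] obtain g where g: "g \<in> G \<inter> V (idx x)" "x = pt g" by blast
    show ?thesis
      unfolding s_def
    proof (rule theI)
      show "g \<in> G \<inter> V (idx x) \<and> pt g = x" using g by simp
      fix h assume "h \<in> G \<inter> V (idx x) \<and> pt h = x"
      then show "h = g" using g V(3)[of "idx x"] by (auto dest: inj_onD)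
    qed
  qed
  have W [measurable]: "pt ` (G \<inter> V i \<inter> S) \<in> sets BX" if "open S" for i S
  proof -
    have "open (V i \<inter> S)" using V(1) that by blast
    then show ?thesis
      unfolding Int_assoc by (intro openin_sets open_image_pt openin_open_Int)
  qed
  have W' [measurable]: "pt ` (G \<inter> V i) \<in> sets BX" for i
    using W[of UNIV i] by simp
  have "s \<in> borel_measurable BX"
  proof (rule borel_measurableI)
    fix S :: "(real^'n^'n) set" assume S: "open S"
    have "s -` S \<inter> space BX = (\<Union>i. (pt ` (G \<inter> V i \<inter> S)) - (\<Union>j<i. pt ` (G \<inter> V j)))"
    proof (intro equalityI subsetI)
      fix x assume "x \<in> s -` S \<inter> space BX"
      then have x: "x \<in> X" "s x \<in> S" by auto
      have "x \<in> pt ` (G \<inter> V (idx x) \<inter> S)" using s[OF x(1)] x(2) by (metis IntI imageI)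
      moreover have "x \<notin> pt ` (G \<inter> V j)" if "j < idx x" for j
        using not_less_Least[of j "\<lambda>i. x \<in> pt ` (G \<inter> V i)"] that by (simp add: idx_def)
      ultimately show "x \<in> (\<Union>i. (pt ` (G \<inter> V i \<inter> S)) - (\<Union>j<i. pt ` (G \<inter> V j)))" by blast
    next
      fix x assume "x \<in> (\<Union>i. (pt ` (G \<inter> V i \<inter> S)) - (\<Union>j<i. pt ` (G \<inter> V j)))"
      then obtain i g where g: "g \<in> G \<inter> V i" "g \<in> S" "x = pt g" "\<And>j. j < i \<Longrightarrow> x \<notin> pt ` (G \<inter> V j)" by blast
      have xX: "x \<in> X" using g by auto
      have "idx x = i"
        unfolding idx_def by (rule Least_equality) (use g in \<open>auto simp: not_less[symmetric]\<close>)
      then have "s x = g" using s[OF xX] g V(3)[of i] by (auto dest: inj_onD)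
      then show "x \<in> s -` S \<inter> space BX" using g xX by simp
    qed
    also have "\<dots> \<in> sets BX" using W[OF S] W' by (intro sets.countable_UN sets.Diff sets.finite_UN) auto
    finally show "s -` S \<inter> space BX \<in> sets BX" .
  qed
  moreover have "\<exists>R'. \<forall>x\<in>OX R. norm (s x) \<le> R'" for R
  proof -
    have "compact (G \<inter> cball 0 R)" by (rule compact_G_cball)
    moreover have "G \<inter> cball 0 R \<subseteq> (\<Union>i\<in>UNIV. V i)" using GV by blast
    ultimately obtain I where I: "finite I" "G \<inter> cball 0 R \<subseteq> (\<Union>i\<in>I. V i)"
      using V(1) by (metis compactE_image subset_UNIV)
    define m where "m = Max (insert 0 I)"
    have "bounded (\<Union>i\<le>m. V i)" using V(2) by (intro bounded_UN) auto
    then obtain R' where R': "\<forall>v\<in>(\<Union>i\<le>m. V i). norm v \<le> R'" using bounded_iff by blast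
    have "norm (s x) \<le> R'" if "x \<in> OX R" for x
    proof -
      from that obtain g where g: "g \<in> G" "norm g < R" "x = pt g" by (auto simp: OX_def)
      then obtain i where i: "i \<in> I" "g \<in> V i" using I(2) by auto
      have "idx x \<le> i" unfolding idx_def by (rule Least_le) (use g i in auto)
      also have "i \<le> m" unfolding m_def using I(1) i by simp
      finally have "s x \<in> (\<Union>i\<le>m. V i)" using s[of x] g by auto
      then show ?thesis using R' by blast
    qed
    then show ?thesis by blast
  qed
  ultimately show ?thesis using s by blast
qed

subsection \<open>Weak-star compactness\<close>

lemma cutoff_limit:
  fixes F :: "real^'n^'n \<Rightarrow> real"
  assumes fin: "finite_measure M'" and sets: "sets M' = sets borel"
    and F: "continuous_on UNIV F" "\<And>x. \<bar>F x\<bar> \<le> b"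
    and eq: "\<And>i :: nat. i \<ge> i0 \<Longrightarrow> (\<integral>x. F x * max 0 (min 1 (real i + 1 - norm x)) \<partial>M') = L"
  shows "(\<integral>x. F x \<partial>M') = L"
proof -
  interpret finite_measure M' by (rule fin)
  let ?\<chi> = "\<lambda>i x. max 0 (min 1 (real i + 1 - norm x))"
  have meas: "h \<in> borel_measurable M'" if "continuous_on UNIV h" for h :: "real^'n^'n \<Rightarrow> real"
    using borel_measurable_continuous_onI[OF that] measurable_cong_sets[OF sets refl] by blast
  have "(\<lambda>i. \<integral>x. F x * ?\<chi> i x \<partial>M') \<longlonglongrightarrow> (\<integral>x. F x \<partial>M')"
  proof (rule integral_dominated_convergence[where w = "\<lambda>_. b"])
    show "F \<in> borel_measurable M'" "(\<lambda>x. F x * ?\<chi> i x) \<in> borel_measurable M'" for i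
      by (intro meas F(1) continuous_intros)+
    show "AE x in M'. (\<lambda>i. F x * ?\<chi> i x) \<longlonglongrightarrow> F x"
    proof (intro AE_I2 tendsto_eventually)
      fix x
      show "\<forall>\<^sub>F i in sequentially. F x * ?\<chi> i x = F x"
        using eventually_ge_at_top[of "nat \<lceil>norm x\<rceil>"]
      proof eventually_elim
        case (elim i)
        then have "norm x \<le> real i" by linarith
        then show ?case by simp
      qed
    qed
    show "AE x in M'. norm (F x * ?\<chi> i x) \<le> b" for i
    proof (intro AE_I2)
      fix x
      have "\<bar>F x\<bar> * ?\<chi> i x \<le> \<bar>F x\<bar> * 1" by (intro mult_left_mono) auto
      then show "norm (F x * ?\<chi> i x) \<le> b" using F(2)[of x] by (simp add: abs_mult)
    qed
  qed auto
  moreover have "(\<lambda>i. \<integral>x. F x * ?\<chi> i x \<partial>M') \<longlonglongrightarrow> L"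
    by (intro tendsto_eventually eventually_sequentiallyI[of i0] eq)
  ultimately show ?thesis using LIMSEQ_unique by blast
qed

text \<open>The measures are moved to the space of matrices by the section, which is bounded on relatively compact
  sets, so that a vague limit there can be pushed forward again. Away from the closed group \<open>G\<close> the
  test functions are extended continuously.\<close>

theorem weak_star_compactness:
  assumes prob: "\<And>j :: nat. prob_space (\<nu> j)" and sets: "\<And>j. sets (\<nu> j) = sets BX"
  shows "\<exists>r \<eta>. strict_mono r \<and> finite_measure \<eta> \<and> sets \<eta> = sets BX \<and> weak_star_lim \<Gamma> G (\<lambda>j. \<nu> (r j)) \<eta>"
proof -
  from borel_section obtain s where s0: "s \<in> borel_measurable BX" "\<forall>x\<in>X. s x \<in> G \<and> pt (s x) = x"
    "\<forall>R. \<exists>R'. \<forall>x\<in>OX R. norm (s x) \<le> R'"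
    by (elim bexE conjE)
  have s: "s \<in> borel_measurable BX" "\<And>x. x \<in> X \<Longrightarrow> s x \<in> G" "\<And>x. x \<in> X \<Longrightarrow> pt (s x) = x"
    and sR: "\<And>R. \<exists>R'. \<forall>x\<in>OX R. norm (s x) \<le> R'"
    using s0 by simp_all
  have space: "space (\<nu> j) = X" for j using sets_eq_imp_space_eq[OF sets] by simp
  have sm: "s \<in> borel_measurable (\<nu> j)" for j using s(1) measurable_cong_sets[OF sets refl] by blast
  define M where "M j = distr (\<nu> j) borel s" for j
  have "prob_space (M j)" "sets (M j) = sets borel" for j
    unfolding M_def by (auto intro: prob_space.prob_space_distr[OF prob sm])
  from vague_compactness[of M, OF this] obtain r M' where r: "strict_mono r"
    and M': "finite_measure M'" "sets M' = sets borel"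
    and lim0: "\<forall>g :: real^'n^'n \<Rightarrow> real. continuous_on UNIV g \<and> (\<exists>R. \<forall>x. norm x \<ge> R \<longrightarrow> g x = 0) \<longrightarrow>
        (\<lambda>j. integral\<^sup>L (M (r j)) g) \<longlonglongrightarrow> integral\<^sup>L M' g"
    by (elim exE conjE)
  have lim: "\<And>g :: real^'n^'n \<Rightarrow> real. continuous_on UNIV g \<Longrightarrow> (\<exists>R. \<forall>x. norm x \<ge> R \<longrightarrow> g x = 0) \<Longrightarrow>
        (\<lambda>j. integral\<^sup>L (M (r j)) g) \<longlonglongrightarrow> integral\<^sup>L M' g"
    using lim0 by simp
  let ?\<chi> = "\<lambda>i x. max 0 (min 1 (real i + 1 - norm (x :: real^'n^'n)))"
  have lim\<chi>: "(\<lambda>j. \<integral>x. F x * ?\<chi> i x \<partial>M (r j)) \<longlonglongrightarrow> (\<integral>x. F x * ?\<chi> i x \<partial>M')"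
    if "continuous_on UNIV F" for F :: "real^'n^'n \<Rightarrow> real" and i :: nat
    by (rule lim) (auto intro!: continuous_intros that exI[of _ "real i + 1"])
  have intM: "(\<integral>x. h x \<partial>M j) = (\<integral>x. h (s x) \<partial>\<nu> j)" if "continuous_on UNIV h" for h :: "real^'n^'n \<Rightarrow> real" and j
    unfolding M_def by (rule integral_distr[OF sm borel_measurable_continuous_onI[OF that]])
  have Gb: "G \<in> sets borel" using closed_G by (rule borel_closed)
  have measM': "h \<in> borel_measurable M'" if "continuous_on UNIV h" for h :: "real^'n^'n \<Rightarrow> real"
    using borel_measurable_continuous_onI[OF that] measurable_cong_sets[OF M'(2) refl] by blast
  have AE_G: "AE x in M'. x \<in> G"
  proof -
    let ?h = "\<lambda>x. min 1 (infdist x G)"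
    have h: "continuous_on UNIV ?h" by (intro continuous_intros)
    have "(\<integral>x. ?h x * ?\<chi> i x \<partial>M') = 0" for i
    proof -
      have "(\<integral>x. ?h x * ?\<chi> i x \<partial>M (r j)) = 0" for j
      proof -
        have "(\<integral>x. ?h x * ?\<chi> i x \<partial>M (r j)) = (\<integral>x. ?h (s x) * ?\<chi> i (s x) \<partial>\<nu> (r j))"
          by (rule intM) (intro continuous_intros)
        also have "\<dots> = (\<integral>x. 0 \<partial>\<nu> (r j))"
          using s(2) by (intro Bochner_Integration.integral_cong) (auto simp: space)
        finally show ?thesis by simp
      qed
      then show ?thesis using lim\<chi>[OF h, of i] by (simp add: LIMSEQ_const_iff)
    qed
    then have "(\<integral>x. ?h x \<partial>M') = 0"
      by (intro cutoff_limit[OF M' h, of 1 0]) (auto simp: infdist_nonneg)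
    moreover have "integrable M' ?h"
      by (rule finite_measure.integrable_const_bound[OF M'(1), of _ 1]) (auto simp: infdist_nonneg intro: measM' h)
    ultimately have "AE x in M'. ?h x = 0"
      using integral_nonneg_eq_0_iff_AE[of M' ?h] by (simp add: infdist_nonneg)
    then show ?thesis
    proof (rule AE_mp, intro AE_I2 impI)
      fix x assume "?h x = 0"
      then have "infdist x G = 0" by (auto simp: min_def split: if_splits)
      then show "x \<in> G" using in_closed_iff_infdist_zero[OF closed_G] one_G by blast
    qed
  qed
  have ptm: "pt \<in> measurable (restrict_space M' G) BX"
  proof (rule measurable_sigma_sets[OF sets_BX])
    fix U assume "U \<in> {U. openin TX U}"
    then have "openin (top_of_set G) {g \<in> G. pt g \<in> U}" by (simp add: openin_TX)
    then obtain T where T: "open T" "{g \<in> G. pt g \<in> U} = G \<inter> T" unfolding openin_open by blast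
    have "pt -` U \<inter> space (restrict_space M' G) = G \<inter> T"
      using T(2) sets_eq_imp_space_eq[OF M'(2)] by (auto simp: space_restrict_space)
    moreover have "G \<inter> T \<in> sets (restrict_space M' G)"
      using T(1) M'(2) Gb by (auto simp: sets_restrict_space)
    ultimately show "pt -` U \<inter> space (restrict_space M' G) \<in> sets (restrict_space M' G)" by simp
  qed (auto simp: openin_TX space_restrict_space)
  define \<eta> where "\<eta> = distr (restrict_space M' G) BX pt"
  have "finite_measure \<eta>"
    unfolding \<eta>_def using Gb M' by (intro finite_measure.finite_measure_distr[OF _ ptm] finite_measure_restrict_space) auto
  moreover have "(\<lambda>j. integral\<^sup>L (\<nu> (r j)) f) \<longlonglongrightarrow> integral\<^sup>L \<eta> f" if f: "f \<in> Cc \<Gamma> G" for f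
  proof -
    obtain b where b: "b > 0" "\<forall>x\<in>X. \<bar>f x\<bar> \<le> b" using Cc_bounded[OF f] by blast
    obtain R where R: "\<forall>x\<in>X - OX R. f x = 0" using Cc_support[OF f] by blast
    obtain R' where R': "\<forall>x\<in>OX R. norm (s x) \<le> R'" using sR by blast
    obtain F where F: "continuous_on UNIV F" "\<And>x. x \<in> G \<Longrightarrow> F x = f (pt x)" "\<And>x. norm (F x) \<le> b"
    proof (rule Tietze[OF Cc_continuous[OF f], of UNIV b])
      show "closedin (top_of_set UNIV) G" using closed_G by simp
      show "\<And>x. x \<in> G \<Longrightarrow> norm (f (pt x)) \<le> b" using b by simp
    qed (use b in auto)
    have eq: "(\<integral>x. F x * ?\<chi> i x \<partial>M (r j)) = integral\<^sup>L (\<nu> (r j)) f" if i: "real i \<ge> R'" for i j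
    proof -
      have "(\<integral>x. F x * ?\<chi> i x \<partial>M (r j)) = (\<integral>x. F (s x) * ?\<chi> i (s x) \<partial>\<nu> (r j))"
        by (rule intM) (intro continuous_intros F)
      also have "\<dots> = (\<integral>x. f x \<partial>\<nu> (r j))"
      proof (rule Bochner_Integration.integral_cong[OF refl])
        fix x assume "x \<in> space (\<nu> (r j))"
        then have x: "x \<in> X" by (simp add: space)
        show "F (s x) * ?\<chi> i (s x) = f x"
        proof (cases "x \<in> OX R")
          case True
          then have "norm (s x) \<le> R'" using R' by blast
          then show ?thesis using i x s F(2) by simp
        next
          case False
          then show ?thesis using R x s F(2) by simp
        qed
      qed
      finally show ?thesis .
    qed
    define L where "L = (\<integral>x. F x * ?\<chi> (nat \<lceil>R'\<rceil>) x \<partial>M')"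
    have nuL: "(\<lambda>j. integral\<^sup>L (\<nu> (r j)) f) \<longlonglongrightarrow> (\<integral>x. F x * ?\<chi> i x \<partial>M')" if "real i \<ge> R'" for i
      using lim\<chi>[OF F(1), of i] eq[OF that] by simp
    have "real (nat \<lceil>R'\<rceil>) \<ge> R'" by linarith
    from nuL[OF this] have nuL0: "(\<lambda>j. integral\<^sup>L (\<nu> (r j)) f) \<longlonglongrightarrow> L" by (simp add: L_def)
    have "(\<integral>x. F x \<partial>M') = L"
    proof (rule cutoff_limit[OF M' F(1), of b "nat \<lceil>R'\<rceil>"])
      show "\<bar>F x\<bar> \<le> b" for x using F(3) by simp
      fix i assume "nat \<lceil>R'\<rceil> \<le> i"
      then have "real i \<ge> R'" by linarith
      from LIMSEQ_unique[OF nuL[OF this] nuL0] show "(\<integral>x. F x * ?\<chi> i x \<partial>M') = L" .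
    qed
    moreover have "integral\<^sup>L \<eta> f = (\<integral>x. F x \<partial>M')"
    proof -
      have "integral\<^sup>L \<eta> f = (\<integral>x. f (pt x) \<partial>restrict_space M' G)"
        unfolding \<eta>_def by (rule integral_distr[OF ptm Cc_measurable[OF f]])
      also have "\<dots> = (\<integral>x. indicator G x *\<^sub>R f (pt x) \<partial>M')"
        using Gb M'(2) sets_eq_imp_space_eq[OF M'(2)] by (intro integral_restrict_space) auto
      also have "\<dots> = (\<integral>x. indicator G x *\<^sub>R F x \<partial>M')"
        using F(2) by (intro Bochner_Integration.integral_cong) (auto simp: indicator_def)
      also have "\<dots> = (\<integral>x. F x \<partial>M')"
      proof (rule integral_cong_AE)
        have [measurable]: "G \<in> sets M'" using Gb M'(2) by simp
        have [measurable]: "F \<in> borel_measurable M'" by (rule measM'[OF F(1)])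
        show "(\<lambda>x. indicator G x *\<^sub>R F x) \<in> borel_measurable M'" "F \<in> borel_measurable M'" by measurable
        show "AE x in M'. indicator G x *\<^sub>R F x = F x" using AE_G by eventually_elim simp
      qed
      finally show ?thesis .
    qed
    ultimately show ?thesis using nuL0 by simp
  qed
  ultimately show ?thesis
    using r unfolding weak_star_lim_def by (intro exI[of _ r] exI[of _ \<eta>]) (auto simp: \<eta>_def)
qed

end

section \<open>The mean ergodic theorem for bounded functions\<close>

context prob_space
begin

lemma integrable_bounded:
  fixes u :: "'a \<Rightarrow> real"
  assumes "u \<in> borel_measurable M" "\<And>x. x \<in> space M \<Longrightarrow> \<bar>u x\<bar> \<le> b"
  shows "integrable M u"
  by (rule integrable_const_bound[of _ b]) (use assms in auto)

lemma integrable_bounded_square: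
  fixes u :: "'a \<Rightarrow> real"
  assumes [measurable]: "u \<in> borel_measurable M" and u: "\<And>x. x \<in> space M \<Longrightarrow> \<bar>u x\<bar> \<le> b"
  shows "integrable M (\<lambda>x. (u x)\<^sup>2)"
proof (rule integrable_bounded[of _ "b\<^sup>2"])
  fix x assume "x \<in> space M"
  from power_mono[OF u[OF this], of 2] show "\<bar>(u x)\<^sup>2\<bar> \<le> b\<^sup>2" by simp
qed measurable

lemma abs_diff_le_double: "\<bar>x\<bar> \<le> b \<Longrightarrow> \<bar>y\<bar> \<le> b \<Longrightarrow> \<bar>x - y\<bar> \<le> 2 * (b :: real)"
  by linarith

text \<open>A subsequence with summable differences converges almost everywhere; the limit is truncated so that it
  obeys the bound everywhere.\<close>

lemma L1_complete_bounded:
  fixes u :: "nat \<Rightarrow> 'a \<Rightarrow> real"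
  assumes meas [measurable]: "\<And>k. u k \<in> borel_measurable M"
    and bd: "\<And>k x. x \<in> space M \<Longrightarrow> \<bar>u k x\<bar> \<le> b"
    and cauchy: "\<And>e. e > 0 \<Longrightarrow> \<exists>N. \<forall>j\<ge>N. \<forall>k\<ge>N. (\<integral>x. \<bar>u j x - u k x\<bar> \<partial>M) \<le> e"
  shows "\<exists>\<phi>\<in>borel_measurable M. (\<forall>x. \<bar>\<phi> x\<bar> \<le> b) \<and> (\<lambda>k. \<integral>x. \<bar>u k x - \<phi> x\<bar> \<partial>M) \<longlonglongrightarrow> 0"
proof -
  obtain x0 where "x0 \<in> space M" using not_empty by blast
  then have b: "b \<ge> 0" using bd[of x0 0] by linarith
  have int: "integrable M (\<lambda>x. \<bar>u j x - u k x\<bar>)" for j k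
    by (rule integrable_bounded[of _ "2 * b"]) (auto intro!: abs_diff_le_double bd)
  obtain n where n: "\<And>i j k. j \<ge> n i \<Longrightarrow> k \<ge> n i \<Longrightarrow> (\<integral>x. \<bar>u j x - u k x\<bar> \<partial>M) \<le> (1 / 2) ^ i"
    using cauchy[of "(1 / 2) ^ _"] by (metis zero_less_divide_1_iff zero_less_numeral zero_less_power)
  define r where "r i = Max (n ` {..i})" for i
  have rn: "r j \<ge> n i" if "j \<ge> i" for i j
    unfolding r_def using that by (intro Max_ge) auto
  let ?d = "\<lambda>i x. \<bar>u (r (Suc i)) x - u (r i) x\<bar>"
  have "(\<integral>\<^sup>+x. (\<Sum>i. ennreal (?d i x)) \<partial>M) = (\<Sum>i. \<integral>\<^sup>+x. ennreal (?d i x) \<partial>M)"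
    by (intro nn_integral_suminf) measurable
  also have "\<dots> \<le> (\<Sum>i. ennreal ((1 / 2) ^ i))"
  proof (rule suminf_le)
    fix i
    have "(\<integral>\<^sup>+x. ennreal (?d i x) \<partial>M) = ennreal (\<integral>x. ?d i x \<partial>M)"
      by (intro nn_integral_eq_integral int) auto
    also have "\<dots> \<le> ennreal ((1 / 2) ^ i)" by (intro ennreal_leI n rn) auto
    finally show "(\<integral>\<^sup>+x. ennreal (?d i x) \<partial>M) \<le> ennreal ((1 / 2) ^ i)" .
  qed auto
  also have "\<dots> < \<infinity>"
    by (subst suminf_ennreal2) (auto intro: summable_geometric)
  finally have "(\<integral>\<^sup>+x. (\<Sum>i. ennreal (?d i x)) \<partial>M) \<noteq> \<infinity>" by simp
  then have "AE x in M. (\<Sum>i. ennreal (?d i x)) \<noteq> \<infinity>"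
    by (intro nn_integral_PInf_AE) measurable
  then have AE_conv: "AE x in M. convergent (\<lambda>i. u (r i) x)"
  proof (rule AE_mp, intro AE_I2 impI)
    fix x assume "(\<Sum>i. ennreal (?d i x)) \<noteq> \<infinity>"
    then have "summable (\<lambda>i. ?d i x)" by (intro summable_suminf_not_top) auto
    then have "summable (\<lambda>i. u (r (Suc i)) x - u (r i) x)" by (rule summable_rabs_cancel)
    then have "convergent (\<lambda>k. \<Sum>i<k. u (r (Suc i)) x - u (r i) x)" by (simp add: summable_iff_convergent)
    then have "convergent (\<lambda>k. u (r k) x - u (r 0) x)"
      by (simp add: sum_lessThan_telescope[of "\<lambda>i. u (r i) x"])
    then show "convergent (\<lambda>i. u (r i) x)" using convergent_add[OF _ convergent_const[of "u (r 0) x"]] by fastforce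
  qed
  define \<phi> where "\<phi> x = max (- b) (min b (lim (\<lambda>i. u (r i) x)))" for x
  have [measurable]: "\<phi> \<in> borel_measurable M" unfolding \<phi>_def by measurable
  have \<phi>b: "\<bar>\<phi> x\<bar> \<le> b" for x using b by (auto simp: \<phi>_def)
  have int\<phi>: "integrable M (\<lambda>x. \<bar>u k x - \<phi> x\<bar>)" for k
    by (rule integrable_bounded[of _ "2 * b"]) (auto intro!: abs_diff_le_double bd \<phi>b)
  have AE_lim: "AE x in M. (\<lambda>i. \<bar>u (r i) x - \<phi> x\<bar>) \<longlonglongrightarrow> 0"
    using AE_conv
  proof (rule AE_mp, intro AE_I2 impI)
    fix x assume x: "x \<in> space M" and "convergent (\<lambda>i. u (r i) x)"
    then have l: "(\<lambda>i. u (r i) x) \<longlonglongrightarrow> lim (\<lambda>i. u (r i) x)" by (simp add: convergent_LIMSEQ_iff)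
    have "\<bar>lim (\<lambda>i. u (r i) x)\<bar> \<le> b"
      by (rule tendsto_upperbound[OF tendsto_rabs[OF l]]) (use bd[OF x] in auto)
    then have "\<phi> x = lim (\<lambda>i. u (r i) x)" by (auto simp: \<phi>_def)
    then show "(\<lambda>i. \<bar>u (r i) x - \<phi> x\<bar>) \<longlonglongrightarrow> 0" using l by (simp add: tendsto_rabs_zero LIM_zero)
  qed
  have "(\<lambda>i. \<integral>x. \<bar>u (r i) x - \<phi> x\<bar> \<partial>M) \<longlonglongrightarrow> (\<integral>x. 0 \<partial>M)"
  proof (rule integral_dominated_convergence[where w = "\<lambda>_. 2 * b"])
    show "AE x in M. norm \<bar>u (r i) x - \<phi> x\<bar> \<le> 2 * b" for i
      by (intro AE_I2) (simp add: abs_diff_le_double bd \<phi>b)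
  qed (use AE_lim in auto)
  then have sub: "(\<lambda>i. \<integral>x. \<bar>u (r i) x - \<phi> x\<bar> \<partial>M) \<longlonglongrightarrow> 0" by simp
  have "(\<lambda>k. \<integral>x. \<bar>u k x - \<phi> x\<bar> \<partial>M) \<longlonglongrightarrow> 0"
  proof (rule LIMSEQ_I)
    fix e :: real assume e: "e > 0"
    obtain I where I: "\<And>i. i \<ge> I \<Longrightarrow> (\<integral>x. \<bar>u (r i) x - \<phi> x\<bar> \<partial>M) < e / 2"
      using order_tendstoD(2)[OF sub, of "e / 2"] e by (auto simp: eventually_sequentially)
    have "(\<lambda>i. (1 / 2 :: real) ^ i) \<longlonglongrightarrow> 0" by (intro LIMSEQ_realpow_zero) auto
    then obtain J where J: "\<And>i. i \<ge> J \<Longrightarrow> (1 / 2 :: real) ^ i < e / 2"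
      using order_tendstoD(2)[of "\<lambda>i. (1 / 2 :: real) ^ i" 0 sequentially "e / 2"] e by (auto simp: eventually_sequentially)
    define i where "i = max I J"
    have "norm ((\<integral>x. \<bar>u k x - \<phi> x\<bar> \<partial>M) - 0) < e" if k: "k \<ge> n i" for k
    proof -
      have "(\<integral>x. \<bar>u k x - \<phi> x\<bar> \<partial>M) \<le> (\<integral>x. \<bar>u k x - u (r i) x\<bar> + \<bar>u (r i) x - \<phi> x\<bar> \<partial>M)"
        by (intro integral_mono int int\<phi> Bochner_Integration.integrable_add) linarith
      also have "\<dots> = (\<integral>x. \<bar>u k x - u (r i) x\<bar> \<partial>M) + (\<integral>x. \<bar>u (r i) x - \<phi> x\<bar> \<partial>M)"
        by (intro Bochner_Integration.integral_add int int\<phi>)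
      also have "\<dots> < e / 2 + e / 2"
        using n[of i k "r i"] k rn[of i i] I[of i] J[of i] by (intro add_strict_mono) (auto simp: i_def)
      finally show ?thesis by (simp add: integral_nonneg_AE)
    qed
    then show "\<exists>no. \<forall>k\<ge>no. norm ((\<integral>x. \<bar>u k x - \<phi> x\<bar> \<partial>M) - 0) < e" by blast
  qed
  then show ?thesis using \<phi>b by (intro bexI[of _ \<phi>]) auto
qed

end

locale measure_preserving = prob_space M for M :: "'a measure" +
  fixes T :: "'a \<Rightarrow> 'a"
  assumes T [measurable]: "T \<in> measurable M M" and preserving: "distr M M T = M"
begin

definition avg :: "('a \<Rightarrow> real) \<Rightarrow> nat \<Rightarrow> 'a \<Rightarrow> real" where
  "avg f k x = (\<Sum>l<k. f ((T ^^ l) x)) / real k"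

lemma T_pow [measurable]: "T ^^ l \<in> measurable M M"
proof (induction l)
  case (Suc l)
  then show ?case using measurable_comp[OF Suc T] by (simp add: o_def)
qed (simp add: id_def)

lemma T_space: "x \<in> space M \<Longrightarrow> (T ^^ l) x \<in> space M"
  using measurable_space[OF T_pow] .

lemma integral_T:
  fixes u :: "'a \<Rightarrow> real"
  assumes "u \<in> borel_measurable M"
  shows "(\<integral>x. u (T x) \<partial>M) = (\<integral>x. u x \<partial>M)"
  using integral_distr[OF T assms] preserving by simp

lemma integral_T_pow:
  fixes u :: "'a \<Rightarrow> real"
  assumes "u \<in> borel_measurable M"
  shows "(\<integral>x. u ((T ^^ l) x) \<partial>M) = (\<integral>x. u x \<partial>M)"
proof (induction l)
  case (Suc l)
  have "(\<lambda>x. u ((T ^^ l) x)) \<in> borel_measurable M" using assms by measurable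
  from integral_T[OF this] Suc show ?case by (simp add: funpow_swap1)
qed simp

lemma avg_measurable [measurable]:
  assumes [measurable]: "f \<in> borel_measurable M"
  shows "avg f k \<in> borel_measurable M"
  unfolding avg_def[abs_def] by measurable

lemma avg_bounded:
  assumes "\<And>x. x \<in> space M \<Longrightarrow> \<bar>f x\<bar> \<le> b" "x \<in> space M" "b \<ge> 0"
  shows "\<bar>avg f k x\<bar> \<le> b"
proof -
  have "\<bar>\<Sum>l<k. f ((T ^^ l) x)\<bar> \<le> (\<Sum>l<k. b)"
    using assms T_space by (intro sum_abs[THEN order_trans] sum_mono) auto
  then show ?thesis using assms(3) by (cases "k = 0") (auto simp: avg_def field_simps)
qed

text \<open>Riesz' argument: all averages of a nearly norm-minimising element \<open>g\<close> of the convex hull of the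
  orbit of \<open>f\<close> lie in that hull and have almost minimal norm, so that they are close to each other by
  the parallelogram law. The averages of \<open>f\<close> and \<open>g\<close> differ by \<open>O(1/k)\<close>.\<close>

inductive_set orbit_hull :: "('a \<Rightarrow> real) \<Rightarrow> ('a \<Rightarrow> real) set" for f where
  base: "f \<in> orbit_hull f"
| shift: "g \<in> orbit_hull f \<Longrightarrow> (\<lambda>x. g (T x)) \<in> orbit_hull f"
| convex: "g \<in> orbit_hull f \<Longrightarrow> h \<in> orbit_hull f \<Longrightarrow> 0 \<le> u \<Longrightarrow> u \<le> 1 \<Longrightarrow>
    (\<lambda>x. u * g x + (1 - u) * h x) \<in> orbit_hull f"

lemma orbit_hull_measurable:
  assumes "f \<in> borel_measurable M" "g \<in> orbit_hull f"
  shows "g \<in> borel_measurable M"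
  using assms(2)
proof induction
  case (shift g)
  note [measurable] = shift.IH
  show ?case by measurable
next
  case (convex g h u)
  note [measurable] = convex.IH
  show ?case by measurable
qed (rule assms(1))

lemma orbit_hull_bounded:
  assumes f: "\<And>x. x \<in> space M \<Longrightarrow> \<bar>f x\<bar> \<le> b" and g: "g \<in> orbit_hull f" and x: "x \<in> space M"
  shows "\<bar>g x\<bar> \<le> b"
  using g x
proof (induction arbitrary: x)
  case (shift g)
  then show ?case using measurable_space[OF T] by blast
next
  case (convex g h u)
  have "\<bar>u * g x + (1 - u) * h x\<bar> \<le> u * \<bar>g x\<bar> + (1 - u) * \<bar>h x\<bar>"
    using convex.hyps by (intro abs_triangle_ineq[THEN order_trans]) (simp add: abs_mult)
  also have "\<dots> \<le> u * b + (1 - u) * b"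
    using convex by (intro add_mono mult_left_mono) auto
  finally show ?case by (simp add: algebra_simps)
qed (use f in auto)

lemma orbit_hull_pow: "g \<in> orbit_hull f \<Longrightarrow> (\<lambda>x. g ((T ^^ l) x)) \<in> orbit_hull f"
proof (induction l)
  case (Suc l)
  then show ?case using orbit_hull.shift[of "\<lambda>x. g ((T ^^ l) x)" f] by (simp add: funpow_swap1)
qed simp

lemma orbit_hull_avg:
  assumes g: "g \<in> orbit_hull f" and "k > 0"
  shows "avg g k \<in> orbit_hull f"
  using assms(2)
proof (induction k rule: nat_induct_non_zero)
  case 1
  then show ?case using g by (simp add: avg_def[abs_def])
next
  case (Suc k)
  have "(\<lambda>x. (real k / real (Suc k)) * avg g k x + (1 - real k / real (Suc k)) * g ((T ^^ k) x)) \<in> orbit_hull f"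
    using Suc g by (intro orbit_hull.convex orbit_hull_pow) auto
  moreover have "(real k / real (Suc k)) * avg g k x + (1 - real k / real (Suc k)) * g ((T ^^ k) x) = avg g (Suc k) x" for x
  proof -
    have "1 - real k / real (Suc k) = 1 / real (Suc k)" by (simp add: field_simps)
    then have "real k / real (Suc k) * (S / real k) + (1 - real k / real (Suc k)) * t = (S + t) / real (Suc k)" for S t :: real
      using Suc.hyps by (simp add: add_divide_distrib)
    then show ?thesis by (simp add: avg_def)
  qed
  ultimately show ?case by simp
qed

lemma avg_shift_diff:
  assumes g: "\<And>x. x \<in> space M \<Longrightarrow> \<bar>g x\<bar> \<le> b" and x: "x \<in> space M" and k: "k > 0"
  shows "\<bar>avg (\<lambda>x. g (T x)) k x - avg g k x\<bar> \<le> 2 * b / real k"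
proof -
  have "(\<Sum>l<k. g (T ((T ^^ l) x))) - (\<Sum>l<k. g ((T ^^ l) x)) = g ((T ^^ k) x) - g x"
    using sum_lessThan_telescope[of "\<lambda>l. g ((T ^^ l) x)" k] by (simp add: sum_subtractf)
  then have "avg (\<lambda>x. g (T x)) k x - avg g k x = (g ((T ^^ k) x) - g x) / real k"
    by (simp add: avg_def diff_divide_distrib[symmetric])
  moreover have "\<bar>g ((T ^^ k) x) - g x\<bar> \<le> 2 * b" using g[OF x] g[OF T_space[OF x, of k]] by linarith
  ultimately show ?thesis using k by (simp add: abs_divide divide_right_mono)
qed

lemma orbit_hull_avg_close:
  assumes f: "\<And>x. x \<in> space M \<Longrightarrow> \<bar>f x\<bar> \<le> b" and g: "g \<in> orbit_hull f"
  shows "\<exists>K\<ge>0. \<forall>k>0. \<forall>x\<in>space M. \<bar>avg g k x - avg f k x\<bar> \<le> K / real k"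
  using g
proof induction
  case base
  then show ?case by (intro exI[of _ 0]) simp
next
  case (shift g)
  then obtain K where K: "K \<ge> 0" "\<And>k x. k > 0 \<Longrightarrow> x \<in> space M \<Longrightarrow> \<bar>avg g k x - avg f k x\<bar> \<le> K / real k" by blast
  obtain x0 where "x0 \<in> space M" using not_empty by blast
  then have b: "b \<ge> 0" using f[of x0] by linarith
  have "\<bar>avg (\<lambda>x. g (T x)) k x - avg f k x\<bar> \<le> (K + 2 * b) / real k" if "k > 0" "x \<in> space M" for k x
  proof -
    have "\<bar>avg (\<lambda>x. g (T x)) k x - avg g k x\<bar> \<le> 2 * b / real k"
      by (rule avg_shift_diff[OF orbit_hull_bounded[OF f shift.hyps] that(2,1)])
    with K(2)[OF that] show ?thesis by (simp add: add_divide_distrib)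
  qed
  then show ?case using K(1) b by (intro exI[of _ "K + 2 * b"]) auto
next
  case (convex g h u)
  from convex.IH(1) obtain K where K: "K \<ge> 0" "\<And>k x. k > 0 \<Longrightarrow> x \<in> space M \<Longrightarrow> \<bar>avg g k x - avg f k x\<bar> \<le> K / real k"
    by blast
  from convex.IH(2) obtain L where L: "L \<ge> 0" "\<And>k x. k > 0 \<Longrightarrow> x \<in> space M \<Longrightarrow> \<bar>avg h k x - avg f k x\<bar> \<le> L / real k"
    by blast
  have "\<bar>avg (\<lambda>x. u * g x + (1 - u) * h x) k x - avg f k x\<bar> \<le> (K + L) / real k" if k: "k > 0" "x \<in> space M" for k x
  proof -
    have eq: "avg (\<lambda>x. u * g x + (1 - u) * h x) k x = u * avg g k x + (1 - u) * avg h k x"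
      by (simp add: avg_def sum.distrib sum_distrib_left add_divide_distrib)
    have "avg (\<lambda>x. u * g x + (1 - u) * h x) k x - avg f k x
        = u * (avg g k x - avg f k x) + (1 - u) * (avg h k x - avg f k x)"
      unfolding eq by (simp add: algebra_simps)
    also have "\<bar>\<dots>\<bar> \<le> u * \<bar>avg g k x - avg f k x\<bar> + (1 - u) * \<bar>avg h k x - avg f k x\<bar>"
      using convex.hyps by (intro abs_triangle_ineq[THEN order_trans]) (simp add: abs_mult)
    also have "\<dots> \<le> 1 * (K / real k) + 1 * (L / real k)"
      using convex.hyps K(2)[OF k] L(2)[OF k] by (intro add_mono mult_mono) auto
    finally show ?thesis by (simp add: add_divide_distrib)
  qed
  then show ?case using K(1) L(1) by (intro exI[of _ "K + L"]) auto
qed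

lemma integral_avg_square_le:
  assumes [measurable]: "g \<in> borel_measurable M" and g: "\<And>x. x \<in> space M \<Longrightarrow> \<bar>g x\<bar> \<le> b" and k: "k > 0"
  shows "(\<integral>x. (avg g k x)\<^sup>2 \<partial>M) \<le> (\<integral>x. (g x)\<^sup>2 \<partial>M)"
proof -
  have b: "b \<ge> 0" using g not_empty by (metis abs_ge_zero equals0I order_trans)
  have int: "integrable M (\<lambda>x. (g ((T ^^ l) x))\<^sup>2)" for l
    by (rule integrable_bounded_square[of _ b]) (auto intro: g T_space)
  have "(\<integral>x. (avg g k x)\<^sup>2 \<partial>M) \<le> (\<integral>x. (\<Sum>l<k. (g ((T ^^ l) x))\<^sup>2) / real k \<partial>M)"
  proof (rule integral_mono)
    show "integrable M (\<lambda>x. (avg g k x)\<^sup>2)"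
      by (rule integrable_bounded_square[of _ b]) (auto intro: avg_bounded[OF g _ b])
    show "integrable M (\<lambda>x. (\<Sum>l<k. (g ((T ^^ l) x))\<^sup>2) / real k)" using int by auto
    fix x
    have "(\<Sum>l<k. g ((T ^^ l) x))\<^sup>2 \<le> (\<Sum>l<k. (g ((T ^^ l) x))\<^sup>2) * real k"
      using Cauchy_Schwarz_ineq_sum[of "\<lambda>l. g ((T ^^ l) x)" "\<lambda>_. 1" "{..<k}"] by simp
    then show "(avg g k x)\<^sup>2 \<le> (\<Sum>l<k. (g ((T ^^ l) x))\<^sup>2) / real k"
      using k by (simp add: avg_def power_divide field_simps power2_eq_square)
  qed
  also have "\<dots> = (\<Sum>l<k. \<integral>x. (g ((T ^^ l) x))\<^sup>2 \<partial>M) / real k"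
    using int by (simp add: Bochner_Integration.integral_sum)
  also have "\<dots> = (\<Sum>l<k. \<integral>x. (g x)\<^sup>2 \<partial>M) / real k"
    by (subst integral_T_pow) auto
  finally show ?thesis using k by simp
qed

lemma avg_L2_Cauchy:
  assumes [measurable]: "f \<in> borel_measurable M" and f: "\<And>x. x \<in> space M \<Longrightarrow> \<bar>f x\<bar> \<le> b" and e: "e > 0"
  shows "\<exists>N. \<forall>j\<ge>N. \<forall>k\<ge>N. (\<integral>x. (avg f j x - avg f k x)\<^sup>2 \<partial>M) \<le> e"
proof -
  let ?C = "orbit_hull f"
  let ?q = "\<lambda>g. \<integral>x. (g x)\<^sup>2 \<partial>M"
  define d where "d = (INF g\<in>?C. ?q g)"
  have ne: "?C \<noteq> {}" using orbit_hull.base by blast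
  have bdd: "bdd_below (?q ` ?C)" by (rule bdd_belowI[of _ 0]) auto
  define \<delta> where "\<delta> = e / 16"
  obtain g where g: "g \<in> ?C" "?q g < d + \<delta>"
    using cInf_lessD[of "?q ` ?C" "d + \<delta>"] ne e by (auto simp: d_def \<delta>_def)
  have dle: "d \<le> ?q h" if "h \<in> ?C" for h unfolding d_def using bdd that by (rule cINF_lower)
  obtain K where K: "K \<ge> 0" "\<And>k x. k > 0 \<Longrightarrow> x \<in> space M \<Longrightarrow> \<bar>avg g k x - avg f k x\<bar> \<le> K / real k"
    using orbit_hull_avg_close[OF f g(1)] by blast
  have gm [measurable]: "g \<in> borel_measurable M" using orbit_hull_measurable g(1) assms(1) by blast
  have gb: "\<And>x. x \<in> space M \<Longrightarrow> \<bar>g x\<bar> \<le> b" using orbit_hull_bounded[OF f g(1)] by blast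
  have b: "b \<ge> 0" using f not_empty by (metis abs_ge_zero equals0I order_trans)
  have close: "(\<integral>x. (avg g j x - avg g k x)\<^sup>2 \<partial>M) \<le> e / 4" if jk: "j > 0" "k > 0" for j k
  proof -
    let ?u = "avg g j" and ?v = "avg g k"
    let ?w = "\<lambda>x. (1 / 2) * ?u x + (1 - 1 / 2) * ?v x"
    have w: "?w \<in> ?C" using jk g by (intro orbit_hull.convex orbit_hull_avg) auto
    have iu: "integrable M (\<lambda>x. (?u x)\<^sup>2)" by (intro integrable_bounded_square[of _ b] avg_measurable gm avg_bounded[OF gb _ b])
    have iv: "integrable M (\<lambda>x. (?v x)\<^sup>2)" by (intro integrable_bounded_square[of _ b] avg_measurable gm avg_bounded[OF gb _ b])
    have iw: "integrable M (\<lambda>x. (?w x)\<^sup>2)"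
      using orbit_hull_measurable[OF assms(1) w] orbit_hull_bounded[OF f w] by (rule integrable_bounded_square)
    have "(\<integral>x. (?u x - ?v x)\<^sup>2 \<partial>M) = (\<integral>x. 2 * (?u x)\<^sup>2 + 2 * (?v x)\<^sup>2 - 4 * (?w x)\<^sup>2 \<partial>M)"
      by (intro Bochner_Integration.integral_cong) (auto simp: power2_eq_square algebra_simps)
    also have "\<dots> = 2 * ?q ?u + 2 * ?q ?v - 4 * ?q ?w"
      using iu iv iw by (simp add: Bochner_Integration.integral_add Bochner_Integration.integral_diff)
    also have "\<dots> \<le> 4 * \<delta>"
    proof -
      have arith: "2 * A + 2 * B - 4 * C \<le> 4 * \<delta>"
        if "A \<le> D" "B \<le> D" "d \<le> C" "D \<le> d + \<delta>" for A B C D :: real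
      proof -
        have "A \<le> d + \<delta>" "B \<le> d + \<delta>" using that by auto
        then have "2 * A + 2 * B \<le> 2 * (d + \<delta>) + 2 * (d + \<delta>)" by (intro add_mono mult_left_mono) auto
        moreover have "4 * d \<le> 4 * C" using that by simp
        ultimately show ?thesis by (simp add: algebra_simps)
      qed
      have "?q ?u \<le> ?q g" by (rule integral_avg_square_le[OF gm _ jk(1)]) (rule gb)
      moreover have "?q ?v \<le> ?q g" by (rule integral_avg_square_le[OF gm _ jk(2)]) (rule gb)
      ultimately show ?thesis using dle[OF w] less_imp_le[OF g(2)] by (rule arith)
    qed
    finally show ?thesis by (simp add: \<delta>_def)
  qed
  define N where "N = Suc (nat \<lceil>4 * K / sqrt e\<rceil>)"
  have N: "N > 0" "real N \<ge> 4 * K / sqrt e" unfolding N_def by (simp, linarith)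
  have "(\<integral>x. (avg f j x - avg f k x)\<^sup>2 \<partial>M) \<le> e" if jk: "j \<ge> N" "k \<ge> N" for j k
  proof -
    have pos: "j > 0" "k > 0" using jk N by auto
    have Ks: "K / real i \<le> sqrt e / 4" if "i \<ge> N" for i
    proof -
      have "4 * K / sqrt e \<le> real i" using N(2) that by linarith
      then have "4 * K \<le> real i * sqrt e" using e by (simp add: field_simps)
      then show ?thesis using N(1) that by (simp add: field_simps)
    qed
    have pt: "(avg f j x - avg f k x)\<^sup>2 \<le> 2 * (avg g j x - avg g k x)\<^sup>2 + e / 2" if x: "x \<in> space M" for x
    proof -
      let ?s = "avg f j x - avg f k x" and ?t = "avg g j x - avg g k x"
      have "\<bar>?s - ?t\<bar> \<le> \<bar>avg g j x - avg f j x\<bar> + \<bar>avg g k x - avg f k x\<bar>" by linarith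
      also have "\<dots> \<le> sqrt e / 4 + sqrt e / 4"
        using K(2)[OF pos(1) x] K(2)[OF pos(2) x] Ks[OF jk(1)] Ks[OF jk(2)] by linarith
      finally have "\<bar>?s - ?t\<bar> \<le> sqrt e / 2" by simp
      then have "(?s - ?t)\<^sup>2 \<le> (sqrt e / 2)\<^sup>2" using e by (simp add: abs_le_square_iff[symmetric])
      also have "\<dots> = e / 4" using e by (simp add: power_divide)
      finally have "(?s - ?t)\<^sup>2 \<le> e / 4" .
      moreover have "?s\<^sup>2 \<le> 2 * ?t\<^sup>2 + 2 * (?s - ?t)\<^sup>2"
        using zero_le_power2[of "2 * ?t - ?s"] by (simp add: power2_eq_square algebra_simps)
      ultimately show ?thesis by linarith
    qed
    have i1: "integrable M (\<lambda>x. (avg f j x - avg f k x)\<^sup>2)"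
      by (rule integrable_bounded_square[of _ "2 * b"]) (auto intro!: abs_diff_le_double avg_bounded[OF f _ b])
    have i2: "integrable M (\<lambda>x. (avg g j x - avg g k x)\<^sup>2)"
      by (rule integrable_bounded_square[of _ "2 * b"]) (auto intro!: abs_diff_le_double avg_bounded[OF gb _ b])
    have "(\<integral>x. (avg f j x - avg f k x)\<^sup>2 \<partial>M) \<le> (\<integral>x. 2 * (avg g j x - avg g k x)\<^sup>2 + e / 2 \<partial>M)"
      using i1 i2 pt by (intro integral_mono) auto
    also have "\<dots> = 2 * (\<integral>x. (avg g j x - avg g k x)\<^sup>2 \<partial>M) + e / 2"
      using i2 by (simp add: Bochner_Integration.integral_add prob_space)
    also have "\<dots> \<le> e" using close[OF pos] by simp
    finally show ?thesis .
  qed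
  then show ?thesis by blast
qed

theorem mean_ergodic:
  assumes [measurable]: "f \<in> borel_measurable M" and f: "\<And>x. x \<in> space M \<Longrightarrow> \<bar>f x\<bar> \<le> b"
  shows "\<exists>\<phi>\<in>borel_measurable M. (\<forall>x. \<bar>\<phi> x\<bar> \<le> b) \<and> (\<lambda>k. \<integral>x. \<bar>avg f k x - \<phi> x\<bar> \<partial>M) \<longlonglongrightarrow> 0"
proof (rule L1_complete_bounded)
  have b: "b \<ge> 0" using f not_empty by (metis abs_ge_zero equals0I order_trans)
  show "\<bar>avg f k x\<bar> \<le> b" if "x \<in> space M" for k x using avg_bounded[OF f that b] by simp
  fix e :: real assume e: "e > 0"
  obtain N where N: "\<And>j k. j \<ge> N \<Longrightarrow> k \<ge> N \<Longrightarrow> (\<integral>x. (avg f j x - avg f k x)\<^sup>2 \<partial>M) \<le> e\<^sup>2"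
    using avg_L2_Cauchy[OF assms(1) f, of "e\<^sup>2"] e by auto
  have "(\<integral>x. \<bar>avg f j x - avg f k x\<bar> \<partial>M) \<le> e" if jk: "j \<ge> N" "k \<ge> N" for j k
  proof -
    have bd: "\<bar>avg f j x - avg f k x\<bar> \<le> 2 * b" if "x \<in> space M" for x
      by (intro abs_diff_le_double avg_bounded[OF f that b])
    have i1: "integrable M (\<lambda>x. \<bar>avg f j x - avg f k x\<bar>)"
      by (rule integrable_bounded[of _ "2 * b"]) (use bd in auto)
    have i2: "integrable M (\<lambda>x. (avg f j x - avg f k x)\<^sup>2)"
      by (rule integrable_bounded_square[of _ "2 * b"]) (use bd in auto)
    have "(\<integral>x. \<bar>avg f j x - avg f k x\<bar> \<partial>M) \<le> (\<integral>x. (avg f j x - avg f k x)\<^sup>2 / (2 * e) + e / 2 \<partial>M)"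
    proof (intro integral_mono i1)
      show "integrable M (\<lambda>x. (avg f j x - avg f k x)\<^sup>2 / (2 * e) + e / 2)" using i2 by auto
      fix x
      let ?t = "avg f j x - avg f k x"
      have "0 \<le> (\<bar>?t\<bar> - e)\<^sup>2" by simp
      then have "2 * e * \<bar>?t\<bar> \<le> ?t\<^sup>2 + e\<^sup>2" by (simp add: power2_diff algebra_simps)
      then show "\<bar>?t\<bar> \<le> ?t\<^sup>2 / (2 * e) + e / 2" using e by (simp add: field_simps power2_eq_square)
    qed
    also have "\<dots> = (\<integral>x. (avg f j x - avg f k x)\<^sup>2 \<partial>M) / (2 * e) + e / 2"
      using i2 by (simp add: Bochner_Integration.integral_add prob_space)
    also have "\<dots> \<le> e\<^sup>2 / (2 * e) + e / 2"
      using N[OF jk] e by (intro add_right_mono divide_right_mono) auto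
    also have "\<dots> = e" using e by (simp add: power2_eq_square)
    finally show ?thesis .
  qed
  then show "\<exists>N. \<forall>j\<ge>N. \<forall>k\<ge>N. (\<integral>x. \<bar>avg f j x - avg f k x\<bar> \<partial>M) \<le> e" by blast
qed measurable

end

section \<open>Measures on the homogeneous space\<close>

lemma Lindelof_openin_indexed:
  fixes f :: "'i \<Rightarrow> 'a::euclidean_space set"
  assumes "\<And>i. i \<in> I \<Longrightarrow> openin (top_of_set S) (f i)"
  shows "\<exists>C\<subseteq>I. countable C \<and> (\<Union>i\<in>C. f i) = (\<Union>i\<in>I. f i)"
proof -
  have "openin (top_of_set S) V" if "V \<in> f ` I" for V using that assms by blast
  then obtain \<F> where \<F>: "\<F> \<subseteq> f ` I" "countable \<F>" "\<Union>\<F> = \<Union>(f ` I)"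
    by (rule Lindelof_openin)
  have "\<exists>C. countable C \<and> C \<subseteq> I \<and> \<F> = f ` C"
    using \<F> by (intro countable_subset_image[THEN iffD1] conjI)
  then show ?thesis using \<F>(3) by blast
qed

context homogeneous_space
begin

lemma borel_probD:
  assumes "borel_prob \<Gamma> G \<mu>"
  shows "prob_space \<mu>" "sets \<mu> = sets BX" "space \<mu> = X"
  using assms sets_eq_imp_space_eq[of \<mu> BX] by (auto simp: borel_prob_def intro: prob_spaceI)

lemma measurable_act_pow':
  assumes "borel_prob \<Gamma> G \<mu>" "h \<in> G"
  shows "act h ^^ l \<in> measurable \<mu> BX"
  using measurable_act_pow[OF assms(2)] measurable_cong_sets[OF borel_probD(2)[OF assms(1)] refl] by blast

lemma act_pow_in: "h \<in> G \<Longrightarrow> x \<in> X \<Longrightarrow> (act h ^^ l) x \<in> X"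
  by (induction l) auto

lemma orbit_average_eq:
  assumes \<mu>: "borel_prob \<Gamma> G \<mu>" and h: "h \<in> G" and k: "k > 0"
  shows "orbit_average \<Gamma> G h \<mu> k = measure_pmf (pmf_of_set {..<k}) \<bind> (\<lambda>l. distr \<mu> BX (act h ^^ l))"
    (is "_ = ?\<rho>")
proof -
  interpret \<mu>: prob_space \<mu> by (rule borel_probD[OF \<mu>])
  have kernel: "(\<lambda>l. distr \<mu> BX (act h ^^ l)) \<in> measurable (measure_pmf (pmf_of_set {..<k})) (subprob_algebra BX)"
    by (auto simp: space_subprob_algebra intro!: prob_space_imp_subprob_space \<mu>.prob_space_distr measurable_act_pow'[OF \<mu> h])
  have sets: "sets ?\<rho> = sets BX" by simp
  have em: "emeasure ?\<rho> A = (\<Sum>l<k. emeasure (distr \<mu> BX (act h ^^ l)) A) / of_nat k" if "A \<in> sets BX" for A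
  proof -
    have ne: "{..<k} \<noteq> {}" using k by auto
    have "emeasure ?\<rho> A = (\<integral>\<^sup>+l. emeasure (distr \<mu> BX (act h ^^ l)) A \<partial>measure_pmf (pmf_of_set {..<k}))"
      by (rule emeasure_bind[OF _ kernel that]) simp
    also have "\<dots> = (\<Sum>l<k. emeasure (distr \<mu> BX (act h ^^ l)) A) / of_nat k"
      using nn_integral_pmf_of_set[OF ne finite_lessThan] by simp
    finally show ?thesis .
  qed
  have "orbit_average \<Gamma> G h \<mu> k = measure_of (space ?\<rho>) (sets ?\<rho>) (emeasure ?\<rho>)"
    unfolding orbit_average_def sets sets_eq_imp_space_eq[OF sets] space_BX
    using sets.sets_into_space[of _ BX]
    by (intro measure_of_eq) (auto simp: em sets.sigma_sets_eq[of BX, simplified])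
  then show ?thesis unfolding measure_of_of_measure .
qed

lemma orbit_average_props:
  assumes \<mu>: "borel_prob \<Gamma> G \<mu>" and h: "h \<in> G" and k: "k > 0"
  shows "sets (orbit_average \<Gamma> G h \<mu> k) = sets BX" "prob_space (orbit_average \<Gamma> G h \<mu> k)"
    "f \<in> borel_measurable BX \<Longrightarrow> (\<integral>\<^sup>+x. f x \<partial>orbit_average \<Gamma> G h \<mu> k) = (\<Sum>l<k. \<integral>\<^sup>+x. f ((act h ^^ l) x) \<partial>\<mu>) / of_nat k"
proof -
  interpret \<mu>: prob_space \<mu> by (rule borel_probD[OF \<mu>])
  let ?P = "measure_pmf (pmf_of_set {..<k})"
  have ne: "{..<k} \<noteq> {}" using k by auto
  have kernel: "(\<lambda>l. distr \<mu> BX (act h ^^ l)) \<in> measurable ?P (subprob_algebra BX)"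
    by (auto simp: space_subprob_algebra intro!: prob_space_imp_subprob_space \<mu>.prob_space_distr measurable_act_pow'[OF \<mu> h])
  show sets: "sets (orbit_average \<Gamma> G h \<mu> k) = sets BX"
    unfolding orbit_average_eq[OF assms] by simp
  show nn: "(\<integral>\<^sup>+x. f x \<partial>orbit_average \<Gamma> G h \<mu> k) = (\<Sum>l<k. \<integral>\<^sup>+x. f ((act h ^^ l) x) \<partial>\<mu>) / of_nat k"
    if f: "f \<in> borel_measurable BX" for f
  proof -
    have "(\<integral>\<^sup>+x. f x \<partial>orbit_average \<Gamma> G h \<mu> k) = (\<integral>\<^sup>+l. \<integral>\<^sup>+y. f y \<partial>distr \<mu> BX (act h ^^ l) \<partial>?P)"
      unfolding orbit_average_eq[OF assms] by (rule nn_integral_bind[OF f kernel])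
    also have "\<dots> = (\<Sum>l<k. \<integral>\<^sup>+y. f y \<partial>distr \<mu> BX (act h ^^ l)) / of_nat k"
      using nn_integral_pmf_of_set[OF ne finite_lessThan] by simp
    also have "\<dots> = (\<Sum>l<k. \<integral>\<^sup>+x. f ((act h ^^ l) x) \<partial>\<mu>) / of_nat k"
    proof -
      have "f \<in> borel_measurable (distr \<mu> BX (act h ^^ l))" for l using f by simp
      from nn_integral_distr[OF measurable_act_pow'[OF \<mu> h] this] show ?thesis by simp
    qed
    finally show ?thesis .
  qed
  have "emeasure (orbit_average \<Gamma> G h \<mu> k) (space (orbit_average \<Gamma> G h \<mu> k)) = (\<integral>\<^sup>+x. 1 \<partial>orbit_average \<Gamma> G h \<mu> k)"
    by simp
  also have "\<dots> = (\<Sum>l<k. \<integral>\<^sup>+x. 1 \<partial>\<mu>) / of_nat k" by (rule nn) simp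
  also have "\<dots> = 1" using k by (simp add: \<mu>.emeasure_space_1 ennreal_divide_self of_nat_less_top)
  finally show "prob_space (orbit_average \<Gamma> G h \<mu> k)" by (rule prob_spaceI)
qed

lemma orbit_average_integral:
  fixes f :: "(real^'n^'n) set \<Rightarrow> real"
  assumes \<mu>: "borel_prob \<Gamma> G \<mu>" and h: "h \<in> G" and k: "k > 0"
    and f: "f \<in> borel_measurable BX" and bd: "\<And>x. x \<in> X \<Longrightarrow> \<bar>f x\<bar> \<le> b"
  shows "(\<integral>x. f x \<partial>orbit_average \<Gamma> G h \<mu> k) = (\<Sum>l<k. \<integral>x. f ((act h ^^ l) x) \<partial>\<mu>) / real k"
proof -
  let ?\<rho> = "orbit_average \<Gamma> G h \<mu> k"
  interpret \<mu>: prob_space \<mu> by (rule borel_probD[OF \<mu>])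
  interpret \<rho>: prob_space ?\<rho> by (rule orbit_average_props[OF \<mu> h k])
  have sp: "space ?\<rho> = X" "space \<mu> = X"
    using sets_eq_imp_space_eq[OF orbit_average_props(1)[OF \<mu> h k]] borel_probD[OF \<mu>] by auto
  have fm: "g \<in> borel_measurable ?\<rho>" if "g \<in> borel_measurable BX" for g :: "_ \<Rightarrow> real"
    using that measurable_cong_sets[OF orbit_average_props(1)[OF \<mu> h k] refl] by blast
  have fl: "(\<lambda>x. g ((act h ^^ l) x)) \<in> borel_measurable \<mu>" if "g \<in> borel_measurable BX" for g :: "_ \<Rightarrow> real" and l
    by (rule measurable_compose[OF measurable_act_pow'[OF \<mu> h] that])
  let ?g = "\<lambda>x. f x + b"
  have gm: "?g \<in> borel_measurable BX" using f by simp
  have g0: "0 \<le> ?g x" "?g x \<le> 2 * b" if "x \<in> X" for x using bd[OF that] by auto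
  have ig: "integrable ?\<rho> ?g"
    by (rule \<rho>.integrable_bounded[of _ "2 * b"]) (use g0 sp fm[OF gm] in auto)
  have il: "integrable \<mu> (\<lambda>x. ?g ((act h ^^ l) x))" for l
    by (rule \<mu>.integrable_bounded[of _ "2 * b"]) (use g0 sp fl[OF gm] act_pow_in[OF h] in auto)
  have if': "integrable ?\<rho> f" "\<And>l. integrable \<mu> (\<lambda>x. f ((act h ^^ l) x))"
    using Bochner_Integration.integrable_diff[OF ig, of "\<lambda>_. b"] Bochner_Integration.integrable_diff[OF il, of "\<lambda>_. b"] by auto
  have pos: "0 \<le> (\<integral>x. ?g ((act h ^^ l) x) \<partial>\<mu>)" for l
    by (intro integral_nonneg_AE AE_I2) (use g0 sp act_pow_in[OF h] in auto)
  have "ennreal (\<integral>x. ?g x \<partial>?\<rho>) = (\<integral>\<^sup>+x. ennreal (?g x) \<partial>?\<rho>)"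
    by (intro nn_integral_eq_integral[symmetric] ig AE_I2) (use g0 sp in auto)
  also have "\<dots> = (\<Sum>l<k. \<integral>\<^sup>+x. ennreal (?g ((act h ^^ l) x)) \<partial>\<mu>) / of_nat k"
    by (rule orbit_average_props[OF \<mu> h k]) (use gm in measurable)
  also have "\<dots> = (\<Sum>l<k. ennreal (\<integral>x. ?g ((act h ^^ l) x) \<partial>\<mu>)) / of_nat k"
    by (intro arg_cong[where f = "\<lambda>y. y / of_nat k"] sum.cong nn_integral_eq_integral il AE_I2 refl) (use g0 sp act_pow_in[OF h] in auto)
  also have "\<dots> = ennreal ((\<Sum>l<k. \<integral>x. ?g ((act h ^^ l) x) \<partial>\<mu>) / real k)"
    using k pos by (simp add: sum_ennreal divide_ennreal sum_nonneg ennreal_of_nat_eq_real_of_nat)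
  finally have "(\<integral>x. ?g x \<partial>?\<rho>) = (\<Sum>l<k. \<integral>x. ?g ((act h ^^ l) x) \<partial>\<mu>) / real k"
    by (subst (asm) ennreal_inj) (auto intro!: integral_nonneg_AE AE_I2 divide_nonneg_nonneg sum_nonneg pos simp: g0 sp)
  also have "(\<integral>x. ?g x \<partial>?\<rho>) = (\<integral>x. f x \<partial>?\<rho>) + b" using if' by (simp add: \<rho>.prob_space)
  also have "(\<Sum>l<k. \<integral>x. ?g ((act h ^^ l) x) \<partial>\<mu>) / real k = (\<Sum>l<k. \<integral>x. f ((act h ^^ l) x) \<partial>\<mu>) / real k + b"
    using if' k by (simp add: \<mu>.prob_space sum.distrib add_divide_distrib)
  finally show ?thesis by simp
qed

text \<open>If mass escaped, averages along some sequence of times would put mass more than \<open>\<epsilon>\<close> outside of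
  ever larger relatively compact sets; a weak-star limit along a subsequence would have mass at most
  \<open>1 - \<epsilon>\<close>.\<close>

lemma tight_averages:
  assumes \<mu>: "borel_prob \<Gamma> G \<mu>" and h: "h \<in> G" and no_loss: "no_mass_loss_on_average \<Gamma> G h \<mu>"
    and \<epsilon>: "\<epsilon> > 0"
  shows "\<exists>R k0. \<forall>k\<ge>k0. k > 0 \<longrightarrow> measure (orbit_average \<Gamma> G h \<mu> k) (X - OX R) \<le> \<epsilon>"
proof (rule ccontr)
  let ?\<rho> = "orbit_average \<Gamma> G h \<mu>"
  assume "\<not> ?thesis"
  then have neg: "\<exists>k\<ge>k0. k > 0 \<and> measure (?\<rho> k) (X - OX R) > \<epsilon>" for R k0
    by (meson not_le)
  have "\<exists>s. \<forall>i. (s i > 0 \<and> measure (?\<rho> (s i)) (X - OX (real i)) > \<epsilon>) \<and> s i < (s (Suc i) :: nat)"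
  proof (rule dependent_nat_choice)
    show "\<exists>k. k > 0 \<and> measure (?\<rho> k) (X - OX (real 0)) > \<epsilon>" using neg[of 0] by blast
    fix k i
    show "\<exists>y. (y > 0 \<and> measure (?\<rho> y) (X - OX (real (Suc i))) > \<epsilon>) \<and> k < y"
      using neg[of "Suc k" "real (Suc i)"] by (metis Suc_le_lessD)
  qed
  then obtain s :: "nat \<Rightarrow> nat" where s: "\<And>i. s i > 0" "\<And>i. measure (?\<rho> (s i)) (X - OX (real i)) > \<epsilon>" "strict_mono s"
    by (auto simp: strict_mono_Suc_iff)
  have P: "prob_space (?\<rho> (s i))" "sets (?\<rho> (s i)) = sets BX" "space (?\<rho> (s i)) = X" for i
    using orbit_average_props[OF \<mu> h s(1)] sets_eq_imp_space_eq[of "?\<rho> (s i)" BX] by auto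
  obtain r \<eta> where r: "strict_mono r" and \<eta>: "finite_measure \<eta>" "sets \<eta> = sets BX"
    and lim: "weak_star_lim \<Gamma> G (\<lambda>j. ?\<rho> (s (r j))) \<eta>"
    using weak_star_compactness[of "\<lambda>i. ?\<rho> (s i)", OF P(1,2)] by blast
  interpret \<eta>: finite_measure \<eta> by (rule \<eta>)
  have sp: "space \<eta> = X" using sets_eq_imp_space_eq[OF \<eta>(2)] by simp
  have "emeasure \<eta> X = 1"
    using no_loss \<eta> lim strict_mono_o[OF s(3) r] unfolding no_mass_loss_on_average_def
    by (auto simp: o_def)
  then have X1: "measure \<eta> X = 1" by (simp add: measure_def)
  have "(\<lambda>i. measure \<eta> (OX (real i))) \<longlonglongrightarrow> measure \<eta> (\<Union>i. OX (real i))"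
    by (intro \<eta>.finite_Lim_measure_incseq) (auto simp: \<eta>(2) incseq_def intro!: OX_mono)
  then have "(\<lambda>i. measure \<eta> (OX (real i))) \<longlonglongrightarrow> 1" using X1 X_eq_Union_OX by simp
  then obtain i where i: "measure \<eta> (OX (real i)) > 1 - \<epsilon> / 2"
    using order_tendstoD(1)[of _ 1 sequentially "1 - \<epsilon> / 2"] \<epsilon> eventually_happens by fastforce
  let ?f = "bump (real i)"
  have fm: "?f \<in> borel_measurable BX" by (rule Cc_measurable[OF bump_Cc])
  have "measure \<eta> (OX (real i)) = (\<integral>x. indicator (OX (real i)) x \<partial>\<eta>)"
    using OX_subset[of "real i"] by (simp add: sp Int_absorb2)
  also have "\<dots> \<le> (\<integral>x. ?f x \<partial>\<eta>)"
  proof (rule integral_mono)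
    show "integrable \<eta> (indicat_real (OX (real i)))" by (simp add: \<eta>(2) less_top[symmetric])
    show "integrable \<eta> ?f"
      using fm measurable_cong_sets[OF \<eta>(2) refl] bump_range
      by (intro \<eta>.integrable_const_bound[of _ 1]) auto
    show "indicat_real (OX (real i)) x \<le> ?f x" for x
      using bump_one[of x "real i"] bump_range[of "real i" x] by (auto simp: indicator_def)
  qed
  finally have big: "(\<integral>x. ?f x \<partial>\<eta>) > 1 - \<epsilon> / 2" using i by linarith
  have "(\<integral>x. ?f x \<partial>\<eta>) \<le> 1 - \<epsilon>"
  proof (rule tendsto_upperbound)
    show "(\<lambda>j. \<integral>x. ?f x \<partial>?\<rho> (s (r j))) \<longlonglongrightarrow> (\<integral>x. ?f x \<partial>\<eta>)"
      using lim bump_Cc by (auto simp: weak_star_lim_def)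
    show "\<forall>\<^sub>F j in sequentially. (\<integral>x. ?f x \<partial>?\<rho> (s (r j))) \<le> 1 - \<epsilon>"
      using eventually_ge_at_top[of "i + 1"]
    proof eventually_elim
      case (elim j)
      interpret \<rho>: prob_space "?\<rho> (s (r j))" by (rule P)
      have rj: "real (i + 1) \<le> real (r j)" using elim seq_suble[OF r, of j] by linarith
      have set: "OX (real (r j)) \<in> sets (?\<rho> (s (r j)))" using P(2) by simp
      have "(\<integral>x. ?f x \<partial>?\<rho> (s (r j))) \<le> (\<integral>x. indicator (OX (real (r j))) x \<partial>?\<rho> (s (r j)))"
      proof (rule integral_mono)
        show "integrable (?\<rho> (s (r j))) (indicat_real (OX (real (r j))))" using set by (simp add: less_top[symmetric])
        show "integrable (?\<rho> (s (r j))) ?f"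
          using fm measurable_cong_sets[OF P(2) refl] bump_range by (intro \<rho>.integrable_const_bound[of _ 1]) auto
        fix x assume "x \<in> space (?\<rho> (s (r j)))"
        then have x: "x \<in> X" using P(3) by simp
        have "?f x = 0" if "x \<notin> OX (real (r j))"
        proof -
          have "OX (real i + 1) \<subseteq> OX (real (r j))" using rj by (intro OX_mono) simp
          then show ?thesis using that bump_zero[OF x, of "real i"] by blast
        qed
        then show "?f x \<le> indicat_real (OX (real (r j))) x" using bump_range[of "real i" x] by (auto simp: indicator_def)
      qed
      also have "\<dots> = measure (?\<rho> (s (r j))) (OX (real (r j)))"
        using OX_subset P(3) by (simp add: Int_absorb2)
      also have "\<dots> = 1 - measure (?\<rho> (s (r j))) (X - OX (real (r j)))"
        using \<rho>.prob_compl[OF set] P(3) by simp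
      also have "\<dots> \<le> 1 - \<epsilon>" using s(2)[of "r j"] by simp
      finally show ?case .
    qed
  qed simp
  with big \<epsilon> show False by simp
qed

text \<open>By the Lindelof property the open null sets have a union of measure \<open>0\<close>.\<close>

lemma AE_msupport:
  assumes \<mu>: "borel_prob \<Gamma> G \<mu>"
  shows "AE x in \<mu>. x \<in> msupport \<Gamma> G \<mu>"
proof -
  interpret \<mu>: prob_space \<mu> by (rule borel_probD[OF \<mu>])
  have sets: "sets \<mu> = sets BX" and sp: "space \<mu> = X" using borel_probD[OF \<mu>] by auto
  let ?N = "{U. openin TX U \<and> emeasure \<mu> U = 0}"
  let ?pre = "\<lambda>U. {g \<in> G. pt g \<in> U}"
  have "\<exists>\<N>\<subseteq>?N. countable \<N> \<and> (\<Union>U\<in>\<N>. ?pre U) = (\<Union>U\<in>?N. ?pre U)"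
    by (rule Lindelof_openin_indexed[where S = G]) (simp add: openin_TX)
  then obtain \<N>
    where \<N>: "\<N> \<subseteq> ?N" "countable \<N>" "(\<Union>U\<in>\<N>. ?pre U) = (\<Union>U\<in>?N. ?pre U)"
    by (elim exE conjE)
  have null: "\<Union>\<N> \<in> null_sets \<mu>"
  proof -
    have "U \<in> null_sets \<mu>" if "U \<in> \<N>" for U
      using that \<N>(1) openin_sets[of U] sets by (intro null_setsI) auto
    then have "(\<Union>U\<in>\<N>. U) \<in> null_sets \<mu>" by (rule null_sets_UN'[OF \<N>(2)])
    then show ?thesis by simp
  qed
  show ?thesis
  proof (rule AE_I'[OF null])
    show "{x \<in> space \<mu>. x \<notin> msupport \<Gamma> G \<mu>} \<subseteq> \<Union>\<N>"
    proof
      fix x assume "x \<in> {x \<in> space \<mu>. x \<notin> msupport \<Gamma> G \<mu>}"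
      then obtain U g where U: "openin TX U" "x \<in> U" "emeasure \<mu> U = 0" and g: "g \<in> G" "x = pt g"
        by (auto simp: sp msupport_def hspace_eq not_gr_zero)
      then have "g \<in> (\<Union>U\<in>?N. ?pre U)" by blast
      then have "g \<in> (\<Union>U\<in>\<N>. ?pre U)" unfolding \<N>(3) .
      then show "x \<in> \<Union>\<N>" using g by auto
    qed
  qed
qed

definition NX :: "real \<Rightarrow> (real^'n^'n) set \<Rightarrow> (real^'n^'n) set set" where
  "NX \<rho> x = {act h x | h. h \<in> G \<and> norm (h - mat 1) < \<rho>}"

lemma openin_NX:
  assumes "x \<in> X"
  shows "openin TX (NX \<rho> x)"
proof -
  obtain g where g: "g \<in> G" "x = pt g" using assms by (auto simp: hspace_eq)
  let ?U = "G \<inter> (\<lambda>k. k ** minv g) -` ball (mat 1) \<rho>"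
  have "NX \<rho> x = pt ` ?U"
  proof (intro equalityI subsetI)
    fix y assume "y \<in> NX \<rho> x"
    then obtain h where h: "h \<in> G" "norm (h - mat 1) < \<rho>" "y = act h x" by (auto simp: NX_def)
    then have "h ** g \<in> ?U" using g by (auto simp: dist_norm norm_minus_commute simp flip: matrix_mul_assoc)
    then show "y \<in> pt ` ?U" using h g by (auto simp: act_pt)
  next
    fix y assume "y \<in> pt ` ?U"
    then obtain k where k: "k \<in> G" "norm (k ** minv g - mat 1) < \<rho>" "y = pt k"
      by (auto simp: dist_norm norm_minus_commute)
    then have "y = act (k ** minv g) x" using g by (simp add: act_pt flip: matrix_mul_assoc)
    then show "y \<in> NX \<rho> x"
      unfolding NX_def using k g by (intro CollectI exI[of _ "k ** minv g"]) simp
  qed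
  moreover have "openin (top_of_set G) ?U"
  proof -
    have "open ((\<lambda>k. k ** minv g) -` ball (mat 1) \<rho>)"
      by (rule open_vimage[OF open_ball continuous_on_mult_right])
    then show ?thesis by (rule openin_open_Int)
  qed
  ultimately show ?thesis using open_image_pt by simp
qed

lemma NX_self: "x \<in> X \<Longrightarrow> \<rho> > 0 \<Longrightarrow> x \<in> NX \<rho> x"
  unfolding NX_def using act_one[of x] by (intro CollectI exI[of _ "mat 1"]) auto

end

locale invariant_measure = homogeneous_space G \<Gamma> for G :: "(real^'n^'n) set" and \<Gamma> +
  fixes m :: "(real^'n^'n) set measure"
  assumes inv: "invariant_prob \<Gamma> G G m"
begin

sublocale m: prob_space m
  using inv borel_probD(1) by (auto simp: invariant_prob_def)

lemma sets_m [measurable_cong]: "sets m = sets BX" and space_m: "space m = X"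
  using inv borel_probD by (auto simp: invariant_prob_def)

lemma distr_m: "h \<in> G \<Longrightarrow> distr m BX (act h) = m"
  using inv by (auto simp: invariant_prob_def)

lemma act_measurable_m: "h \<in> G \<Longrightarrow> act h \<in> measurable m BX"
  using measurable_act measurable_cong_sets[OF sets_m refl] by blast

lemma emeasure_act: "h \<in> G \<Longrightarrow> A \<in> sets BX \<Longrightarrow> emeasure m {x \<in> X. act h x \<in> A} = emeasure m A"
  using emeasure_distr[OF act_measurable_m, of h A] distr_m[of h] space_m
  by (simp add: vimage_def Int_def conj_commute)

text \<open>Countably many translates of a non-empty open set cover the space.\<close>

lemma open_positive:
  assumes U: "openin TX U" "U \<noteq> {}"
  shows "emeasure m U > 0"
proof (rule ccontr)
  assume "\<not> ?thesis"
  then have U0: "emeasure m U = 0" by (simp add: not_gr_zero)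
  obtain g0 where g0: "g0 \<in> G" "pt g0 \<in> U" using U by (auto simp: openin_TX hspace_eq)
  let ?V = "\<lambda>h. {k \<in> G. pt (h ** k) \<in> U}"
  have V: "openin (top_of_set G) (?V h)" if h: "h \<in> G" for h
  proof -
    have "openin TX {x \<in> topspace TX. act h x \<in> U}" using continuous_map_act[OF h] U(1) by (auto simp: continuous_map)
    then have "openin (top_of_set G) {k \<in> G. pt k \<in> {x \<in> topspace TX. act h x \<in> U}}" by (simp add: openin_TX)
    also have "{k \<in> G. pt k \<in> {x \<in> topspace TX. act h x \<in> U}} = ?V h" using h by (auto simp: act_pt)
    finally show ?thesis .
  qed
  have "\<exists>H\<subseteq>G. countable H \<and> (\<Union>h\<in>H. ?V h) = (\<Union>h\<in>G. ?V h)"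
    by (rule Lindelof_openin_indexed) (rule V)
  then obtain H
    where H: "H \<subseteq> G" "countable H" "(\<Union>h\<in>H. ?V h) = (\<Union>h\<in>G. ?V h)" by (elim exE conjE)
  have "X \<subseteq> (\<Union>h\<in>H. {x \<in> X. act h x \<in> U})"
  proof
    fix x assume "x \<in> X"
    then obtain k where k: "k \<in> G" "x = pt k" by (auto simp: hspace_eq)
    have "k \<in> ?V (g0 ** minv k)" using k g0 by (simp flip: matrix_mul_assoc)
    then have "k \<in> (\<Union>h\<in>G. ?V h)" using k g0 by (intro UN_I[of "g0 ** minv k"]) auto
    then obtain h where "h \<in> H" "k \<in> ?V h" unfolding H(3)[symmetric] by blast
    then have "act h x \<in> U" using k H(1) by (simp add: act_pt subset_iff)
    then show "x \<in> (\<Union>h\<in>H. {x \<in> X. act h x \<in> U})" using k \<open>h \<in> H\<close> by (intro UN_I[of h]) auto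
  qed
  moreover have "(\<Union>h\<in>H. {x \<in> X. act h x \<in> U}) \<in> null_sets m"
  proof (rule null_sets_UN'[OF H(2)])
    fix h assume "h \<in> H"
    then have h: "h \<in> G" using H(1) by blast
    have "{x \<in> X. act h x \<in> U} \<in> sets m"
      using measurable_sets[OF act_measurable_m[OF h] openin_sets[OF U(1)]] space_m by (simp add: vimage_def Int_def conj_commute)
    then show "{x \<in> X. act h x \<in> U} \<in> null_sets m"
      using emeasure_act[OF h openin_sets[OF U(1)]] U0 by (intro null_setsI) auto
  qed
  ultimately have "X \<in> null_sets m" using null_sets_subset[of _ m X] sets_m sets.top[of BX] by simp
  then show False using m.emeasure_space_1 space_m by auto
qed

text \<open>The points of \<open>OX R\<close> have representatives in a compact set, and near a limit \<open>l\<close> of representatives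
  the neighbourhoods contain a fixed neighbourhood of \<open>pt l\<close>, which has positive measure.\<close>

lemma NX_lower_bound:
  assumes \<rho>: "\<rho> > 0"
  shows "\<exists>c>0. \<forall>x\<in>OX R. measure m (NX \<rho> x) \<ge> c"
proof (rule ccontr)
  assume neg: "\<not> ?thesis"
  have "\<exists>g. g \<in> G \<inter> cball 0 R \<and> measure m (NX \<rho> (pt g)) < 1 / Suc k" for k :: nat
  proof -
    have "(1 :: real) / Suc k > 0" by simp
    then obtain x where "x \<in> OX R" "measure m (NX \<rho> x) < 1 / Suc k" using neg by (meson not_le)
    then show ?thesis by (auto simp: OX_def)
  qed
  then obtain g where g: "\<forall>k. g k \<in> G \<inter> cball 0 R" "\<And>k :: nat. measure m (NX \<rho> (pt (g k))) < 1 / Suc k"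
    by metis
  from seq_compactE[OF compact_imp_seq_compact[OF compact_G_cball] g(1)]
  obtain l r where l: "l \<in> G \<inter> cball 0 R" "strict_mono r" "(g \<circ> r) \<longlonglongrightarrow> l" .
  have gG: "g k \<in> G" for k using g(1) by blast
  have lG: "l \<in> G" using l by blast
  define C where "C = norm (mat 1 :: real^'n^'n) + 1"
  have C: "C > 0" unfolding C_def by (intro add_nonneg_pos) auto
  have "(\<lambda>k. l ** minv ((g \<circ> r) k)) \<longlonglongrightarrow> l ** minv l"
    using lG gG by (intro mm.tendsto tendsto_minv l(3) tendsto_const) auto
  then have "(\<lambda>k. l ** minv (g (r k))) \<longlonglongrightarrow> mat 1" using lG by simp
  then have "\<forall>\<^sub>F k in sequentially. dist (l ** minv (g (r k))) (mat 1) < min 1 (\<rho> / 2)"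
    using \<rho> by (intro tendstoD) auto
  then obtain K where K: "\<And>k. k \<ge> K \<Longrightarrow> norm (l ** minv (g (r k)) - mat 1) < min 1 (\<rho> / 2)"
    by (auto simp: eventually_sequentially dist_norm)
  define \<rho>' where "\<rho>' = \<rho> / (2 * C)"
  have \<rho>': "\<rho>' > 0" using \<rho> C by (simp add: \<rho>'_def)
  have sub: "NX \<rho>' (pt l) \<subseteq> NX \<rho> (pt (g (r k)))" if "k \<ge> K" for k
  proof
    fix y assume "y \<in> NX \<rho>' (pt l)"
    then obtain h where h: "h \<in> G" "norm (h - mat 1) < \<rho>'" "y = act h (pt l)" by (auto simp: NX_def)
    let ?k = "l ** minv (g (r k))"
    have kG: "?k \<in> G" using lG gG by simp
    have y: "y = act (h ** ?k) (pt (g (r k)))"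
      using h lG gG by (simp add: act_pt flip: matrix_mul_assoc)
    have nk: "norm ?k \<le> C"
      using K[OF that] norm_triangle_ineq2[of ?k "mat 1"] by (simp add: C_def)
    have "h ** ?k - mat 1 = (h - mat 1) ** ?k + (?k - mat 1)" by (simp add: mm.diff_left)
    then have "norm (h ** ?k - mat 1) \<le> norm ((h - mat 1) ** ?k) + norm (?k - mat 1)" by (metis norm_triangle_ineq)
    also have "norm ((h - mat 1) ** ?k) \<le> \<rho>' * C"
    proof (rule order_trans[OF norm_matrix_mult_le], rule mult_mono)
      show "norm (h - mat 1) \<le> \<rho>'" "norm ?k \<le> C" using h(2) nk by auto
    qed (use \<rho>' in auto)
    also have "\<rho>' * C = \<rho> / 2" using C by (simp add: \<rho>'_def)
    also have "\<rho> / 2 + norm (?k - mat 1) < \<rho>" using K[OF that] by simp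
    finally show "y \<in> NX \<rho> (pt (g (r k)))" unfolding NX_def using y h kG by auto
  qed
  have pos: "measure m (NX \<rho>' (pt l)) > 0"
    using open_positive[OF openin_NX[of "pt l" \<rho>']] NX_self[of "pt l" \<rho>'] \<rho>' lG
    by (auto simp: m.emeasure_eq_measure)
  obtain N where N: "1 / Suc N < measure m (NX \<rho>' (pt l))" using pos nat_approx_posE by blast
  let ?k = "max K N"
  have "measure m (NX \<rho>' (pt l)) \<le> measure m (NX \<rho> (pt (g (r ?k))))"
    using sub[of ?k] openin_sets[OF openin_NX[of "pt (g (r ?k))" \<rho>]] gG sets_m by (intro m.finite_measure_mono) auto
  also have "\<dots> < 1 / Suc (r ?k)" by (rule g)
  also have "\<dots> \<le> 1 / Suc N"
    using seq_suble[OF l(2), of ?k] by (intro divide_left_mono) auto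
  finally show False using N by simp
qed

end

section \<open>Ergodicity from unique ergodicity of the Auslander subgroup\<close>

context invariant_measure
begin

lemma Cc_act_uniformly_continuous:
  assumes f: "f \<in> Cc \<Gamma> G" and h: "h \<in> G" and e: "e > 0"
  shows "\<exists>\<rho>>0. \<forall>g\<in>G. \<forall>x\<in>X. norm (g - mat 1) < \<rho> \<longrightarrow> \<bar>f (act h (act g x)) - f (act h x)\<bar> < e"
proof -
  obtain \<rho> where \<rho>: "\<rho> > 0" "\<And>g x. g \<in> G \<Longrightarrow> x \<in> X \<Longrightarrow> norm (g - mat 1) < \<rho> \<Longrightarrow> \<bar>f (act g x) - f x\<bar> < e"
    using Cc_uniformly_continuous[OF f e] by blast
  define C where "C = norm h * norm (minv h) + 1"
  have C: "C > 0" unfolding C_def by (intro add_nonneg_pos) auto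
  have "\<bar>f (act h (act g x)) - f (act h x)\<bar> < e" if g: "g \<in> G" "x \<in> X" "norm (g - mat 1) < \<rho> / C" for g x
  proof -
    let ?k = "h ** g ** minv h"
    have "?k - mat 1 = h ** (g - mat 1) ** minv h" using h by (simp add: mm.diff_left mm.diff_right)
    then have "norm (?k - mat 1) \<le> norm (h ** (g - mat 1)) * norm (minv h)"
      by (simp add: norm_matrix_mult_le)
    also have "\<dots> \<le> norm h * norm (g - mat 1) * norm (minv h)"
      by (intro mult_right_mono norm_matrix_mult_le) auto
    also have "\<dots> \<le> C * norm (g - mat 1)" by (simp add: C_def algebra_simps)
    also have "\<dots> < \<rho>" using g(3) C by (simp add: field_simps)
    finally have "\<bar>f (act ?k (act h x)) - f (act h x)\<bar> < e" using \<rho>(2)[of ?k "act h x"] g h by simp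
    moreover have "act ?k (act h x) = act h (act g x)"
      using g h by (simp add: act_act flip: matrix_mul_assoc)
    ultimately show ?thesis by simp
  qed
  then show ?thesis using \<rho>(1) C by (intro exI[of _ "\<rho> / C"]) auto
qed

lemma act_measurable_mm [measurable]: "h \<in> G \<Longrightarrow> act h \<in> measurable m m"
  using act_measurable_m measurable_cong_sets[OF refl sets_m] by blast

lemma measure_preserving_act: "h \<in> G \<Longrightarrow> measure_preserving m (act h)"
proof
  assume h: "h \<in> G"
  show "act h \<in> measurable m m" using h by simp
  have "distr m m (act h) = distr m BX (act h)" by (intro distr_cong) (auto simp: sets_m)
  then show "distr m m (act h) = m" using distr_m[OF h] by simp
qed

end

text \<open>Here \<open>\<phi>\<close> is the limit in mean of the averages of \<open>f\<close>.\<close>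

locale ergodic_limit = invariant_measure G \<Gamma> m for G :: "(real^'n^'n) set" and \<Gamma> m +
  fixes a :: "real^'n^'n" and f \<phi> :: "(real^'n^'n) set \<Rightarrow> real" and b :: real
  assumes a: "a \<in> G" and f: "f \<in> Cc \<Gamma> G" and fb: "\<And>x. x \<in> X \<Longrightarrow> \<bar>f x\<bar> \<le> b" and b: "b > 0"
    and \<phi> [measurable]: "\<phi> \<in> borel_measurable m" and \<phi>b: "\<And>x. \<bar>\<phi> x\<bar> \<le> b"
    and lim: "(\<lambda>k. \<integral>x. \<bar>measure_preserving.avg (act a) f k x - \<phi> x\<bar> \<partial>m) \<longlonglongrightarrow> 0"
begin

sublocale mp: measure_preserving m "act a"
  by (rule measure_preserving_act[OF a])

text \<open>The displacement of \<open>\<phi>\<close> in mean. It is subadditive on \<open>G\<close> and continuous at the identity, as \<open>\<phi>\<close> is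
  close to an average of \<open>f\<close>, a finite sum of uniformly continuous functions.\<close>

definition disp :: "real^'n^'n \<Rightarrow> real" where
  "disp g = (\<integral>x. \<bar>\<phi> (act g x) - \<phi> x\<bar> \<partial>m)"

lemma fm [measurable]: "f \<in> borel_measurable m"
  using Cc_measurable[OF f] measurable_cong_sets[OF sets_m refl] by blast

lemma avg_b: "x \<in> X \<Longrightarrow> \<bar>mp.avg f k x\<bar> \<le> b"
  using mp.avg_bounded[of f b x k] fb b space_m by auto

lemma integrable_diff:
  assumes "u \<in> borel_measurable m" "v \<in> borel_measurable m" "\<And>x. x \<in> X \<Longrightarrow> \<bar>u x\<bar> \<le> b" "\<And>x. x \<in> X \<Longrightarrow> \<bar>v x\<bar> \<le> b"
  shows "integrable m (\<lambda>x. \<bar>u x - v x\<bar>)"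
proof (rule m.integrable_bounded[of _ "2 * b"])
  show "(\<lambda>x. \<bar>u x - v x\<bar>) \<in> borel_measurable m" using assms(1,2) by measurable
  show "\<bar>\<bar>u x - v x\<bar>\<bar> \<le> 2 * b" if "x \<in> space m" for x
    using assms(3,4)[of x] that space_m by auto
qed

lemma \<phi>_act [measurable]: "h \<in> G \<Longrightarrow> (\<lambda>x. \<phi> (act h x)) \<in> borel_measurable m"
  by (rule measurable_compose[OF act_measurable_mm \<phi>])

lemma avg_act [measurable]: "h \<in> G \<Longrightarrow> (\<lambda>x. mp.avg f k (act h x)) \<in> borel_measurable m"
  by (rule measurable_compose[OF act_measurable_mm mp.avg_measurable[OF fm]])

lemma integral_act_m:
  fixes u :: "(real^'n^'n) set \<Rightarrow> real"
  assumes h: "h \<in> G" and u: "u \<in> borel_measurable m"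
  shows "(\<integral>x. u (act h x) \<partial>m) = (\<integral>x. u x \<partial>m)"
  by (rule measure_preserving.integral_T[OF measure_preserving_act[OF h] u])

lemma L1_triangle:
  assumes [measurable]: "u \<in> borel_measurable m" "v \<in> borel_measurable m" "w \<in> borel_measurable m"
    and b: "\<And>x. x \<in> X \<Longrightarrow> \<bar>u x\<bar> \<le> b" "\<And>x. x \<in> X \<Longrightarrow> \<bar>v x\<bar> \<le> b" "\<And>x. x \<in> X \<Longrightarrow> \<bar>w x\<bar> \<le> b"
  shows "(\<integral>x. \<bar>u x - w x\<bar> \<partial>m) \<le> (\<integral>x. \<bar>u x - v x\<bar> \<partial>m) + (\<integral>x. \<bar>v x - w x\<bar> \<partial>m)"
proof -
  have i: "integrable m (\<lambda>x. \<bar>u x - w x\<bar>)" "integrable m (\<lambda>x. \<bar>u x - v x\<bar>)" "integrable m (\<lambda>x. \<bar>v x - w x\<bar>)"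
    by (intro integrable_diff assms(1-3) b; assumption)+
  have "(\<integral>x. \<bar>u x - w x\<bar> \<partial>m) \<le> (\<integral>x. \<bar>u x - v x\<bar> + \<bar>v x - w x\<bar> \<partial>m)"
    using i by (intro integral_mono) auto
  also have "\<dots> = (\<integral>x. \<bar>u x - v x\<bar> \<partial>m) + (\<integral>x. \<bar>v x - w x\<bar> \<partial>m)"
    using i by (intro Bochner_Integration.integral_add)
  finally show ?thesis .
qed

lemma disp_nonneg: "disp g \<ge> 0"
  unfolding disp_def by (intro integral_nonneg_AE) auto

lemma disp_mult:
  assumes g: "g \<in> G" and h: "h \<in> G"
  shows "disp (g ** h) \<le> disp g + disp h"
proof -
  have "disp (g ** h) = (\<integral>x. \<bar>\<phi> (act g (act h x)) - \<phi> x\<bar> \<partial>m)"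
    unfolding disp_def using g h by (intro Bochner_Integration.integral_cong) (auto simp: act_act space_m)
  also have "\<dots> \<le> (\<integral>x. \<bar>\<phi> (act g (act h x)) - \<phi> (act h x)\<bar> \<partial>m) + (\<integral>x. \<bar>\<phi> (act h x) - \<phi> x\<bar> \<partial>m)"
    using g h \<phi>b by (intro L1_triangle \<phi> \<phi>_act measurable_compose[OF act_measurable_mm \<phi>_act]) auto
  also have "(\<integral>x. \<bar>\<phi> (act g (act h x)) - \<phi> (act h x)\<bar> \<partial>m) = disp g"
    unfolding disp_def
    by (rule integral_act_m[OF h]) (intro borel_measurable_abs borel_measurable_diff \<phi>_act \<phi> g)
  finally show ?thesis by (simp add: disp_def)
qed

lemma disp_inv:
  assumes g: "g \<in> G"
  shows "disp (minv g) = disp g"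
proof -
  have "(\<integral>x. \<bar>\<phi> (act (minv g) (act g x)) - \<phi> (act g x)\<bar> \<partial>m) = disp (minv g)"
    unfolding disp_def
    by (rule integral_act_m[OF g]) (intro borel_measurable_abs borel_measurable_diff \<phi>_act \<phi> minv_G g)
  moreover have "(\<integral>x. \<bar>\<phi> (act (minv g) (act g x)) - \<phi> (act g x)\<bar> \<partial>m) = disp g"
    unfolding disp_def using g by (intro Bochner_Integration.integral_cong) (auto simp: act_act space_m abs_minus_commute)
  ultimately show ?thesis by simp
qed

lemma disp_le_avg:
  assumes g: "g \<in> G"
  shows "disp g \<le> 2 * (\<integral>x. \<bar>mp.avg f k x - \<phi> x\<bar> \<partial>m) + (\<integral>x. \<bar>mp.avg f k (act g x) - mp.avg f k x\<bar> \<partial>m)"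
proof -
  have gb: "\<bar>mp.avg f k (act g x)\<bar> \<le> b" if "x \<in> X" for x using avg_b g that by simp
  have "disp g \<le> (\<integral>x. \<bar>\<phi> (act g x) - mp.avg f k (act g x)\<bar> \<partial>m) + (\<integral>x. \<bar>mp.avg f k (act g x) - \<phi> x\<bar> \<partial>m)"
    unfolding disp_def by (intro L1_triangle \<phi>_act avg_act g \<phi> gb \<phi>b)
  also have "(\<integral>x. \<bar>mp.avg f k (act g x) - \<phi> x\<bar> \<partial>m)
      \<le> (\<integral>x. \<bar>mp.avg f k (act g x) - mp.avg f k x\<bar> \<partial>m) + (\<integral>x. \<bar>mp.avg f k x - \<phi> x\<bar> \<partial>m)"
    by (intro L1_triangle avg_act g \<phi> mp.avg_measurable fm gb \<phi>b avg_b)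
  also have "(\<integral>x. \<bar>\<phi> (act g x) - mp.avg f k (act g x)\<bar> \<partial>m) = (\<integral>x. \<bar>\<phi> x - mp.avg f k x\<bar> \<partial>m)"
    by (rule integral_act_m[OF g]) measurable
  also have "\<dots> = (\<integral>x. \<bar>mp.avg f k x - \<phi> x\<bar> \<partial>m)" by (simp add: abs_minus_commute)
  finally show ?thesis by simp
qed

lemma disp_a: "disp a = 0"
proof -
  have "(\<lambda>k. 2 * (\<integral>x. \<bar>mp.avg f k x - \<phi> x\<bar> \<partial>m) + 2 * b * (1 / real k)) \<longlonglongrightarrow> 2 * 0 + 2 * b * 0"
    by (intro tendsto_add tendsto_mult tendsto_const lim lim_1_over_n)
  moreover have "disp a \<le> 2 * (\<integral>x. \<bar>mp.avg f k x - \<phi> x\<bar> \<partial>m) + 2 * b * (1 / real k)" if k: "k > 0" for k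
  proof -
    have avg_a: "mp.avg f k (act a x) = mp.avg (\<lambda>x. f (act a x)) k x" for x
      by (simp add: mp.avg_def funpow_swap1)
    have "(\<integral>x. \<bar>mp.avg f k (act a x) - mp.avg f k x\<bar> \<partial>m) \<le> (\<integral>x. 2 * b * (1 / real k) \<partial>m)"
    proof (rule integral_mono)
      show "integrable m (\<lambda>x. \<bar>mp.avg f k (act a x) - mp.avg f k x\<bar>)"
        using a by (intro integrable_diff avg_act mp.avg_measurable fm avg_b) auto
      show "\<bar>mp.avg f k (act a x) - mp.avg f k x\<bar> \<le> 2 * b * (1 / real k)" if "x \<in> space m" for x
        using mp.avg_shift_diff[of f b x k] fb that k unfolding avg_a by (simp add: space_m)
    qed auto
    then show ?thesis using disp_le_avg[OF a, of k] by (simp add: m.prob_space)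
  qed
  then have "\<forall>\<^sub>F k in sequentially. disp a \<le> 2 * (\<integral>x. \<bar>mp.avg f k x - \<phi> x\<bar> \<partial>m) + 2 * b * (1 / real k)"
    by (intro eventually_mono[OF eventually_gt_at_top[of 0]])
  ultimately have "disp a \<le> 2 * 0 + 2 * b * 0"
    by (intro tendsto_lowerbound) auto
  then show ?thesis using disp_nonneg[of a] by simp
qed

lemma disp_a_pow: "disp (mpow a l) = 0" "disp (minv (mpow a l)) = 0"
proof -
  show *: "disp (mpow a l) = 0"
  proof (induction l)
    case 0
    have "disp (mat 1) = (\<integral>x. 0 \<partial>m)"
      unfolding disp_def by (intro Bochner_Integration.integral_cong) (auto simp: space_m)
    then show ?case by simp
  next
    case (Suc l)
    then show ?case using disp_mult[OF a mpow_G[OF a, of l]] disp_a disp_nonneg[of "mpow a (Suc l)"] by (simp add: mpow_Suc)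
  qed
  then show "disp (minv (mpow a l)) = 0" using disp_inv a by simp
qed

lemma disp_continuous_at_one:
  assumes e: "e > 0"
  shows "\<exists>\<rho>>0. \<forall>g\<in>G. norm (g - mat 1) < \<rho> \<longrightarrow> disp g < e"
proof -
  have "\<forall>\<^sub>F k in sequentially. (\<integral>x. \<bar>mp.avg f k x - \<phi> x\<bar> \<partial>m) < e / 4 \<and> k > 0"
    using e by (intro eventually_conj order_tendstoD(2)[OF lim] eventually_gt_at_top) auto
  from eventually_happens[OF this] obtain k where k: "(\<integral>x. \<bar>mp.avg f k x - \<phi> x\<bar> \<partial>m) < e / 4" "k > 0"
    by (elim disjE exE conjE) auto
  have "\<exists>\<rho>>0. \<forall>l<j. \<forall>g\<in>G. \<forall>x\<in>X. norm (g - mat 1) < \<rho> \<longrightarrow> \<bar>f (act (mpow a l) (act g x)) - f (act (mpow a l) x)\<bar> < e / 4" for j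
  proof (induction j)
    case 0
    show ?case by (intro exI[of _ 1]) auto
  next
    case (Suc j)
    then obtain \<rho>1 where \<rho>1: "\<rho>1 > 0" "\<And>l g x. l < j \<Longrightarrow> g \<in> G \<Longrightarrow> x \<in> X \<Longrightarrow> norm (g - mat 1) < \<rho>1 \<Longrightarrow>
        \<bar>f (act (mpow a l) (act g x)) - f (act (mpow a l) x)\<bar> < e / 4" by blast
    obtain \<rho>2 where \<rho>2: "\<rho>2 > 0" "\<And>g x. g \<in> G \<Longrightarrow> x \<in> X \<Longrightarrow> norm (g - mat 1) < \<rho>2 \<Longrightarrow>
        \<bar>f (act (mpow a j) (act g x)) - f (act (mpow a j) x)\<bar> < e / 4"
      using Cc_act_uniformly_continuous[OF f mpow_G[OF a, of j], of "e / 4"] e by auto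
    show ?case
      using \<rho>1 \<rho>2 by (intro exI[of _ "min \<rho>1 \<rho>2"]) (auto simp: less_Suc_eq)
  qed
  from this[of k] obtain \<rho> where \<rho>: "\<rho> > 0" "\<And>l g x. l < k \<Longrightarrow> g \<in> G \<Longrightarrow> x \<in> X \<Longrightarrow> norm (g - mat 1) < \<rho> \<Longrightarrow>
        \<bar>f (act (mpow a l) (act g x)) - f (act (mpow a l) x)\<bar> < e / 4" by blast
  have "disp g < e" if g: "g \<in> G" "norm (g - mat 1) < \<rho>" for g
  proof -
    have "(\<integral>x. \<bar>mp.avg f k (act g x) - mp.avg f k x\<bar> \<partial>m) \<le> (\<integral>x. e / 4 \<partial>m)"
    proof (rule integral_mono)
      show "integrable m (\<lambda>x. \<bar>mp.avg f k (act g x) - mp.avg f k x\<bar>)"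
        using g by (intro integrable_diff avg_act mp.avg_measurable fm avg_b) auto
      fix x assume "x \<in> space m"
      then have x: "x \<in> X" by (simp add: space_m)
      have "mp.avg f k (act g x) - mp.avg f k x = (\<Sum>l<k. f ((act a ^^ l) (act g x)) - f ((act a ^^ l) x)) / real k"
        by (simp add: mp.avg_def sum_subtractf diff_divide_distrib)
      also have "\<bar>\<dots>\<bar> \<le> (\<Sum>l<k. \<bar>f ((act a ^^ l) (act g x)) - f ((act a ^^ l) x)\<bar>) / real k"
        by (simp add: abs_divide divide_right_mono sum_abs)
      also have "\<dots> \<le> (\<Sum>l<k. e / 4) / real k"
      proof (intro divide_right_mono sum_mono)
        fix l assume "l \<in> {..<k}"
        then show "\<bar>f ((act a ^^ l) (act g x)) - f ((act a ^^ l) x)\<bar> \<le> e / 4"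
          using \<rho>(2)[of l g x] g x a by (simp add: act_pow)
      qed auto
      finally show "\<bar>mp.avg f k (act g x) - mp.avg f k x\<bar> \<le> e / 4" using k by simp
    qed auto
    then show ?thesis using disp_le_avg[OF g(1), of k] k(1) e by (simp add: m.prob_space)
  qed
  then show ?thesis using \<rho>(1) by blast
qed

lemma disp_tendsto:
  assumes "\<And>k. g k \<in> G" "g \<longlonglongrightarrow> mat 1"
  shows "(\<lambda>k. disp (g k)) \<longlonglongrightarrow> 0"
proof (rule LIMSEQ_I)
  fix e :: real assume "e > 0"
  then obtain \<rho> where \<rho>: "\<rho> > 0" "\<And>h. h \<in> G \<Longrightarrow> norm (h - mat 1) < \<rho> \<Longrightarrow> disp h < e"
    using disp_continuous_at_one by blast
  from LIMSEQ_D[OF assms(2) \<rho>(1)] obtain K where "\<And>k. k \<ge> K \<Longrightarrow> norm (g k - mat 1) < \<rho>" by blast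
  then have "norm (disp (g k) - 0) < e" if "k \<ge> K" for k
    using \<rho>(2)[OF assms(1)] that disp_nonneg[of "g k"] by simp
  then show "\<exists>no. \<forall>k\<ge>no. norm (disp (g k) - 0) < e" by blast
qed

text \<open>Mautner's phenomenon: conjugation by powers of \<open>a\<close>, which fix \<open>\<phi>\<close>, does not change by how
  much a group element moves \<open>\<phi>\<close>.\<close>

lemma disp_horospherical:
  assumes "g \<in> G_plus G a \<union> G_minus G a"
  shows "g \<in> G \<and> disp g = 0"
proof -
  have gG: "g \<in> G" using assms by (auto simp: G_plus_def G_minus_def)
  have conj: "disp g \<le> disp (p ** g ** q)" if p: "p \<in> G" "q \<in> G" "q ** p = mat 1" "disp p = 0" "disp q = 0" for p q
  proof -
    have "p ** q = mat 1" using p(3) matrix_left_right_inverse by blast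
    then have "q ** (p ** g ** q) ** p = g" using p(3) by (metis matrix_mul_assoc matrix_mul_lid matrix_mul_rid)
    then have "disp g = disp (q ** (p ** g ** q) ** p)" by simp
    also have "\<dots> \<le> disp q + disp (p ** g ** q) + disp p"
      using disp_mult[of "q ** (p ** g ** q)" p] disp_mult[of q "p ** g ** q"] p gG by simp
    finally show ?thesis using p by simp
  qed
  have "\<exists>p q. (\<forall>k :: nat. p k \<in> G \<and> q k \<in> G \<and> q k ** p k = mat 1 \<and> disp (p k) = 0 \<and> disp (q k) = 0) \<and>
      (\<lambda>k. p k ** g ** q k) \<longlonglongrightarrow> mat 1"
  proof (cases "g \<in> G_plus G a")
    case True
    then show ?thesis
      using G_plus_iff[OF a, of g] a disp_a_pow
      by (intro exI[of _ "\<lambda>k. minv (mpow a k)"] exI[of _ "\<lambda>k. mpow a k"]) auto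
  next
    case False
    then show ?thesis
      using G_minus_tendsto[OF a, of g] assms a disp_a_pow
      by (intro exI[of _ "\<lambda>k. mpow a k"] exI[of _ "\<lambda>k. minv (mpow a k)"]) auto
  qed
  then obtain p q where pq: "\<And>k :: nat. p k \<in> G \<and> q k \<in> G \<and> q k ** p k = mat 1 \<and> disp (p k) = 0 \<and> disp (q k) = 0"
      "(\<lambda>k. p k ** g ** q k) \<longlonglongrightarrow> mat 1" by (elim exE conjE) blast
  have "(\<lambda>k. disp (p k ** g ** q k)) \<longlonglongrightarrow> 0" using pq gG by (intro disp_tendsto) auto
  moreover have "disp g \<le> disp (p k ** g ** q k)" for k using pq(1)[of k] by (intro conj) auto
  ultimately have "disp g \<le> 0" by (intro tendsto_lowerbound) auto
  then show ?thesis using gG disp_nonneg[of g] by simp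
qed

lemma auslander_fixes:
  assumes h: "h \<in> auslander G a"
  shows "h \<in> G \<and> disp h = 0"
proof -
  let ?S = "{g \<in> G. disp g = 0}"
  have "subgroup ?S (SL\<lparr>carrier := G\<rparr>)"
  proof
    show "x \<otimes>\<^bsub>SL\<lparr>carrier := G\<rparr>\<^esub> y \<in> ?S" if "x \<in> ?S" "y \<in> ?S" for x y
      using that disp_mult[of x y] disp_nonneg[of "x ** y"] by simp
    show "\<one>\<^bsub>SL\<lparr>carrier := G\<rparr>\<^esub> \<in> ?S" using disp_a_pow(1)[of 0] by simp
    show "inv\<^bsub>SL\<lparr>carrier := G\<rparr>\<^esub> x \<in> ?S" if "x \<in> ?S" for x
      using that SL.m_inv_consistent[OF subgroup_G, of x] disp_inv[of x] minv_G[of x] by simp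
  qed auto
  moreover have "closed ?S"
    unfolding closed_sequential_limits
  proof (intro allI impI)
    fix s g assume "(\<forall>k :: nat. s k \<in> ?S) \<and> s \<longlonglongrightarrow> g"
    then have s: "\<And>k. s k \<in> G" "\<And>k. disp (s k) = 0" "s \<longlonglongrightarrow> g" by auto
    have g: "g \<in> G" using closed_sequentially[OF closed_G s(1,3)] .
    have "(\<lambda>k. minv (s k) ** g) \<longlonglongrightarrow> minv g ** g"
      using s g by (intro mm.tendsto tendsto_minv tendsto_const) auto
    then have "(\<lambda>k. disp (minv (s k) ** g)) \<longlonglongrightarrow> 0" using s g by (intro disp_tendsto) auto
    moreover have "disp g \<le> disp (minv (s k) ** g)" for k
      using disp_mult[of "s k" "minv (s k) ** g"] s g by (simp add: matrix_mul_assoc)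
    ultimately have "disp g \<le> 0" by (intro tendsto_lowerbound) auto
    then show "g \<in> ?S" using g disp_nonneg[of g] by simp
  qed
  ultimately have "auslander G a \<subseteq> ?S"
    unfolding auslander_def using disp_horospherical by (intro hull_minimal) auto
  then show ?thesis using h by blast
qed

text \<open>A positive affine function \<open>w\<close> of \<open>\<phi>\<close> is the density of a probability measure that is again
  invariant under the Auslander subgroup, hence equal to \<open>m\<close>; so \<open>w\<close> is constant.\<close>

lemma \<phi>_constant:
  assumes uerg: "uniquely_ergodic \<Gamma> G (auslander G a)"
  shows "AE x in m. \<phi> x = (\<integral>x. f x \<partial>m)"
proof -
  have i\<phi>: "integrable m \<phi>" by (rule m.integrable_bounded[of _ b]) (use \<phi>b in auto)
  define Z where "Z = (\<integral>x. \<phi> x \<partial>m) + b + 1"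
  define w where "w x = (\<phi> x + b + 1) / Z" for x
  have "(\<integral>x. - b \<partial>m) \<le> (\<integral>x. \<phi> x \<partial>m)" using i\<phi> \<phi>b by (intro integral_mono) (auto simp: abs_le_iff minus_le_iff)
  then have Z: "Z > 0" by (simp add: Z_def m.prob_space)
  have wm [measurable]: "w \<in> borel_measurable m" unfolding w_def by measurable
  have w0: "w x \<ge> 0" for x using \<phi>b[of x] Z unfolding w_def by (intro divide_nonneg_pos) (auto simp: abs_le_iff)
  have iw: "integrable m w" unfolding w_def using i\<phi> by auto
  have "(\<integral>x. w x \<partial>m) = 1"
    unfolding w_def using i\<phi> Z by (simp add: m.prob_space Z_def)
  then have w1: "(\<integral>\<^sup>+x. ennreal (w x) \<partial>m) = 1"
    using iw w0 by (subst nn_integral_eq_integral) auto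
  define \<rho> where "\<rho> = density m (\<lambda>x. ennreal (w x))"
  have "emeasure \<rho> (space m) = (\<integral>\<^sup>+x. ennreal (w x) * indicator (space m) x \<partial>m)"
    unfolding \<rho>_def by (rule emeasure_density) auto
  also have "\<dots> = (\<integral>\<^sup>+x. ennreal (w x) \<partial>m)" by (intro nn_integral_cong) simp
  finally have \<rho>: "borel_prob \<Gamma> G \<rho>"
    unfolding borel_prob_def using w1 by (simp add: sets_m \<rho>_def)
  have "invariant_prob \<Gamma> G (auslander G a) \<rho>"
    unfolding invariant_prob_def
  proof (intro conjI ballI \<rho>)
    fix h assume "h \<in> auslander G a"
    then have h: "h \<in> G" "disp h = 0" using auslander_fixes by auto
    have "AE x in m. \<bar>\<phi> (act h x) - \<phi> x\<bar> = 0"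
      using h(2) integral_nonneg_eq_0_iff_AE[of m "\<lambda>x. \<bar>\<phi> (act h x) - \<phi> x\<bar>"]
        integrable_diff[OF \<phi>_act[OF h(1)] \<phi>] \<phi>b by (simp add: disp_def)
    then have AEw: "AE x in m. w (act h x) = w x" by eventually_elim (simp add: w_def)
    show "distr \<rho> BX (act h) = \<rho>"
    proof (rule measure_eqI)
      show "sets (distr \<rho> BX (act h)) = sets \<rho>" by (simp add: \<rho>_def sets_m)
      fix A assume "A \<in> sets (distr \<rho> BX (act h))"
      then have A: "A \<in> sets BX" by simp
      have A' [measurable]: "A \<in> sets m" using A sets_m by simp
      have hm: "act h \<in> measurable \<rho> BX" using act_measurable_m[OF h(1)] by (simp add: \<rho>_def)
      have hA: "act h -` A \<inter> X \<in> sets m" using measurable_sets[OF act_measurable_m[OF h(1)] A] space_m by simp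
      have "emeasure (distr \<rho> BX (act h)) A = emeasure \<rho> (act h -` A \<inter> X)"
        using emeasure_distr[OF hm A] by (simp add: \<rho>_def space_m)
      also have "\<dots> = (\<integral>\<^sup>+x. ennreal (w x) * indicator (act h -` A \<inter> X) x \<partial>m)"
        unfolding \<rho>_def using hA by (intro emeasure_density) auto
      also have "\<dots> = (\<integral>\<^sup>+x. ennreal (w (act h x)) * indicator A (act h x) \<partial>m)"
        by (rule nn_integral_cong_AE) (use AEw AE_space in eventually_elim, auto simp: indicator_def space_m)
      also have "\<dots> = (\<integral>\<^sup>+x. ennreal (w x) * indicator A x \<partial>distr m m (act h))"
        using h(1) by (intro nn_integral_distr[symmetric]) auto
      also have "\<dots> = (\<integral>\<^sup>+x. ennreal (w x) * indicator A x \<partial>m)"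
        using measure_preserving.preserving[OF measure_preserving_act[OF h(1)]] by simp
      also have "\<dots> = emeasure \<rho> A"
        unfolding \<rho>_def by (rule emeasure_density[symmetric]) auto
      finally show "emeasure (distr \<rho> BX (act h)) A = emeasure \<rho> A" .
    qed
  qed
  moreover have "invariant_prob \<Gamma> G (auslander G a) m"
    using inv auslander_fixes by (auto simp: invariant_prob_def)
  ultimately have "\<rho> = m" using uerg unfolding uniquely_ergodic_def by blast
  then have "density m (\<lambda>x. ennreal (w x)) = density m (\<lambda>_. 1)" by (simp add: \<rho>_def density_1)
  then have "AE x in m. ennreal (w x) = 1"
    by (intro m.density_unique) auto
  then have AE\<phi>: "AE x in m. \<phi> x = Z - b - 1"
  proof eventually_elim
    case (elim x)
    then have "w x = 1" by (simp add: ennreal_eq_1)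
    then show ?case using Z by (simp add: w_def field_simps)
  qed
  have "(\<lambda>k. (\<integral>x. mp.avg f k x \<partial>m) - (\<integral>x. \<phi> x \<partial>m)) \<longlonglongrightarrow> 0"
  proof (rule Lim_null_comparison[OF _ lim], intro always_eventually allI)
    fix k
    have ia: "integrable m (mp.avg f k)"
      by (rule m.integrable_bounded[of _ b]) (use avg_b space_m in auto)
    have "norm ((\<integral>x. mp.avg f k x \<partial>m) - (\<integral>x. \<phi> x \<partial>m)) = norm (\<integral>x. mp.avg f k x - \<phi> x \<partial>m)"
      using ia i\<phi> by simp
    also have "\<dots> \<le> (\<integral>x. norm (mp.avg f k x - \<phi> x) \<partial>m)" by (rule integral_norm_bound)
    finally show "norm ((\<integral>x. mp.avg f k x \<partial>m) - (\<integral>x. \<phi> x \<partial>m)) \<le> (\<integral>x. \<bar>mp.avg f k x - \<phi> x\<bar> \<partial>m)" by simp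
  qed
  moreover have "\<forall>\<^sub>F k in sequentially. (\<integral>x. mp.avg f k x \<partial>m) - (\<integral>x. \<phi> x \<partial>m) = (\<integral>x. f x \<partial>m) - (\<integral>x. \<phi> x \<partial>m)"
    using eventually_gt_at_top[of 0]
  proof eventually_elim
    case (elim k)
    have il: "integrable m (\<lambda>x. f ((act a ^^ l) x))" for l
      using fb act_pow_in[OF a] by (intro m.integrable_bounded[of _ b]) (auto simp: space_m)
    have "(\<integral>x. mp.avg f k x \<partial>m) = (\<Sum>l<k. \<integral>x. f ((act a ^^ l) x) \<partial>m) / real k"
      unfolding mp.avg_def using il by simp
    also have "\<dots> = (\<integral>x. f x \<partial>m)" using mp.integral_T_pow[OF fm] elim by simp
    finally show ?case by simp
  qed
  ultimately have "(\<lambda>k :: nat. (\<integral>x. f x \<partial>m) - (\<integral>x. \<phi> x \<partial>m)) \<longlonglongrightarrow> 0"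
    by (rule Lim_transform_eventually)
  then have "(\<integral>x. f x \<partial>m) = (\<integral>x. \<phi> x \<partial>m)" by (simp add: LIMSEQ_const_iff)
  with AE\<phi> show ?thesis by (simp add: Z_def)
qed

end

context invariant_measure
begin

theorem averages_converge_in_measure:
  assumes a: "a \<in> G" and uerg: "uniquely_ergodic \<Gamma> G (auslander G a)" and f: "f \<in> Cc \<Gamma> G" and e: "e > 0"
  shows "(\<lambda>k. measure m {x \<in> X. \<bar>(\<Sum>l<k. f ((act a ^^ l) x)) / real k - (\<integral>x. f x \<partial>m)\<bar> > e}) \<longlonglongrightarrow> 0"
proof -
  interpret mp: measure_preserving m "act a" by (rule measure_preserving_act[OF a])
  obtain b where b: "b > 0" "\<forall>x\<in>X. \<bar>f x\<bar> \<le> b" using Cc_bounded[OF f] by blast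
  have fm [measurable]: "f \<in> borel_measurable m"
    using Cc_measurable[OF f] measurable_cong_sets[OF sets_m refl] by blast
  have "\<exists>\<phi>\<in>borel_measurable m. (\<forall>x. \<bar>\<phi> x\<bar> \<le> b) \<and> (\<lambda>k. \<integral>x. \<bar>mp.avg f k x - \<phi> x\<bar> \<partial>m) \<longlonglongrightarrow> 0"
    by (rule mp.mean_ergodic[OF fm]) (use b space_m in auto)
  then obtain \<phi> where \<phi>: "\<phi> \<in> borel_measurable m" "\<forall>x. \<bar>\<phi> x\<bar> \<le> b"
    "(\<lambda>k. \<integral>x. \<bar>mp.avg f k x - \<phi> x\<bar> \<partial>m) \<longlonglongrightarrow> 0" by (elim bexE conjE)
  interpret ergodic_limit G \<Gamma> m a f \<phi> b
    by unfold_locales (use a f b \<phi> in auto)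
  note AE = \<phi>_constant[OF uerg]
  let ?c = "\<integral>x. f x \<partial>m"
  let ?u = "\<lambda>k x. \<bar>mp.avg f k x - ?c\<bar>"
  have u: "(\<integral>x. ?u k x \<partial>m) = (\<integral>x. \<bar>mp.avg f k x - \<phi> x\<bar> \<partial>m)" for k
    using AE by (intro integral_cong_AE) (auto elim!: eventually_mono)
  have iu: "integrable m (?u k)" for k
  proof (rule m.integrable_bounded[of _ "b + \<bar>?c\<bar>"])
    show "\<bar>?u k x\<bar> \<le> b + \<bar>?c\<bar>" if "x \<in> space m" for x
      using avg_b[of x k] that space_m by auto
  qed measurable
  have "(\<lambda>k. measure m {x \<in> X. ?u k x > e}) \<longlonglongrightarrow> 0"
  proof (rule Lim_null_comparison)
    have "(\<lambda>k. (\<integral>x. ?u k x \<partial>m) * (1 / e)) \<longlonglongrightarrow> 0 * (1 / e)"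
      unfolding u by (intro tendsto_mult tendsto_const lim)
    then show "(\<lambda>k. (\<integral>x. ?u k x \<partial>m) * (1 / e)) \<longlonglongrightarrow> 0" by simp
    show "\<forall>\<^sub>F k in sequentially. norm (measure m {x \<in> X. ?u k x > e}) \<le> (\<integral>x. ?u k x \<partial>m) * (1 / e)"
    proof (intro always_eventually allI)
      fix k
      let ?A = "{x \<in> X. ?u k x > e}"
      have A: "?A \<in> sets m"
      proof -
        have "?A = {x \<in> space m. ?u k x > e}" by (simp add: space_m)
        also have "\<dots> \<in> sets m" by measurable
        finally show ?thesis .
      qed
      have "e * measure m ?A = (\<integral>x. e * indicator ?A x \<partial>m)" 
      proof -
        have "?A \<inter> space m = ?A" by (auto simp: space_m)
        then show ?thesis using A by simp
      qed
      also have "\<dots> \<le> (\<integral>x. ?u k x \<partial>m)"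
      proof (rule integral_mono[OF _ iu])
        have "emeasure m ?A < \<infinity>" by (simp add: m.emeasure_eq_measure)
        then show "integrable m (\<lambda>x. e * indicator ?A x)"
          by (intro integrable_mult_right integrable_real_indicator A)
        show "e * indicator ?A x \<le> ?u k x" for x by (cases "x \<in> ?A") auto
      qed
      finally show "norm (measure m ?A) \<le> (\<integral>x. ?u k x \<partial>m) * (1 / e)" using e by (simp add: field_simps)
    qed
  qed
  then show ?thesis by (simp add: mp.avg_def)
qed

end

section \<open>Covering numbers of deviation sets in expanding plaques\<close>

text \<open>Points \<open>exp v exp w\<close> with \<open>v\<close>, \<open>w\<close> in small balls of \<open>g_minus\<close> and \<open>g_zero\<close> are referred to by \<open>P\<close> in
  the names below; under conjugation by positive powers of \<open>a\<close> they stay bounded, whereas \<open>exp y\<close> with \<open>y\<close> in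
  \<open>g_plus\<close> is expanded by the factor \<open>c\<close> exactly.\<close>

locale dynamics = expanding G a Bm Bz Bp c + invariant_measure G \<Gamma> m
  for G :: "(real^'n^'n) set" and a Bm Bz Bp c \<Gamma> m
begin

abbreviation "\<tau> \<equiv> \<bar>c\<bar>"
abbreviation "n \<equiv> card Bp"

lemma span_plus_G: "y \<in> span Bp \<Longrightarrow> mexp y \<in> G"
  using spans_lie(3) mexp_G by blast

lemma sball_plus_G: "y \<in> sball Bp r \<Longrightarrow> mexp y \<in> G"
  using sball_lie mexp_G by blast

lemma P_G: "v \<in> sball Bm r \<Longrightarrow> w \<in> sball Bz r' \<Longrightarrow> mexp v ** mexp w \<in> G"
  using sball_lie mexp_G mult_G by blast

lemma act_pow_conj:
  assumes "h \<in> G" "z \<in> X"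
  shows "(act a ^^ l) (act h z) = act (mpow a l ** h ** minv (mpow a l)) ((act a ^^ l) z)"
  using assms by (simp add: act_pow act_act flip: matrix_mul_assoc)

lemma act_pow_mexp_plus:
  assumes "y \<in> span Bp" "z \<in> X"
  shows "(act a ^^ l) (act (mexp y) z) = act (mexp (c ^ l *\<^sub>R y)) ((act a ^^ l) z)"
  using assms span_plus_G by (simp add: act_pow_conj conj_mexp Ad_pow_plus)

lemma conj_P:
  assumes v: "v \<in> sball Bm r" and w: "w \<in> sball Bz r"
  shows "mpow a l ** (mexp v ** mexp w) ** minv (mpow a l) = mexp ((Ad a ^^ l) v) ** mexp w"
proof -
  have "mpow a l ** (mexp v ** mexp w) ** minv (mpow a l)
      = mpow a l ** mexp v ** (minv (mpow a l) ** mpow a l) ** mexp w ** minv (mpow a l)"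
    by (simp add: matrix_mul_assoc)
  also have "\<dots> = (mpow a l ** mexp v ** minv (mpow a l)) ** (mpow a l ** mexp w ** minv (mpow a l))"
    by (simp only: matrix_mul_assoc)
  also have "\<dots> = mexp ((Ad a ^^ l) v) ** mexp ((Ad a ^^ l) w)" by (simp add: conj_mexp)
  finally show ?thesis using Ad_pow_zero[OF sball_span[OF w]] by simp
qed

lemma minv_conj: "p \<in> G \<Longrightarrow> q \<in> G \<Longrightarrow> minv (p ** q ** minv p) = p ** minv q ** minv p"
  by (simp add: minv_mult matrix_mul_assoc)

lemma act_pow_P:
  assumes "v \<in> sball Bm r" "w \<in> sball Bz r" "z \<in> X"
  shows "(act a ^^ l) (act (mexp v ** mexp w) z) = act (mexp ((Ad a ^^ l) v) ** mexp w) ((act a ^^ l) z)"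
  using assms P_G[OF assms(1,2)] by (simp add: act_pow_conj conj_P)

lemma act_plus_add:
  assumes "y \<in> span Bp" "u \<in> span Bp" "z \<in> X"
  shows "act (mexp (y + u)) z = act (mexp y) (act (mexp u) z)"
  using assms span_plus_G by (simp add: act_act mexp_add_plus)

lemma mexp_sball_near_one:
  assumes B: "independent B" and t: "t > 0"
  shows "\<exists>r>0. \<forall>v\<in>sball B r. norm (mexp (v :: real^'n^'n) - mat 1) \<le> t"
proof -
  obtain K where K: "K > 0" "\<forall>s\<ge>0. \<forall>v\<in>sball B s. norm v \<le> K * s" using norm_sball_le[OF B] by blast
  obtain d where d: "d > 0" "\<And>v :: real^'n^'n. dist v 0 < d \<Longrightarrow> dist (mexp v) (mexp 0) < t"
    using continuous_mexp t unfolding continuous_on_iff by (metis UNIV_I)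
  have "norm (mexp v - mat 1) \<le> t" if v: "v \<in> sball B (d / (2 * K))" for v
  proof -
    have "d / (2 * K) \<ge> 0" using d(1) K(1) by simp
    with K(2) v have "norm v \<le> K * (d / (2 * K))" by blast
    also have "\<dots> < d" using K(1) d(1) by simp
    finally show ?thesis using d(2)[of v] by (simp add: dist_norm)
  qed
  then show ?thesis using d(1) K(1) by (intro exI[of _ "d / (2 * K)"]) auto
qed

lemma norm_near_one_mult_diff_le:
  fixes p k :: "real^'n^'n"
  assumes "norm (p - mat 1) \<le> t" "norm (k - mat 1) \<le> t" "t \<le> 1"
  shows "norm (p ** k - mat 1) \<le> 3 * t"
proof -
  have t: "t \<ge> 0" using assms(1) norm_ge_zero order_trans by blast
  have "p ** k - mat 1 = (p - mat 1) ** (k - mat 1) + (p - mat 1) + (k - mat 1)"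
    by (simp add: mm.diff_left mm.diff_right)
  then have "norm (p ** k - mat 1) \<le> norm ((p - mat 1) ** (k - mat 1)) + norm (p - mat 1) + norm (k - mat 1)"
    by (metis (no_types, lifting) add_mono_thms_linordered_semiring(3) norm_triangle_ineq norm_triangle_le)
  also have "norm ((p - mat 1) ** (k - mat 1)) \<le> t * 1"
    using assms t by (intro order_trans[OF norm_matrix_mult_le mult_mono]) auto
  finally show ?thesis using assms by simp
qed

lemma P_near_one:
  assumes t: "t > 0"
  shows "\<exists>r>0. \<forall>v\<in>sball Bm r. \<forall>w\<in>sball Bz r.
    norm (mexp v ** mexp w - mat 1) \<le> t \<and> norm (minv (mexp v ** mexp w) - mat 1) \<le> t"
proof -
  obtain \<rho> where \<rho>: "\<rho> > 0" "\<rho> \<le> t" "\<And>h. h \<in> G \<Longrightarrow> norm (h - mat 1) < \<rho> \<Longrightarrow> norm (minv h - mat 1) < t"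
    using inverse_at_one[OF t] by blast
  define t' where "t' = min 1 (\<rho> / 6)"
  have t': "t' > 0" "t' \<le> 1" "3 * t' < \<rho>" using \<rho>(1) by (auto simp: t'_def)
  obtain r1 where r1: "r1 > 0" "\<And>v. v \<in> sball Bm r1 \<Longrightarrow> norm (mexp v - mat 1) \<le> t'"
    using mexp_sball_near_one[OF indep(1) t'(1)] by blast
  obtain r2 where r2: "r2 > 0" "\<And>v. v \<in> sball Bz r2 \<Longrightarrow> norm (mexp v - mat 1) \<le> t'"
    using mexp_sball_near_one[OF indep(2) t'(1)] by blast
  have "norm (mexp v ** mexp w - mat 1) \<le> t \<and> norm (minv (mexp v ** mexp w) - mat 1) \<le> t"
    if v: "v \<in> sball Bm (min r1 r2)" and w: "w \<in> sball Bz (min r1 r2)" for v w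
  proof -
    have "norm (mexp v - mat 1) \<le> t'" "norm (mexp w - mat 1) \<le> t'"
      using r1(2)[OF sball_mono[OF min.cobounded1 v]] r2(2)[OF sball_mono[OF min.cobounded2 w]] by auto
    from norm_near_one_mult_diff_le[OF this t'(2)]
    have "norm (mexp v ** mexp w - mat 1) < \<rho>" using t'(3) by simp
    then show ?thesis using \<rho>(2) \<rho>(3)[OF P_G[OF v w]] by simp
  qed
  then show ?thesis using r1(1) r2(1) by (intro exI[of _ "min r1 r2"]) auto
qed

text \<open>A displacement in the expanding direction which is small, and whose expansions by \<open>a\<close> up to
  time \<open>M\<close> stay within bounded distance of displacements \<open>d\<close> that are still small at time \<open>M\<close>, is of
  size \<open>\<tau> ^ -M\<close>: as long as \<open>c ^ l e0\<close> lies in the range where \<open>mexp\<close> is injective it is in fact much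
  smaller, so that one more multiplication by \<open>c\<close> does not leave this range.\<close>

lemma expanding_displacement:
  "\<exists>s1>0. \<forall>s. 0 < s \<and> s \<le> s1 \<longrightarrow> (\<exists>r>0. \<exists>\<theta>. 0 < \<theta> \<and> \<theta> \<le> 1 \<and>
     (\<forall>M v v' w w' d e0. v \<in> sball Bm r \<and> v' \<in> sball Bm r \<and> w \<in> sball Bz r \<and> w' \<in> sball Bz r \<and>
        d \<in> sball Bp (2 * \<theta> * s / \<tau> ^ M) \<and> e0 \<in> sball Bp (4 * s) \<and>
        mexp e0 = mexp v ** mexp w ** mexp d ** minv (mexp v' ** mexp w') \<longrightarrow> e0 \<in> sball Bp (s / \<tau> ^ M)))"
proof -
  obtain \<eta>0 where \<eta>0: "\<eta>0 > 0" "\<And>Y :: real^'n^'n. norm Y \<le> \<eta>0 \<Longrightarrow> norm Y \<le> 2 * norm (mexp Y - mat 1)"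
    using norm_le_mexp_diff by blast
  obtain K where K: "K > 0" "\<forall>s\<ge>0. \<forall>v\<in>sball Bp s. norm v \<le> K * s" using norm_sball_le[OF indep(3)] by blast
  show ?thesis
  proof (rule exI[of _ "\<eta>0 / (4 * K)"], intro conjI allI impI)
    show "\<eta>0 / (4 * K) > 0" using \<eta>0 K by simp
    fix s assume s: "0 < s \<and> s \<le> \<eta>0 / (4 * K)"
    obtain \<eta>1 where \<eta>1: "\<eta>1 > 0" "\<forall>v\<in>span Bp. norm v < \<eta>1 \<longrightarrow> v \<in> sball Bp s"
      using sball_contains_ball[OF indep(3)] s by blast
    define \<sigma> where "\<sigma> = min \<eta>1 (\<eta>0 / \<tau>) / 4"
    have \<sigma>: "\<sigma> > 0" "2 * \<sigma> < \<eta>1" "2 * \<sigma> * \<tau> \<le> \<eta>0"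
    proof -
      show p: "\<sigma> > 0" using \<eta>1(1) \<eta>0(1) by (simp add: \<sigma>_def)
      have "4 * \<sigma> = min \<eta>1 (\<eta>0 / \<tau>)" by (simp add: \<sigma>_def)
      then have le: "4 * \<sigma> \<le> \<eta>1" "4 * \<sigma> \<le> \<eta>0 / \<tau>" by auto
      show "2 * \<sigma> < \<eta>1" using le(1) p by linarith
      have "2 * \<sigma> \<le> \<eta>0 / \<tau>" using le(2) p by linarith
      then show "2 * \<sigma> * \<tau> \<le> \<eta>0" by (simp add: field_simps)
    qed
    define t where "t = min (1 / 3) (\<sigma> / 9)"
    have t: "t > 0" "3 * t \<le> 1" "9 * t \<le> \<sigma>" using \<sigma>(1) by (auto simp: t_def)
    obtain r where r: "r > 0" "\<And>v w. v \<in> sball Bm r \<Longrightarrow> w \<in> sball Bz r \<Longrightarrow>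
        norm (mexp v ** mexp w - mat 1) \<le> t \<and> norm (minv (mexp v ** mexp w) - mat 1) \<le> t"
      using P_near_one[OF t(1)] by blast
    obtain r' where r': "r' > 0" "\<And>d. d \<in> sball Bp r' \<Longrightarrow> norm (mexp d - mat 1) \<le> t"
      using mexp_sball_near_one[OF indep(3) t(1)] by blast
    define \<theta> where "\<theta> = min 1 (r' / (2 * s))"
    have \<theta>: "0 < \<theta>" "\<theta> \<le> 1" "2 * \<theta> * s \<le> r'"
    proof -
      show "0 < \<theta>" "\<theta> \<le> 1" using r'(1) s by (auto simp: \<theta>_def)
      have "\<theta> * (2 * s) \<le> (r' / (2 * s)) * (2 * s)" unfolding \<theta>_def using s by (intro mult_right_mono) auto
      then show "2 * \<theta> * s \<le> r'" using s by (simp add: mult_ac)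
    qed
    have main: "e0 \<in> sball Bp (s / \<tau> ^ M)"
      if v: "v \<in> sball Bm r" "v' \<in> sball Bm r" and w: "w \<in> sball Bz r" "w' \<in> sball Bz r"
        and d: "d \<in> sball Bp (2 * \<theta> * s / \<tau> ^ M)" and e0: "e0 \<in> sball Bp (4 * s)"
        and eq: "mexp e0 = mexp v ** mexp w ** mexp d ** minv (mexp v' ** mexp w')"
      for M v v' w w' d e0
    proof -
      have near: "norm (mexp (c ^ l *\<^sub>R e0) - mat 1) \<le> \<sigma>" if l: "l \<le> M" for l
      proof -
        let ?p = "mexp ((Ad a ^^ l) v) ** mexp w" and ?p' = "mexp ((Ad a ^^ l) v') ** mexp w'"
        let ?q = "mexp v' ** mexp w'" and ?A = "mpow a l"
        have q: "?q \<in> G" using P_G[OF v(2) w(2)] .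
        have inv: "?A ** minv ?q ** minv ?A = minv ?p'"
        proof -
          have "minv ?p' = minv (?A ** ?q ** minv ?A)" by (simp only: conj_P[OF v(2) w(2)])
          also have "\<dots> = ?A ** minv ?q ** minv ?A" by (rule minv_conj[OF mpow_G[OF a_G] q])
          finally show ?thesis by simp
        qed
        have "mexp (c ^ l *\<^sub>R e0) = ?A ** mexp e0 ** minv ?A"
          using Ad_pow_plus[OF sball_span[OF e0]] by (simp add: conj_mexp)
        also have "\<dots> = ?A ** (mexp v ** mexp w) ** (minv ?A ** ?A) ** mexp d ** (minv ?A ** ?A) ** minv ?q ** minv ?A"
          by (simp add: eq matrix_mul_assoc)
        also have "\<dots> = (?A ** (mexp v ** mexp w) ** minv ?A) ** (?A ** mexp d ** minv ?A) ** (?A ** minv ?q ** minv ?A)"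
          by (simp only: matrix_mul_assoc)
        also have "\<dots> = ?p ** mexp (c ^ l *\<^sub>R d) ** minv ?p'"
          using Ad_pow_plus[OF sball_span[OF d]] by (simp only: conj_P[OF v(1) w(1)] inv conj_mexp)
        finally have e: "mexp (c ^ l *\<^sub>R e0) = ?p ** mexp (c ^ l *\<^sub>R d) ** minv ?p'" .
        have "c ^ l *\<^sub>R d \<in> sball Bp r'"
        proof -
          have "c ^ l *\<^sub>R d \<in> sball Bp (\<bar>c ^ l\<bar> * (2 * \<theta> * s / \<tau> ^ M))"
            using d by (subst sball_scaleR[OF indep(3)]) auto
          moreover have "\<bar>c ^ l\<bar> * (2 * \<theta> * s / \<tau> ^ M) \<le> r'"
          proof -
            have "\<tau> ^ l \<le> \<tau> ^ M" using abs_c l by (intro power_increasing) auto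
            then have "\<tau> ^ l * (2 * \<theta> * s / \<tau> ^ M) \<le> \<tau> ^ M * (2 * \<theta> * s / \<tau> ^ M)"
              using \<theta>(1) s by (intro mult_right_mono) auto
            then show ?thesis using \<theta>(3) by (simp add: power_abs)
          qed
          ultimately show ?thesis by (rule sball_mono[rotated])
        qed
        then have "norm (mexp (c ^ l *\<^sub>R d) - mat 1) \<le> t" by (rule r')
        moreover have "norm (?p - mat 1) \<le> t" "norm (minv ?p' - mat 1) \<le> t"
          using r(2)[OF Ad_pow_sball_minus[OF v(1)] w(1)] r(2)[OF Ad_pow_sball_minus[OF v(2)] w(2)] by auto
        ultimately have "norm (?p ** mexp (c ^ l *\<^sub>R d) - mat 1) \<le> 3 * t" "norm (minv ?p' - mat 1) \<le> 3 * t"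
          using norm_near_one_mult_diff_le[of ?p t "mexp (c ^ l *\<^sub>R d)"] t by auto
        from norm_near_one_mult_diff_le[OF this t(2)] show ?thesis using t(3) by (simp add: e)
      qed
      have small: "norm (c ^ l *\<^sub>R e0) \<le> 2 * \<sigma>" if "l \<le> M" for l
        using that
      proof (induction l)
        case 0
        have "norm e0 \<le> K * (4 * s)" using K(2) e0 s by simp
        also have "\<dots> \<le> \<eta>0" using s K(1) by (simp add: field_simps)
        finally show ?case using \<eta>0(2)[of e0] near[of 0] by simp
      next
        case (Suc l)
        have "norm (c ^ Suc l *\<^sub>R e0) = \<tau> * norm (c ^ l *\<^sub>R e0)" by (simp add: abs_mult mult.assoc)
        also have "\<dots> \<le> \<tau> * (2 * \<sigma>)" using Suc by (intro mult_left_mono) auto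
        also have "\<dots> \<le> \<eta>0" using \<sigma>(3) by (simp add: mult_ac)
        finally show ?case using \<eta>0(2)[of "c ^ Suc l *\<^sub>R e0"] near[OF Suc.prems] by linarith
      qed
      have "c ^ M *\<^sub>R e0 \<in> span Bp" by (rule span_scale[OF sball_span[OF e0]])
      moreover have "norm (c ^ M *\<^sub>R e0) < \<eta>1" using small[OF order_refl] \<sigma>(2) by linarith
      ultimately have "c ^ M *\<^sub>R e0 \<in> sball Bp s" using \<eta>1(2) by blast
      then have "c ^ M *\<^sub>R e0 \<in> sball Bp (\<bar>c ^ M\<bar> * (s / \<tau> ^ M))" by (simp add: power_abs)
      then show ?thesis by (subst (asm) sball_scaleR[OF indep(3)]) auto
    qed
    show "\<exists>r>0. \<exists>\<theta>. 0 < \<theta> \<and> \<theta> \<le> 1 \<and>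
     (\<forall>M v v' w w' d e0. v \<in> sball Bm r \<and> v' \<in> sball Bm r \<and> w \<in> sball Bz r \<and> w' \<in> sball Bz r \<and>
        d \<in> sball Bp (2 * \<theta> * s / \<tau> ^ M) \<and> e0 \<in> sball Bp (4 * s) \<and>
        mexp e0 = mexp v ** mexp w ** mexp d ** minv (mexp v' ** mexp w') \<longrightarrow> e0 \<in> sball Bp (s / \<tau> ^ M))"
    proof (rule exI[of _ r], rule conjI[OF r(1)], rule exI[of _ \<theta>], intro conjI \<theta>(1,2) allI impI)
      fix M v v' w w' d e0
      assume H: "v \<in> sball Bm r \<and> v' \<in> sball Bm r \<and> w \<in> sball Bz r \<and> w' \<in> sball Bz r \<and>
        d \<in> sball Bp (2 * \<theta> * s / \<tau> ^ M) \<and> e0 \<in> sball Bp (4 * s) \<and>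
        mexp e0 = mexp v ** mexp w ** mexp d ** minv (mexp v' ** mexp w')"
      show "e0 \<in> sball Bp (s / \<tau> ^ M)" by (rule main[of v v' w w' d M e0]) (use H in blast)+
    qed
  qed
qed

text \<open>Covering numbers, at scale \<open>s / \<tau> ^ k\<close> and uniformly over all plaques of size \<open>s\<close>.\<close>

definition coverable :: "real \<Rightarrow> (real^'n^'n) set set \<Rightarrow> nat \<Rightarrow> real \<Rightarrow> bool" where
  "coverable s S k N \<longleftrightarrow> (\<forall>x\<in>X. \<exists>A. finite A \<and> A \<subseteq> span Bp \<and> real (card A) \<le> N \<and>
     (\<forall>y\<in>sball Bp s. act (mexp y) x \<in> S \<longrightarrow> (\<exists>u\<in>A. y - u \<in> sball Bp (s / \<tau> ^ k))))"

lemma coverable_X: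
  assumes s: "s > 0"
  shows "coverable s X k (4 ^ n * \<tau> ^ (n * k))"
  unfolding coverable_def
proof
  fix x assume "x \<in> X"
  have "s / \<tau> ^ k \<le> s" using s abs_c one_le_power[of \<tau> k] by (simp add: divide_le_eq)
  then obtain U where U: "finite U" "U \<subseteq> sball Bp (2 * s)" "real (card U) \<le> (4 * s / (s / \<tau> ^ k)) ^ n"
    "\<forall>y\<in>sball Bp s. \<exists>u\<in>U. y - u \<in> sball Bp (s / \<tau> ^ k)"
    using sball_grid[OF indep(3), of "s / \<tau> ^ k" s] s by auto
  have "4 * s / (s / \<tau> ^ k) = 4 * \<tau> ^ k" using s by simp
  then have pw: "(4 * s / (s / \<tau> ^ k)) ^ n = 4 ^ n * \<tau> ^ (n * k)"
    by (simp only: power_mult_distrib power_mult[symmetric] mult.commute[of k])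
  show "\<exists>A. finite A \<and> A \<subseteq> span Bp \<and> real (card A) \<le> 4 ^ n * \<tau> ^ (n * k) \<and>
     (\<forall>y\<in>sball Bp s. act (mexp y) x \<in> X \<longrightarrow> (\<exists>u\<in>A. y - u \<in> sball Bp (s / \<tau> ^ k)))"
  proof (intro exI[of _ U] conjI)
    show "finite U" by (rule U(1))
    show "U \<subseteq> span Bp" using U(2) sball_span by blast
    show "real (card U) \<le> 4 ^ n * \<tau> ^ (n * k)" using U(3) unfolding pw .
    show "\<forall>y\<in>sball Bp s. act (mexp y) x \<in> X \<longrightarrow> (\<exists>u\<in>U. y - u \<in> sball Bp (s / \<tau> ^ k))"
      using U(4) by blast
  qed
qed

text \<open>A cell of scale \<open>s / \<tau> ^ i\<close> is expanded by the \<open>i\<close>-th power of the map onto a plaque of size \<open>s\<close>.\<close>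

lemma coverable_compose:
  assumes S0: "coverable s S0 i N0" and S: "coverable s S k N" and N: "N \<ge> 0"
  shows "coverable s {z \<in> S0. (act a ^^ i) z \<in> S} (i + k) (N0 * N)"
  unfolding coverable_def
proof
  fix x assume x: "x \<in> X"
  from bspec[OF S0[unfolded coverable_def] x]
  obtain A where A: "finite A" "A \<subseteq> span Bp" "real (card A) \<le> N0"
    "\<forall>y\<in>sball Bp s. act (mexp y) x \<in> S0 \<longrightarrow> (\<exists>u\<in>A. y - u \<in> sball Bp (s / \<tau> ^ i))"
    by (elim exE conjE)
  let ?x = "\<lambda>u. (act a ^^ i) (act (mexp u) x)"
  have xX: "?x u \<in> X" if "u \<in> A" for u
    using that A(2) x span_plus_G by (intro act_pow_in[OF a_G] act_in) auto
  have "\<forall>u\<in>A. \<exists>B. finite B \<and> B \<subseteq> span Bp \<and> real (card B) \<le> N \<and>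
     (\<forall>y\<in>sball Bp s. act (mexp y) (?x u) \<in> S \<longrightarrow> (\<exists>u\<in>B. y - u \<in> sball Bp (s / \<tau> ^ k)))"
    using bspec[OF S[unfolded coverable_def] xX] by (intro ballI)
  from bchoice[OF this] obtain B where BB: "\<forall>u\<in>A. finite (B u) \<and> B u \<subseteq> span Bp \<and> real (card (B u)) \<le> N \<and>
     (\<forall>y\<in>sball Bp s. act (mexp y) (?x u) \<in> S \<longrightarrow> (\<exists>u'\<in>B u. y - u' \<in> sball Bp (s / \<tau> ^ k)))" ..
  have B: "finite (B u)" "B u \<subseteq> span Bp" "real (card (B u)) \<le> N"
    "\<forall>y\<in>sball Bp s. act (mexp y) (?x u) \<in> S \<longrightarrow> (\<exists>u'\<in>B u. y - u' \<in> sball Bp (s / \<tau> ^ k))"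
    if "u \<in> A" for u
    using bspec[OF BB that] by simp_all
  define C where "C = (\<Union>u\<in>A. (\<lambda>u'. u + (1 / c ^ i) *\<^sub>R u') ` B u)"
  have "finite C" unfolding C_def using A(1) B(1) by auto
  moreover have "C \<subseteq> span Bp"
  proof
    fix y assume "y \<in> C"
    then obtain u u' where "u \<in> A" "u' \<in> B u" "y = u + (1 / c ^ i) *\<^sub>R u'" unfolding C_def by blast
    moreover have "u \<in> span Bp" "u' \<in> span Bp" using A(2) B(2) calculation by auto
    ultimately show "y \<in> span Bp" by (simp only: span_add span_scale)
  qed
  moreover have "real (card C) \<le> N0 * N"
  proof -
    have "card C \<le> (\<Sum>u\<in>A. card ((\<lambda>u'. u + (1 / c ^ i) *\<^sub>R u') ` B u))" unfolding C_def by (rule card_UN_le[OF A(1)])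
    also have "\<dots> \<le> (\<Sum>u\<in>A. card (B u))" by (rule sum_mono) (rule card_image_le[OF B(1)])
    finally have "real (card C) \<le> real (\<Sum>u\<in>A. card (B u))" by (rule of_nat_mono)
    also have "\<dots> = (\<Sum>u\<in>A. real (card (B u)))" by (rule of_nat_sum)
    also have "\<dots> \<le> (\<Sum>u\<in>A. N)" by (intro sum_mono B(3))
    also have "\<dots> = real (card A) * N" by simp
    also have "\<dots> \<le> N0 * N" using A(3) N by (rule mult_right_mono)
    finally show ?thesis .
  qed
  moreover have "\<exists>u\<in>C. y - u \<in> sball Bp (s / \<tau> ^ (i + k))"
    if y: "y \<in> sball Bp s" "act (mexp y) x \<in> {z \<in> S0. (act a ^^ i) z \<in> S}" for y
  proof -
    have "\<exists>u\<in>A. y - u \<in> sball Bp (s / \<tau> ^ i)" using bspec[OF A(4) y(1)] y(2) by simp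
    then obtain u where u: "u \<in> A" "y - u \<in> sball Bp (s / \<tau> ^ i)" ..
    have uspan: "u \<in> span Bp" using A(2) u(1) by blast
    let ?y = "c ^ i *\<^sub>R (y - u)"
    have "?y \<in> sball Bp (\<bar>c ^ i\<bar> * (s / \<tau> ^ i))" using u(2) by (subst sball_scaleR[OF indep(3)]) auto
    then have ys: "?y \<in> sball Bp s" by (simp add: power_abs)
    have "act (mexp y) x = act (mexp (y - u)) (act (mexp u) x)"
      using act_plus_add[OF sball_span[OF u(2)] uspan x] by simp
    then have "(act a ^^ i) (act (mexp y) x) = act (mexp ?y) (?x u)"
      using act_pow_mexp_plus[OF sball_span[OF u(2)] act_in[OF span_plus_G[OF uspan] x]] by simp
    then have "\<exists>u'\<in>B u. ?y - u' \<in> sball Bp (s / \<tau> ^ k)"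
      using bspec[OF B(4)[OF u(1)] ys] y(2) by simp
    then obtain u' where u': "u' \<in> B u" "?y - u' \<in> sball Bp (s / \<tau> ^ k)" ..
    have "(1 / c ^ i) *\<^sub>R (?y - u') \<in> sball Bp (\<bar>1 / c ^ i\<bar> * (s / \<tau> ^ k))"
      using u'(2) by (subst sball_scaleR[OF indep(3)]) auto
    moreover have "(1 / c ^ i) *\<^sub>R (?y - u') = y - (u + (1 / c ^ i) *\<^sub>R u')"
      by (simp add: scaleR_diff_right)
    moreover have "\<bar>1 / c ^ i\<bar> * (s / \<tau> ^ k) = s / \<tau> ^ (i + k)" by (simp add: power_abs power_add)
    ultimately have "y - (u + (1 / c ^ i) *\<^sub>R u') \<in> sball Bp (s / \<tau> ^ (i + k))" by (simp only:)
    moreover have "u + (1 / c ^ i) *\<^sub>R u' \<in> C" unfolding C_def using u(1) u'(1) by blast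
    ultimately show ?thesis by blast
  qed
  ultimately show "\<exists>A. finite A \<and> A \<subseteq> span Bp \<and> real (card A) \<le> N0 * N \<and>
     (\<forall>y\<in>sball Bp s. act (mexp y) x \<in> {z \<in> S0. (act a ^^ i) z \<in> S} \<longrightarrow> (\<exists>u\<in>A. y - u \<in> sball Bp (s / \<tau> ^ (i + k))))"
    by (intro exI[of _ C]) blast
qed

lemma coverable_mono: "coverable s S k N \<Longrightarrow> S' \<subseteq> S \<Longrightarrow> N \<le> N' \<Longrightarrow> coverable s S' k N'"
  unfolding coverable_def by (meson order_trans subsetD)

text \<open>Each of the \<open>q\<close> blocks of length \<open>M\<close> is covered with the full number \<open>4 ^ n * \<tau> ^ (n * M)\<close> of cells or, at
  the times in \<open>J\<close>, with only \<open>\<epsilon> * \<tau> ^ (n * M)\<close> of them.\<close>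

lemma coverable_blocks:
  assumes s: "s > 0" and B: "coverable s B M (\<epsilon> * \<tau> ^ (n * M))" and BX: "B \<subseteq> X" and \<epsilon>: "\<epsilon> \<ge> 0" and J: "J \<subseteq> {..<q}"
  shows "coverable s {z \<in> X. \<forall>j\<in>J. (act a ^^ (M * j)) z \<in> B} (M * q) (\<epsilon> ^ card J * (4 ^ n) ^ q * \<tau> ^ (n * (M * q)))"
  using J
proof (induction q arbitrary: J)
  case 0
  then have "J = {}" by auto
  then show ?case
    unfolding coverable_def by (auto intro!: exI[of _ "{0}"] simp: span_zero)
next
  case (Suc q)
  let ?J = "{j. Suc j \<in> J}"
  let ?S = "{z \<in> X. \<forall>j\<in>?J. (act a ^^ (M * j)) z \<in> B}"
  let ?N = "\<epsilon> ^ card ?J * (4 ^ n) ^ q * \<tau> ^ (n * (M * q))"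
  have J': "?J \<subseteq> {..<q}" using Suc.prems by auto
  have finJ: "finite J" using Suc.prems finite_subset by blast
  have IH: "coverable s ?S (M * q) ?N" by (rule Suc.IH[OF J'])
  have N: "?N \<ge> 0" using \<epsilon> by simp
  have img: "Suc ` ?J = J - {0}"
  proof
    show "J - {0} \<subseteq> Suc ` ?J"
    proof
      fix j assume "j \<in> J - {0}"
      then show "j \<in> Suc ` ?J" by (cases j) auto
    qed
  qed auto
  have cJ: "card (J - {0}) = card ?J" unfolding img[symmetric] by (rule card_image) auto
  have shift: "(act a ^^ (M * Suc j)) z = (act a ^^ (M * j)) ((act a ^^ M) z)" for j z
    by (simp add: funpow_add add.commute[of M])
  have M: "M * Suc q = M + M * q" by simp
  show ?case
  proof (cases "0 \<in> J")
    case True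
    have "card J = Suc (card ?J)" using card_Suc_Diff1[OF finJ True] cJ by simp
    moreover have "coverable s {z \<in> B. (act a ^^ M) z \<in> ?S} (M + M * q) (\<epsilon> * \<tau> ^ (n * M) * ?N)"
      by (rule coverable_compose[OF B IH N])
    moreover have "{z \<in> X. \<forall>j\<in>J. (act a ^^ (M * j)) z \<in> B} \<subseteq> {z \<in> B. (act a ^^ M) z \<in> ?S}"
      using True act_pow_in[OF a_G] by (auto simp flip: shift)
    moreover have "\<epsilon> * \<tau> ^ (n * M) * ?N \<le> \<epsilon> ^ Suc (card ?J) * (4 ^ n) ^ Suc q * \<tau> ^ (n * (M + M * q))"
    proof -
      have "\<epsilon> * \<tau> ^ (n * M) * ?N = 1 * (\<epsilon> ^ Suc (card ?J) * (4 ^ n) ^ q * \<tau> ^ (n * (M + M * q)))"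
        by (simp add: power_add distrib_left)
      also have "\<dots> \<le> 4 ^ n * (\<epsilon> ^ Suc (card ?J) * (4 ^ n) ^ q * \<tau> ^ (n * (M + M * q)))"
        using \<epsilon> by (intro mult_right_mono) auto
      finally show ?thesis by (simp add: mult_ac)
    qed
    ultimately show ?thesis unfolding M by (simp only:) (rule coverable_mono)
  next
    case False
    then have "card J = card ?J" using cJ by simp
    moreover have "coverable s {z \<in> X. (act a ^^ M) z \<in> ?S} (M + M * q) (4 ^ n * \<tau> ^ (n * M) * ?N)"
      by (rule coverable_compose[OF coverable_X[OF s] IH N])
    moreover have "{z \<in> X. \<forall>j\<in>J. (act a ^^ (M * j)) z \<in> B} \<subseteq> {z \<in> X. (act a ^^ M) z \<in> ?S}"
      using act_pow_in[OF a_G] by (auto simp flip: shift)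
    moreover have "4 ^ n * \<tau> ^ (n * M) * ?N \<le> \<epsilon> ^ card ?J * (4 ^ n) ^ Suc q * \<tau> ^ (n * (M + M * q))"
      by (simp add: power_add distrib_left mult_ac)
    ultimately show ?thesis unfolding M by (simp only:) (rule coverable_mono)
  qed
qed

end

context dynamics
begin

lemma c_pow_sball:
  assumes "y \<in> sball Bp r"
  shows "c ^ l *\<^sub>R y \<in> sball Bp (\<tau> ^ l * r)"
proof -
  have "c ^ l *\<^sub>R y \<in> sball Bp (\<bar>c ^ l\<bar> * r)" using assms by (subst sball_scaleR[OF indep(3)]) auto
  then show ?thesis by (simp add: power_abs)
qed

definition dev :: "((real^'n^'n) set \<Rightarrow> real) \<Rightarrow> nat \<Rightarrow> (real^'n^'n) set \<Rightarrow> real" where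
  "dev f M z = \<bar>(\<Sum>l<M. f ((act a ^^ l) z)) / real M - (\<integral>x. f x \<partial>m)\<bar>"

lemma dev_measurable:
  assumes "f \<in> borel_measurable BX"
  shows "dev f M \<in> borel_measurable BX"
proof -
  have [measurable]: "(\<lambda>z. f ((act a ^^ l) z)) \<in> borel_measurable BX" for l
    by (rule measurable_compose[OF measurable_act_pow[OF a_G] assms])
  show ?thesis unfolding dev_def[abs_def] by measurable
qed

lemma dev_diff_le:
  assumes "\<And>l. l < M \<Longrightarrow> \<bar>f ((act a ^^ l) z') - f ((act a ^^ l) z)\<bar> \<le> \<beta> l"
  shows "\<bar>dev f M z' - dev f M z\<bar> \<le> (\<Sum>l<M. \<beta> l) / real M"
proof -
  let ?S = "\<lambda>z. \<Sum>l<M. f ((act a ^^ l) z)"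
  have "\<bar>?S z' - ?S z\<bar> = \<bar>\<Sum>l<M. f ((act a ^^ l) z') - f ((act a ^^ l) z)\<bar>" by (simp add: sum_subtractf)
  also have "\<dots> \<le> (\<Sum>l<M. \<bar>f ((act a ^^ l) z') - f ((act a ^^ l) z)\<bar>)" by (rule sum_abs)
  also have "\<dots> \<le> (\<Sum>l<M. \<beta> l)" using assms by (intro sum_mono) simp
  finally have "\<bar>?S z' - ?S z\<bar> / real M \<le> (\<Sum>l<M. \<beta> l) / real M" by (rule divide_right_mono) simp
  moreover have "\<bar>dev f M z' - dev f M z\<bar> \<le> \<bar>?S z' / real M - ?S z / real M\<bar>" unfolding dev_def by linarith
  moreover have "\<bar>?S z' / real M - ?S z / real M\<bar> = \<bar>?S z' - ?S z\<bar> / real M"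
    by (simp add: abs_divide flip: diff_divide_distrib)
  ultimately show ?thesis by linarith
qed

text \<open>Displacements in the contracting and neutral directions do not grow, so that they change the
  time averages by little, whatever the length of the orbit.\<close>

lemma dev_P:
  assumes f: "f \<in> Cc \<Gamma> G" and e: "e > 0"
  shows "\<exists>s>0. \<forall>v\<in>sball Bm s. \<forall>w\<in>sball Bz s. \<forall>z\<in>X. \<forall>M.
    \<bar>dev f M (act (mexp v ** mexp w) z) - dev f M z\<bar> \<le> e"
proof -
  obtain \<rho> where \<rho>: "\<rho> > 0" "\<And>h x. h \<in> G \<Longrightarrow> x \<in> X \<Longrightarrow> norm (h - mat 1) < \<rho> \<Longrightarrow> \<bar>f (act h x) - f x\<bar> < e"
    using Cc_uniformly_continuous[OF f e] by blast
  have "\<rho> / 2 > 0" using \<rho>(1) by simp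
  from P_near_one[OF this] obtain s where s: "s > 0" "\<And>v w. v \<in> sball Bm s \<Longrightarrow> w \<in> sball Bz s \<Longrightarrow>
    norm (mexp v ** mexp w - mat 1) \<le> \<rho> / 2" by blast
  have "\<bar>dev f M (act (mexp v ** mexp w) z) - dev f M z\<bar> \<le> e"
    if v: "v \<in> sball Bm s" and w: "w \<in> sball Bz s" and z: "z \<in> X" for v w z M
  proof -
    have "\<bar>f ((act a ^^ l) (act (mexp v ** mexp w) z)) - f ((act a ^^ l) z)\<bar> \<le> e" for l
    proof -
      note v' = Ad_pow_sball_minus[OF v, of l]
      have "norm (mexp ((Ad a ^^ l) v) ** mexp w - mat 1) < \<rho>" using s(2)[OF v' w] \<rho>(1) by linarith
      from \<rho>(2)[OF P_G[OF v' w] act_pow_in[OF a_G z, of l] this]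
      show ?thesis by (simp add: act_pow_P[OF v w z])
    qed
    from dev_diff_le[of M f _ z "\<lambda>_. e", OF this]
    have "\<bar>dev f M (act (mexp v ** mexp w) z) - dev f M z\<bar> \<le> (\<Sum>l<M. e) / real M" .
    also have "\<dots> \<le> e" using e by simp
    finally show ?thesis .
  qed
  then show ?thesis using s(1) by blast
qed

text \<open>A displacement of size \<open>\<tau> ^ -M\<close> in the expanding direction stays small except for the last few
  of the first \<open>M\<close> steps.\<close>

lemma dev_plus:
  assumes f: "f \<in> Cc \<Gamma> G" and e: "e > 0" and s: "s > 0"
  shows "\<exists>M1. \<forall>M\<ge>M1. \<forall>y\<in>sball Bp (s / \<tau> ^ M). \<forall>z\<in>X.
    \<bar>dev f M (act (mexp y) z) - dev f M z\<bar> \<le> 2 * e"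
proof -
  obtain \<rho> where \<rho>: "\<rho> > 0" "\<And>h x. h \<in> G \<Longrightarrow> x \<in> X \<Longrightarrow> norm (h - mat 1) < \<rho> \<Longrightarrow> \<bar>f (act h x) - f x\<bar> < e"
    using Cc_uniformly_continuous[OF f e] by blast
  have "\<rho> / 2 > 0" using \<rho>(1) by simp
  from mexp_sball_near_one[OF indep(3) this]
  obtain r where r: "r > 0" "\<And>v. v \<in> sball Bp r \<Longrightarrow> norm (mexp v - mat 1) \<le> \<rho> / 2" by blast
  obtain b where b: "b > 0" "\<And>x. x \<in> X \<Longrightarrow> \<bar>f x\<bar> \<le> b" using Cc_bounded[OF f] by blast
  obtain l0 where l0: "s / r < \<tau> ^ l0" using real_arch_pow[OF abs_c] by blast
  have l0': "s / \<tau> ^ l0 \<le> r"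
  proof -
    have "s < \<tau> ^ l0 * r" using l0 r(1) by (simp add: pos_divide_less_eq)
    then show ?thesis by (simp add: divide_le_eq mult.commute)
  qed
  obtain M1 where M1: "2 * b * real l0 / e \<le> real M1" using real_arch_simple by blast
  have "\<bar>dev f M (act (mexp y) z) - dev f M z\<bar> \<le> 2 * e"
    if M: "M \<ge> Suc M1" and y: "y \<in> sball Bp (s / \<tau> ^ M)" and z: "z \<in> X" for M y z
  proof -
    define \<beta> where "\<beta> l = (if M < l + l0 then 2 * b else 0) + e" for l
    have \<beta>: "\<bar>f ((act a ^^ l) (act (mexp y) z)) - f ((act a ^^ l) z)\<bar> \<le> \<beta> l" for l
    proof -
      have zl: "(act a ^^ l) z \<in> X" by (rule act_pow_in[OF a_G z])
      have yl: "c ^ l *\<^sub>R y \<in> sball Bp (\<tau> ^ l * (s / \<tau> ^ M))" by (rule c_pow_sball[OF y])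
      have eq: "(act a ^^ l) (act (mexp y) z) = act (mexp (c ^ l *\<^sub>R y)) ((act a ^^ l) z)"
        by (rule act_pow_mexp_plus[OF sball_span[OF y] z])
      show ?thesis
      proof (cases "M < l + l0")
        case True
        have "\<bar>f (act (mexp (c ^ l *\<^sub>R y)) ((act a ^^ l) z))\<bar> \<le> b"
          by (rule b(2)[OF act_in[OF sball_plus_G[OF yl] zl]])
        moreover have "\<bar>f ((act a ^^ l) z)\<bar> \<le> b" by (rule b(2)[OF zl])
        ultimately show ?thesis using True e by (simp add: \<beta>_def eq)
      next
        case False
        then obtain j where j: "M = l + l0 + j" using le_Suc_ex not_less by blast
        have "\<tau> ^ l * (s / \<tau> ^ M) = (s / \<tau> ^ l0) / \<tau> ^ j" by (simp add: j power_add)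
        also have "\<dots> \<le> (s / \<tau> ^ l0) / 1" using s abs_c one_le_power[of \<tau> j] by (intro divide_left_mono) auto
        also have "\<dots> \<le> r" using l0' by simp
        finally have "norm (mexp (c ^ l *\<^sub>R y) - mat 1) \<le> \<rho> / 2" by (rule r(2)[OF sball_mono[OF _ yl]])
        then have "norm (mexp (c ^ l *\<^sub>R y) - mat 1) < \<rho>" using \<rho>(1) by linarith
        from \<rho>(2)[OF sball_plus_G[OF yl] zl this] show ?thesis using False by (simp add: \<beta>_def eq)
      qed
    qed
    have "(\<Sum>l<M. \<beta> l) = 2 * b * real (card {l\<in>{..<M}. M < l + l0}) + real M * e"
      by (simp add: \<beta>_def sum.distrib sum.If_cases Int_def mult.commute)
    also have "card {l\<in>{..<M}. M < l + l0} \<le> card {M - l0..<M}" by (intro card_mono) auto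
    also have "card {M - l0..<M} \<le> l0" by simp
    finally have "(\<Sum>l<M. \<beta> l) \<le> 2 * b * real l0 + real M * e" using b(1) by simp
    also have "2 * b * real l0 \<le> real M1 * e" using M1 e by (simp add: pos_divide_le_eq)
    also have "real M1 * e \<le> real M * e" using M e by simp
    finally have "(\<Sum>l<M. \<beta> l) \<le> (2 * e) * real M" by simp
    then have "(\<Sum>l<M. \<beta> l) / real M \<le> 2 * e" using M by (simp add: pos_divide_le_eq)
    with dev_diff_le[OF \<beta>, of M] show ?thesis by linarith
  qed
  then show ?thesis by (intro exI[of _ "Suc M1"] allI impI ballI) 
qed

text \<open>Integrating the number of \<open>u\<close> with \<open>act (mexp u) z\<close> in \<open>E\<close> over all \<open>z\<close> gives \<open>card U\<close> times the
  measure of \<open>E\<close>, by invariance; it cannot be too large on all of \<open>N\<close>.\<close>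

lemma good_base_point:
  assumes U: "finite U" "U \<subseteq> span Bp" and E: "E \<in> sets BX" and N: "N \<in> sets BX" "N \<noteq> {}"
    and c0: "c0 > 0" "c0 \<le> measure m N" and t: "measure m E < t"
  shows "\<exists>z\<in>N. real (card {u\<in>U. act (mexp u) z \<in> E}) * c0 \<le> real (card U) * t"
proof (cases "U = {}")
  case True
  then show ?thesis using N(2) by auto
next
  case False
  then have cU: "real (card U) > 0" using U(1) by (simp add: card_gt_0_iff)
  let ?F = "\<lambda>z. \<Sum>u\<in>U. indicator {z \<in> X. act (mexp u) z \<in> E} z :: real"
  have meas: "{z \<in> X. act (mexp u) z \<in> E} \<in> sets m" if "u \<in> U" for u
  proof -
    have "mexp u \<in> G" using span_plus_G U(2) that by blast
    from measurable_sets[OF measurable_act[OF this] E] have "act (mexp u) -` E \<inter> X \<in> sets m"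
      by (simp add: sets_m)
    moreover have "act (mexp u) -` E \<inter> X = {z \<in> X. act (mexp u) z \<in> E}" by blast
    ultimately show ?thesis by simp
  qed
  have mE: "measure m {z \<in> X. act (mexp u) z \<in> E} = measure m E" if "u \<in> U" for u
  proof -
    have "mexp u \<in> G" using span_plus_G U(2) that by blast
    from emeasure_act[OF this E] show ?thesis by (simp add: measure_def)
  qed
  have ind: "integrable m (indicator A :: _ \<Rightarrow> real)" if "A \<in> sets m" for A
    using that m.emeasure_finite[of A] by (simp add: integrable_indicator_iff less_top[symmetric])
  have int: "integrable m ?F" by (rule Bochner_Integration.integrable_sum) (rule ind[OF meas])
  have tot: "(\<integral>z. ?F z \<partial>m) = real (card U) * measure m E"
  proof -
    have "(\<integral>z. ?F z \<partial>m) = (\<Sum>u\<in>U. \<integral>z. indicator {z \<in> X. act (mexp u) z \<in> E} z \<partial>m)"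
      by (rule Bochner_Integration.integral_sum) (rule ind[OF meas])
    also have "\<dots> = (\<Sum>u\<in>U. measure m E)"
    proof (rule sum.cong[OF refl])
      fix u assume u: "u \<in> U"
      have "{z \<in> X. act (mexp u) z \<in> E} \<inter> space m = {z \<in> X. act (mexp u) z \<in> E}" by (auto simp: space_m)
      then show "(\<integral>z. indicator {z \<in> X. act (mexp u) z \<in> E} z \<partial>m) = measure m E" using mE[OF u] by simp
    qed
    finally show ?thesis by simp
  qed
  have NX: "N \<subseteq> X" using sets.sets_into_space[OF N(1)] by simp
  have F: "?F z = real (card {u\<in>U. act (mexp u) z \<in> E})" if "z \<in> X" for z
  proof -
    have "?F z = (\<Sum>u\<in>U. if act (mexp u) z \<in> E then 1 else 0)" using that by (intro sum.cong) auto
    also have "\<dots> = real (card {u\<in>U. act (mexp u) z \<in> E})" using U(1) by (simp add: sum.If_cases Int_def)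
    finally show ?thesis .
  qed
  show ?thesis
  proof (rule ccontr)
    assume neg: "\<not> ?thesis"
    let ?\<alpha> = "real (card U) * t / c0"
    have big: "?\<alpha> \<le> ?F z" if "z \<in> N" for z
    proof -
      have "real (card U) * t < real (card {u\<in>U. act (mexp u) z \<in> E}) * c0" using neg that by (meson not_le)
      then show ?thesis using F[of z] NX that c0(1) by (simp add: pos_divide_le_eq subset_iff)
    qed
    have intN: "integrable m (\<lambda>z. ?\<alpha> * indicator N z)"
      using ind[of N] N(1) by (simp add: sets_m)
    have t0: "t \<ge> 0" using t measure_nonneg[of m E] by linarith
    have "real (card U) * t = ?\<alpha> * c0" using c0(1) by simp
    also have "\<dots> \<le> ?\<alpha> * measure m N"
      by (rule mult_left_mono[OF c0(2)]) (use c0(1) t0 in simp)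
    also have "\<dots> = (\<integral>z. ?\<alpha> * indicator N z \<partial>m)" using NX by (simp add: space_m Int_absorb2)
    also have "\<dots> \<le> (\<integral>z. ?F z \<partial>m)"
    proof (rule integral_mono[OF intN int])
      fix z assume "z \<in> space m"
      show "?\<alpha> * indicator N z \<le> ?F z"
        by (cases "z \<in> N") (use big in \<open>auto intro!: sum_nonneg\<close>)
    qed
    also have "\<dots> = real (card U) * measure m E" by (rule tot)
    finally show False using t cU by simp
  qed
qed

text \<open>Conjugation by a bounded set of elements is continuous at the identity.\<close>

lemma conj_near_one:
  assumes \<rho>: "\<rho> > 0" and r: "r > 0"
  shows "\<exists>\<rho>'>0. \<forall>y\<in>sball Bp r. \<forall>g\<in>G. norm (g - mat 1) < \<rho>' \<longrightarrow>
    norm (mexp y ** minv g ** mexp (- y) - mat 1) < \<rho>"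
proof -
  obtain K where K: "K > 0" "\<forall>s\<ge>0. \<forall>v\<in>sball Bp s. norm v \<le> K * s" using norm_sball_le[OF indep(3)] by blast
  have "compact (mexp ` cball (0::real^'n^'n) (K * r))"
    by (intro compact_continuous_image continuous_on_subset[OF continuous_mexp]) auto
  then have "bounded (mexp ` cball (0::real^'n^'n) (K * r))" by (rule compact_imp_bounded)
  then obtain E where E0: "E > 0" "\<forall>Z\<in>mexp ` cball (0::real^'n^'n) (K * r). norm Z \<le> E"
    unfolding bounded_pos by blast
  have E: "E > 0" "norm (mexp Y) \<le> E" if "norm Y \<le> K * r" for Y :: "real^'n^'n"
    using E0 that by auto
  have "\<rho> / (E * E) > 0" using \<rho> E0(1) by simp
  from inverse_at_one[OF this] obtain \<rho>' where \<rho>': "\<rho>' > 0" "\<And>h. h \<in> G \<Longrightarrow> norm (h - mat 1) < \<rho>' \<Longrightarrow> norm (minv h - mat 1) < \<rho> / (E * E)"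
    by blast
  have "norm (mexp y ** minv g ** mexp (- y) - mat 1) < \<rho>"
    if y: "y \<in> sball Bp r" and g: "g \<in> G" "norm (g - mat 1) < \<rho>'" for y g
  proof -
    have "norm y \<le> K * r" using K(2) y r by simp
    then have b: "norm (mexp y) \<le> E" "norm (mexp (- y)) \<le> E" using E(2)[of y] E(2)[of "- y"] by auto
    have "mexp y ** mexp (- y) = mat 1" using mexp_minus(1)[of y] by simp
    then have "mexp y ** minv g ** mexp (- y) - mat 1 = mexp y ** (minv g - mat 1) ** mexp (- y)"
      by (simp add: mm.diff_left mm.diff_right)
    then have "norm (mexp y ** minv g ** mexp (- y) - mat 1) \<le> norm (mexp y ** (minv g - mat 1)) * norm (mexp (- y))"
      using norm_matrix_mult_le by metis
    also have "\<dots> \<le> (norm (mexp y) * norm (minv g - mat 1)) * norm (mexp (- y))"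
      by (intro mult_right_mono norm_matrix_mult_le) auto
    also have "\<dots> \<le> (E * norm (minv g - mat 1)) * E"
      using b E0(1) by (intro mult_mono mult_right_mono) auto
    also have "\<dots> = norm (minv g - mat 1) * (E * E)" by simp
    also have "\<dots> < \<rho>" using \<rho>'(2)[OF g] E0(1) by (simp add: pos_less_divide_eq)
    finally show ?thesis .
  qed
  then show ?thesis using \<rho>'(1) by blast
qed

text \<open>If the points \<open>exp y . x\<close> with \<open>y\<close> of size \<open>s\<close> were bad for more than a small proportion of
  cells of size \<open>s / \<tau> ^ M\<close>, then the same would hold, up to changing \<open>f\<close>-averages by a small amount,
  along the plaques through all points close to a bad one. Since these points form a set of mass
  bounded from below, this contradicts the convergence of the averages in measure. The cells of two
  nearby plaques are compared by sliding along the contracting and neutral directions; by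
  \<open>expanding_displacement\<close> this does not merge cells which are further apart than their size.\<close>

lemma bad_set_coverable:
  assumes f: "f \<in> Cc \<Gamma> G" and e: "e > 0" and uerg: "uniquely_ergodic \<Gamma> G (auslander G a)"
  shows "\<exists>s1>0. \<forall>s R \<epsilon>. 0 < s \<and> s \<le> s1 \<and> \<epsilon> > 0 \<longrightarrow>
    (\<exists>M1. \<forall>M\<ge>M1. coverable s {z \<in> OX R. dev f M z > 4 * e} M (\<epsilon> * \<tau> ^ (n * M)))"
proof -
  from expanding_displacement obtain s1 where s1: "s1 > 0" and s1': "\<forall>s. 0 < s \<and> s \<le> s1 \<longrightarrow> (\<exists>r>0. \<exists>\<theta>. 0 < \<theta> \<and> \<theta> \<le> 1 \<and>
     (\<forall>M v v' w w' d e0. v \<in> sball Bm r \<and> v' \<in> sball Bm r \<and> w \<in> sball Bz r \<and> w' \<in> sball Bz r \<and>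
        d \<in> sball Bp (2 * \<theta> * s / \<tau> ^ M) \<and> e0 \<in> sball Bp (4 * s) \<and>
        mexp e0 = mexp v ** mexp w ** mexp d ** minv (mexp v' ** mexp w') \<longrightarrow> e0 \<in> sball Bp (s / \<tau> ^ M)))"
    by (elim exE conjE)
  show ?thesis
  proof (rule exI[of _ s1], intro conjI s1 allI impI)
    fix s R \<epsilon> :: real assume H: "0 < s \<and> s \<le> s1 \<and> \<epsilon> > 0"
    then have s: "s > 0" "s \<le> s1" and \<epsilon>: "\<epsilon> > 0" by auto
    have "0 < s \<and> s \<le> s1" using s by simp
    from s1'[rule_format, OF this] obtain r1 \<theta> where r1: "r1 > 0" and \<theta>: "0 < \<theta>" "\<theta> \<le> 1"
      and disp: "\<forall>M v v' w w' d e0. v \<in> sball Bm r1 \<and> v' \<in> sball Bm r1 \<and> w \<in> sball Bz r1 \<and> w' \<in> sball Bz r1 \<and>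
        d \<in> sball Bp (2 * \<theta> * s / \<tau> ^ M) \<and> e0 \<in> sball Bp (4 * s) \<and>
        mexp e0 = mexp v ** mexp w ** mexp d ** minv (mexp v' ** mexp w') \<longrightarrow> e0 \<in> sball Bp (s / \<tau> ^ M)"
      by (elim exE conjE)
    obtain r2 where r2: "r2 > 0" and devP: "\<forall>v\<in>sball Bm r2. \<forall>w\<in>sball Bz r2. \<forall>z\<in>X. \<forall>M.
       \<bar>dev f M (act (mexp v ** mexp w) z) - dev f M z\<bar> \<le> e" using dev_P[OF f e] by (elim exE conjE)
    define r where "r = min (min r1 r2) s"
    have r: "r > 0" "r \<le> r1" "r \<le> r2" "r \<le> s" using r1 r2 s(1) by (auto simp: r_def)
    obtain \<rho>1 where \<rho>1: "\<rho>1 > 0" and chart: "\<forall>g\<in>G. norm (g - mat 1) < \<rho>1 \<longrightarrow>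
       (\<exists>v\<in>sball Bm r. \<exists>w\<in>sball Bz r. \<exists>y\<in>sball Bp r. g = mexp v ** mexp w ** mexp y)"
      using local_coordinates[OF r(1)] by (elim exE conjE)
    have "2 * s > 0" using s(1) by simp
    from conj_near_one[OF \<rho>1 this] obtain \<rho> where \<rho>: "\<rho> > 0" and conj: "\<forall>y\<in>sball Bp (2 * s). \<forall>g\<in>G.
       norm (g - mat 1) < \<rho> \<longrightarrow> norm (mexp y ** minv g ** mexp (- y) - mat 1) < \<rho>1" by (elim exE conjE)
    obtain c0 where c0: "c0 > 0" and mNX: "\<forall>x\<in>OX R. c0 \<le> measure m (NX \<rho> x)"
      using NX_lower_bound[OF \<rho>, of R] by (elim exE conjE)
    define t where "t = \<epsilon> * c0 * (\<theta> / 12) ^ n"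
    have t: "t > 0" using \<epsilon> c0 \<theta>(1) by (simp add: t_def)
    obtain M2 where M2: "\<forall>M\<ge>M2. \<forall>y\<in>sball Bp (s / \<tau> ^ M). \<forall>z\<in>X. \<bar>dev f M (act (mexp y) z) - dev f M z\<bar> \<le> 2 * e"
      using dev_plus[OF f e s(1)] by (elim exE)
    have "eventually (\<lambda>M. measure m {x \<in> X. dev f M x > e} < t) sequentially"
      using order_tendstoD(2)[OF averages_converge_in_measure[OF a_G uerg f e] t] unfolding dev_def .
    then obtain M3 where M3: "\<forall>M\<ge>M3. measure m {x \<in> X. dev f M x > e} < t"
      unfolding eventually_sequentially by (elim exE)
    show "\<exists>M1. \<forall>M\<ge>M1. coverable s {z \<in> OX R. dev f M z > 4 * e} M (\<epsilon> * \<tau> ^ (n * M))"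
    proof (rule exI[of _ "max M2 M3"], intro allI impI)
      fix M assume M: "M \<ge> max M2 M3"
      let ?S = "{z \<in> OX R. dev f M z > 4 * e}" and ?E = "{x \<in> X. dev f M x > e}"
      let ?\<delta> = "\<theta> * s / \<tau> ^ M"
      have \<delta>: "?\<delta> > 0" "?\<delta> \<le> s / \<tau> ^ M" "?\<delta> \<le> 3 * s"
      proof -
        show "?\<delta> > 0" using \<theta> s by simp
        have "\<theta> * s \<le> 1 * s" using \<theta> s by (intro mult_right_mono) auto
        then show "?\<delta> \<le> s / \<tau> ^ M" by (simp add: divide_right_mono)
        also have "s / \<tau> ^ M \<le> s / 1" using s abs_c one_le_power[of \<tau> M] by (intro divide_left_mono) auto
        finally show "?\<delta> \<le> 3 * s" using s by simp
      qed
      have E: "?E \<in> sets BX"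
        using measurable_sets[OF dev_measurable[OF Cc_measurable[OF f], of M], of "{e<..}"]
        by (simp add: vimage_def Int_def conj_commute)
      show "coverable s ?S M (\<epsilon> * \<tau> ^ (n * M))"
        unfolding coverable_def
      proof
        fix x assume x: "x \<in> X"
        let ?Bad = "{y \<in> sball Bp s. act (mexp y) x \<in> ?S}"
        show "\<exists>A. finite A \<and> A \<subseteq> span Bp \<and> real (card A) \<le> \<epsilon> * \<tau> ^ (n * M) \<and>
          (\<forall>y\<in>sball Bp s. act (mexp y) x \<in> ?S \<longrightarrow> (\<exists>u\<in>A. y - u \<in> sball Bp (s / \<tau> ^ M)))"
        proof (cases "?Bad = {}")
          case True
          then show ?thesis using \<epsilon> by (intro exI[of _ "{}"]) auto
        next
          case False
          then obtain y0 where y0: "y0 \<in> sball Bp s" "act (mexp y0) x \<in> ?S" by blast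
          define x0 where "x0 = act (mexp y0) x"
          have x0: "x0 \<in> OX R" "x0 \<in> X" using y0(2) OX_subset by (auto simp: x0_def)
          from sball_grid[OF indep(3) \<delta>(1,3)] obtain U where U: "finite U" "U \<subseteq> sball Bp (2 * (3 * s))"
            "real (card U) \<le> (4 * (3 * s) / ?\<delta>) ^ n" "\<forall>y\<in>sball Bp (3 * s). \<exists>u\<in>U. y - u \<in> sball Bp ?\<delta>"
            by (elim exE conjE)
          have Usp: "U \<subseteq> span Bp" using U(2) sball_span by blast
          have N: "NX \<rho> x0 \<in> sets BX" "NX \<rho> x0 \<noteq> {}"
            using openin_sets[OF openin_NX[OF x0(2)]] NX_self[OF x0(2) \<rho>] by auto
          have "c0 \<le> measure m (NX \<rho> x0)" "measure m ?E < t" using mNX x0(1) M3 M by auto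
          from good_base_point[OF U(1) Usp E N c0 this] obtain z where zN: "z \<in> NX \<rho> x0"
            and cz: "real (card {u\<in>U. act (mexp u) z \<in> ?E}) * c0 \<le> real (card U) * t" by (elim bexE)
          let ?V = "{u\<in>U. act (mexp u) z \<in> ?E}"
          obtain g where g: "g \<in> G" "norm (g - mat 1) < \<rho>" "z = act g x0" using zN unfolding NX_def by blast
          have z: "z \<in> X" using g x0 by simp
          have "\<exists>u v w y1. u \<in> ?V \<and> v \<in> sball Bm r \<and> w \<in> sball Bz r \<and> y1 \<in> sball Bp (3 * s) \<and> y1 - u \<in> sball Bp ?\<delta> \<and>
              mexp (y - y0) ** minv g = mexp v ** mexp w ** mexp y1" if y: "y \<in> ?Bad" for y
          proof -
            have y': "y - y0 \<in> sball Bp (2 * s)" using sball_diff[OF indep(3), of y s y0 s] y y0(1) by simp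
            have ysp: "y - y0 \<in> span Bp" by (rule sball_span[OF y'])
            let ?k = "mexp (y - y0) ** minv g ** mexp (- (y - y0))"
            have kG: "?k \<in> G" using ysp g(1) by (intro mult_G span_plus_G minv_G) (auto simp: span_diff span_neg intro: span_neg[of "y - y0" Bp, simplified])
            have "norm (?k - mat 1) < \<rho>1" using conj y' g by blast
            from chart[rule_format, OF kG this] obtain v w y2 where vw: "v \<in> sball Bm r" "w \<in> sball Bz r" "y2 \<in> sball Bp r"
              and k: "?k = mexp v ** mexp w ** mexp y2" by (elim bexE)
            define y1 where "y1 = y2 + (y - y0)"
            have y1: "y1 \<in> sball Bp (3 * s)"
              using sball_add[OF indep(3) sball_mono[OF r(4) vw(3)] y'] by (simp add: y1_def)
            have "?k ** mexp (y - y0) = mexp (y - y0) ** minv g ** (mexp (- (y - y0)) ** mexp (y - y0))"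
              by (simp only: matrix_mul_assoc)
            then have "mexp (y - y0) ** minv g = ?k ** mexp (y - y0)"
              by (simp only: mexp_minus matrix_mul_rid)
            also have "\<dots> = mexp v ** mexp w ** (mexp y2 ** mexp (y - y0))" by (simp only: k matrix_mul_assoc)
            finally have eq: "mexp (y - y0) ** minv g = mexp v ** mexp w ** mexp y1"
              using mexp_add_plus[OF sball_span[OF vw(3)] ysp] by (simp add: y1_def)
            obtain u where u: "u \<in> U" "y1 - u \<in> sball Bp ?\<delta>" using bspec[OF U(4) y1] by (elim bexE)
            have uG: "mexp u \<in> G" using span_plus_G Usp u(1) by blast
            have y1G: "mexp y1 \<in> G" by (rule sball_plus_G[OF y1])
            have x0z: "x0 = act (minv g) z" using g x0 by (simp add: act_act)
            have "act (mexp y) x = act (mexp (y - y0)) x0"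
              using act_plus_add[OF ysp sball_span[OF y0(1)] x] by (simp add: x0_def)
            also have "\<dots> = act (mexp (y - y0) ** minv g) z"
              unfolding x0z by (rule act_act) (use span_plus_G[OF ysp] g z in auto)
            also have "\<dots> = act (mexp v ** mexp w) (act (mexp y1) z)"
              unfolding eq by (rule act_act[symmetric, OF P_G[OF vw(1,2)] y1G z])
            finally have e1: "act (mexp y) x = act (mexp v ** mexp w) (act (mexp y1) z)" .
            have e2: "act (mexp y1) z = act (mexp (y1 - u)) (act (mexp u) z)"
              using act_plus_add[OF sball_span[OF u(2)] _ z, of u] u(1) Usp by auto
            have d1: "\<bar>dev f M (act (mexp y) x) - dev f M (act (mexp y1) z)\<bar> \<le> e"
              unfolding e1 using devP sball_mono[OF r(3) vw(1)] sball_mono[OF r(3) vw(2)] act_in[OF y1G z] by blast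
            have "M \<ge> M2" using M by simp
            then have d2: "\<bar>dev f M (act (mexp y1) z) - dev f M (act (mexp u) z)\<bar> \<le> 2 * e"
              unfolding e2 using M2 sball_mono[OF \<delta>(2) u(2)] act_in[OF uG z] by blast
            have "dev f M (act (mexp y) x) > 4 * e" using y by simp
            then have "dev f M (act (mexp u) z) > e" using d1 d2 by linarith
            then have "u \<in> ?V" using u(1) act_in[OF uG z] by simp
            then show ?thesis using vw(1,2) y1 u(2) eq by blast
          qed
          then have "\<forall>y\<in>?Bad. \<exists>u. u \<in> ?V \<and> (\<exists>v w y1. v \<in> sball Bm r \<and> w \<in> sball Bz r \<and> y1 - u \<in> sball Bp ?\<delta> \<and>
              mexp (y - y0) ** minv g = mexp v ** mexp w ** mexp y1)" by blast
          from bchoice[OF this] obtain \<phi> where \<phi>: "\<forall>y\<in>?Bad. \<phi> y \<in> ?V \<and> (\<exists>v w y1. v \<in> sball Bm r \<and> w \<in> sball Bz r \<and>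
              y1 - \<phi> y \<in> sball Bp ?\<delta> \<and> mexp (y - y0) ** minv g = mexp v ** mexp w ** mexp y1)" ..
          have cell: "y - y' \<in> sball Bp (s / \<tau> ^ M)" if y: "y \<in> ?Bad" "y' \<in> ?Bad" and same: "\<phi> y = \<phi> y'" for y y'
          proof -
            from bspec[OF \<phi> y(1)] obtain v w y1 where v: "v \<in> sball Bm r" "w \<in> sball Bz r" "y1 - \<phi> y \<in> sball Bp ?\<delta>"
              and eq: "mexp (y - y0) ** minv g = mexp v ** mexp w ** mexp y1" by (elim conjE exE)
            from bspec[OF \<phi> y(2)] obtain v' w' y1' where v': "v' \<in> sball Bm r" "w' \<in> sball Bz r" "y1' - \<phi> y' \<in> sball Bp ?\<delta>"
              and eq': "mexp (y' - y0) ** minv g = mexp v' ** mexp w' ** mexp y1'" by (elim conjE exE)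
            have sp: "y \<in> span Bp" "y' \<in> span Bp" "y0 \<in> span Bp" using y y0(1) sball_span by blast+
            have spu: "\<phi> y \<in> span Bp" "\<phi> y' \<in> span Bp" using \<phi> y Usp by blast+
            have sp1: "y1 \<in> span Bp" "y1' \<in> span Bp"
              using span_add[OF sball_span[OF v(3)] spu(1)] span_add[OF sball_span[OF v'(3)] spu(2)] by auto
            have d: "y1 - y1' \<in> sball Bp (2 * \<theta> * s / \<tau> ^ M)"
              using sball_diff[OF indep(3) v(3) v'(3)] by (simp add: same mult.assoc)
            have "y - y' \<in> sball Bp (s + s)" using y by (intro sball_diff[OF indep(3)]) auto
            then have e0: "y - y' \<in> sball Bp (4 * s)" by (rule sball_mono[rotated]) (use s in simp)
            let ?p = "mexp v ** mexp w" and ?p' = "mexp v' ** mexp w'"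
            have pG: "?p \<in> G" "?p' \<in> G" using P_G v v' by auto
            have G1: "mexp (y' - y0) \<in> G" "mexp (y - y0) \<in> G" "mexp y1' \<in> G" 
              using sp sp1 by (auto intro!: span_plus_G span_diff)
            have "mexp (y - y') = mexp ((y - y0) + (- (y' - y0)))" by simp
            also have "\<dots> = mexp (y - y0) ** mexp (- (y' - y0))"
              using sp by (intro mexp_add_plus span_diff span_neg) auto
            also have "mexp (- (y' - y0)) = minv (mexp (y' - y0))"
              using minv_mexp spans_lie(3) span_diff[OF sp(2,3)] by (metis subsetD)
            also have "mexp (y - y0) ** minv (mexp (y' - y0)) = (mexp (y - y0) ** minv g) ** minv (mexp (y' - y0) ** minv g)"
            proof -
              have "minv (mexp (y' - y0) ** minv g) = g ** minv (mexp (y' - y0))"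
                using G1(1) g(1) by (simp add: minv_mult)
              then have "(mexp (y - y0) ** minv g) ** minv (mexp (y' - y0) ** minv g)
                  = mexp (y - y0) ** (minv g ** g) ** minv (mexp (y' - y0))" by (simp only: matrix_mul_assoc)
              then show ?thesis using g(1) by simp
            qed
            also have "\<dots> = ?p ** mexp y1 ** minv (?p' ** mexp y1')" by (simp only: eq eq')
            also have "minv (?p' ** mexp y1') = minv (mexp y1') ** minv ?p'" by (rule minv_mult[OF pG(2) G1(3)])
            also have "minv (mexp y1') = mexp (- y1')" using minv_mexp spans_lie(3) sp1(2) by (metis subsetD)
            also have "?p ** mexp y1 ** (mexp (- y1') ** minv ?p') = ?p ** (mexp y1 ** mexp (- y1')) ** minv ?p'"
              by (simp only: matrix_mul_assoc)
            also have "mexp y1 ** mexp (- y1') = mexp (y1 - y1')"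
              using mexp_add_plus[OF sp1(1) span_neg[OF sp1(2)]] by simp
            finally have eqe: "mexp (y - y') = mexp v ** mexp w ** mexp (y1 - y1') ** minv (mexp v' ** mexp w')" .
            show ?thesis
              using disp[rule_format, OF conjI[OF sball_mono[OF r(2) v(1)] conjI[OF sball_mono[OF r(2) v'(1)]
                conjI[OF sball_mono[OF r(2) v(2)] conjI[OF sball_mono[OF r(2) v'(2)] conjI[OF d conjI[OF e0 eqe]]]]]]] .
          qed
          define A where "A = inv_into ?Bad \<phi> ` (\<phi> ` ?Bad)"
          have sub: "\<phi> ` ?Bad \<subseteq> ?V" using \<phi> by blast
          have finV: "finite ?V" using U(1) by simp
          have fin: "finite (\<phi> ` ?Bad)" using finite_subset[OF sub finV] .
          have AB: "y \<in> ?Bad" if "y \<in> A" for y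
            using that unfolding A_def by (elim imageE) (simp only: inv_into_into imageI)
          have "card A \<le> card ?V"
            unfolding A_def by (rule order_trans[OF card_image_le[OF fin] card_mono[OF finV sub]])
          then have "real (card A) * c0 \<le> real (card ?V) * c0" using c0 by simp
          also have "\<dots> \<le> real (card U) * t" by (rule cz)
          also have "\<dots> \<le> (4 * (3 * s) / ?\<delta>) ^ n * t" by (rule mult_right_mono[OF U(3) less_imp_le[OF t]])
          also have "4 * (3 * s) / ?\<delta> = 12 / \<theta> * \<tau> ^ M" using s(1) \<theta>(1) by simp
          also have "(12 / \<theta> * \<tau> ^ M) ^ n * t = (\<epsilon> * \<tau> ^ (n * M)) * c0 * ((12 / \<theta>) ^ n * (\<theta> / 12) ^ n)"
          proof -
            have "(12 / \<theta> * \<tau> ^ M) ^ n = (12 / \<theta>) ^ n * \<tau> ^ (n * M)"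
              by (simp only: power_mult_distrib power_mult[symmetric] mult.commute[of n])
            then show ?thesis unfolding t_def by (simp only: mult_ac)
          qed
          also have "(12 / \<theta>) ^ n * (\<theta> / 12) ^ n = 1" using \<theta>(1) by (simp flip: power_mult_distrib)
          finally have cA: "real (card A) \<le> \<epsilon> * \<tau> ^ (n * M)" using c0 by simp
          show ?thesis
          proof (intro exI[of _ A] conjI ballI impI)
            show "finite A" unfolding A_def using fin by simp
            show "A \<subseteq> span Bp"
            proof
              fix y assume "y \<in> A"
              from AB[OF this] have "y \<in> sball Bp s" by simp
              then show "y \<in> span Bp" by (rule sball_span)
            qed
            show "real (card A) \<le> \<epsilon> * \<tau> ^ (n * M)" by (rule cA)
            fix y assume y: "y \<in> sball Bp s" "act (mexp y) x \<in> ?S"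
            then have yB: "y \<in> ?Bad" by simp
            let ?u = "inv_into ?Bad \<phi> (\<phi> y)"
            have uA: "?u \<in> A" unfolding A_def by (rule imageI[OF imageI[OF yB]])
            have "\<phi> ?u = \<phi> y" by (rule f_inv_into_f[OF imageI[OF yB]])
            from cell[OF yB AB[OF uA] this[symmetric]]
            show "\<exists>u\<in>A. y - u \<in> sball Bp (s / \<tau> ^ M)" using uA by (rule bexI)
          qed
        qed
      qed
    qed
  qed
qed

end

section \<open>The exceptional set has small measure\<close>

lemma compact_closed_sball:
  assumes B: "independent (B :: (real^'n^'n) set)"
  shows "compact {v \<in> span B. \<forall>b\<in>B. \<bar>representation B v b\<bar> \<le> r}" (is "compact ?C")
proof -
  obtain K where K: "K > 0" "\<forall>s\<ge>0. \<forall>v\<in>sball B s. norm v \<le> K * s" using norm_sball_le[OF B] by blast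
  obtain L where L: "L > 0" "\<forall>v\<in>span B. \<forall>b\<in>B. \<bar>representation B v b\<bar> \<le> L * norm v"
    using representation_bounded[OF B] by blast
  have "norm v \<le> K * (\<bar>r\<bar> + 1)" if "v \<in> ?C" for v
  proof -
    have "v \<in> sball B (\<bar>r\<bar> + 1)" using that unfolding sball_def by force
    then show ?thesis using K(2) by simp
  qed
  then have "bounded ?C" unfolding bounded_iff by blast
  moreover have "closed ?C"
    unfolding closed_sequential_limits
  proof (intro allI impI)
    fix v l assume "(\<forall>k. v k \<in> ?C) \<and> v \<longlonglongrightarrow> l"
    then have v: "\<And>k. v k \<in> ?C" and lim: "v \<longlonglongrightarrow> l" by auto
    have l: "l \<in> span B" by (rule closed_sequentially[OF closed_span _ lim]) (use v in auto)
    have "\<bar>representation B l b\<bar> \<le> r" if b: "b \<in> B" for b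
    proof (rule LIMSEQ_le_const)
      have "(\<lambda>k. L * norm (l - v k) + r) \<longlonglongrightarrow> L * norm (l - l) + r"
        by (intro tendsto_intros lim)
      then show "(\<lambda>k. L * norm (l - v k) + r) \<longlonglongrightarrow> r" by simp
      have "\<bar>representation B l b\<bar> \<le> L * norm (l - v k) + r" for k
      proof -
        have vk: "v k \<in> span B" "\<bar>representation B (v k) b\<bar> \<le> r" using v[of k] b by auto
        have "representation B (l - v k) b = representation B l b - representation B (v k) b"
          using representation_diff[OF B vk(1) l] by simp
        moreover have "\<bar>representation B (l - v k) b\<bar> \<le> L * norm (l - v k)"
          using L(2) span_diff[OF l vk(1)] b by blast
        ultimately show ?thesis using vk(2) by linarith
      qed
      then show "\<exists>N. \<forall>k\<ge>N. \<bar>representation B l b\<bar> \<le> L * norm (l - v k) + r" by blast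
    qed
    then show "l \<in> ?C" using l by simp
  qed
  ultimately show ?thesis by (simp add: compact_eq_bounded_closed)
qed

lemma sball_sigma_compact:
  assumes B: "independent (B :: (real^'n^'n) set)"
  shows "\<exists>C :: nat \<Rightarrow> (real^'n^'n) set. (\<forall>j. compact (C j)) \<and> incseq C \<and> (\<Union>j. C j) = sball B s"
proof -
  define C where "C j = {v \<in> span B. \<forall>b\<in>B. \<bar>representation B v b\<bar> \<le> s - inverse (real (Suc j))}" for j :: nat
  have "incseq C"
  proof (rule incseq_SucI)
    fix j
    have "inverse (real (Suc (Suc j))) \<le> inverse (real (Suc j))" by (rule le_imp_inverse_le) auto
    then have le: "s - inverse (real (Suc j)) \<le> s - inverse (real (Suc (Suc j)))" by linarith
    show "C j \<subseteq> C (Suc j)" unfolding C_def using order_trans[OF _ le] by blast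
  qed
  moreover have "v \<in> (\<Union>j. C j)" if v: "v \<in> sball B s" for v
  proof -
    have fin: "finite B" using B by (rule independent_imp_finite)
    define t where "t = Min (insert 1 ((\<lambda>b. s - \<bar>representation B v b\<bar>) ` B))"
    have "t > 0" using v fin by (auto simp: t_def sball_def)
    from reals_Archimedean[OF this] obtain j where j: "inverse (real (Suc j)) < t" by blast
    have "\<bar>representation B v b\<bar> \<le> s - inverse (real (Suc j))" if "b \<in> B" for b
    proof -
      have "t \<le> s - \<bar>representation B v b\<bar>" unfolding t_def using fin that by (intro Min_le) auto
      then show ?thesis using j by linarith
    qed
    then have "v \<in> C j" unfolding C_def using sball_span[OF v] by blast
    then show ?thesis by blast
  qed
  moreover have "C j \<subseteq> sball B s" for j
  proof
    fix v assume v: "v \<in> C j"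
    have "inverse (real (Suc j)) > 0" by simp
    then have lt: "s - inverse (real (Suc j)) < s" by linarith
    show "v \<in> sball B s" using v le_less_trans[OF _ lt] unfolding C_def sball_def by blast
  qed
  moreover have "compact (C j)" for j unfolding C_def by (rule compact_closed_sball[OF B])
  ultimately show ?thesis by (intro exI[of _ C]) blast
qed

context dynamics
begin

text \<open>The box is the image of a countable union of compact sets.\<close>

lemma exp_box_sets:
  assumes x: "x \<in> X" and u: "u \<in> span Bp"
  shows "exp_box Bm Bz Bp s r u x \<in> sets BX"
proof -
  obtain g where g: "g \<in> G" "x = pt g" using x hspace_eq by blast
  obtain C1 C2 C3 :: "nat \<Rightarrow> (real^'n^'n) set" where
    C1: "\<forall>j. compact (C1 j)" "incseq C1" "(\<Union>j. C1 j) = sball Bm s" and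
    C2: "\<forall>j. compact (C2 j)" "incseq C2" "(\<Union>j. C2 j) = sball Bz s" and
    C3: "\<forall>j. compact (C3 j)" "incseq C3" "(\<Union>j. C3 j) = sball Bp r"
    using sball_sigma_compact[OF indep(1), of s] sball_sigma_compact[OF indep(2), of s]
      sball_sigma_compact[OF indep(3), of r] by (elim exE conjE)
  let ?F = "\<lambda>p. mexp (fst p) ** mexp (fst (snd p)) ** mexp (snd (snd p) + u) ** g"
  let ?D = "\<lambda>j. ?F ` (C1 j \<times> C2 j \<times> C3 j)"
  have in1: "v \<in> sball Bm s" if "v \<in> C1 j" for v j using C1(3) that by blast
  have in2: "v \<in> sball Bz s" if "v \<in> C2 j" for v j using C2(3) that by blast
  have in3: "v \<in> sball Bp r" if "v \<in> C3 j" for v j using C3(3) that by blast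
  have yu: "mexp (y + u) \<in> G" if "y \<in> sball Bp r" for y
    using span_plus_G[OF span_add[OF sball_span[OF that] u]] .
  have cont: "continuous_on A ?F" for A
  proof -
    have e: "continuous_on A (\<lambda>p. mexp (h p))" if "continuous_on A h" for h :: "_ \<Rightarrow> real^'n^'n"
      by (rule continuous_on_compose2[OF continuous_mexp that]) auto
    show ?thesis by (intro mm.continuous_on e continuous_intros)
  qed
  have "compact (?D j)" for j
    using C1(1) C2(1) C3(1) by (intro compact_continuous_image cont compact_Times) auto
  moreover have "?D j \<subseteq> G" for j
  proof
    fix h assume "h \<in> ?D j"
    then obtain v w y where "v \<in> C1 j" "w \<in> C2 j" "y \<in> C3 j" and h: "h = ?F (v, w, y)" by blast
    then have "mexp v ** mexp w \<in> G" "mexp (y + u) \<in> G" using P_G[OF in1 in2] yu[OF in3] by auto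
    then show "h \<in> G" unfolding h using g(1) by (simp add: mult_G)
  qed
  ultimately have "pt ` (\<Union>j. ?D j) \<in> sets BX" by (rule sigma_compact_image_sets)
  moreover have "pt ` (\<Union>j. ?D j) = exp_box Bm Bz Bp s r u x"
  proof -
    have *: "act (mexp v ** mexp w ** mexp (y + u)) x = pt (?F (v, w, y))"
      if "v \<in> sball Bm s" "w \<in> sball Bz s" "y \<in> sball Bp r" for v w y
      using act_pt[OF mult_G[OF P_G[OF that(1,2)] yu[OF that(3)]] g(1)] g(2) by simp
    show ?thesis
    proof (intro equalityI subsetI)
      fix z assume "z \<in> pt ` (\<Union>j. ?D j)"
      then obtain j v w y where "v \<in> C1 j" "w \<in> C2 j" "y \<in> C3 j" "z = pt (?F (v, w, y))" by auto
      then show "z \<in> exp_box Bm Bz Bp s r u x"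
        unfolding exp_box_def using *[of v w y] in1 in2 in3 by fastforce
    next
      fix z assume "z \<in> exp_box Bm Bz Bp s r u x"
      then obtain v w y where vwy: "v \<in> sball Bm s" "w \<in> sball Bz s" "y \<in> sball Bp r"
        and z: "z = act (mexp v ** mexp w ** mexp (y + u)) x" unfolding exp_box_def by blast
      obtain i j k where ijk: "v \<in> C1 i" "w \<in> C2 j" "y \<in> C3 k" using vwy C1(3) C2(3) C3(3) by blast
      let ?l = "max i (max j k)"
      have "v \<in> C1 ?l" "w \<in> C2 ?l" "y \<in> C3 ?l"
      proof -
        have "i \<le> ?l" "j \<le> ?l" "k \<le> ?l" by simp_all
        from incseqD[OF C1(2) this(1)] incseqD[OF C2(2) this(2)] incseqD[OF C3(2) this(3)] ijk
        show "v \<in> C1 ?l" "w \<in> C2 ?l" "y \<in> C3 ?l" by blast+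
      qed
      then have "?F (v, w, y) \<in> ?D ?l" by (intro imageI) simp
      then show "z \<in> pt ` (\<Union>j. ?D j)" using z *[OF vwy] by blast
    qed
  qed
  ultimately show ?thesis by simp
qed

text \<open>Each cell which meets the plaque of size \<open>s / 2\<close> has its centre \<open>u\<close> at distance at most \<open>3 * s / 4\<close>, so
  that the condition on the local dimension applies around \<open>u\<close> with radii \<open>s / 4\<close> and \<open>s / \<tau> ^ K\<close>. The
  comparison measure is finite, which bounds its contribution uniformly.\<close>

lemma covered_measure_le:
  assumes ld: "local_dim_unstable \<Gamma> G Bm Bz Bp \<mu> \<kappa> s0 \<Lambda>" and s: "0 < s" "s < s0"
  shows "\<exists>C\<ge>0. \<forall>x\<in>msupport \<Gamma> G \<mu>. \<forall>S K N A. 4 < \<tau> ^ K \<and> coverable s S K N \<and> A \<in> sets BX \<and>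
    (\<forall>z\<in>A. \<exists>v\<in>sball Bm s. \<exists>w\<in>sball Bz s. \<exists>y\<in>sball Bp (s / 2). z = act (mexp v ** mexp w) (act (mexp y) x) \<and> act (mexp y) x \<in> S)
    \<longrightarrow> measure \<mu> A \<le> N * (C * (4 / \<tau> ^ K) powr \<kappa>)"
proof -
  have \<mu>: "borel_prob \<Gamma> G \<mu>" and \<Lambda>: "finite_measure \<Lambda>" using ld unfolding local_dim_unstable_def by auto
  from ld obtain C where C: "\<forall>s' s u \<delta>. \<forall>x \<in> msupport \<Gamma> G \<mu>.
        0 < s' \<and> s' \<le> s \<and> s < s0 \<and>
        u \<in> sball Bp s \<and> (\<lambda>y. y + u) ` sball Bp s' \<subseteq> sball Bp s \<and>
        0 < \<delta> \<and> \<delta> < 1 \<longrightarrow>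
        measure \<mu> (exp_box Bm Bz Bp s (\<delta> * s') u x)
          \<le> C * \<delta> powr \<kappa> * measure \<Lambda> (exp_box Bm Bz Bp s s' u x)"
    unfolding local_dim_unstable_def by (elim exE conjE)
  interpret \<mu>: prob_space \<mu> by (rule borel_probD[OF \<mu>])
  interpret \<Lambda>: finite_measure \<Lambda> by (rule \<Lambda>)
  let ?C = "\<bar>C\<bar> * measure \<Lambda> (space \<Lambda>)"
  show ?thesis
  proof (rule exI[of _ ?C], intro conjI ballI allI impI)
    show "0 \<le> ?C" by simp
    fix x S K N A
    assume x: "x \<in> msupport \<Gamma> G \<mu>"
    assume H: "4 < \<tau> ^ K \<and> coverable s S K N \<and> A \<in> sets BX \<and>
      (\<forall>z\<in>A. \<exists>v\<in>sball Bm s. \<exists>w\<in>sball Bz s. \<exists>y\<in>sball Bp (s / 2). z = act (mexp v ** mexp w) (act (mexp y) x) \<and> act (mexp y) x \<in> S)"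
    note K = H[THEN conjunct1] and cov = H[THEN conjunct2, THEN conjunct1]
      and A = H[THEN conjunct2, THEN conjunct2, THEN conjunct1] and box = H[THEN conjunct2, THEN conjunct2, THEN conjunct2]
    have xX: "x \<in> X" using x by (simp add: msupport_def)
    from bspec[OF cov[unfolded coverable_def] xX] obtain D where D: "finite D" "D \<subseteq> span Bp" "real (card D) \<le> N"
      "\<forall>y\<in>sball Bp s. act (mexp y) x \<in> S \<longrightarrow> (\<exists>u\<in>D. y - u \<in> sball Bp (s / \<tau> ^ K))"
      by (elim exE conjE)
    let ?D = "{u\<in>D. \<exists>y\<in>sball Bp (s / 2). y - u \<in> sball Bp (s / \<tau> ^ K)}"
    let ?box = "\<lambda>u. exp_box Bm Bz Bp s (s / \<tau> ^ K) u x"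
    have meas: "?box u \<in> sets \<mu>" if "u \<in> ?D" for u
      using exp_box_sets[OF xX] that D(2) borel_probD(2)[OF \<mu>] by blast
    have sK: "s / \<tau> ^ K \<le> s / 4" using K s(1) by (intro divide_left_mono) auto
    have one: "measure \<mu> (?box u) \<le> ?C * (4 / \<tau> ^ K) powr \<kappa>" if u: "u \<in> ?D" for u
    proof -
      from u obtain y where y: "y \<in> sball Bp (s / 2)" "y - u \<in> sball Bp (s / \<tau> ^ K)" by blast
      have "y - (y - u) \<in> sball Bp (s / 2 + s / 4)"
        by (rule sball_diff[OF indep(3) y(1) sball_mono[OF sK y(2)]])
      then have u34: "u \<in> sball Bp (s / 2 + s / 4)" by simp
      have us: "u \<in> sball Bp s" by (rule sball_mono[OF _ u34]) (use s in simp)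
      have sub: "(\<lambda>y. y + u) ` sball Bp (s / 4) \<subseteq> sball Bp s"
      proof
        fix v assume "v \<in> (\<lambda>y. y + u) ` sball Bp (s / 4)"
        then obtain y where "y \<in> sball Bp (s / 4)" "v = y + u" by blast
        then have "v \<in> sball Bp (s / 4 + (s / 2 + s / 4))" using sball_add[OF indep(3) _ u34] by blast
        then show "v \<in> sball Bp s" by simp
      qed
      have "measure \<mu> (exp_box Bm Bz Bp s (4 / \<tau> ^ K * (s / 4)) u x)
          \<le> C * (4 / \<tau> ^ K) powr \<kappa> * measure \<Lambda> (exp_box Bm Bz Bp s (s / 4) u x)"
        using C[rule_format, OF x, of "s / 4" s u "4 / \<tau> ^ K"] s us sub K by simp
      also have "4 / \<tau> ^ K * (s / 4) = s / \<tau> ^ K" by simp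
      also have "C * (4 / \<tau> ^ K) powr \<kappa> * measure \<Lambda> (exp_box Bm Bz Bp s (s / 4) u x)
          \<le> \<bar>C\<bar> * (4 / \<tau> ^ K) powr \<kappa> * measure \<Lambda> (space \<Lambda>)"
        by (intro mult_mono \<Lambda>.bounded_measure) auto
      finally show ?thesis by (simp add: mult_ac)
    qed
    have sub: "A \<subseteq> (\<Union>u\<in>?D. ?box u)"
    proof
      fix z assume "z \<in> A"
      from bspec[OF box this] obtain v w y where vwy: "v \<in> sball Bm s" "w \<in> sball Bz s" "y \<in> sball Bp (s / 2)"
        and z: "z = act (mexp v ** mexp w) (act (mexp y) x)" "act (mexp y) x \<in> S" by (elim bexE conjE)
      have ys: "y \<in> sball Bp s" by (rule sball_mono[OF _ vwy(3)]) (use s in simp)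
      from bspec[OF D(4) ys] z(2) obtain u where u: "u \<in> D" "y - u \<in> sball Bp (s / \<tau> ^ K)" by blast
      have "z = act (mexp v ** mexp w ** mexp ((y - u) + u)) x"
        using act_act[OF P_G[OF vwy(1,2)] sball_plus_G[OF ys] xX] z(1) by simp
      then have "z \<in> ?box u" unfolding exp_box_def using vwy(1,2) u(2) by blast
      then show "z \<in> (\<Union>u\<in>?D. ?box u)" using u vwy(3) by blast
    qed
    have finD: "finite ?D" using D(1) by simp
    have "measure \<mu> A \<le> measure \<mu> (\<Union>u\<in>?D. ?box u)"
      using meas finD by (intro \<mu>.finite_measure_mono[OF sub] sets.finite_UN) auto
    also have "\<dots> \<le> (\<Sum>u\<in>?D. measure \<mu> (?box u))"
      using meas by (intro \<mu>.finite_measure_subadditive_finite finD) auto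
    also have "\<dots> \<le> (\<Sum>u\<in>?D. ?C * (4 / \<tau> ^ K) powr \<kappa>)" by (intro sum_mono one)
    also have "\<dots> = real (card ?D) * (?C * (4 / \<tau> ^ K) powr \<kappa>)" by simp
    also have "\<dots> \<le> N * (?C * (4 / \<tau> ^ K) powr \<kappa>)"
    proof (rule mult_right_mono)
      have "card ?D \<le> card D" by (rule card_mono[OF D(1)]) auto
      then show "real (card ?D) \<le> N" using D(3) by linarith
    qed simp
    finally show "measure \<mu> A \<le> N * (?C * (4 / \<tau> ^ K) powr \<kappa>)" .
  qed
qed

end

text \<open>Sorting visits by their residue modulo \<open>M\<close>.\<close>

lemma visits_in_residue_class:
  fixes p :: real
  assumes M: "M > 0" and many: "p * real k \<le> real (card {l\<in>{..<k}. P l})"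
  shows "\<exists>i<M. \<exists>J\<subseteq>{..<Suc (k div M)}. p * real k / real M \<le> real (card J) \<and> (\<forall>j\<in>J. P (i + M * j))"
proof (rule ccontr)
  assume neg: "\<not> ?thesis"
  let ?V = "\<lambda>i. {l\<in>{..<k}. P l \<and> l mod M = i}"
  have lt: "real (card (?V i)) < p * real k / real M" if i: "i < M" for i
  proof -
    let ?J = "(\<lambda>l. l div M) ` ?V i"
    have dm: "i + M * (l div M) = l" if "l \<in> ?V i" for l
    proof -
      have "l mod M = i" using that by simp
      with mult_div_mod_eq[of M l] show ?thesis by (simp only: add.commute)
    qed
    have "inj_on (\<lambda>l. l div M) (?V i)"
    proof (rule inj_onI)
      fix l l' assume l: "l \<in> ?V i" "l' \<in> ?V i" and eq: "l div M = l' div M"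
      have "l = i + M * (l div M)" by (rule dm[OF l(1), symmetric])
      also have "\<dots> = l'" unfolding eq by (rule dm[OF l(2)])
      finally show "l = l'" .
    qed
    then have cJ: "card ?J = card (?V i)" by (rule card_image)
    have J: "?J \<subseteq> {..<Suc (k div M)}"
    proof
      fix j assume "j \<in> ?J"
      then obtain l where "l < k" "j = l div M" by blast
      then show "j \<in> {..<Suc (k div M)}" using div_le_mono[of l k M] by simp
    qed
    have PJ: "\<forall>j\<in>?J. P (i + M * j)"
    proof
      fix j assume "j \<in> ?J"
      then obtain l where l: "l \<in> ?V i" "j = l div M" by blast
      show "P (i + M * j)" unfolding l(2) dm[OF l(1)] using l(1) by simp
    qed
    have "\<not> p * real k / real M \<le> real (card ?J)"
    proof
      assume "p * real k / real M \<le> real (card ?J)"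
      then have "\<exists>i<M. \<exists>J\<subseteq>{..<Suc (k div M)}. p * real k / real M \<le> real (card J) \<and> (\<forall>j\<in>J. P (i + M * j))"
        using i J PJ by (intro exI[of _ i] exI[of _ ?J] conjI)
      with neg show False ..
    qed
    then show ?thesis unfolding cJ by (simp only: not_le)
  qed
  have "{l\<in>{..<k}. P l} = (\<Union>i<M. ?V i)" using M by auto
  then have "card {l\<in>{..<k}. P l} \<le> (\<Sum>i<M. card (?V i))" using card_UN_le[of "{..<M}" ?V] by simp
  then have "real (card {l\<in>{..<k}. P l}) \<le> real (\<Sum>i<M. card (?V i))" by (rule of_nat_mono)
  also have "\<dots> = (\<Sum>i<M. real (card (?V i)))" by (rule of_nat_sum)
  also have "\<dots> < (\<Sum>i<M. p * real k / real M)" using M lt by (intro sum_strict_mono) auto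
  also have "\<dots> = p * real k" using M by simp
  finally show False using many by simp
qed


text \<open>Covering a plaque at scale \<open>\<tau> ^ -K\<close> takes about \<open>\<tau> ^ (n * K)\<close> cells. If \<open>\<kappa>\<close> is close to \<open>n\<close>,
  the measure of a cell compensates this up to a factor \<open>2\<close> per \<open>M\<close> steps.\<close>

lemma cell_measure_compensates_count:
  fixes \<tau> \<kappa> \<xi> :: real
  assumes \<tau>: "\<tau> > 1" and \<xi>: "\<xi> \<ge> 0" "\<tau> powr (\<xi> * real M) \<le> 2" and \<kappa>: "\<kappa> = real d - \<xi>" "\<kappa> \<ge> 0" and i: "i < M"
    and K: "K = i + M * Suc Q"
  shows "\<tau> ^ (d * K) * (4 / \<tau> ^ K) powr \<kappa> \<le> 4 ^ d * 2 ^ (Q + 2)"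
proof -
  have KM: "real K \<le> real M * real (Q + 2)"
  proof -
    have "K \<le> M + M * Suc Q" using i by (simp add: K)
    also have "\<dots> = M * (Q + 2)" by (simp add: algebra_simps)
    finally have "real K \<le> real (M * (Q + 2))" by (rule of_nat_mono)
    then show ?thesis by (simp only: of_nat_mult)
  qed
  have "(4 / \<tau> ^ K) powr \<kappa> = 4 powr \<kappa> / (\<tau> ^ K) powr \<kappa>" by (rule powr_divide)
  also have "(\<tau> ^ K) powr \<kappa> = \<tau> powr (real K * \<kappa>)" using \<tau> by (simp add: powr_realpow[symmetric] powr_powr)
  finally have "\<tau> ^ (d * K) * (4 / \<tau> ^ K) powr \<kappa> = 4 powr \<kappa> * (\<tau> ^ (d * K) / \<tau> powr (real K * \<kappa>))" by simp
  also have "\<tau> ^ (d * K) / \<tau> powr (real K * \<kappa>) = \<tau> powr (real K * \<xi>)"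
  proof -
    have "\<tau> ^ (d * K) = \<tau> powr (real (d * K))" by (rule powr_realpow[symmetric]) (use \<tau> in simp)
    moreover have "real (d * K) - real K * \<kappa> = real K * \<xi>" by (simp add: \<kappa>(1) algebra_simps)
    ultimately show ?thesis by (simp only: powr_diff[symmetric])
  qed
  also have "4 powr \<kappa> * \<tau> powr (real K * \<xi>) \<le> 4 ^ d * 2 ^ (Q + 2)"
  proof (rule mult_mono)
    have "4 powr \<kappa> \<le> 4 powr real d" using \<xi>(1) \<kappa>(1) by (intro powr_mono) auto
    then show "4 powr \<kappa> \<le> 4 ^ d" by (simp add: powr_realpow)
    have "real K * \<xi> \<le> (\<xi> * real M) * real (Q + 2)" using mult_right_mono[OF KM \<xi>(1)] by (simp only: mult_ac)
    then have "\<tau> powr (real K * \<xi>) \<le> \<tau> powr ((\<xi> * real M) * real (Q + 2))" using \<tau> by (intro powr_mono) auto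
    also have "\<dots> = (\<tau> powr (\<xi> * real M)) powr real (Q + 2)" by (rule powr_powr[symmetric])
    also have "\<dots> = (\<tau> powr (\<xi> * real M)) ^ (Q + 2)" by (rule powr_realpow) (use \<tau> in simp)
    also have "\<dots> \<le> 2 ^ (Q + 2)" by (rule power_mono[OF \<xi>(2)]) simp
    finally show "\<tau> powr (real K * \<xi>) \<le> 2 ^ (Q + 2)" .
  qed auto
  finally show ?thesis .
qed

context dynamics
begin

text \<open>A point which visits bad points for a positive proportion of the time does so along one residue
  class modulo \<open>M\<close>. For each set of times at which this happens the relevant part of a plaque is
  covered by a number of cells which is smaller than that for the whole plaque by a factor \<open>\<epsilon>\<close> for
  each visit; there are at most \<open>2 ^ (k / M + 1)\<close> such sets. As \<open>\<mu>\<close> has dimension close to \<open>n\<close>,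
  these cells carry little mass.\<close>

lemma exceptional_set_null:
  assumes f: "f \<in> Cc \<Gamma> G" and e: "e > 0" and p: "p > 0" and uerg: "uniquely_ergodic \<Gamma> G (auslander G a)"
    and lmd: "local_max_dim_unstable \<Gamma> G a Bm Bz Bp \<mu>"
  shows "\<exists>M>0. (\<lambda>k. measure \<mu> {z \<in> X. p * real k \<le>
    real (card {l\<in>{..<k}. (act a ^^ l) z \<in> OX R \<and> dev f M ((act a ^^ l) z) > 5 * e})}) \<longlonglongrightarrow> 0"
proof -
  obtain s0 \<Lambda> where s0: "s0 > 0" and ld: "\<And>\<kappa>. 0 < \<kappa> \<Longrightarrow> \<kappa> < real n \<Longrightarrow> local_dim_unstable \<Gamma> G Bm Bz Bp \<mu> \<kappa> s0 \<Lambda>"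
    using lmd unfolding local_max_dim_unstable_def dim_plus(1) by blast
  have half: "1 / 2 < real n" using dim_plus(2) by linarith
  from ld[OF _ half] have \<mu>: "borel_prob \<Gamma> G \<mu>" and comp: "compactin TX (msupport \<Gamma> G \<mu>)"
    unfolding local_dim_unstable_def by auto
  interpret \<mu>: prob_space \<mu> by (rule borel_probD[OF \<mu>])
  have sets_\<mu>: "sets \<mu> = sets BX" by (rule borel_probD[OF \<mu>])
  obtain s1 where s1: "s1 > 0" and cov1: "\<forall>s R \<epsilon>. 0 < s \<and> s \<le> s1 \<and> \<epsilon> > 0 \<longrightarrow>
      (\<exists>M1. \<forall>M\<ge>M1. coverable s {z \<in> OX R. dev f M z > 4 * e} M (\<epsilon> * \<tau> ^ (n * M)))"
    using bad_set_coverable[OF f e uerg] by (elim exE conjE)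
  obtain s2 where s2: "s2 > 0" and devP: "\<forall>v\<in>sball Bm s2. \<forall>w\<in>sball Bz s2. \<forall>z\<in>X. \<forall>M.
      \<bar>dev f M (act (mexp v ** mexp w) z) - dev f M z\<bar> \<le> e" using dev_P[OF f e] by (elim exE conjE)
  obtain s3 where s3: "s3 > 0" and invP: "\<forall>v\<in>sball Bm s3. \<forall>w\<in>sball Bz s3.
      norm (mexp v ** mexp w - mat 1) \<le> 1 \<and> norm (minv (mexp v ** mexp w) - mat 1) \<le> 1"
    using P_near_one[OF zero_less_one] by (elim exE conjE)
  define s where "s = min (min s1 s2) (min s3 (s0 / 2))"
  have s: "s > 0" "s \<le> s1" "s \<le> s2" "s \<le> s3" "s \<le> s0 / 2" using s0 s1 s2 s3 by (auto simp: s_def)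
  have ss0: "s < s0" using s(5) s0 by linarith
  have "s / 2 > 0" using s(1) by simp
  from local_coordinates[OF this] obtain \<rho> where \<rho>: "\<rho> > 0" and chart: "\<forall>g\<in>G. norm (g - mat 1) < \<rho> \<longrightarrow>
      (\<exists>v\<in>sball Bm (s / 2). \<exists>w\<in>sball Bz (s / 2). \<exists>y\<in>sball Bp (s / 2). g = mexp v ** mexp w ** mexp y)"
    by (elim exE conjE)
  have suppX: "msupport \<Gamma> G \<mu> \<subseteq> X" by (auto simp: msupport_def)
  obtain F where F: "finite F" "F \<subseteq> msupport \<Gamma> G \<mu>" "msupport \<Gamma> G \<mu> \<subseteq> (\<Union>x\<in>F. NX \<rho> x)"
  proof -
    let ?U = "NX \<rho> ` msupport \<Gamma> G \<mu>"
    have op: "\<And>u. u \<in> ?U \<Longrightarrow> openin TX u" using openin_NX suppX by auto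
    have "msupport \<Gamma> G \<mu> \<subseteq> \<Union>?U" using NX_self[OF _ \<rho>] suppX by auto
    have "\<exists>\<F>. finite \<F> \<and> \<F> \<subseteq> ?U \<and> msupport \<Gamma> G \<mu> \<subseteq> \<Union>\<F>"
      by (rule compactinD[OF comp _ \<open>msupport \<Gamma> G \<mu> \<subseteq> \<Union>?U\<close>]) (rule op)
    then obtain \<F> where \<F>: "finite \<F>" "\<F> \<subseteq> ?U" "msupport \<Gamma> G \<mu> \<subseteq> \<Union>\<F>"
      by (elim exE conjE)
    from finite_subset_image[OF \<F>(1,2)] obtain F where "F \<subseteq> msupport \<Gamma> G \<mu>" "finite F" "\<F> = NX \<rho> ` F"
      by (elim exE conjE)
    then show ?thesis using that \<F>(3) by simp
  qed
  obtain L :: nat where L: "1 / p \<le> real L" using real_arch_simple by blast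
  have Lp: "1 \<le> real L * p" using L p by (simp add: pos_divide_le_eq)
  \<comment> \<open>\<open>\<eta>\<close> beats the factors \<open>2\<close> for the choice of visits, \<open>4 ^ n\<close> for the covering and \<open>2\<close> for the
    dimension per block, and leaves \<open>1 / 2\<close>; \<open>\<eta> ^ L\<close> per visit gives \<open>\<eta>\<close> per block, as a proportion \<open>p \<ge> 1 / L\<close>
    of the blocks is visited.\<close>
  define \<eta> :: real where "\<eta> = 1 / (8 * 4 ^ n)"
  have \<eta>: "\<eta> > 0" "\<eta> \<le> 1"
  proof -
    show "\<eta> > 0" by (simp add: \<eta>_def)
    have "(1::real) \<le> 4 ^ n" by (rule one_le_power) simp
    then have "(1::real) \<le> 8 * 4 ^ n" by linarith
    then show "\<eta> \<le> 1" by (simp add: \<eta>_def)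
  qed
  have "0 < s \<and> s \<le> s1 \<and> \<eta> ^ L > 0" using s \<eta> by simp
  from cov1[rule_format, OF this, of "2 * R"]
  obtain M1 where M1: "\<forall>M\<ge>M1. coverable s {z \<in> OX (2 * R). dev f M z > 4 * e} M (\<eta> ^ L * \<tau> ^ (n * M))" by (elim exE)
  define M where "M = Suc M1"
  define B where "B = {z \<in> OX (2 * R). dev f M z > 4 * e}"
  have M: "M > 0" by (simp add: M_def)
  have covB: "coverable s B M (\<eta> ^ L * \<tau> ^ (n * M))" unfolding B_def by (rule M1[rule_format]) (simp add: M_def)
  have BX: "B \<subseteq> X" using OX_subset by (auto simp: B_def)
  \<comment> \<open>The defect \<open>\<xi>\<close> of the dimension costs at most a factor \<open>2\<close> in \<open>M\<close> steps.\<close>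
  define \<xi> where "\<xi> = min (1 / 2) (ln 2 / (real M * ln \<tau>))"
  have ln\<tau>: "ln \<tau> > 0" using abs_c by simp
  have \<xi>: "\<xi> > 0" "\<xi> \<le> 1 / 2" "\<tau> powr (\<xi> * real M) \<le> 2"
  proof -
    show "\<xi> > 0" using M ln\<tau> by (auto simp: \<xi>_def)
    show "\<xi> \<le> 1 / 2" unfolding \<xi>_def by (rule min.cobounded1)
    have "\<xi> * (real M * ln \<tau>) \<le> (ln 2 / (real M * ln \<tau>)) * (real M * ln \<tau>)"
    proof (rule mult_right_mono)
      show "\<xi> \<le> ln 2 / (real M * ln \<tau>)" unfolding \<xi>_def by (rule min.cobounded2)
    qed (use ln\<tau> in simp)
    also have "\<dots> = ln 2" using M ln\<tau> by simp
    finally have "\<xi> * real M * ln \<tau> \<le> ln 2" by (simp only: mult.assoc)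
    then have "exp (\<xi> * real M * ln \<tau>) \<le> exp (ln 2)" by (simp only: exp_le_cancel_iff)
    then show "\<tau> powr (\<xi> * real M) \<le> 2" by (simp add: powr_def)
  qed
  define \<kappa> where "\<kappa> = real n - \<xi>"
  have \<kappa>: "0 < \<kappa>" "\<kappa> < real n" using \<xi>(1,2) half unfolding \<kappa>_def by linarith+
  from covered_measure_le[OF ld[OF \<kappa>] s(1) ss0] obtain C where C0: "C \<ge> 0" and
    C: "\<forall>x\<in>msupport \<Gamma> G \<mu>. \<forall>S K N A. 4 < \<tau> ^ K \<and> coverable s S K N \<and> A \<in> sets BX \<and>
    (\<forall>z\<in>A. \<exists>v\<in>sball Bm s. \<exists>w\<in>sball Bz s. \<exists>y\<in>sball Bp (s / 2). z = act (mexp v ** mexp w) (act (mexp y) x) \<and> act (mexp y) x \<in> S)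
    \<longrightarrow> measure \<mu> A \<le> N * (C * (4 / \<tau> ^ K) powr \<kappa>)" by (elim exE conjE)
  let ?bad = "{z \<in> OX R. dev f M z > 5 * e}"
  let ?E = "\<lambda>k. {z \<in> X. p * real k \<le> real (card {l\<in>{..<k}. (act a ^^ l) z \<in> OX R \<and> dev f M ((act a ^^ l) z) > 5 * e})}"
  have badm: "?bad \<in> sets BX"
  proof -
    have "?bad = OX R \<inter> (dev f M -` {5 * e<..} \<inter> space BX)" using OX_subset by auto
    also have "\<dots> \<in> sets BX"
      by (intro sets.Int OX_sets measurable_sets[OF dev_measurable[OF Cc_measurable[OF f]]]) auto
    finally show ?thesis .
  qed
  have Tbad: "{z \<in> X. (act a ^^ l) z \<in> ?bad} \<in> sets BX" for l
  proof -
    have "{z \<in> X. (act a ^^ l) z \<in> ?bad} = (act a ^^ l) -` ?bad \<inter> space BX" by auto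
    also have "\<dots> \<in> sets BX" by (rule measurable_sets[OF measurable_act_pow[OF a_G] badm])
    finally show ?thesis .
  qed
  define V where "V x i J = NX \<rho> x \<inter> {z \<in> X. \<forall>j\<in>J. (act a ^^ (i + M * j)) z \<in> ?bad}" for x i J
  have Vm: "V x i J \<in> sets BX" if "x \<in> F" "finite J" for x i J
  proof -
    have "{z \<in> X. \<forall>j\<in>J. (act a ^^ (i + M * j)) z \<in> ?bad} \<in> sets BX"
      using sets.sets_Collect_finite_All'[OF _ that(2), of BX "\<lambda>j z. (act a ^^ (i + M * j)) z \<in> ?bad"]
        Tbad sets.top[of BX] by (cases "J = {}") auto
    moreover have "NX \<rho> x \<in> sets BX" using openin_sets[OF openin_NX] that F(2) suppX by blast
    ultimately show ?thesis unfolding V_def by blast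
  qed
  have Vbound: "measure \<mu> (V x i J) \<le> (4 * C * (4 ^ n) ^ 3) * (1 / 4) ^ Q"
    if x: "x \<in> F" and i: "i < M" and J: "J \<subseteq> {..<Suc Q}" and cJ: "real Q \<le> real L * real (card J)"
      and big: "4 < \<tau> ^ (M * Suc Q)" for x i J Q
  proof -
    let ?S1 = "{z \<in> X. \<forall>j\<in>J. (act a ^^ (M * j)) z \<in> B}"
    let ?S = "{z \<in> X. (act a ^^ i) z \<in> ?S1}"
    let ?K = "i + M * Suc Q"
    let ?N1 = "(\<eta> ^ L) ^ card J * (4 ^ n) ^ Suc Q * \<tau> ^ (n * (M * Suc Q))"
    let ?N = "4 ^ n * \<tau> ^ (n * i) * ?N1"
    have finJ: "finite J" using J finite_subset by blast
    have xs: "x \<in> msupport \<Gamma> G \<mu>" "x \<in> X" using x F(2) suppX by auto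
    have c1: "coverable s ?S1 (M * Suc Q) ?N1" by (rule coverable_blocks[OF s(1) covB BX _ J]) (use \<eta> in simp)
    have N1: "?N1 \<ge> 0" using \<eta> by simp
    have c2: "coverable s ?S ?K ?N" by (rule coverable_compose[OF coverable_X[OF s(1)] c1 N1])
    have "1 * \<tau> ^ (M * Suc Q) \<le> \<tau> ^ i * \<tau> ^ (M * Suc Q)"
      using abs_c by (intro mult_right_mono one_le_power) auto
    then have K4: "4 < \<tau> ^ ?K" using big by (simp only: power_add mult_1)
    have "\<forall>z\<in>V x i J. \<exists>v\<in>sball Bm s. \<exists>w\<in>sball Bz s. \<exists>y\<in>sball Bp (s / 2).
        z = act (mexp v ** mexp w) (act (mexp y) x) \<and> act (mexp y) x \<in> ?S"
    proof
      fix z assume "z \<in> V x i J"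
      then have zN: "z \<in> NX \<rho> x" and zJ: "\<And>j. j \<in> J \<Longrightarrow> (act a ^^ (i + M * j)) z \<in> ?bad" unfolding V_def by auto
      from zN obtain g where g: "g \<in> G" "norm (g - mat 1) < \<rho>" "z = act g x" unfolding NX_def by blast
      from chart[rule_format, OF g(1,2)] obtain v w y where vwy: "v \<in> sball Bm (s / 2)" "w \<in> sball Bz (s / 2)" "y \<in> sball Bp (s / 2)"
        and geq: "g = mexp v ** mexp w ** mexp y" by (elim bexE)
      have s2: "s / 2 \<le> s" using s by simp
      have v: "v \<in> sball Bm s" by (rule sball_mono[OF s2 vwy(1)])
      have w: "w \<in> sball Bz s" by (rule sball_mono[OF s2 vwy(2)])
      let ?x = "act (mexp y) x"
      have xX: "?x \<in> X" by (rule act_in[OF sball_plus_G[OF vwy(3)] xs(2)])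
      have zeq: "z = act (mexp v ** mexp w) ?x"
        unfolding g(3) geq by (rule act_act[symmetric, OF P_G[OF v w] sball_plus_G[OF vwy(3)] xs(2)])
      have "(act a ^^ l) ?x \<in> B" if bad: "(act a ^^ l) z \<in> ?bad" for l
      proof -
        let ?v = "(Ad a ^^ l) v"
        let ?p = "mexp ?v ** mexp w"
        note v' = Ad_pow_sball_minus[OF v, of l]
        have pG: "?p \<in> G" by (rule P_G[OF v' w])
        have lX: "(act a ^^ l) ?x \<in> X" by (rule act_pow_in[OF a_G xX])
        have zl: "(act a ^^ l) z = act ?p ((act a ^^ l) ?x)" unfolding zeq by (rule act_pow_P[OF v w xX])
        have xl: "(act a ^^ l) ?x = act (minv ?p) ((act a ^^ l) z)"
          using pG lX by (simp add: zl act_act minv_left)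
        have "norm (minv ?p - mat 1) \<le> 1" using invP sball_mono[OF s(4) v'] sball_mono[OF s(4) w] by blast
        then have "(act a ^^ l) ?x \<in> OX (2 * R)"
          unfolding xl using bad by (intro OX_act minv_G pG) auto
        moreover have "\<bar>dev f M ((act a ^^ l) z) - dev f M ((act a ^^ l) ?x)\<bar> \<le> e"
          unfolding zl using devP sball_mono[OF s(3) v'] sball_mono[OF s(3) w] lX by blast
        moreover have "dev f M ((act a ^^ l) z) > 5 * e" using bad by simp
        ultimately have "(act a ^^ l) ?x \<in> OX (2 * R) \<and> dev f M ((act a ^^ l) ?x) > 4 * e" by linarith
        then show ?thesis by (simp add: B_def)
      qed
      then have "(act a ^^ (i + M * j)) ?x \<in> B" if "j \<in> J" for j using zJ[OF that] by blast
      then have "(act a ^^ (M * j)) ((act a ^^ i) ?x) \<in> B" if "j \<in> J" for j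
        using that by (simp add: add.commute[of i] funpow_add)
      then have "?x \<in> ?S" using xX act_pow_in[OF a_G xX] by simp
      then show "\<exists>v\<in>sball Bm s. \<exists>w\<in>sball Bz s. \<exists>y\<in>sball Bp (s / 2).
        z = act (mexp v ** mexp w) (act (mexp y) x) \<and> act (mexp y) x \<in> ?S" using v w vwy(3) zeq by blast
    qed
    with C[rule_format, OF xs(1), of ?K ?S ?N "V x i J"] K4 c2 Vm[OF x finJ]
    have "measure \<mu> (V x i J) \<le> ?N * (C * (4 / \<tau> ^ ?K) powr \<kappa>)" by blast
    also have "\<dots> = C * (4 ^ n * (4 ^ n) ^ Suc Q * (\<eta> ^ L) ^ card J * (\<tau> ^ (n * ?K) * (4 / \<tau> ^ ?K) powr \<kappa>))"
      by (simp only: power_add distrib_left mult_ac)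
    also have "\<dots> \<le> C * (4 ^ n * (4 ^ n) ^ Suc Q * \<eta> ^ Q * (4 ^ n * 2 ^ (Q + 2)))"
    proof -
      have "Q \<le> L * card J" using cJ by (simp flip: of_nat_mult)
      then have "(\<eta> ^ L) ^ card J \<le> \<eta> ^ Q"
        unfolding power_mult[symmetric] using \<eta> by (intro power_decreasing) auto
      then have "4 ^ n * (4 ^ n) ^ Suc Q * (\<eta> ^ L) ^ card J \<le> 4 ^ n * (4 ^ n) ^ Suc Q * \<eta> ^ Q"
        by (rule mult_left_mono) simp
      moreover have "\<tau> ^ (n * ?K) * (4 / \<tau> ^ ?K) powr \<kappa> \<le> 4 ^ n * 2 ^ (Q + 2)"
        by (rule cell_measure_compensates_count[OF abs_c less_imp_le[OF \<xi>(1)] \<xi>(3) \<kappa>_def less_imp_le[OF \<kappa>(1)] i refl])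
      ultimately have "4 ^ n * (4 ^ n) ^ Suc Q * (\<eta> ^ L) ^ card J * (\<tau> ^ (n * ?K) * (4 / \<tau> ^ ?K) powr \<kappa>)
          \<le> 4 ^ n * (4 ^ n) ^ Suc Q * \<eta> ^ Q * (4 ^ n * 2 ^ (Q + 2))"
        by (rule mult_mono) (use \<eta> in auto)
      then show ?thesis by (rule mult_left_mono[OF _ C0])
    qed
    also have "\<dots> = (4 * C * (4 ^ n) ^ 3) * ((4 ^ n) * \<eta> * 2) ^ Q"
      by (simp only: power_mult_distrib power_add power_Suc numeral_eq_Suc power_0 One_nat_def) (simp add: mult_ac power2_eq_square)
    also have "(4 ^ n) * \<eta> * 2 = 1 / 4" by (simp add: \<eta>_def)
    finally show ?thesis .
  qed
  have bound: "measure \<mu> (?E k) \<le> real (card F) * (real M * (8 * C * (4 ^ n) ^ 3)) * (1 / 2) ^ (k div M)"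
    if big: "4 < \<tau> ^ (M * Suc (k div M))" for k
  proof -
    let ?Q = "k div M"
    let ?JJ = "{J. J \<subseteq> {..<Suc ?Q} \<and> real ?Q \<le> real L * real (card J)}"
    let ?I = "F \<times> {..<M} \<times> ?JJ"
    let ?V = "\<lambda>q. V (fst q) (fst (snd q)) (snd (snd q))"
    have JJ: "finite ?JJ" "card ?JJ \<le> 2 ^ Suc ?Q"
    proof -
      have sub: "?JJ \<subseteq> Pow {..<Suc ?Q}" by blast
      show "finite ?JJ" by (rule finite_subset[OF sub]) simp
      have "card ?JJ \<le> card (Pow {..<Suc ?Q})" by (rule card_mono[OF _ sub]) simp
      then show "card ?JJ \<le> 2 ^ Suc ?Q" by (simp only: card_Pow[OF finite_lessThan] card_lessThan)
    qed
    have finI: "finite ?I" using F(1) JJ(1) by simp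
    have Vmeas: "?V q \<in> sets \<mu>" if "q \<in> ?I" for q
    proof -
      have "snd (snd q) \<subseteq> {..<Suc ?Q}" using that by auto
      then have "finite (snd (snd q))" by (rule finite_subset) simp
      then show ?thesis using Vm[of "fst q" "snd (snd q)" "fst (snd q)"] that unfolding sets_\<mu> by auto
    qed
    have Um: "(\<Union>q\<in>?I. ?V q) \<in> sets \<mu>" using finI Vmeas by (intro sets.finite_UN) auto
    have "AE z in \<mu>. z \<in> ?E k \<longrightarrow> z \<in> (\<Union>q\<in>?I. ?V q)"
      using AE_msupport[OF \<mu>]
    proof eventually_elim
      fix z assume zs: "z \<in> msupport \<Gamma> G \<mu>"
      show "z \<in> ?E k \<longrightarrow> z \<in> (\<Union>q\<in>?I. ?V q)"
      proof
        assume zE: "z \<in> ?E k"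
        from zs F(3) obtain x where x: "x \<in> F" "z \<in> NX \<rho> x" by blast
        have "p * real k \<le> real (card {l\<in>{..<k}. (act a ^^ l) z \<in> ?bad})" using zE by simp
        from visits_in_residue_class[OF M this] obtain i J where iJ: "i < M" "J \<subseteq> {..<Suc ?Q}"
          "p * real k / real M \<le> real (card J)" "\<forall>j\<in>J. (act a ^^ (i + M * j)) z \<in> ?bad" by (elim exE conjE)
        have "real ?Q \<le> real k / real M" by (rule of_nat_div_le_of_nat)
        also have "\<dots> \<le> (real L * p) * (real k / real M)" using mult_right_mono[OF Lp, of "real k / real M"] by simp
        also have "\<dots> = real L * (p * real k / real M)" by simp
        also have "\<dots> \<le> real L * real (card J)" by (rule mult_left_mono[OF iJ(3)]) simp
        finally have "(x, i, J) \<in> ?I" using x iJ by simp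
        moreover have "z \<in> ?V (x, i, J)" unfolding V_def using x(2) zE iJ(4) by simp
        ultimately show "z \<in> (\<Union>q\<in>?I. ?V q)" by (rule UN_I)
      qed
    qed
    then have "measure \<mu> (?E k) \<le> measure \<mu> (\<Union>q\<in>?I. ?V q)" by (rule \<mu>.finite_measure_mono_AE[OF _ Um])
    also have "\<dots> \<le> (\<Sum>q\<in>?I. measure \<mu> (?V q))"
      using Vmeas by (intro \<mu>.finite_measure_subadditive_finite finI) auto
    also have "\<dots> \<le> (\<Sum>q\<in>?I. (4 * C * (4 ^ n) ^ 3) * (1 / 4) ^ ?Q)"
    proof (rule sum_mono)
      fix q assume "q \<in> ?I"
      then show "measure \<mu> (?V q) \<le> (4 * C * (4 ^ n) ^ 3) * (1 / 4) ^ ?Q" by (intro Vbound big) auto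
    qed
    also have "\<dots> = real (card F) * real M * real (card ?JJ) * ((4 * C * (4 ^ n) ^ 3) * (1 / 4) ^ ?Q)"
      by (simp only: sum_constant card_cartesian_product card_lessThan of_nat_mult mult_ac)
    also have "\<dots> \<le> real (card F) * real M * 2 ^ Suc ?Q * ((4 * C * (4 ^ n) ^ 3) * (1 / 4) ^ ?Q)"
    proof -
      have "real (card ?JJ) \<le> real (2 ^ Suc ?Q)" by (rule of_nat_mono[OF JJ(2)])
      then have "real (card ?JJ) \<le> 2 ^ Suc ?Q" by (simp only: of_nat_power of_nat_numeral)
      then have "real (card F) * real M * real (card ?JJ) \<le> real (card F) * real M * 2 ^ Suc ?Q"
        by (rule mult_left_mono) simp
      then show ?thesis by (rule mult_right_mono) (use C0 in simp)
    qed
    also have "\<dots> = real (card F) * (real M * (8 * C * (4 ^ n) ^ 3)) * (2 * (1 / 4)) ^ ?Q"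
      by (simp only: power_mult_distrib power_Suc) simp
    finally show ?thesis by simp
  qed
  have divlim: "filterlim (\<lambda>k. k div M) at_top sequentially"
    unfolding filterlim_at_top
  proof
    fix Z
    show "eventually (\<lambda>k. Z \<le> k div M) sequentially"
      using eventually_ge_at_top[of "Z * M"]
    proof eventually_elim
      case (elim k)
      then show ?case using M by (simp add: less_eq_div_iff_mult_less_eq)
    qed
  qed
  obtain q0 where q0: "4 < \<tau> ^ q0" using real_arch_pow[OF abs_c] by blast
  have ev: "eventually (\<lambda>k. 4 < \<tau> ^ (M * Suc (k div M))) sequentially"
    using filterlim_at_top[THEN iffD1, OF divlim, rule_format, of q0]
  proof eventually_elim
    case (elim k)
    have "q0 \<le> 1 * Suc (k div M)" using elim by simp
    also have "\<dots> \<le> M * Suc (k div M)" using M by (intro mult_right_mono) auto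
    finally have "\<tau> ^ q0 \<le> \<tau> ^ (M * Suc (k div M))" using abs_c by (intro power_increasing) auto
    then show ?case using q0 by linarith
  qed
  have "(\<lambda>k. (1 / 2 :: real) ^ (k div M)) \<longlonglongrightarrow> 0"
    by (rule filterlim_compose[OF LIMSEQ_power_zero divlim]) simp
  from tendsto_mult_right_zero[OF this, of "real (card F) * (real M * (8 * C * (4 ^ n) ^ 3))"]
  have "(\<lambda>k. measure \<mu> (?E k)) \<longlonglongrightarrow> 0"
    by (rule tendsto_sandwich[OF _ _ tendsto_const, rotated 2])
      (use eventually_mono[OF ev bound] in auto)
  then show ?thesis using M by blast
qed

end

section \<open>Convergence of the averages\<close>

lemma sum_shift_diff_le:
  fixes g :: "nat \<Rightarrow> real"
  assumes "\<And>l. \<bar>g l\<bar> \<le> b"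
  shows "\<bar>(\<Sum>l<k. g (l + j)) - (\<Sum>l<k. g l)\<bar> \<le> 2 * b * real j"
proof (induction j)
  case (Suc j)
  have "(\<Sum>l<k. g (Suc l + j) - g (l + j)) = g (k + j) - g (0 + j)"
    by (rule sum_lessThan_telescope)
  then have "(\<Sum>l<k. g (l + Suc j)) - (\<Sum>l<k. g (l + j)) = g (k + j) - g j"
    by (simp add: sum_subtractf)
  then have "\<bar>(\<Sum>l<k. g (l + Suc j)) - (\<Sum>l<k. g (l + j))\<bar> \<le> 2 * b"
    using assms[of "k + j"] assms[of j] by linarith
  then have "\<bar>(\<Sum>l<k. g (l + Suc j)) - (\<Sum>l<k. g l)\<bar> \<le> 2 * b + 2 * b * real j" using Suc.IH by linarith
  also have "\<dots> = 2 * b * real (Suc j)" by (simp add: algebra_simps)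
  finally show ?case .
qed simp

text \<open>A long average hardly changes when the sequence is replaced by its running averages of fixed
  length.\<close>

lemma sum_running_averages:
  fixes g :: "nat \<Rightarrow> real"
  assumes g: "\<And>l. \<bar>g l\<bar> \<le> b" and M: "M > 0"
  shows "\<bar>(\<Sum>l<k. (\<Sum>j<M. g (j + l)) / real M) - (\<Sum>l<k. g l)\<bar> \<le> 2 * b * real M"
proof -
  have b: "b \<ge> 0" using g[of 0] by linarith
  have "(\<Sum>l<k. (\<Sum>j<M. g (j + l)) / real M) = (\<Sum>j<M. \<Sum>l<k. g (l + j)) / real M"
    by (simp add: sum.swap[of _ "{..<k}"] add.commute flip: sum_divide_distrib)
  moreover have "(\<Sum>l<k. g l) = (\<Sum>j<M. \<Sum>l<k. g l) / real M" using M by simp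
  ultimately have "(\<Sum>l<k. (\<Sum>j<M. g (j + l)) / real M) - (\<Sum>l<k. g l)
      = (\<Sum>j<M. (\<Sum>l<k. g (l + j)) - (\<Sum>l<k. g l)) / real M"
    by (simp only: sum_subtractf diff_divide_distrib)
  also have "\<bar>\<dots>\<bar> = \<bar>\<Sum>j<M. (\<Sum>l<k. g (l + j)) - (\<Sum>l<k. g l)\<bar> / real M" by simp
  also have "\<dots> \<le> (\<Sum>j<M. 2 * b * real M) / real M"
  proof (intro divide_right_mono order_trans[OF sum_abs] sum_mono)
    fix j assume "j \<in> {..<M}"
    then have "2 * b * real j \<le> 2 * b * real M" using b by (intro mult_left_mono) auto
    then show "\<bar>(\<Sum>l<k. g (l + j)) - (\<Sum>l<k. g l)\<bar> \<le> 2 * b * real M"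
      using sum_shift_diff_le[where g = g and b = b and k = k and j = j, OF g] by linarith
  qed simp
  also have "\<dots> = 2 * b * real M" using M by simp
  finally show ?thesis .
qed

context dynamics
begin

text \<open>Replace \<open>f\<close> by its averages over \<open>M\<close> steps. These deviate from the mean by at most \<open>e\<close>, except at times
  spent outside \<open>OX R\<close> or at bad points, where the deviation is at most \<open>D\<close>.\<close>

lemma orbit_average_deviation_le:
  assumes \<mu>: "borel_prob \<Gamma> G \<mu>" and f: "f \<in> Cc \<Gamma> G" and b: "\<And>x. x \<in> X \<Longrightarrow> \<bar>f x\<bar> \<le> b"
    and D: "D = b + \<bar>\<integral>x. f x \<partial>m\<bar>" and e: "e \<ge> 0" and p: "p \<ge> 0" and M: "M > 0" and k: "k > 0"
  shows "\<bar>(\<integral>x. f x \<partial>orbit_average \<Gamma> G a \<mu> k) - (\<integral>x. f x \<partial>m)\<bar>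
    \<le> 2 * b * real M / real k + e + D * measure (orbit_average \<Gamma> G a \<mu> k) (X - OX R) + D * p
      + D * measure \<mu> {z \<in> X. p * real k \<le>
          real (card {l\<in>{..<k}. (act a ^^ l) z \<in> OX R \<and> dev f M ((act a ^^ l) z) > e})}"
proof -
  interpret \<mu>: prob_space \<mu> by (rule borel_probD[OF \<mu>])
  have sp: "space \<mu> = X" and st: "sets \<mu> = sets BX" using borel_probD[OF \<mu>] by auto
  let ?I = "\<integral>x. f x \<partial>m" and ?T = "\<lambda>l z. (act a ^^ l) z"
  let ?P = "\<lambda>l z. ?T l z \<in> OX R \<and> dev f M (?T l z) > e"
  define E where "E = {z \<in> X. p * real k \<le> real (card {l\<in>{..<k}. ?P l z})}"
  let ?out = "\<lambda>l z. indicator (X - OX R) (?T l z) :: real"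
  let ?h = "\<lambda>z. (\<Sum>l<k. f (?T l z)) - real k * ?I"
  let ?u = "\<lambda>z. (2 * b * real M + e * real k + D * p * real k) + D * (\<Sum>l<k. ?out l z) + D * real k * indicator E z"
  have "pt (mat 1) \<in> X" by (rule pt_in[OF one_G])
  then have b0: "b \<ge> 0" using b by (meson abs_ge_zero order_trans)
  then have D0: "D \<ge> 0" using D by simp
  have dev_le: "dev f M z \<le> D" if "z \<in> X" for z
  proof -
    have "\<bar>\<Sum>l<M. f (?T l z)\<bar> \<le> (\<Sum>l<M. \<bar>f (?T l z)\<bar>)" by (rule sum_abs)
    also have "\<dots> \<le> (\<Sum>l<M. b)" using b act_pow_in[OF a_G that] by (intro sum_mono) blast
    finally have "\<bar>\<Sum>l<M. f (?T l z)\<bar> / real M \<le> b" using M by (simp add: pos_divide_le_eq mult.commute)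
    then have "\<bar>(\<Sum>l<M. f (?T l z)) / real M\<bar> \<le> b" by simp
    then show ?thesis unfolding dev_def D by linarith
  qed
  have point: "\<bar>?h z\<bar> \<le> ?u z" if z: "z \<in> X" for z
  proof -
    have zl: "?T l z \<in> X" for l by (rule act_pow_in[OF a_G z])
    have g: "\<bar>f (?T l z)\<bar> \<le> b" for l by (rule b[OF zl])
    have A: "\<bar>(\<Sum>l<k. (\<Sum>j<M. f (?T (j + l) z)) / real M) - (\<Sum>l<k. f (?T l z))\<bar> \<le> 2 * b * real M"
      by (rule sum_running_averages[OF g M])
    have "(\<Sum>l<k. (\<Sum>j<M. f (?T (j + l) z)) / real M) - real k * ?I
        = (\<Sum>l<k. (\<Sum>j<M. f (?T j (?T l z))) / real M - ?I)"
      by (simp add: sum_subtractf funpow_add)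
    also have "\<bar>\<dots>\<bar> \<le> (\<Sum>l<k. dev f M (?T l z))"
      unfolding dev_def by (rule sum_abs)
    also have "\<dots> \<le> (\<Sum>l<k. e + D * ?out l z + D * (if ?P l z then 1 else 0))"
    proof (rule sum_mono)
      fix l
      show "dev f M (?T l z) \<le> e + D * ?out l z + D * (if ?P l z then 1 else 0)"
        using dev_le[OF zl[of l]] zl[of l] D0 e by (cases "?T l z \<in> OX R"; cases "dev f M (?T l z) > e") auto
    qed
    also have "\<dots> = e * real k + D * (\<Sum>l<k. ?out l z) + D * real (card {l\<in>{..<k}. ?P l z})"
      by (simp add: sum.distrib sum_distrib_left[symmetric] sum.If_cases Int_def mult.commute)
    also have "\<dots> \<le> e * real k + D * (\<Sum>l<k. ?out l z) + D * (p * real k + real k * indicator E z)"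
    proof (intro add_left_mono mult_left_mono D0)
      have "card {l\<in>{..<k}. ?P l z} \<le> card {..<k}" by (intro card_mono) auto
      then have "real (card {l\<in>{..<k}. ?P l z}) \<le> real k" by simp
      moreover have "p * real k \<ge> 0" using p by simp
      ultimately show "real (card {l\<in>{..<k}. ?P l z}) \<le> p * real k + real k * indicator E z"
        using z by (cases "z \<in> E") (auto simp: E_def)
    qed
    finally have "\<bar>(\<Sum>l<k. (\<Sum>j<M. f (?T (j + l) z)) / real M) - real k * ?I\<bar>
      \<le> e * real k + D * (\<Sum>l<k. ?out l z) + D * (p * real k + real k * indicator E z)" .
    with A have "\<bar>?h z\<bar> \<le> 2 * b * real M + (e * real k + D * (\<Sum>l<k. ?out l z) + D * (p * real k + real k * indicator E z))"
      by linarith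
    also have "\<dots> = ?u z" by (simp add: algebra_simps)
    finally show ?thesis .
  qed
  have fm: "f \<in> borel_measurable BX" by (rule Cc_measurable[OF f])
  have Tm: "(\<lambda>z. g (?T l z)) \<in> borel_measurable \<mu>" if "g \<in> borel_measurable BX" for g :: "_ \<Rightarrow> real" and l
    by (rule measurable_compose[OF measurable_act_pow'[OF \<mu> a_G] that])
  have outm: "(indicator (X - OX R) :: _ \<Rightarrow> real) \<in> borel_measurable BX"
    using OX_sets[of R] sets.compl_sets[OF OX_sets[of R]] by simp
  have Em: "E \<in> sets \<mu>"
  proof -
    let ?bad = "OX R \<inter> (dev f M -` {e<..} \<inter> space BX)"
    have "?bad \<in> sets BX"
      by (intro sets.Int OX_sets measurable_sets[OF dev_measurable[OF fm]]) auto
    then have "(indicator ?bad :: _ \<Rightarrow> real) \<in> borel_measurable BX" by simp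
    then have "(\<lambda>z. \<Sum>l<k. indicator ?bad (?T l z) :: real) \<in> borel_measurable \<mu>"
      by (intro borel_measurable_sum Tm)
    then have meas: "{z \<in> space \<mu>. p * real k \<le> (\<Sum>l<k. indicator ?bad (?T l z) :: real)} \<in> sets \<mu>"
      by (intro borel_measurable_le borel_measurable_const)
    have cnt: "(\<Sum>l<k. indicator ?bad (?T l z) :: real) = real (card {l\<in>{..<k}. ?P l z})" if "z \<in> X" for z
    proof -
      have "(\<Sum>l<k. indicator ?bad (?T l z) :: real) = (\<Sum>l<k. if ?P l z then 1 else 0)"
        using act_pow_in[OF a_G that] by (intro sum.cong) (auto simp: indicator_def)
      also have "\<dots> = real (card {l\<in>{..<k}. ?P l z})" by (simp add: sum.If_cases Int_def)
      finally show ?thesis .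
    qed
    have "{z \<in> space \<mu>. p * real k \<le> (\<Sum>l<k. indicator ?bad (?T l z) :: real)} = E"
      unfolding sp E_def by (rule Collect_cong, rule conj_cong[OF refl]) (simp only: cnt)
    with meas show ?thesis by (simp only:)
  qed
  have int_f: "integrable \<mu> (\<lambda>z. f (?T l z))" for l
  proof (rule \<mu>.integrable_bounded[of _ b])
    fix z assume "z \<in> space \<mu>"
    then show "\<bar>f (?T l z)\<bar> \<le> b" unfolding sp by (intro b act_pow_in[OF a_G])
  qed (rule Tm[OF fm])
  have int_out: "integrable \<mu> (?out l)" for l
  proof (rule \<mu>.integrable_bounded[of _ 1])
    show "\<bar>?out l z\<bar> \<le> 1" for z by (simp only: indicator_def split: if_split) simp
  qed (rule Tm[OF outm])
  have int_E: "integrable \<mu> (indicator E :: _ \<Rightarrow> real)"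
    using Em \<mu>.emeasure_finite[of E] by (simp add: integrable_indicator_iff less_top[symmetric])
  have int_h: "integrable \<mu> ?h" 
    by (intro Bochner_Integration.integrable_diff Bochner_Integration.integrable_sum int_f \<mu>.integrable_const)
  have int_S: "integrable \<mu> (\<lambda>z. \<Sum>l<k. ?out l z)" using int_out by (rule Bochner_Integration.integrable_sum)
  have int_u: "integrable \<mu> ?u"
    by (intro Bochner_Integration.integrable_add integrable_mult_right int_S int_E \<mu>.integrable_const)
  have le: "\<bar>\<integral>z. ?h z \<partial>\<mu>\<bar> \<le> (\<integral>z. ?u z \<partial>\<mu>)"
  proof (rule abs_leI)
    show "(\<integral>z. ?h z \<partial>\<mu>) \<le> (\<integral>z. ?u z \<partial>\<mu>)"
      by (rule integral_mono[OF int_h int_u], rule order_trans[OF abs_ge_self point]) (simp only: sp)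
    have "(\<integral>z. - ?h z \<partial>\<mu>) \<le> (\<integral>z. ?u z \<partial>\<mu>)"
      by (rule integral_mono[OF Bochner_Integration.integrable_minus[OF int_h] int_u],
          rule order_trans[OF abs_ge_minus_self point]) (simp only: sp)
    then show "- (\<integral>z. ?h z \<partial>\<mu>) \<le> (\<integral>z. ?u z \<partial>\<mu>)"
      by (simp only: Bochner_Integration.integral_minus)
  qed
  have ih: "(\<integral>z. ?h z \<partial>\<mu>) = real k * ((\<integral>x. f x \<partial>orbit_average \<Gamma> G a \<mu> k) - ?I)"
  proof -
    have "(\<integral>z. ?h z \<partial>\<mu>) = (\<Sum>l<k. \<integral>z. f (?T l z) \<partial>\<mu>) - real k * ?I"
      using int_f by (subst Bochner_Integration.integral_diff) (auto simp: \<mu>.prob_space)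
    also have "(\<Sum>l<k. \<integral>z. f (?T l z) \<partial>\<mu>) = real k * (\<integral>x. f x \<partial>orbit_average \<Gamma> G a \<mu> k)"
    proof -
      have oa: "(\<integral>x. f x \<partial>orbit_average \<Gamma> G a \<mu> k) = (\<Sum>l<k. \<integral>z. f (?T l z) \<partial>\<mu>) / real k"
        by (rule orbit_average_integral[OF \<mu> a_G k fm]) (rule b)
      show ?thesis unfolding oa using k by simp
    qed
    finally show ?thesis by (simp only: right_diff_distrib)
  qed
  have iu: "(\<integral>z. ?u z \<partial>\<mu>) = real k * (2 * b * real M / real k + e
      + D * measure (orbit_average \<Gamma> G a \<mu> k) (X - OX R) + D * p + D * measure \<mu> E)"
  proof -
    have spo: "space (orbit_average \<Gamma> G a \<mu> k) = X"
      using sets_eq_imp_space_eq[OF orbit_average_props(1)[OF \<mu> a_G k]] by simp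
    have "(\<integral>x. indicator (X - OX R) x \<partial>orbit_average \<Gamma> G a \<mu> k) = (\<Sum>l<k. \<integral>z. ?out l z \<partial>\<mu>) / real k"
      by (rule orbit_average_integral[OF \<mu> a_G k outm, of 1]) (auto simp: indicator_def)
    moreover have "(X - OX R) \<inter> space (orbit_average \<Gamma> G a \<mu> k) = X - OX R" unfolding spo by blast
    ultimately have "measure (orbit_average \<Gamma> G a \<mu> k) (X - OX R) = (\<Sum>l<k. \<integral>z. ?out l z \<partial>\<mu>) / real k"
      by (simp only: Bochner_Integration.integral_indicator)
    then have out: "(\<Sum>l<k. \<integral>z. ?out l z \<partial>\<mu>) = real k * measure (orbit_average \<Gamma> G a \<mu> k) (X - OX R)"
      using k by (simp only: nonzero_mult_div_cancel_left times_divide_eq_right of_nat_eq_0_iff)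
    have "(\<integral>z. ?u z \<partial>\<mu>) = (\<integral>z. (2 * b * real M + e * real k + D * p * real k) + D * (\<Sum>l<k. ?out l z) \<partial>\<mu>)
        + (\<integral>z. D * real k * indicator E z \<partial>\<mu>)"
      by (rule Bochner_Integration.integral_add)
        (intro Bochner_Integration.integrable_add integrable_mult_right int_S int_E \<mu>.integrable_const)+
    also have "(\<integral>z. (2 * b * real M + e * real k + D * p * real k) + D * (\<Sum>l<k. ?out l z) \<partial>\<mu>)
        = (2 * b * real M + e * real k + D * p * real k) + (\<integral>z. D * (\<Sum>l<k. ?out l z) \<partial>\<mu>)"
    proof -
      have "(\<integral>z. (2 * b * real M + e * real k + D * p * real k) + D * (\<Sum>l<k. ?out l z) \<partial>\<mu>)
          = (\<integral>z. (2 * b * real M + e * real k + D * p * real k) \<partial>\<mu>) + (\<integral>z. D * (\<Sum>l<k. ?out l z) \<partial>\<mu>)"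
        by (rule Bochner_Integration.integral_add) (intro integrable_mult_right int_S \<mu>.integrable_const)+
      also have "(\<integral>z. (2 * b * real M + e * real k + D * p * real k) \<partial>\<mu>) = 2 * b * real M + e * real k + D * p * real k"
        by (simp add: \<mu>.prob_space)
      finally show ?thesis .
    qed
    also have "(\<integral>z. D * (\<Sum>l<k. ?out l z) \<partial>\<mu>) = D * (\<Sum>l<k. \<integral>z. ?out l z \<partial>\<mu>)"
      by (simp only: integral_mult_right_zero Bochner_Integration.integral_sum[OF int_out])
    also have "(\<integral>z. D * real k * indicator E z \<partial>\<mu>) = D * real k * measure \<mu> E"
    proof -
      have "E \<inter> space \<mu> = E" using sets.sets_into_space[OF Em] by blast
      then show ?thesis by (simp only: integral_mult_right_zero Bochner_Integration.integral_indicator)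
    qed
    finally have "(\<integral>z. ?u z \<partial>\<mu>) = (2 * b * real M + e * real k + D * p * real k)
      + D * (real k * measure (orbit_average \<Gamma> G a \<mu> k) (X - OX R)) + D * real k * measure \<mu> E" unfolding out .
    then show ?thesis using k by (simp only: distrib_left) (simp add: mult_ac)
  qed
  have "real k * \<bar>(\<integral>x. f x \<partial>orbit_average \<Gamma> G a \<mu> k) - ?I\<bar> \<le> real k * (2 * b * real M / real k + e
      + D * measure (orbit_average \<Gamma> G a \<mu> k) (X - OX R) + D * p + D * measure \<mu> E)"
    using le unfolding ih iu by (simp only: abs_mult abs_of_nat)
  then show ?thesis unfolding E_def[symmetric] by (rule mult_left_le_imp_le) (use k in simp)
qed

theorem orbit_averages_converge:
  assumes \<mu>: "borel_prob \<Gamma> G \<mu>" and f: "f \<in> Cc \<Gamma> G" and uerg: "uniquely_ergodic \<Gamma> G (auslander G a)"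
    and lmd: "local_max_dim_unstable \<Gamma> G a Bm Bz Bp \<mu>" and no_loss: "no_mass_loss_on_average \<Gamma> G a \<mu>"
  shows "(\<lambda>k. \<integral>x. f x \<partial>orbit_average \<Gamma> G a \<mu> k) \<longlonglongrightarrow> (\<integral>x. f x \<partial>m)"
proof (rule LIMSEQ_I)
  fix \<omega> :: real assume \<omega>: "\<omega> > 0"
  obtain b where b: "b > 0" "\<And>x. x \<in> X \<Longrightarrow> \<bar>f x\<bar> \<le> b" using Cc_bounded[OF f] by blast
  define D where "D = b + \<bar>\<integral>x. f x \<partial>m\<bar>"
  have D: "D > 0" using b(1) by (simp add: D_def)
  define t where "t = \<omega> / (6 * D)"
  have t: "t > 0" "D * t = \<omega> / 6" using \<omega> D by (auto simp: t_def)
  define e where "e = \<omega> / 30"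
  have e: "e > 0" using \<omega> by (simp add: e_def)
  obtain R k0 where tight: "\<And>k. k \<ge> k0 \<Longrightarrow> k > 0 \<Longrightarrow> measure (orbit_average \<Gamma> G a \<mu> k) (X - OX R) \<le> t"
    using tight_averages[OF \<mu> a_G no_loss t(1)] by blast
  from exceptional_set_null[OF f e t(1) uerg lmd, of R] obtain M where M: "M > 0" and
    lim: "(\<lambda>k. measure \<mu> {z \<in> X. t * real k \<le>
      real (card {l\<in>{..<k}. (act a ^^ l) z \<in> OX R \<and> dev f M ((act a ^^ l) z) > 5 * e})}) \<longlonglongrightarrow> 0"
    by (elim exE conjE)
  from order_tendstoD(2)[OF lim t(1)] obtain k1 where
    k1: "\<forall>k\<ge>k1. measure \<mu> {z \<in> X. t * real k \<le>
      real (card {l\<in>{..<k}. (act a ^^ l) z \<in> OX R \<and> dev f M ((act a ^^ l) z) > 5 * e})} < t"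
    unfolding eventually_sequentially by (elim exE)
  have "(\<lambda>k. 2 * b * real M / real k) \<longlonglongrightarrow> 0" by (rule lim_const_over_n)
  moreover have "\<omega> / 6 > 0" using \<omega> by simp
  ultimately have "eventually (\<lambda>k. 2 * b * real M / real k < \<omega> / 6) sequentially" by (rule order_tendstoD(2))
  then obtain k2 where k2: "\<forall>k\<ge>k2. 2 * b * real M / real k < \<omega> / 6" unfolding eventually_sequentially by (elim exE)
  have "norm ((\<integral>x. f x \<partial>orbit_average \<Gamma> G a \<mu> k) - (\<integral>x. f x \<partial>m)) < \<omega>" if k: "k \<ge> Suc (k0 + k1 + k2)" for k
  proof -
    let ?m1 = "measure (orbit_average \<Gamma> G a \<mu> k) (X - OX R)"
    let ?m2 = "measure \<mu> {z \<in> X. t * real k \<le>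
      real (card {l\<in>{..<k}. (act a ^^ l) z \<in> OX R \<and> dev f M ((act a ^^ l) z) > 5 * e})}"
    have kk: "k > 0" "k \<ge> k0" "k \<ge> k1" "k \<ge> k2" using k by auto
    have "5 * e \<ge> 0" "t \<ge> 0" using e t by auto
    from orbit_average_deviation_le[OF \<mu> f b(2) D_def this M kk(1), of R]
    have le: "\<bar>(\<integral>x. f x \<partial>orbit_average \<Gamma> G a \<mu> k) - (\<integral>x. f x \<partial>m)\<bar>
      \<le> 2 * b * real M / real k + 5 * e + D * ?m1 + D * t + D * ?m2" .
    have m1: "D * ?m1 \<le> D * t" using tight[OF kk(2,1)] D by simp
    have m2: "D * ?m2 \<le> D * t" using k1[rule_format, OF kk(3)] D by simp
    have m3: "2 * b * real M / real k < \<omega> / 6" using k2 kk(4) by blast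
    have "5 * e = \<omega> / 6" by (simp add: e_def)
    then have "\<bar>(\<integral>x. f x \<partial>orbit_average \<Gamma> G a \<mu> k) - (\<integral>x. f x \<partial>m)\<bar> < \<omega>"
      using le m1 m2 m3 \<omega> unfolding t(2) by linarith
    then show ?thesis by simp
  qed
  then show "\<exists>k0. \<forall>k\<ge>k0. norm ((\<integral>x. f x \<partial>orbit_average \<Gamma> G a \<mu> k) - (\<integral>x. f x \<partial>m)) < \<omega>" by blast
qed

end

theorem theorem5p4:
  fixes G \<Gamma> :: "(real ^ 'n ^ 'n) set"
    and a :: "real ^ 'n ^ 'n"
    and m_X \<mu> :: "(real ^ 'n ^ 'n) set measure"
    and Bm Bz Bp :: "(real ^ 'n ^ 'n) set"
  assumes G: "subgroup G SL" "closed G" "connected G"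
    and \<Gamma>: "lattice_in \<Gamma> G"
    and m_X: "invariant_prob \<Gamma> G G m_X"
    and a: "class_A G a"
    and bases: "eigenbasis a (g_minus G a) Bm" "eigenbasis a (g_zero G a) Bz"
      "eigenbasis a (g_plus G a) Bp"
    and \<mu>: "borel_prob \<Gamma> G \<mu>"
    and abelian: "\<forall>g \<in> G_plus G a. \<forall>h \<in> G_plus G a. g ** h = h ** g"
    and eigenspace: "\<exists>c. Ad_eigenvalue G a c \<and> g_plus G a = Ad_eigenspace G a c"
    and uerg: "uniquely_ergodic \<Gamma> G (auslander G a)"
    and local_max: "local_max_dim_unstable \<Gamma> G a Bm Bz Bp \<mu>"
    and no_loss: "no_mass_loss_on_average \<Gamma> G a \<mu>"
  shows "weak_star_lim \<Gamma> G (\<lambda>k. orbit_average \<Gamma> G a \<mu> k) m_X"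
proof -
  obtain c where c: "Ad_eigenvalue G a c" "g_plus G a = Ad_eigenspace G a c" using eigenspace by blast
  have \<Gamma>': "subgroup \<Gamma> (SL\<lparr>carrier := G\<rparr>)" "Isolated.discrete \<Gamma>"
    using \<Gamma> unfolding lattice_in_def by blast+
  interpret dynamics G a Bm Bz Bp c \<Gamma> m_X
    by (intro dynamics.intro expanding.intro expanding_axioms.intro invariant_measure.intro
        invariant_measure_axioms.intro homogeneous_space.intro homogeneous_space_axioms.intro closed_linear_group.intro)
      (fact G(1,2) \<Gamma>' a bases c abelian m_X)+
  show ?thesis
    unfolding weak_star_lim_def
    using orbit_averages_converge[OF \<mu> _ uerg local_max no_loss] by blast
qed

end
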